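(* Let $R$ be a complete discrete valuation ring with field of fractions $K$. Let $\Lambda$ be an $R$-order in a finite-dimensional semisimple $K$-algebra $A$. Let $\Lambda'$ and $\Lambda''$ be maximal $R$-orders in $A$ such that $\Lambda'\supseteq\Lambda$ and $\Lambda''\supseteq\Lambda$. Let $(e_i)$ be a complete set of primitive central idempotents of $A$ (so that $1 = \sum e_i$ is the decomposition of $1$ into primitive orthogonal central idempotents). Put $\Lambda'_i=\Lambda'e_i$ and $\Lambda''_i=\Lambda''e_i$. Let $S'_i$ be a simple left $\Lambda'_i$-module and $S''_i$ be a simple left $\Lambda''_i$-module. Then $[S'_i]=[S''_i]$ in $\mathcal{G}(\Lambda)$.
   Context: An $R$-order in $A$ is an $R$-subalgebra of $A$ that is finitely generated as an $R$-module and spans $A$ over $K$. $\mathcal{G}(\Lambda)$ is the Grothendieck group of the category of finite-length left $\Lambda$-modules, written multiplicatively; by Jordan–Hölder it is the free abelian group on the set of isomorphism classes of simple left $\Lambda$-modules. The modules $S_i'$ and $S_i''$ are regarded as left $\Lambda$-modules via $\Lambda\subseteq\Lambda'\to\Lambda'_i$ and $\Lambda\subseteq\Lambda''\to\Lambda''_i$ (multiplication by $e_i$); they have finite length over $\Lambda$. *)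

theory Defs
  imports "HOL-Algebra.Algebra"
begin

section \<open>Left modules over a ring that need not be commutative\<close>

text \<open>
  The library locale \<^locale>\<open>module\<close> has a commutative ring of scalars. The following has the same
  axioms over an arbitrary ring. As there, the fields \<^const>\<open>monoid.mult\<close> and \<^const>\<open>monoid.one\<close>
  of the module record are not used. The library notion \<^locale>\<open>submodule\<close> makes no assumption on
  the scalars and is used unchanged.
\<close>

locale left_module = R?: ring R + M?: abelian_group M
  for R :: "('l, 'x) ring_scheme" (structure) and M :: "('l, 'm, 'y) module_scheme" (structure) +
  assumes smult_closed [simp, intro]:
      "\<lbrakk>a \<in> carrier R; x \<in> carrier M\<rbrakk> \<Longrightarrow> a \<odot>\<^bsub>M\<^esub> x \<in> carrier M"
    and smult_l_distr:
      "\<lbrakk>a \<in> carrier R; b \<in> carrier R; x \<in> carrier M\<rbrakk> \<Longrightarrow>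
        (a \<oplus> b) \<odot>\<^bsub>M\<^esub> x = a \<odot>\<^bsub>M\<^esub> x \<oplus>\<^bsub>M\<^esub> b \<odot>\<^bsub>M\<^esub> x"
    and smult_r_distr:
      "\<lbrakk>a \<in> carrier R; x \<in> carrier M; y \<in> carrier M\<rbrakk> \<Longrightarrow>
        a \<odot>\<^bsub>M\<^esub> (x \<oplus>\<^bsub>M\<^esub> y) = a \<odot>\<^bsub>M\<^esub> x \<oplus>\<^bsub>M\<^esub> a \<odot>\<^bsub>M\<^esub> y"
    and smult_assoc1:
      "\<lbrakk>a \<in> carrier R; b \<in> carrier R; x \<in> carrier M\<rbrakk> \<Longrightarrow>
        (a \<otimes> b) \<odot>\<^bsub>M\<^esub> x = a \<odot>\<^bsub>M\<^esub> (b \<odot>\<^bsub>M\<^esub> x)"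
    and smult_one [simp]:
      "x \<in> carrier M \<Longrightarrow> \<one> \<odot>\<^bsub>M\<^esub> x = x"

definition simple_module :: "('l, 'x) ring_scheme \<Rightarrow> ('l, 'm, 'y) module_scheme \<Rightarrow> bool" where
  "simple_module L M \<longleftrightarrow>
     left_module L M \<and> carrier M \<noteq> {\<zero>\<^bsub>M\<^esub>} \<and>
     (\<forall>N. submodule N L M \<longrightarrow> N = {\<zero>\<^bsub>M\<^esub>} \<or> N = carrier M)"

definition semisimple_module :: "('l, 'x) ring_scheme \<Rightarrow> ('l, 'm, 'y) module_scheme \<Rightarrow> bool" where
  "semisimple_module L M \<longleftrightarrow>
     left_module L M \<and>
     (\<forall>N. submodule N L M \<longrightarrow>
       (\<exists>N'. submodule N' L M \<and> N \<inter> N' = {\<zero>\<^bsub>M\<^esub>} \<and> N <+>\<^bsub>M\<^esub> N' = carrier M))"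

text \<open>Existence of a composition series, as a finite chain that cannot be refined.\<close>

definition finite_length_module :: "('l, 'x) ring_scheme \<Rightarrow> ('l, 'm, 'y) module_scheme \<Rightarrow> bool" where
  "finite_length_module L M \<longleftrightarrow>
     left_module L M \<and>
     (\<exists>(F :: nat \<Rightarrow> 'm set) n.
        F 0 = {\<zero>\<^bsub>M\<^esub>} \<and> F n = carrier M \<and>
        (\<forall>j\<le>n. submodule (F j) L M) \<and>
        (\<forall>j<n. F j \<subset> F (Suc j) \<and>
           (\<forall>N. submodule N L M \<and> F j \<subseteq> N \<and> N \<subseteq> F (Suc j) \<longrightarrow> N = F j \<or> N = F (Suc j))))"

definition module_hom_set ::
  "('l, 'x) ring_scheme \<Rightarrow> ('l, 'm, 'y) module_scheme \<Rightarrow> ('l, 'n, 'z) module_scheme \<Rightarrow> ('m \<Rightarrow> 'n) set"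
  where
  "module_hom_set L M N =
     {f \<in> carrier M \<rightarrow> carrier N.
        (\<forall>x\<in>carrier M. \<forall>y\<in>carrier M. f (x \<oplus>\<^bsub>M\<^esub> y) = f x \<oplus>\<^bsub>N\<^esub> f y) \<and>
        (\<forall>a\<in>carrier L. \<forall>x\<in>carrier M. f (a \<odot>\<^bsub>M\<^esub> x) = a \<odot>\<^bsub>N\<^esub> f x)}"

text \<open>\<open>0 \<rightarrow> N \<rightarrow> M \<rightarrow> Q \<rightarrow> 0\<close> is exact for some choice of the two homomorphisms.\<close>

definition short_exact ::
  "('l, 'x) ring_scheme \<Rightarrow> ('l, 'n) module \<Rightarrow> ('l, 'm) module \<Rightarrow> ('l, 'q) module \<Rightarrow> bool" where
  "short_exact L N M Q \<longleftrightarrow>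
     (\<exists>f g. f \<in> module_hom_set L N M \<and> g \<in> module_hom_set L M Q \<and>
        inj_on f (carrier N) \<and> g ` carrier M = carrier Q \<and>
        f ` carrier N = {x \<in> carrier M. g x = \<zero>\<^bsub>Q\<^esub>})"

text \<open>Pullback of a module structure along a map \<open>h\<close> into the ring of scalars.\<close>

definition restrict_scalars :: "('l \<Rightarrow> 'r) \<Rightarrow> ('r, 'm) module \<Rightarrow> ('l, 'm) module" where
  "restrict_scalars h M =
     \<lparr>carrier = carrier M, monoid.mult = monoid.mult M, one = \<one>\<^bsub>M\<^esub>, ring.zero = \<zero>\<^bsub>M\<^esub>, add = add M,
      smult = (\<lambda>a x. h a \<odot>\<^bsub>M\<^esub> x)\<rparr>"


section \<open>The Grothendieck group of finite-length modules\<close>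

text \<open>
  Generators are the finite-length left \<open>L\<close>-modules, relations are given by the short exact sequences.
  Isomorphic modules are identified by the relations with \<open>N = 0\<close> (and \<open>[0] = 1\<close> by \<open>M = N = Q = 0\<close>).

  HOL has no type of all modules, so the modules range over those whose carrier is contained in a
  type \<open>'m\<close>, which stays arbitrary. Nothing is lost: up to isomorphism these modules are closed under
  submodules and quotients (a quotient can be carried by a transversal), so by Jordan--Hoelder
  the resulting group is free on the isomorphism classes of simple modules carried by \<open>'m\<close>. Hence it
  embeds into the corresponding group for any larger type.

  The group operation of the free abelian group is addition of finitely supported functions; as a
  group in the sense of HOL-Algebra, it and its quotient are written multiplicatively.
\<close>

definition finite_length_modules :: "('l, 'x) ring_scheme \<Rightarrow> ('l, 'm) module set" where
  "finite_length_modules L = {M. finite_length_module L M}"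

definition grothendieck_relations :: "('l, 'x) ring_scheme \<Rightarrow> (('l, 'm) module \<Rightarrow>\<^sub>0 int) set" where
  "grothendieck_relations L =
     generate (free_Abelian_group (finite_length_modules L))
       {frag_of M - (frag_of N + frag_of Q) | M N Q.
          M \<in> finite_length_modules L \<and> N \<in> finite_length_modules L \<and> Q \<in> finite_length_modules L \<and>
          short_exact L N M Q}"

definition grothendieck_group :: "('l, 'x) ring_scheme \<Rightarrow> (('l, 'm) module \<Rightarrow>\<^sub>0 int) set monoid" where
  "grothendieck_group L =
     free_Abelian_group (finite_length_modules L) Mod grothendieck_relations L"

definition grothendieck_class ::
  "('l, 'x) ring_scheme \<Rightarrow> ('l, 'm) module \<Rightarrow> (('l, 'm) module \<Rightarrow>\<^sub>0 int) set" where
  "grothendieck_class L M =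
     grothendieck_relations L #>\<^bsub>free_Abelian_group (finite_length_modules L)\<^esub> frag_of M"


section \<open>Complete discrete valuation rings\<close>

definition discrete_valuation_ring :: "('r, 'x) ring_scheme \<Rightarrow> bool" where
  "discrete_valuation_ring R \<longleftrightarrow>
     principal_domain R \<and> (\<exists>!\<mm>. maximalideal \<mm> R) \<and> \<not> field R"

definition ideal_power :: "('r, 'x) ring_scheme \<Rightarrow> 'r set \<Rightarrow> nat \<Rightarrow> 'r set" where
  "ideal_power R J n = ((\<lambda>H. ideal_prod R J H) ^^ n) (carrier R)"

text \<open>Every Cauchy sequence for the \<open>J\<close>-adic topology has exactly one limit.\<close>

definition adically_complete :: "('r, 'x) ring_scheme \<Rightarrow> 'r set \<Rightarrow> bool" where
  "adically_complete R J \<longleftrightarrow>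
     (\<forall>x :: nat \<Rightarrow> 'r. range x \<subseteq> carrier R \<longrightarrow>
        (\<forall>N. \<exists>k. \<forall>m\<ge>k. \<forall>n\<ge>k. x m \<ominus>\<^bsub>R\<^esub> x n \<in> ideal_power R J N) \<longrightarrow>
        (\<exists>!y. y \<in> carrier R \<and> (\<forall>N. \<exists>k. \<forall>n\<ge>k. x n \<ominus>\<^bsub>R\<^esub> y \<in> ideal_power R J N)))"

definition complete_discrete_valuation_ring :: "('r, 'x) ring_scheme \<Rightarrow> bool" where
  "complete_discrete_valuation_ring R \<longleftrightarrow>
     discrete_valuation_ring R \<and> (\<forall>\<mm>. maximalideal \<mm> R \<longrightarrow> adically_complete R \<mm>)"

text \<open>The field \<open>K\<close> is the field of fractions of its subring \<open>R\<close>.\<close>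

definition is_fraction_field :: "('k, 'x) ring_scheme \<Rightarrow> 'k set \<Rightarrow> bool" where
  "is_fraction_field K R \<longleftrightarrow>
     field K \<and> subring R K \<and>
     (\<forall>x\<in>carrier K. \<exists>a\<in>R. \<exists>b\<in>R - {\<zero>\<^bsub>K\<^esub>}. x = a \<otimes>\<^bsub>K\<^esub> inv\<^bsub>K\<^esub> b)"


section \<open>Algebras and orders\<close>

text \<open>The library locale \<^locale>\<open>algebra\<close> requires the algebra to be commutative.\<close>

locale assoc_algebra = module R M + ring M
  for R :: "('k, 'x) ring_scheme" (structure) and M :: "('k, 'a, 'y) module_scheme" (structure) +
  assumes smult_assoc2:
      "\<lbrakk>a \<in> carrier R; x \<in> carrier M; y \<in> carrier M\<rbrakk> \<Longrightarrow>
        (a \<odot>\<^bsub>M\<^esub> x) \<otimes>\<^bsub>M\<^esub> y = a \<odot>\<^bsub>M\<^esub> (x \<otimes>\<^bsub>M\<^esub> y)"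
    and smult_assoc3:
      "\<lbrakk>a \<in> carrier R; x \<in> carrier M; y \<in> carrier M\<rbrakk> \<Longrightarrow>
        x \<otimes>\<^bsub>M\<^esub> (a \<odot>\<^bsub>M\<^esub> y) = a \<odot>\<^bsub>M\<^esub> (x \<otimes>\<^bsub>M\<^esub> y)"

text \<open>Linear combinations of elements of \<open>B\<close> with coefficients in a set \<open>C\<close> of scalars.\<close>

definition lin_span :: "'k set \<Rightarrow> ('k, 'a, 'x) module_scheme \<Rightarrow> 'a set \<Rightarrow> 'a set" where
  "lin_span C M B =
     {(\<Oplus>\<^bsub>M\<^esub> x\<in>F. c x \<odot>\<^bsub>M\<^esub> x) | c F. finite F \<and> F \<subseteq> B \<and> c \<in> F \<rightarrow> C}"

definition finite_dimensional_algebra :: "('k, 'x) ring_scheme \<Rightarrow> ('k, 'a) module \<Rightarrow> bool" where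
  "finite_dimensional_algebra K A \<longleftrightarrow>
     assoc_algebra K A \<and>
     (\<exists>B. finite B \<and> B \<subseteq> carrier A \<and> lin_span (carrier K) A B = carrier A)"

definition regular_module :: "('a, 'x) ring_scheme \<Rightarrow> ('a, 'a) module" where
  "regular_module A =
     \<lparr>carrier = carrier A, monoid.mult = monoid.mult A, one = \<one>\<^bsub>A\<^esub>, ring.zero = \<zero>\<^bsub>A\<^esub>, add = add A,
      smult = monoid.mult A\<rparr>"

definition semisimple_ring :: "('a, 'x) ring_scheme \<Rightarrow> bool" where
  "semisimple_ring A \<longleftrightarrow> ring A \<and> semisimple_module A (regular_module A)"

definition is_order :: "('k, 'x) ring_scheme \<Rightarrow> 'k set \<Rightarrow> ('k, 'a) module \<Rightarrow> 'a set \<Rightarrow> bool" where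
  "is_order K R A \<Lambda> \<longleftrightarrow>
     subring \<Lambda> A \<and> (\<forall>r\<in>R. \<forall>x\<in>\<Lambda>. r \<odot>\<^bsub>A\<^esub> x \<in> \<Lambda>) \<and>
     (\<exists>B. finite B \<and> B \<subseteq> \<Lambda> \<and> lin_span R A B = \<Lambda>) \<and>
     lin_span (carrier K) A \<Lambda> = carrier A"

definition is_maximal_order ::
  "('k, 'x) ring_scheme \<Rightarrow> 'k set \<Rightarrow> ('k, 'a) module \<Rightarrow> 'a set \<Rightarrow> bool" where
  "is_maximal_order K R A \<Lambda> \<longleftrightarrow>
     is_order K R A \<Lambda> \<and> (\<forall>\<Gamma>. is_order K R A \<Gamma> \<and> \<Lambda> \<subseteq> \<Gamma> \<longrightarrow> \<Gamma> = \<Lambda>)"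


section \<open>Central idempotents\<close>

definition central_idempotent :: "('a, 'x) ring_scheme \<Rightarrow> 'a \<Rightarrow> bool" where
  "central_idempotent A e \<longleftrightarrow>
     e \<in> carrier A \<and> e \<otimes>\<^bsub>A\<^esub> e = e \<and> (\<forall>x\<in>carrier A. e \<otimes>\<^bsub>A\<^esub> x = x \<otimes>\<^bsub>A\<^esub> e)"

definition primitive_central_idempotent :: "('a, 'x) ring_scheme \<Rightarrow> 'a \<Rightarrow> bool" where
  "primitive_central_idempotent A e \<longleftrightarrow>
     central_idempotent A e \<and> e \<noteq> \<zero>\<^bsub>A\<^esub> \<and>
     (\<forall>f g. central_idempotent A f \<and> central_idempotent A g \<and> f \<otimes>\<^bsub>A\<^esub> g = \<zero>\<^bsub>A\<^esub> \<and> e = f \<oplus>\<^bsub>A\<^esub> g \<longrightarrow>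
        f = \<zero>\<^bsub>A\<^esub> \<or> g = \<zero>\<^bsub>A\<^esub>)"

definition complete_primitive_central_idempotents ::
  "('a, 'x) ring_scheme \<Rightarrow> 'i set \<Rightarrow> ('i \<Rightarrow> 'a) \<Rightarrow> bool" where
  "complete_primitive_central_idempotents A I e \<longleftrightarrow>
     finite I \<and> (\<forall>i\<in>I. primitive_central_idempotent A (e i)) \<and>
     (\<forall>i\<in>I. \<forall>j\<in>I. i \<noteq> j \<longrightarrow> e i \<otimes>\<^bsub>A\<^esub> e j = \<zero>\<^bsub>A\<^esub>) \<and>
     (\<Oplus>\<^bsub>A\<^esub> i\<in>I. e i) = \<one>\<^bsub>A\<^esub>"

text \<open>The ring \<open>\<Lambda>e\<close>, whose identity element is \<open>e\<close>, for a central idempotent \<open>e\<close> of \<open>A\<close>.\<close>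

definition idempotent_component :: "('a, 'x) ring_scheme \<Rightarrow> 'a set \<Rightarrow> 'a \<Rightarrow> 'a ring" where
  "idempotent_component A \<Lambda> e =
     \<lparr>carrier = (\<lambda>x. x \<otimes>\<^bsub>A\<^esub> e) ` \<Lambda>, monoid.mult = monoid.mult A, one = e, ring.zero = \<zero>\<^bsub>A\<^esub>, add = add A\<rparr>"

end

theory Submission
  imports Defs "HOL-Library.Multiset"
begin

text \<open>
  Let \<open>e = e\<^sub>i\<close>, let \<open>V = A\<epsilon>\<close> be a minimal left ideal of \<open>A e\<close>, and let the division ring
  \<open>D = \<epsilon>A\<epsilon>\<close> act on \<open>V\<close> from the right. Right multiplication by \<open>d\<close> in \<open>D\<close> is \<open>\<Lambda>\<close>-linear, so the
  class of \<open>M / M d\<close> in \<open>\<G>(\<Lambda>)\<close> is the same for all \<open>\<Lambda>\<close>-lattices \<open>M\<close> of \<open>V\<close> with \<open>M d \<subseteq> M\<close>. Its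
  length defines a discrete valuation on \<open>D\<close>; completeness of \<open>R\<close> yields that every \<open>d\<close> or its inverse
  stabilises a lattice, so that the elements \<open>d\<close> of non-negative valuation form a subring \<open>\<Delta>\<close>. Let \<open>p\<close>
  be a uniformizer.

  If \<open>M\<close> is the \<open>\<Delta>\<close>-bidual of \<open>\<Lambda>'\<epsilon>\<close>, then \<open>\<Lambda>'e\<close> is the left order of \<open>M\<close> by maximality, and all
  \<open>\<Lambda>'\<close>-lattices in \<open>V\<close> are of the form \<open>M c\<close>. A simple \<open>\<Lambda>'e\<close>-module is a quotient of two of these,
  hence has the class of \<open>M / M p\<close>. The same holds for \<open>\<Lambda>''\<close> with the same \<open>p\<close>.
\<close>


section \<open>Composition factors\<close>

text \<open>Completeness enters through one chain. For \<open>d\<close> in the division ring, the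
  elements of a lattice whose first \<open>n\<close> multiples by \<open>d\<close> stay in the
  lattice form a decreasing chain of lattices. Either its intersection is non-zero and is stabilised
  by \<open>d\<close>, or a Chevalley argument ends it in a lattice that the inverse of
  \<open>d\<close> stabilises. Closure of \<Delta> under addition is the obstacle, because two
  elements of \<Delta> come with two different stable lattices; dividing by one of them reduces it
  to the case where one element is \<epsilon>.

  Whatever has to agree for \<Lambda>' and \<Lambda>'', namely the division ring, its valuation and
  \<open>p\<close>, is built from \<Lambda> and \<epsilon> alone. That the class of M / M d does not
  depend on M is a comparison of the chains through M d and through N between M and N d, as
  \<open>d\<close> carries M / N to M d / N d.

  Composition factors are counted inside A, as multisets of annihilators attached to chains of
  submodules, because quotient modules have no natural carrier there. Abstract modules and relations
  of the Grothendieck group are reached only at the end, by presenting a module as a quotient of two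
  such submodules.\<close>

context ring
begin

text \<open>\<open>C\<close> is only a set of scalars. With \<Lambda>, \<Lambda>', the valuation
  ring or the whole ring in its place, lattices over different orders and left ideals become
  instances of one predicate inside the fixed ring \<open>R\<close>.\<close>

definition smod :: "'a set \<Rightarrow> 'a set \<Rightarrow> bool" where
  "smod C W \<longleftrightarrow> W \<subseteq> carrier R \<and> \<zero> \<in> W \<and> (\<forall>x\<in>W. \<forall>y\<in>W. x \<ominus> y \<in> W) \<and> (\<forall>c\<in>C. \<forall>x\<in>W. c \<otimes> x \<in> W)"

lemma smodI:
  assumes "W \<subseteq> carrier R" "\<zero> \<in> W" "\<And>x y. x \<in> W \<Longrightarrow> y \<in> W \<Longrightarrow> x \<ominus> y \<in> W"
    "\<And>c x. c \<in> C \<Longrightarrow> x \<in> W \<Longrightarrow> c \<otimes> x \<in> W"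
  shows "smod C W"
  using assms unfolding smod_def by blast

lemma smod_carrier: "smod C W \<Longrightarrow> W \<subseteq> carrier R"
  and smod_zero: "smod C W \<Longrightarrow> \<zero> \<in> W"
  and smod_minus: "smod C W \<Longrightarrow> x \<in> W \<Longrightarrow> y \<in> W \<Longrightarrow> x \<ominus> y \<in> W"
  and smod_smult: "smod C W \<Longrightarrow> c \<in> C \<Longrightarrow> x \<in> W \<Longrightarrow> c \<otimes> x \<in> W"
  unfolding smod_def by blast+

lemma smod_mem_carrier: "smod C W \<Longrightarrow> x \<in> W \<Longrightarrow> x \<in> carrier R"
  using smod_carrier by blast

lemma smod_neg:
  assumes "smod C W" "x \<in> W" shows "\<ominus> x \<in> W"
  using smod_minus[OF assms(1) smod_zero[OF assms(1)] assms(2)] smod_mem_carrier[OF assms]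
  by (simp add: minus_eq)

lemma smod_add:
  assumes "smod C W" "x \<in> W" "y \<in> W" shows "x \<oplus> y \<in> W"
  using smod_minus[OF assms(1,2) smod_neg[OF assms(1,3)]] smod_mem_carrier[OF assms(1)] assms(2,3)
  by (simp add: minus_eq)

lemma smod_mono: "smod C W \<Longrightarrow> C' \<subseteq> C \<Longrightarrow> smod C' W"
  unfolding smod_def by blast

lemma smod_Int: "smod C W \<Longrightarrow> smod C Y \<Longrightarrow> smod C (W \<inter> Y)"
  unfolding smod_def by blast

lemma subring_smod:
  assumes "subring B R" "C \<subseteq> B" shows "smod C B"
proof (rule smodI)
  note B = subringE[OF assms(1)]
  show "B \<subseteq> carrier R" "\<zero> \<in> B" using B by auto
  show "x \<ominus> y \<in> B" if "x \<in> B" "y \<in> B" for x y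
    using B(7)[OF that(1) B(5)[OF that(2)]] by (simp add: minus_eq)
  show "c \<otimes> x \<in> B" if "c \<in> C" "x \<in> B" for c x using B(6) assms(2) that by blast
qed

lemma smod_minus_cancel:
  assumes "smod C W" "x \<oplus> y \<in> W" "x \<in> W" "y \<in> carrier R"
  shows "y \<in> W"
proof -
  have "x \<in> carrier R" using assms smod_mem_carrier by blast
  then have "y = (x \<oplus> y) \<ominus> x" using assms(4) by algebra
  then show ?thesis using smod_minus[OF assms(1,2,3)] by simp
qed

lemma mem_set_add: "z \<in> W <+>\<^bsub>R\<^esub> Y \<longleftrightarrow> (\<exists>x\<in>W. \<exists>y\<in>Y. z = x \<oplus> y)"
  unfolding set_add_def' by blast

lemma smod_sum:
  assumes W: "smod C W" and Y: "smod C Y" and C: "C \<subseteq> carrier R"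
  shows "smod C (W <+>\<^bsub>R\<^esub> Y)"
proof (rule smodI)
  note c = smod_mem_carrier[OF W] smod_mem_carrier[OF Y]
  show "W <+>\<^bsub>R\<^esub> Y \<subseteq> carrier R" using c by (auto simp: mem_set_add)
  show "\<zero> \<in> W <+>\<^bsub>R\<^esub> Y"
    unfolding mem_set_add by (rule bexI[OF _ smod_zero[OF W]], rule bexI[OF _ smod_zero[OF Y]]) simp
  show "x \<ominus> y \<in> W <+>\<^bsub>R\<^esub> Y" if xy: "x \<in> W <+>\<^bsub>R\<^esub> Y" "y \<in> W <+>\<^bsub>R\<^esub> Y" for x y
  proof -
    obtain a b a' b' where h: "a \<in> W" "b \<in> Y" "a' \<in> W" "b' \<in> Y" "x = a \<oplus> b" "y = a' \<oplus> b'"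
      using xy unfolding mem_set_add by blast
    have "x \<ominus> y = (a \<ominus> a') \<oplus> (b \<ominus> b')" using c h(1-4) unfolding h(5,6) by algebra
    then show ?thesis using smod_minus[OF W h(1,3)] smod_minus[OF Y h(2,4)] unfolding mem_set_add by blast
  qed
  show "k \<otimes> x \<in> W <+>\<^bsub>R\<^esub> Y" if kx: "k \<in> C" "x \<in> W <+>\<^bsub>R\<^esub> Y" for k x
  proof -
    obtain a b where h: "a \<in> W" "b \<in> Y" "x = a \<oplus> b"
      using kx unfolding mem_set_add by blast
    have "k \<otimes> x = k \<otimes> a \<oplus> k \<otimes> b" using c h(1-2) kx(1) C unfolding h(3) by (auto intro: r_distr)
    then show ?thesis using smod_smult[OF W kx(1) h(1)] smod_smult[OF Y kx(1) h(2)] unfolding mem_set_add by blast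
  qed
qed

lemma subset_sum_left:
  assumes "smod C W" "smod C Y" shows "W \<subseteq> W <+>\<^bsub>R\<^esub> Y"
proof
  fix x assume "x \<in> W"
  moreover have "x = x \<oplus> \<zero>" using smod_mem_carrier[OF assms(1) \<open>x \<in> W\<close>] by simp
  ultimately show "x \<in> W <+>\<^bsub>R\<^esub> Y" using smod_zero[OF assms(2)] unfolding mem_set_add by blast
qed

lemma subset_sum_right:
  assumes "smod C W" "smod C Y" shows "Y \<subseteq> W <+>\<^bsub>R\<^esub> Y"
proof
  fix x assume "x \<in> Y"
  moreover have "x = \<zero> \<oplus> x" using smod_mem_carrier[OF assms(2) \<open>x \<in> Y\<close>] by simp
  ultimately show "x \<in> W <+>\<^bsub>R\<^esub> Y" using smod_zero[OF assms(1)] unfolding mem_set_add by blast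
qed

lemma sum_least:
  assumes "smod C Z" "W \<subseteq> Z" "Y \<subseteq> Z" shows "W <+>\<^bsub>R\<^esub> Y \<subseteq> Z"
  using assms smod_add[OF assms(1)] unfolding set_add_def' by blast

text \<open>Dedekind's modular law, the source of the computations with intersections in
  \<open>comp_sum\<close> and \<open>comp_split\<close>.\<close>

lemma modular:
  assumes W: "smod C W" and Z: "smod C Z" and Y: "smod C Y" and "W \<subseteq> Z"
  shows "(W <+>\<^bsub>R\<^esub> Y) \<inter> Z = W <+>\<^bsub>R\<^esub> (Y \<inter> Z)"
proof
  show "(W <+>\<^bsub>R\<^esub> Y) \<inter> Z \<subseteq> W <+>\<^bsub>R\<^esub> (Y \<inter> Z)"
  proof
    fix z assume "z \<in> (W <+>\<^bsub>R\<^esub> Y) \<inter> Z"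
    then obtain x y where h: "x \<in> W" "y \<in> Y" "z = x \<oplus> y" "z \<in> Z" unfolding set_add_def' by blast
    then have "y \<in> Z" using smod_minus_cancel[OF Z] \<open>W \<subseteq> Z\<close> smod_mem_carrier[OF Y] by blast
    then show "z \<in> W <+>\<^bsub>R\<^esub> (Y \<inter> Z)" using h unfolding mem_set_add by blast
  qed
  show "W <+>\<^bsub>R\<^esub> (Y \<inter> Z) \<subseteq> (W <+>\<^bsub>R\<^esub> Y) \<inter> Z"
    using \<open>W \<subseteq> Z\<close> smod_add[OF Z] unfolding set_add_def' by blast
qed

text \<open>Simplicity of \<open>P / M\<close>, expressed by intermediate submodules so that no
  quotient has to be formed.\<close>

definition covers :: "'a set \<Rightarrow> 'a set \<Rightarrow> 'a set \<Rightarrow> bool" where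
  "covers C M P \<longleftrightarrow> smod C M \<and> smod C P \<and> M \<subset> P \<and>
     (\<forall>W. smod C W \<longrightarrow> M \<subseteq> W \<longrightarrow> W \<subseteq> P \<longrightarrow> W = M \<or> W = P)"

text \<open>A simple module is determined up to isomorphism by the annihilator of any one of its non-zero
  elements; this is the set of all these annihilators for \<open>P / M\<close>.\<close>

definition simple_key :: "'a set \<Rightarrow> 'a set \<Rightarrow> 'a set \<Rightarrow> 'a set set" where
  "simple_key C M P = (\<lambda>x. {c \<in> C. c \<otimes> x \<in> M}) ` (P - M)"

text \<open>A composition series of \<open>M / N\<close> with the multiset of isomorphism types of
  its factors. The chain itself is forgotten, so that two series can be compared by their multisets
  alone.\<close>

inductive comp_factors :: "'a set \<Rightarrow> 'a set \<Rightarrow> 'a set \<Rightarrow> 'a set set multiset \<Rightarrow> bool" for C where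
  comp_refl: "smod C N \<Longrightarrow> comp_factors C N N {#}"
| comp_step: "comp_factors C N M ms \<Longrightarrow> covers C M P \<Longrightarrow> comp_factors C N P (add_mset (simple_key C M P) ms)"

lemma comp_smod: "comp_factors C N M ms \<Longrightarrow> smod C N \<and> smod C M \<and> N \<subseteq> M"
  by (induction rule: comp_factors.induct) (auto simp: covers_def)

lemma comp_trans: "comp_factors C M P b \<Longrightarrow> comp_factors C N M a \<Longrightarrow> comp_factors C N P (a + b)"
  by (induction rule: comp_factors.induct) (auto intro: comp_factors.intros)

text \<open>The second isomorphism theorem \<open>P / (P \<inter> Q) \<cong> (P + Q) / Q\<close> for simple quotients.\<close>

lemma covers_sum:
  assumes c: "covers C (P \<inter> Q) P" and Q: "smod C Q" and C: "C \<subseteq> carrier R"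
  shows "covers C Q (P <+>\<^bsub>R\<^esub> Q)" and "simple_key C Q (P <+>\<^bsub>R\<^esub> Q) = simple_key C (P \<inter> Q) P"
proof -
  have P: "smod C P" using c by (simp add: covers_def)
  have nPQ: "\<not> P \<subseteq> Q" using c by (auto simp: covers_def)
  show "covers C Q (P <+>\<^bsub>R\<^esub> Q)"
    unfolding covers_def
  proof (intro conjI allI impI)
    show "smod C Q" "smod C (P <+>\<^bsub>R\<^esub> Q)" using P Q C by (auto intro: smod_sum)
    show "Q \<subset> P <+>\<^bsub>R\<^esub> Q" using subset_sum_left[OF P Q] subset_sum_right[OF P Q] nPQ by blast
    fix W assume W: "smod C W" "Q \<subseteq> W" "W \<subseteq> P <+>\<^bsub>R\<^esub> Q"
    have "P \<inter> W = P \<inter> Q \<or> P \<inter> W = P"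
      using c W smod_Int[OF P W(1)] unfolding covers_def by blast
    then show "W = Q \<or> W = P <+>\<^bsub>R\<^esub> Q"
    proof
      assume h: "P \<inter> W = P \<inter> Q"
      have "W \<subseteq> Q"
      proof
        fix x assume x: "x \<in> W"
        then obtain a b where ab: "a \<in> P" "b \<in> Q" "x = a \<oplus> b" using W(3) unfolding set_add_def' by blast
        have "b \<oplus> a \<in> W" using x ab smod_mem_carrier[OF P] smod_mem_carrier[OF Q] a_comm by simp
        then have "a \<in> W" using smod_minus_cancel[OF W(1)] ab W(2) smod_mem_carrier[OF P] by blast
        then show "x \<in> Q" using h ab smod_add[OF Q] by blast
      qed
      then show ?thesis using W(2) by blast
    next
      assume "P \<inter> W = P"
      then show ?thesis using sum_least[OF W(1)] W by blast
    qed
  qed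
  have key: "{c \<in> C. c \<otimes> (a \<oplus> b) \<in> Q} = {c \<in> C. c \<otimes> a \<in> P \<inter> Q}" if ab: "a \<in> P" "b \<in> Q" for a b
  proof -
    have "c \<otimes> (a \<oplus> b) \<in> Q \<longleftrightarrow> c \<otimes> a \<in> P \<inter> Q" if cc: "c \<in> C" for c
    proof -
      have car: "c \<in> carrier R" "a \<in> carrier R" "b \<in> carrier R"
        using ab cc C smod_mem_carrier[OF P] smod_mem_carrier[OF Q] by auto
      have e: "c \<otimes> (a \<oplus> b) = c \<otimes> b \<oplus> c \<otimes> a" using car by algebra
      have cb: "c \<otimes> b \<in> Q" using smod_smult[OF Q cc ab(2)] .
      show ?thesis unfolding e
        using smod_minus_cancel[OF Q _ cb, of "c \<otimes> a"] smod_add[OF Q cb] car smod_smult[OF P cc ab(1)]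
        by auto
    qed
    then show ?thesis by blast
  qed
  show "simple_key C Q (P <+>\<^bsub>R\<^esub> Q) = simple_key C (P \<inter> Q) P"
  proof
    show "simple_key C Q (P <+>\<^bsub>R\<^esub> Q) \<subseteq> simple_key C (P \<inter> Q) P"
    proof
      fix k assume "k \<in> simple_key C Q (P <+>\<^bsub>R\<^esub> Q)"
      then obtain a b where h: "a \<in> P" "b \<in> Q" "a \<oplus> b \<notin> Q" "k = {c \<in> C. c \<otimes> (a \<oplus> b) \<in> Q}"
        unfolding simple_key_def mem_set_add[abs_def] image_iff by (auto simp: mem_set_add)
      have "a \<notin> Q" using h smod_add[OF Q] by blast
      then show "k \<in> simple_key C (P \<inter> Q) P"
        using h key[OF h(1,2)] unfolding simple_key_def by auto
    qed
    show "simple_key C (P \<inter> Q) P \<subseteq> simple_key C Q (P <+>\<^bsub>R\<^esub> Q)"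
    proof
      fix k assume "k \<in> simple_key C (P \<inter> Q) P"
      then obtain a where h: "a \<in> P" "a \<notin> Q" "k = {c \<in> C. c \<otimes> a \<in> P \<inter> Q}"
        unfolding simple_key_def by blast
      have "a \<oplus> \<zero> = a" using smod_mem_carrier[OF P h(1)] by simp
      then show "k \<in> simple_key C Q (P <+>\<^bsub>R\<^esub> Q)"
        using h key[OF h(1) smod_zero[OF Q]] subset_sum_left[OF P Q] unfolding simple_key_def by auto
    qed
  qed
qed

text \<open>The second isomorphism theorem for whole chains: adding \<open>W\<close> to every term
  keeps each step simple of the same type, as \<open>P \<inter> (M + W) = M\<close> by the modular
  law.\<close>

lemma comp_sum:
  assumes "comp_factors C Y Z b" "smod C W" "W \<inter> Z = Y" "C \<subseteq> carrier R"
  shows "comp_factors C W (Z <+>\<^bsub>R\<^esub> W) b"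
  using assms
proof (induction rule: comp_factors.induct)
  case (comp_refl N)
  then have "N \<subseteq> W" by blast
  then have "N <+>\<^bsub>R\<^esub> W = W"
    using subset_sum_right[of C N W] sum_least[of C W N W] comp_refl by blast
  then show ?case using comp_refl comp_factors.comp_refl by simp
next
  case (comp_step N M ms P)
  have M: "smod C M" and P: "smod C P" and MP: "M \<subseteq> P" using comp_step.hyps by (auto simp: covers_def)
  have NM: "N \<subseteq> M" using comp_smod comp_step.hyps by blast
  have XM: "W \<inter> M = N" using comp_step.prems MP NM by blast
  have ih: "comp_factors C W (M <+>\<^bsub>R\<^esub> W) ms" using comp_step XM by blast
  let ?Q = "M <+>\<^bsub>R\<^esub> W"
  have Q: "smod C ?Q" using smod_sum M comp_step.prems by blast
  have "P \<inter> ?Q = M <+>\<^bsub>R\<^esub> (W \<inter> P)" using modular[OF M P comp_step.prems(1) MP] by blast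
  also have "\<dots> = M"
    using comp_step.prems(2) NM subset_sum_left[OF M, of N] sum_least[OF M, of M N] comp_smod[OF comp_step.hyps(1)] by auto
  finally have PQ: "P \<inter> ?Q = M" .
  have cov: "covers C ?Q (P <+>\<^bsub>R\<^esub> ?Q)" "simple_key C ?Q (P <+>\<^bsub>R\<^esub> ?Q) = simple_key C M P"
    using covers_sum[OF _ Q, of P] PQ comp_step by auto
  have PX: "smod C (P <+>\<^bsub>R\<^esub> W)" using smod_sum P comp_step.prems by blast
  have "P <+>\<^bsub>R\<^esub> ?Q = P <+>\<^bsub>R\<^esub> W"
  proof
    show "P <+>\<^bsub>R\<^esub> ?Q \<subseteq> P <+>\<^bsub>R\<^esub> W"
      using sum_least[OF PX] subset_sum_left[OF P comp_step.prems(1)] subset_sum_right[OF P comp_step.prems(1)] MP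
      by (meson order_trans)
    show "P <+>\<^bsub>R\<^esub> W \<subseteq> P <+>\<^bsub>R\<^esub> ?Q"
      using sum_least[OF smod_sum[OF P Q]] subset_sum_left[OF P Q] subset_sum_right[OF P Q]
        subset_sum_right[OF M comp_step.prems(1)] comp_step.prems(3) by (meson order_trans)
  qed
  then show ?case using comp_factors.comp_step[OF ih, of "P <+>\<^bsub>R\<^esub> W"] cov by simp
qed

text \<open>The given chain is intersected with \<open>W\<close> below and joined with
  \<open>W\<close> above. In the induction the top factor \<open>P / M\<close> goes to the upper
  part if \<open>W \<subseteq> M\<close>; otherwise \<open>M + W = P\<close>, and
  \<open>P / M\<close>, being isomorphic to \<open>W / (W \<inter> M)\<close>, goes to the lower
  part.\<close>

lemma comp_split:
  assumes "comp_factors C N M ms" "smod C W" "N \<subseteq> W" "W \<subseteq> M" "C \<subseteq> carrier R"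
  shows "\<exists>a b. comp_factors C N W a \<and> comp_factors C W M b \<and> ms = a + b"
  using assms
proof (induction arbitrary: W rule: comp_factors.induct)
  case (comp_refl N)
  then have "W = N" by blast
  then show ?case using comp_refl.hyps comp_factors.comp_refl by fastforce
next
  case (comp_step N M ms P)
  have M: "smod C M" and P: "smod C P" and MP: "M \<subseteq> P"
    and cov: "\<And>Z. smod C Z \<Longrightarrow> M \<subseteq> Z \<Longrightarrow> Z \<subseteq> P \<Longrightarrow> Z = M \<or> Z = P"
    using comp_step.hyps by (auto simp: covers_def)
  show ?case
  proof (cases "W \<subseteq> M")
    case True
    then obtain a b where ab: "comp_factors C N W a" "comp_factors C W M b" "ms = a + b"
      using comp_step by blast
    then show ?thesis using comp_factors.comp_step[OF ab(2) comp_step.hyps(2)] by fastforce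
  next
    case False
    have sX: "smod C W" using comp_step by blast
    have C: "C \<subseteq> carrier R" using comp_step by blast
    have "M <+>\<^bsub>R\<^esub> W = P"
      using cov[OF smod_sum[OF M sX C] subset_sum_left[OF M sX] sum_least[OF P MP comp_step.prems(3)]]
        False subset_sum_right[OF M sX] by blast
    have XM: "covers C (W \<inter> M) W"
      unfolding covers_def
    proof (intro conjI allI impI)
      show "smod C (W \<inter> M)" "smod C W" using sX M smod_Int by auto
      show "W \<inter> M \<subset> W" using False by blast
      fix Z assume Z: "smod C Z" "W \<inter> M \<subseteq> Z" "Z \<subseteq> W"
      have "M <+>\<^bsub>R\<^esub> Z = M \<or> M <+>\<^bsub>R\<^esub> Z = P"
        using cov[OF smod_sum[OF M Z(1) C] subset_sum_left[OF M Z(1)] sum_least[OF P MP]]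
          Z comp_step.prems(3) by blast
      then show "Z = W \<inter> M \<or> Z = W"
      proof
        assume "M <+>\<^bsub>R\<^esub> Z = M"
        then show ?thesis using subset_sum_right[OF M Z(1)] Z by blast
      next
        assume h: "M <+>\<^bsub>R\<^esub> Z = P"
        have "W = (Z <+>\<^bsub>R\<^esub> M) \<inter> W"
        proof -
          have "Z <+>\<^bsub>R\<^esub> M = P" using h set_add_comm[OF smod_carrier[OF M] smod_carrier[OF Z(1)]] by simp
          then show ?thesis using comp_step.prems(3) by blast
        qed
        also have "\<dots> = Z <+>\<^bsub>R\<^esub> (M \<inter> W)" using modular[OF Z(1) sX M Z(3)] .
        also have "\<dots> \<subseteq> Z" using sum_least[OF Z(1), of Z "M \<inter> W"] Z(2) by blast
        finally show ?thesis using Z(3) by blast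
      qed
    qed
    have key: "simple_key C M P = simple_key C (W \<inter> M) W"
    proof -
      have "W <+>\<^bsub>R\<^esub> M = P" using \<open>M <+>\<^bsub>R\<^esub> W = P\<close> set_add_comm[OF smod_carrier[OF M] smod_carrier[OF sX]] by simp
      then show ?thesis using covers_sum(2)[OF XM M C] by simp
    qed
    obtain a b where ab: "comp_factors C N (W \<inter> M) a" "comp_factors C (W \<inter> M) M b" "ms = a + b"
      using comp_step.IH[OF smod_Int[OF sX M]] comp_step.prems comp_smod[OF comp_step.hyps(1)] by blast
    have "comp_factors C N W (add_mset (simple_key C M P) a)"
      using comp_factors.comp_step[OF ab(1) XM] key by simp
    moreover have "comp_factors C W P b"
      using comp_sum[OF ab(2) sX _ C] \<open>M <+>\<^bsub>R\<^esub> W = P\<close> by simp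
    ultimately show ?thesis using ab(3) by (metis add_mset_add_single union_mset_add_mset_left)
  qed
qed

lemma comp_self: "comp_factors C N M ms \<Longrightarrow> N = M \<longleftrightarrow> ms = {#}"
proof (induction rule: comp_factors.induct)
  case (comp_step N M ms P)
  then have "N \<subseteq> M" "M \<subset> P" using comp_smod covers_def by blast+
  then show ?case by auto
qed simp

lemma comp_covers:
  assumes "comp_factors C M P b" "covers C M P"
  shows "b = {#simple_key C M P#}"
  using assms(1)
proof cases
  case comp_refl
  then show ?thesis using assms(2) by (auto simp: covers_def)
next
  case (comp_step Z b')
  have "M \<subseteq> Z" "smod C Z" "Z \<subset> P" using comp_smod comp_step by (auto simp: covers_def)
  then have "Z = M" using assms(2) unfolding covers_def by blast
  then show ?thesis using comp_step comp_self[of C M M b'] by auto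
qed

text \<open>The Jordan-Hoelder argument: splitting the second series at the last proper term
  \<open>M\<close> of the first leaves only the simple factor \<open>P / M\<close> above it, and
  induction applies below.\<close>

theorem comp_unique:
  assumes "comp_factors C N M ms" "comp_factors C N M ms'" "C \<subseteq> carrier R"
  shows "ms = ms'"
  using assms
proof (induction arbitrary: ms' rule: comp_factors.induct)
  case (comp_refl N)
  then show ?case using comp_self by blast
next
  case (comp_step N M ms P)
  have "smod C M" "M \<subseteq> P" "N \<subseteq> M" using comp_step comp_smod by (auto simp: covers_def)
  then obtain a b where ab: "comp_factors C N M a" "comp_factors C M P b" "ms' = a + b"
    using comp_split comp_step.prems by blast
  then show ?case using comp_step.IH[OF ab(1) comp_step.prems(2)] comp_covers[OF ab(2) comp_step.hyps(2)] by simp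
qed

text \<open>Among the proper \<open>D\<close>-submodules of \<open>M\<close> one of greatest
  \<open>C\<close>-length is maximal, so the factor above it is simple over \<open>D\<close>, and
  induction on the \<open>C\<close>-length takes care of the rest.\<close>

lemma comp_finer:
  assumes "comp_factors C N M ms" "C \<subseteq> D" "D \<subseteq> carrier R" "smod D N" "smod D M"
  shows "\<exists>ms. comp_factors D N M ms"
  using assms
proof (induction "size ms" arbitrary: M ms rule: less_induct)
  case less
  have C: "C \<subseteq> carrier R" using less.prems by blast
  have sub: "\<exists>a. comp_factors C N Z a \<and> size a \<le> size ms \<and> (Z \<noteq> M \<longrightarrow> size a < size ms)"
    if Z: "smod D Z" "N \<subseteq> Z" "Z \<subseteq> M" for Z
  proof -
    obtain a b where ab: "comp_factors C N Z a" "comp_factors C Z M b" "ms = a + b"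
      using comp_split[OF less.prems(1) smod_mono[OF Z(1) less.prems(2)] Z(2,3) C] by blast
    then show ?thesis using comp_self[OF ab(2)] nonempty_has_size by force
  qed
  show ?case
  proof (cases "N = M")
    case True
    then show ?thesis using comp_refl[of D N] less.prems by auto
  next
    case False
    \<comment> \<open>The \<open>C\<close>-length of \<open>Z / N\<close>, well defined by
      \<open>comp_unique\<close>.\<close>
    let ?f = "\<lambda>Z. size (THE a. comp_factors C N Z a)"
    let ?P = "\<lambda>Z. smod D Z \<and> N \<subseteq> Z \<and> Z \<subset> M"
    have fe: "?f Z = size a" if "comp_factors C N Z a" for Z a
      using that comp_unique[OF _ _ C] by (metis the_equality)
    have NM: "N \<subseteq> M" using comp_smod less.prems(1) by blast
    have "?P N" using less.prems NM False by blast
    moreover have "?f Z < Suc (size ms)" if "?P Z" for Z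
      using sub[of Z] that fe by fastforce
    ultimately obtain Z where Z: "?P Z" and mx: "\<And>Y. ?P Y \<Longrightarrow> ?f Y \<le> ?f Z"
      using ex_has_greatest_nat_lemma[of ?P N ?f "Suc (size ms)"] ex_has_greatest_nat[of ?P N ?f "Suc (size ms)"]
      by (metis less_or_eq_imp_le)
    obtain a where a: "comp_factors C N Z a" "size a < size ms" using sub[of Z] Z by blast
    have cov: "covers D Z M"
      unfolding covers_def
    proof (intro conjI allI impI)
      show "smod D Z" "smod D M" "Z \<subset> M" using Z less.prems by auto
      fix W assume W: "smod D W" "Z \<subseteq> W" "W \<subseteq> M"
      show "W = Z \<or> W = M"
      proof (rule ccontr)
        assume n: "\<not> (W = Z \<or> W = M)"
        then have PX: "?P W" using W Z by blast
        obtain c where c: "comp_factors C N W c" using sub[of W] PX by blast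
        obtain a' b' where ab: "comp_factors C N Z a'" "comp_factors C Z W b'" "c = a' + b'"
          using comp_split[OF c smod_mono[OF _ less.prems(2)] _ W(2) C] Z by blast
        have "b' \<noteq> {#}" using comp_self[OF ab(2)] n by blast
        then have "size a' < size c" using ab(3) nonempty_has_size by force
        then show False using mx[OF PX] fe[OF c] fe[OF ab(1)] by simp
      qed
    qed
    obtain ms' where "comp_factors D N Z ms'"
      using less.hyps[OF a(2) a(1)] less.prems Z by blast
    then show ?thesis using comp_step[OF _ cov] by blast
  qed
qed

end

section \<open>Central discrete valuation rings of scalars\<close>

text \<open>Here and in the locales below, \<open>R\<close> is the algebra A. The valuation ring is
  its central copy \<open>S\<close>, with uniformizer \<open>t\<close>, whose inverse in A is
  \<open>u\<close>. Valuations are encoded by \<open>S_local\<close>: an element is divisible by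
  \<open>t\<close> or a unit. Completeness is asked for sequences whose \<open>n\<close>-th step is
  a multiple of \<open>t [^] n\<close>, the form in which limits are constructed later.\<close>

locale central_dvr = ring R for R (structure) +
  fixes S :: "'a set" and t u :: 'a
  assumes S_subring: "subring S R"
    and S_central: "\<lbrakk>s \<in> S; x \<in> carrier R\<rbrakk> \<Longrightarrow> s \<otimes> x = x \<otimes> s"
    and t_in_S: "t \<in> S" and u_closed [simp]: "u \<in> carrier R" and t_u: "t \<otimes> u = \<one>"
    and S_local: "s \<in> S \<Longrightarrow> (\<exists>r\<in>S. s = t \<otimes> r) \<or> (\<exists>r\<in>S. s \<otimes> r = \<one>)"
    and S_separated: "\<lbrakk>s \<in> S; \<And>n::nat. \<exists>r\<in>S. s = t [^] n \<otimes> r\<rbrakk> \<Longrightarrow> s = \<zero>"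
    and S_complete: "\<lbrakk>\<And>n. a n \<in> S; \<And>n::nat. \<exists>r\<in>S. a (Suc n) \<ominus> a n = t [^] n \<otimes> r\<rbrakk> \<Longrightarrow>
      \<exists>y\<in>S. \<forall>n. \<exists>r\<in>S. y \<ominus> a n = t [^] n \<otimes> r"
begin

section \<open>Arithmetic with the uniformizer and its inverse\<close>

lemma S_carrier: "s \<in> S \<Longrightarrow> s \<in> carrier R"
  using subringE(1)[OF S_subring] by blast

lemma S_sub: "S \<subseteq> carrier R"
  using S_carrier by blast

lemma t_closed [simp]: "t \<in> carrier R"
  using t_in_S S_carrier by blast

lemma one_in_S: "\<one> \<in> S" and zero_in_S: "\<zero> \<in> S"
  using subringE[OF S_subring] by auto

lemma tpow_S: "t [^] (n::nat) \<in> S"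
proof (induction n)
  case 0 then show ?case using one_in_S by simp
next
  case (Suc n)
  then show ?case using subringE(6)[OF S_subring Suc t_in_S] by simp
qed

lemma tpow_comm: "x \<in> carrier R \<Longrightarrow> t [^] (n::nat) \<otimes> x = x \<otimes> t [^] n"
  using S_central tpow_S by blast

lemma tpow_pull: "\<lbrakk>x \<in> carrier R; y \<in> carrier R\<rbrakk> \<Longrightarrow> x \<otimes> (t [^] (n::nat) \<otimes> y) = t [^] n \<otimes> (x \<otimes> y)"
  by (metis m_assoc nat_pow_closed t_closed tpow_comm)

lemma u_t: "u \<otimes> t = \<one>"
  using S_central[OF t_in_S u_closed] t_u by simp

lemma u_central: "x \<in> carrier R \<Longrightarrow> u \<otimes> x = x \<otimes> u"
proof -
  assume x: "x \<in> carrier R"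
  have "u \<otimes> x = u \<otimes> (x \<otimes> (t \<otimes> u))" using x t_u by simp
  also have "\<dots> = u \<otimes> ((t \<otimes> x) \<otimes> u)" using x S_central[OF t_in_S x] by (simp add: m_assoc)
  also have "\<dots> = (u \<otimes> t) \<otimes> (x \<otimes> u)" using x by (simp add: m_assoc)
  finally show ?thesis using x u_t by simp
qed

lemma upow_comm: "x \<in> carrier R \<Longrightarrow> u [^] (n::nat) \<otimes> x = x \<otimes> u [^] n"
proof (induction n)
  case (Suc n)
  then show ?case by (metis m_assoc nat_pow_Suc nat_pow_closed u_central u_closed)
qed simp

lemma upow_pull: "\<lbrakk>x \<in> carrier R; y \<in> carrier R\<rbrakk> \<Longrightarrow> x \<otimes> (u [^] (n::nat) \<otimes> y) = u [^] n \<otimes> (x \<otimes> y)"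
  by (metis m_assoc nat_pow_closed u_closed upow_comm)

lemma u_t_pow: "u [^] (n::nat) \<otimes> t [^] n = \<one>"
proof (induction n)
  case (Suc n)
  have "u [^] Suc n \<otimes> t [^] Suc n = (u [^] n \<otimes> u) \<otimes> (t \<otimes> t [^] n)"
    using tpow_comm[of t n] by simp
  also have "\<dots> = u [^] n \<otimes> ((u \<otimes> t) \<otimes> t [^] n)" by (simp add: m_assoc)
  finally show ?case using Suc u_t by simp
qed simp

lemma upow_tpow [simp]: "x \<in> carrier R \<Longrightarrow> u [^] (n::nat) \<otimes> (t [^] n \<otimes> x) = x"
  by (simp add: m_assoc[symmetric] u_t_pow)

lemma tpow_upow [simp]: "x \<in> carrier R \<Longrightarrow> t [^] (n::nat) \<otimes> (u [^] n \<otimes> x) = x"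
  using upow_tpow[of x n] tpow_pull[of "u [^] n" x n] by simp

lemma tpow_add: "x \<in> carrier R \<Longrightarrow> t [^] (m::nat) \<otimes> (t [^] (n::nat) \<otimes> x) = t [^] (m + n) \<otimes> x"
  by (simp add: m_assoc[symmetric] nat_pow_mult)

lemma tpow_zero_iff: "x \<in> carrier R \<Longrightarrow> t [^] (n::nat) \<otimes> x = \<zero> \<longleftrightarrow> x = \<zero>"
  by (metis nat_pow_closed r_null t_closed upow_tpow u_closed)

lemma S_smod: "smod S S"
  using subring_smod[OF S_subring] by simp

lemma smod_tpow: "\<lbrakk>smod S W; x \<in> W\<rbrakk> \<Longrightarrow> t [^] (n::nat) \<otimes> x \<in> W"
  using smod_smult tpow_S by blast

lemma tpow_mono:
  assumes "smod S W" "x \<in> carrier R" "t [^] (m::nat) \<otimes> x \<in> W" "m \<le> n"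
  shows "t [^] n \<otimes> x \<in> W"
  using smod_tpow[OF assms(1,3), of "n - m"] assms by (simp add: tpow_add)

lemma smod_scale:
  assumes "smod S W" shows "smod S ((\<lambda>x. t [^] (n::nat) \<otimes> x) ` W)"
proof (rule smodI)
  note c = smod_mem_carrier[OF assms]
  show "(\<lambda>x. t [^] n \<otimes> x) ` W \<subseteq> carrier R" using c by auto
  show "\<zero> \<in> (\<lambda>x. t [^] n \<otimes> x) ` W" using smod_zero[OF assms] by (auto intro!: image_eqI[of _ _ \<zero>])
  fix x y assume "x \<in> (\<lambda>x. t [^] n \<otimes> x) ` W" "y \<in> (\<lambda>x. t [^] n \<otimes> x) ` W"
  then obtain x' y' where h: "x' \<in> W" "y' \<in> W" "x = t [^] n \<otimes> x'" "y = t [^] n \<otimes> y'" by blast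
  then have "x \<ominus> y = t [^] n \<otimes> (x' \<ominus> y')" using c by (simp add: minus_eq r_distr r_minus)
  then show "x \<ominus> y \<in> (\<lambda>x. t [^] n \<otimes> x) ` W" using smod_minus[OF assms h(1,2)] by blast
next
  fix s x assume s: "s \<in> S" "x \<in> (\<lambda>x. t [^] n \<otimes> x) ` W"
  then obtain x' where h: "x' \<in> W" "x = t [^] n \<otimes> x'" by blast
  then have "s \<otimes> x = t [^] n \<otimes> (s \<otimes> x')" using tpow_pull[OF S_carrier[OF s(1)]] smod_mem_carrier[OF assms] by simp
  then show "s \<otimes> x \<in> (\<lambda>x. t [^] n \<otimes> x) ` W" using smod_smult[OF assms s(1) h(1)] by blast
qed

text \<open>The exponent is the largest \<open>n\<close> such that \<open>t [^] n\<close> divides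
  \<open>s\<close>; it exists as \<open>S\<close> is separated, and the cofactor is a unit because
  it is not divisible by \<open>t\<close>.\<close>

lemma S_valuation:
  assumes "s \<in> S" "s \<noteq> \<zero>"
  obtains n :: nat and y z where "y \<in> S" "z \<in> S" "z \<otimes> y = \<one>" "s = t [^] n \<otimes> y" "z \<otimes> s = t [^] n"
proof -
  let ?P = "\<lambda>n::nat. \<not> (\<exists>r\<in>S. s = t [^] n \<otimes> r)"
  have "\<exists>n. ?P n" using S_separated[OF assms(1)] assms(2) by blast
  then obtain n where n: "?P n" by blast
  have "\<not> ?P 0" using assms S_carrier by auto
  then have "\<exists>m<n. (\<forall>i\<le>m. \<not> ?P i) \<and> ?P (Suc m)"
    using ex_least_nat_less[of ?P n] n by blast
  then obtain m where m: "\<not> ?P m" "?P (Suc m)" by blast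
  then obtain v where v: "v \<in> S" "s = t [^] m \<otimes> v" by blast
  have "\<not> (\<exists>r\<in>S. v = t \<otimes> r)"
  proof
    assume "\<exists>r\<in>S. v = t \<otimes> r"
    then obtain r where r: "r \<in> S" "v = t \<otimes> r" by blast
    have "s = t [^] Suc m \<otimes> r" using v r S_carrier by (simp add: m_assoc)
    then show False using m(2) r(1) by blast
  qed
  then obtain r where r: "r \<in> S" "v \<otimes> r = \<one>" using S_local[OF v(1)] by blast
  then have rv: "r \<otimes> v = \<one>" using S_central[OF r(1) S_carrier[OF v(1)]] by simp
  then have "r \<otimes> s = t [^] m" using v r S_carrier tpow_pull[of r v m] by simp
  then show ?thesis using that v r(1) rv by blast
qed

section \<open>Finitely generated modules over the valuation ring\<close>

lemma Span_Nil: "Span S [] = {\<zero>}"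
  and Span_Cons: "Span S (b # bs) = line_extension S b (Span S bs)"
  by simp_all

declare Span.simps [simp del]

lemma Span_Cons_iff: "z \<in> Span S (b # bs) \<longleftrightarrow> (\<exists>s\<in>S. \<exists>v\<in>Span S bs. z = s \<otimes> b \<oplus> v)"
  using line_extension_mem_iff by (simp add: Span_Cons)

lemma smod_line_extension:
  assumes "smod S W" "b \<in> carrier R"
  shows "smod S (line_extension S b W)" "W \<subseteq> line_extension S b W" "b \<in> line_extension S b W"
proof -
  note c = smod_mem_carrier[OF assms(1)] assms(2)
  show "smod S (line_extension S b W)"
  proof (rule smodI)
    show "line_extension S b W \<subseteq> carrier R" using c S_carrier by (auto simp: line_extension_mem_iff)
    have "\<zero> = \<zero> \<otimes> b \<oplus> \<zero>" using c by simp
    then show "\<zero> \<in> line_extension S b W" using zero_in_S smod_zero[OF assms(1)] unfolding line_extension_mem_iff by blast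
    fix x y assume "x \<in> line_extension S b W" "y \<in> line_extension S b W"
    then obtain r v s w where h: "r \<in> S" "s \<in> S" "v \<in> W" "w \<in> W" "x = r \<otimes> b \<oplus> v" "y = s \<otimes> b \<oplus> w"
      unfolding line_extension_mem_iff by blast
    have "x \<ominus> y = (r \<ominus> s) \<otimes> b \<oplus> (v \<ominus> w)" unfolding h(5,6) using c h(1-4) S_carrier by algebra
    then show "x \<ominus> y \<in> line_extension S b W"
      using smod_minus[OF S_smod h(1,2)] smod_minus[OF assms(1) h(3,4)] unfolding line_extension_mem_iff by blast
  next
    fix k x assume k: "k \<in> S" "x \<in> line_extension S b W"
    then obtain r v where h: "r \<in> S" "v \<in> W" "x = r \<otimes> b \<oplus> v"
      unfolding line_extension_mem_iff by blast
    have "k \<otimes> x = (k \<otimes> r) \<otimes> b \<oplus> k \<otimes> v" unfolding h(3) using c h(1,2) k S_carrier by algebra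
    then show "k \<otimes> x \<in> line_extension S b W"
      using smod_smult[OF S_smod k(1) h(1)] smod_smult[OF assms(1) k(1) h(2)] unfolding line_extension_mem_iff by blast
  qed
  show "W \<subseteq> line_extension S b W"
  proof
    fix x assume "x \<in> W"
    moreover have "x = \<zero> \<otimes> b \<oplus> x" using c \<open>x \<in> W\<close> by simp
    ultimately show "x \<in> line_extension S b W" using zero_in_S unfolding line_extension_mem_iff by blast
  qed
  have "b = \<one> \<otimes> b \<oplus> \<zero>" using c by simp
  then show "b \<in> line_extension S b W" using one_in_S smod_zero[OF assms(1)] unfolding line_extension_mem_iff by blast
qed

lemma line_extension_least:
  assumes "smod S W" "Z \<subseteq> W" "b \<in> W" shows "line_extension S b Z \<subseteq> W"
proof
  fix x assume "x \<in> line_extension S b Z"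
  then obtain s v where "s \<in> S" "v \<in> Z" "x = s \<otimes> b \<oplus> v" unfolding line_extension_mem_iff by blast
  then show "x \<in> W" using assms smod_add[OF assms(1) smod_smult[OF assms(1)]] by blast
qed

lemma smod_null: "smod S {\<zero>}"
  by (rule smodI) (auto simp: S_carrier minus_eq)

lemma smod_Span: "set bs \<subseteq> carrier R \<Longrightarrow> smod S (Span S bs)"
  by (induction bs) (auto simp: Span_Nil Span_Cons intro: smod_null smod_line_extension)

lemma Span_superset: "set bs \<subseteq> carrier R \<Longrightarrow> set bs \<subseteq> Span S bs"
proof (induction bs)
  case (Cons b bs)
  then have "smod S (Span S bs)" "b \<in> carrier R" using smod_Span by auto
  then show ?case using Cons smod_line_extension[of "Span S bs" b] by (auto simp: Span_Cons)
qed simp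

lemma Span_least: "\<lbrakk>smod S W; set bs \<subseteq> W\<rbrakk> \<Longrightarrow> Span S bs \<subseteq> W"
  by (induction bs) (auto simp: Span_Nil Span_Cons smod_zero dest: line_extension_least)

lemma Span_rmult:
  assumes "set cs \<subseteq> carrier R" "d \<in> carrier R"
  shows "(\<lambda>x. x \<otimes> d) ` Span S cs = Span S (map (\<lambda>b. b \<otimes> d) cs)"
  using assms(1)
proof (induction cs)
  case Nil
  then show ?case using assms(2) by (simp add: Span_Nil)
next
  case (Cons c cs)
  have c: "c \<in> carrier R" using Cons.prems by auto
  have Q: "smod S (Span S cs)" using smod_Span Cons.prems by auto
  have ih: "(\<lambda>x. x \<otimes> d) ` Span S cs = Span S (map (\<lambda>b. b \<otimes> d) cs)" using Cons by auto
  have e: "(s \<otimes> c \<oplus> v) \<otimes> d = s \<otimes> (c \<otimes> d) \<oplus> v \<otimes> d" if "s \<in> S" "v \<in> Span S cs" for s v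
    using that c assms(2) S_carrier smod_mem_carrier[OF Q] by (simp add: l_distr m_assoc)
  have "z \<in> (\<lambda>x. x \<otimes> d) ` Span S (c # cs) \<longleftrightarrow> z \<in> Span S (map (\<lambda>b. b \<otimes> d) (c # cs))" for z
  proof -
    have "z \<in> (\<lambda>x. x \<otimes> d) ` Span S (c # cs) \<longleftrightarrow> (\<exists>s\<in>S. \<exists>v\<in>Span S cs. z = (s \<otimes> c \<oplus> v) \<otimes> d)"
      unfolding image_iff Bex_def Span_Cons_iff by blast
    also have "\<dots> \<longleftrightarrow> (\<exists>s\<in>S. \<exists>v\<in>Span S cs. z = s \<otimes> (c \<otimes> d) \<oplus> v \<otimes> d)" using e by auto
    also have "\<dots> \<longleftrightarrow> (\<exists>s\<in>S. \<exists>v\<in>(\<lambda>x. x \<otimes> d) ` Span S cs. z = s \<otimes> (c \<otimes> d) \<oplus> v)" by blast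
    finally show ?thesis unfolding ih by (simp add: Span_Cons_iff)
  qed
  then show ?case by blast
qed

lemma tpow_distr:
  assumes "x \<in> carrier R" "y \<in> carrier R"
  shows "t [^] (n::nat) \<otimes> (x \<oplus> y) = t [^] n \<otimes> x \<oplus> t [^] n \<otimes> y"
    "t [^] n \<otimes> (x \<ominus> y) = t [^] n \<otimes> x \<ominus> t [^] n \<otimes> y"
  using assms by (simp_all add: r_distr r_minus minus_eq)

text \<open>Krull's intersection theorem, by induction on the generators. Let \<open>b\<close> be
  the first one and Q the span of the others. If a non-zero multiple of \<open>b\<close> lies in Q,
  then so does some \<open>t [^] m \<otimes> b\<close>, and everything moves into Q at the cost of
  \<open>m\<close> in the exponent. Otherwise coefficients of \<open>b\<close> are unique, and that
  of \<open>x\<close> is divisible by all powers of \<open>t\<close>.\<close>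

lemma Span_separated:
  assumes "set bs \<subseteq> carrier R" "\<And>n::nat. \<exists>w\<in>Span S bs. x = t [^] n \<otimes> w"
  shows "x = \<zero>"
  using assms
proof (induction bs arbitrary: x)
  case Nil
  then show ?case by (auto simp: Span_Nil)
next
  case (Cons b bs)
  let ?Q = "Span S bs"
  have b: "b \<in> carrier R" and Q: "smod S ?Q" using Cons.prems smod_Span by auto
  note cQ = smod_mem_carrier[OF Q]
  obtain s q where sq: "\<And>n. s n \<in> S" "\<And>n. q n \<in> ?Q" "\<And>n::nat. x = t [^] n \<otimes> (s n \<otimes> b \<oplus> q n)"
    using Cons.prems(2) unfolding Bex_def Span_Cons_iff by metis
  have xc: "x \<in> carrier R" using sq(1,2,3)[of 0] b cQ S_carrier by simp
  show ?case
  proof (cases "\<exists>r\<in>S. r \<noteq> \<zero> \<and> r \<otimes> b \<in> ?Q")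
    case True
    then obtain r where r: "r \<in> S" "r \<noteq> \<zero>" "r \<otimes> b \<in> ?Q" by blast
    then obtain m :: nat and r' where m: "r' \<in> S" "r' \<otimes> r = t [^] m" using S_valuation by blast
    have "t [^] m \<otimes> b = r' \<otimes> (r \<otimes> b)"
      using m r S_carrier b by (simp add: m_assoc[symmetric])
    then have tb: "t [^] m \<otimes> b \<in> ?Q" using smod_smult[OF Q m(1) r(3)] by simp
    have "\<exists>w\<in>?Q. x = t [^] n \<otimes> w" for n :: nat
    proof -
      \<comment> \<open>The representation of \<open>x\<close> at exponent \<open>n + m\<close> is
        used, the surplus \<open>m\<close> being spent on moving \<open>b\<close> into
        \<open>?Q\<close>.\<close>
      let ?w = "s (n + m) \<otimes> (t [^] m \<otimes> b) \<oplus> t [^] m \<otimes> q (n + m)"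
      have "?w \<in> ?Q" using smod_add[OF Q smod_smult[OF Q sq(1) tb] smod_tpow[OF Q sq(2)]] .
      moreover have "?w = t [^] m \<otimes> (s (n + m) \<otimes> b \<oplus> q (n + m))"
        using tpow_pull[OF S_carrier[OF sq(1)] b] sq(1,2) S_carrier cQ b by (simp add: tpow_distr)
      then have "t [^] n \<otimes> ?w = x"
        using sq(3)[of "n + m"] sq(1,2) S_carrier cQ b by (simp add: tpow_add)
      ultimately show ?thesis by metis
    qed
    then show ?thesis using Cons.IH Cons.prems(1) by simp
  next
    case False
    have eq: "t [^] n \<otimes> s n = s 0" for n
    proof (rule ccontr)
      assume ne: "t [^] n \<otimes> s n \<noteq> s 0"
      let ?r = "t [^] n \<otimes> s n \<ominus> s 0"
      have c: "s 0 \<in> carrier R" "t [^] n \<otimes> s n \<in> carrier R" "q 0 \<in> carrier R" "t [^] n \<otimes> q n \<in> carrier R"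
        using sq S_carrier cQ by auto
      have "?r \<in> S" using smod_minus[OF S_smod] smod_tpow[OF S_smod sq(1)] sq(1) by blast
      moreover have "?r \<noteq> \<zero>" using ne c by (simp add: r_right_minus_eq)
      moreover have "?r \<otimes> b = q 0 \<ominus> t [^] n \<otimes> q n"
      proof -
        have "s 0 \<otimes> b \<oplus> q 0 = (t [^] n \<otimes> s n) \<otimes> b \<oplus> t [^] n \<otimes> q n"
          using sq(3)[of 0] sq(3)[of n] sq(1,2) S_carrier cQ b by (simp add: tpow_distr m_assoc)
        moreover have "?r \<otimes> b = ((t [^] n \<otimes> s n) \<otimes> b \<oplus> t [^] n \<otimes> q n) \<ominus> s 0 \<otimes> b \<ominus> t [^] n \<otimes> q n"
          using c b by algebra
        moreover have "(s 0 \<otimes> b \<oplus> q 0) \<ominus> s 0 \<otimes> b \<ominus> t [^] n \<otimes> q n = q 0 \<ominus> t [^] n \<otimes> q n"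
          using c b by algebra
        ultimately show ?thesis by simp
      qed
      moreover have "q 0 \<ominus> t [^] n \<otimes> q n \<in> ?Q" using smod_minus[OF Q sq(2) smod_tpow[OF Q sq(2)]] .
      ultimately show False using False by auto
    qed
    have "s 0 = \<zero>" using S_separated[of "s 0"] sq(1) eq by metis
    then have "s n = \<zero>" for n using eq[of n] sq(1)[of n] S_carrier tpow_zero_iff by simp
    then have "x = t [^] n \<otimes> q n" for n using sq b cQ by simp
    then have "\<exists>w\<in>?Q. x = t [^] n \<otimes> w" for n :: nat using sq(2) by metis
    then show ?thesis using Cons.IH Cons.prems(1) by simp
  qed
qed

text \<open>The differences, not the terms, are lifted to coefficients: the generators may be
  dependent, so coefficients chosen separately for each \<open>x n\<close> need not converge. The
  partial sums \<open>r\<close> and \<open>v\<close> of the lifted differences converge, the first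
  in \<open>S\<close>, the second by induction.\<close>

lemma Span_complete:
  assumes "set bs \<subseteq> carrier R" "\<And>n. x n \<in> Span S bs" "\<And>n::nat. \<exists>w\<in>Span S bs. x (Suc n) \<ominus> x n = t [^] n \<otimes> w"
  shows "\<exists>y\<in>Span S bs. \<forall>n. \<exists>w\<in>Span S bs. y \<ominus> x n = t [^] n \<otimes> w"
  using assms
proof (induction bs arbitrary: x)
  case Nil
  then have "x n = \<zero>" for n by (simp add: Span_Nil)
  then show ?case by (auto simp: Span_Nil minus_eq)
next
  case (Cons b bs)
  let ?Q = "Span S bs"
  have b: "b \<in> carrier R" and Q: "smod S ?Q" using Cons.prems smod_Span by auto
  note cQ = smod_mem_carrier[OF Q]
  obtain r0 v0 where rv0: "r0 \<in> S" "v0 \<in> ?Q" "x 0 = r0 \<otimes> b \<oplus> v0"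
    using Cons.prems(2)[of 0] unfolding Span_Cons_iff by blast
  obtain s q where sq: "\<And>n. s n \<in> S" "\<And>n. q n \<in> ?Q" "\<And>n::nat. x (Suc n) \<ominus> x n = t [^] n \<otimes> (s n \<otimes> b \<oplus> q n)"
    using Cons.prems(3) unfolding Bex_def Span_Cons_iff by metis
  define r where "r = rec_nat r0 (\<lambda>n a. a \<oplus> t [^] n \<otimes> s n)"
  define v where "v = rec_nat v0 (\<lambda>n a. a \<oplus> t [^] n \<otimes> q n)"
  have r: "r n \<in> S" for n
    by (induction n) (auto simp: r_def rv0 intro: smod_add[OF S_smod] smod_tpow[OF S_smod] sq(1))
  have v: "v n \<in> ?Q" for n
    by (induction n) (auto simp: v_def rv0 intro: smod_add[OF Q] smod_tpow[OF Q] sq(2))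
  have rS: "r (Suc n) \<ominus> r n = t [^] n \<otimes> s n" for n
  proof -
    have "r (Suc n) = r n \<oplus> t [^] n \<otimes> s n" by (simp add: r_def)
    moreover have "r n \<in> carrier R" "t [^] n \<otimes> s n \<in> carrier R" using r sq(1) S_carrier by auto
    ultimately show ?thesis by algebra
  qed
  have vS: "v (Suc n) \<ominus> v n = t [^] n \<otimes> q n" for n
  proof -
    have "v (Suc n) = v n \<oplus> t [^] n \<otimes> q n" by (simp add: v_def)
    moreover have "v n \<in> carrier R" "t [^] n \<otimes> q n \<in> carrier R" using v sq(2) cQ by auto
    ultimately show ?thesis by algebra
  qed
  have x: "x n = r n \<otimes> b \<oplus> v n" for n
  proof (induction n)
    case 0
    then show ?case using rv0 by (simp add: r_def v_def)
  next
    case (Suc n)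
    have c: "x n \<in> carrier R" "x (Suc n) \<in> carrier R"
      using Cons.prems smod_Span[OF Cons.prems(1)] smod_mem_carrier by blast+
    have c2: "t [^] n \<in> carrier R" "s n \<in> carrier R" "q n \<in> carrier R" "r n \<in> carrier R" "v n \<in> carrier R"
      using sq r v S_carrier cQ by auto
    have "x (Suc n) = x n \<oplus> (x (Suc n) \<ominus> x n)" using c by algebra
    also have "\<dots> = (r n \<otimes> b \<oplus> v n) \<oplus> t [^] n \<otimes> (s n \<otimes> b \<oplus> q n)" using sq(3)[of n] unfolding Suc by simp
    also have "\<dots> = (r n \<oplus> t [^] n \<otimes> s n) \<otimes> b \<oplus> (v n \<oplus> t [^] n \<otimes> q n)" using c2 b by algebra
    finally show ?case by (simp add: r_def v_def)
  qed
  obtain r' where r': "r' \<in> S" "\<And>n. \<exists>w\<in>S. r' \<ominus> r n = t [^] n \<otimes> w"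
    using S_complete[of r] r rS sq(1) by blast
  obtain v' where v': "v' \<in> ?Q" "\<And>n. \<exists>w\<in>?Q. v' \<ominus> v n = t [^] n \<otimes> w"
  proof -
    have "\<exists>w\<in>?Q. v (Suc n) \<ominus> v n = t [^] n \<otimes> w" for n using vS sq(2) by blast
    then show ?thesis using Cons.IH[of v] v Cons.prems(1) that by auto
  qed
  show ?case
  proof (rule bexI[of _ "r' \<otimes> b \<oplus> v'"], intro allI)
    show "r' \<otimes> b \<oplus> v' \<in> Span S (b # bs)" using r' v' unfolding Span_Cons_iff by blast
    fix n
    obtain w z where w: "w \<in> S" "r' \<ominus> r n = t [^] n \<otimes> w" and z: "z \<in> ?Q" "v' \<ominus> v n = t [^] n \<otimes> z"
      using r' v' by blast
    have c: "r' \<in> carrier R" "r n \<in> carrier R" "v' \<in> carrier R" "v n \<in> carrier R" "w \<in> carrier R" "z \<in> carrier R"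
      using r r' v v' w z S_carrier cQ by auto
    have "r' \<otimes> b \<oplus> v' \<ominus> x n = (r' \<ominus> r n) \<otimes> b \<oplus> (v' \<ominus> v n)" unfolding x using c b by algebra
    also have "\<dots> = t [^] n \<otimes> (w \<otimes> b \<oplus> z)" unfolding w z using c b by (simp add: r_distr m_assoc)
    finally have "r' \<otimes> b \<oplus> v' \<ominus> x n = t [^] n \<otimes> (w \<otimes> b \<oplus> z)" .
    moreover have "w \<otimes> b \<oplus> z \<in> Span S (b # bs)" using w(1) z(1) unfolding Span_Cons_iff by blast
    ultimately show "\<exists>w\<in>Span S (b # bs). r' \<otimes> b \<oplus> v' \<ominus> x n = t [^] n \<otimes> w" by blast
  qed
qed

text \<open>As for ideals of a discrete valuation ring: an element of \<open>W\<close> whose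
  coefficient at \<open>b\<close> is \<open>t [^] n\<close> with \<open>n\<close> least clears the
  \<open>b\<close>-coefficient of every other element of \<open>W\<close>, and what remains lies in
  \<open>W \<inter> ?Q\<close>, to which induction applies.\<close>

lemma Span_noetherian:
  assumes "set bs \<subseteq> carrier R" "smod S W" "W \<subseteq> Span S bs"
  shows "\<exists>cs. set cs \<subseteq> W \<and> W = Span S cs"
  using assms
proof (induction bs arbitrary: W)
  case Nil
  then have "W = Span S []" using smod_zero by (auto simp: Span_Nil)
  then show ?case by (metis empty_set empty_subsetI)
next
  case (Cons b bs)
  let ?Q = "Span S bs"
  have b: "b \<in> carrier R" and Q: "smod S ?Q" using Cons.prems smod_Span by auto
  note cQ = smod_mem_carrier[OF Q] and cW = smod_mem_carrier[OF Cons.prems(2)]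
  have "\<exists>cs. set cs \<subseteq> W \<inter> ?Q \<and> W \<inter> ?Q = Span S cs"
    using Cons.IH[OF _ smod_Int[OF Cons.prems(2) Q]] Cons.prems(1) by auto
  then obtain cs where cs: "set cs \<subseteq> W \<inter> ?Q" "W \<inter> ?Q = Span S cs" by blast
  let ?P = "\<lambda>n::nat. \<exists>v\<in>?Q. t [^] n \<otimes> b \<oplus> v \<in> W"
  have lead: "\<exists>m. ?P m \<and> (\<exists>y\<in>S. s = t [^] m \<otimes> y)"
    if h: "s \<in> S" "s \<noteq> \<zero>" "v \<in> ?Q" "s \<otimes> b \<oplus> v \<in> W" for s v
  proof -
    obtain m :: nat and y r where r: "y \<in> S" "r \<in> S" "s = t [^] m \<otimes> y" "r \<otimes> s = t [^] m"
      using S_valuation[OF h(1,2)] by metis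
    then have "r \<otimes> (s \<otimes> b \<oplus> v) = t [^] m \<otimes> b \<oplus> r \<otimes> v"
      using h(1,3) S_carrier cQ b by (simp add: r_distr m_assoc[symmetric])
    then show ?thesis
      using smod_smult[OF Cons.prems(2) r(2) h(4)] smod_smult[OF Q r(2) h(3)] r(1,3) by metis
  qed
  show ?case
  proof (cases "\<exists>n. ?P n")
    case False
    have "W \<subseteq> ?Q"
    proof
      fix w assume w: "w \<in> W"
      then obtain s v where sv: "s \<in> S" "v \<in> ?Q" "w = s \<otimes> b \<oplus> v" using Cons.prems(3) Span_Cons_iff by blast
      then have "s = \<zero>" using lead[of s v] w False by blast
      then show "w \<in> ?Q" using sv b cQ by simp
    qed
    then show ?thesis using cs by (metis inf.orderE)
  next
    case True
    define n where "n = (LEAST n. ?P n)"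
    have n: "?P n" and least: "\<And>m. ?P m \<Longrightarrow> n \<le> m"
      unfolding n_def using LeastI_ex[OF True] by (blast intro: Least_le)+
    obtain v where v: "v \<in> ?Q" "t [^] n \<otimes> b \<oplus> v \<in> W" using n by blast
    let ?c = "t [^] n \<otimes> b \<oplus> v"
    have cc: "set (?c # cs) \<subseteq> W" using v cs by auto
    have "W \<subseteq> Span S (?c # cs)"
    proof
      fix w assume w: "w \<in> W"
      then obtain s z where sz: "s \<in> S" "z \<in> ?Q" "w = s \<otimes> b \<oplus> z" using Cons.prems(3) Span_Cons_iff by blast
      have "\<exists>r\<in>S. s = t [^] n \<otimes> r"
      proof (cases "s = \<zero>")
        case True
        then show ?thesis using zero_in_S by (metis nat_pow_closed r_null t_closed)
      next
        case False
        then obtain m y where my: "?P m" "y \<in> S" "s = t [^] m \<otimes> y" using lead[of s z] sz w by blast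
        then have "s = t [^] n \<otimes> (t [^] (m - n) \<otimes> y)" using least[OF my(1)] S_carrier by (simp add: tpow_add)
        then show ?thesis using smod_tpow[OF S_smod my(2)] by blast
      qed
      then obtain r where r: "r \<in> S" "s = t [^] n \<otimes> r" by blast
      have c: "r \<in> carrier R" "v \<in> carrier R" "z \<in> carrier R" using r v sz S_carrier cQ by auto
      have "w = r \<otimes> ?c \<oplus> (z \<ominus> r \<otimes> v)"
      proof -
        have "s \<otimes> b = r \<otimes> (t [^] n \<otimes> b)" using r c b tpow_pull[of r b n] by (simp add: m_assoc)
        then have "w = r \<otimes> (t [^] n \<otimes> b) \<oplus> z" using sz by simp
        moreover have "t [^] n \<otimes> b \<in> carrier R" using b by simp
        ultimately show ?thesis using c by algebra
      qed
      moreover have "z \<ominus> r \<otimes> v \<in> W \<inter> ?Q"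
      proof -
        have "z \<ominus> r \<otimes> v \<in> ?Q" using smod_minus[OF Q sz(2) smod_smult[OF Q r(1) v(1)]] .
        moreover have "r \<otimes> ?c \<in> W" using smod_smult[OF Cons.prems(2) r(1) v(2)] .
        ultimately show ?thesis
          using smod_minus_cancel[OF Cons.prems(2)] w \<open>w = r \<otimes> ?c \<oplus> (z \<ominus> r \<otimes> v)\<close> cQ by (metis IntI)
      qed
      ultimately show "w \<in> Span S (?c # cs)" using r(1) cs unfolding Span_Cons_iff by blast
    qed
    moreover have "Span S (?c # cs) \<subseteq> W" using Span_least[OF Cons.prems(2) cc] .
    ultimately show ?thesis using cc by blast
  qed
qed

text \<open>Passing from \<open>t \<otimes> b\<close> to \<open>b\<close> adds nothing or one simple
  factor, since \<open>S\<close> modulo \<open>t\<close> is a field. The chain through the multiples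
  of \<open>b\<close> by descending powers of \<open>t\<close> thus has at most \<open>n\<close>
  steps.\<close>

lemma comp_line_extension:
  assumes "smod S W" "b \<in> carrier R" "t [^] (n::nat) \<otimes> b \<in> W"
  shows "\<exists>ms. comp_factors S W (line_extension S b W) ms"
  using assms
proof (induction n arbitrary: b)
  case 0
  then have "line_extension S b W = W"
    using line_extension_least[of W W b] smod_line_extension[of W b] by auto
  then show ?case using comp_refl[OF 0(1)] by auto
next
  case (Suc n)
  let ?V = "line_extension S (t \<otimes> b) W" and ?W = "line_extension S b W"
  have tb: "t [^] n \<otimes> (t \<otimes> b) \<in> W" using Suc.prems by (simp add: m_assoc[symmetric])
  then obtain ms where ms: "comp_factors S W ?V ms" using Suc.IH[of "t \<otimes> b"] Suc.prems by auto
  have V: "smod S ?V" and W: "smod S ?W" "W \<subseteq> ?W" "b \<in> ?W"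
    using smod_line_extension Suc.prems by auto
  have VW: "?V \<subseteq> ?W" using line_extension_least[OF W(1,2)] smod_smult[OF W(1) t_in_S W(3)] by blast
  show ?case
  proof (cases "?V = ?W")
    case True
    then show ?thesis using ms by auto
  next
    case False
    have "covers S ?V ?W"
      unfolding covers_def
    proof (intro conjI allI impI)
      show "smod S ?V" "smod S ?W" "?V \<subset> ?W" using V W VW False by auto
      fix Z assume Z: "smod S Z" "?V \<subseteq> Z" "Z \<subseteq> ?W"
      show "Z = ?V \<or> Z = ?W"
      proof (cases "Z \<subseteq> ?V")
        case True
        then show ?thesis using Z by blast
      next
        case False
        then obtain z where z: "z \<in> Z" "z \<notin> ?V" by blast
        then obtain s w where sw: "s \<in> S" "w \<in> W" "z = s \<otimes> b \<oplus> w"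
          using Z(3) line_extension_mem_iff by blast
        have c: "s \<in> carrier R" "w \<in> carrier R" "b \<in> carrier R"
          using sw Suc.prems S_carrier smod_mem_carrier[OF Suc.prems(1)] by auto
        have "\<not> (\<exists>r\<in>S. s = t \<otimes> r)"
        proof
          assume "\<exists>r\<in>S. s = t \<otimes> r"
          then obtain r where r: "r \<in> S" "s = t \<otimes> r" by blast
          then have "z = r \<otimes> (t \<otimes> b) \<oplus> w"
            using sw c S_carrier[OF r(1)] S_central[OF r(1) t_closed] by (simp add: m_assoc[symmetric])
          then show False using z(2) r(1) sw(2) line_extension_mem_iff by blast
        qed
        then obtain r where r: "r \<in> S" "s \<otimes> r = \<one>" using S_local[OF sw(1)] by blast
        then have "r \<otimes> s = \<one>" using S_central[OF r(1) c(1)] by simp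
        then have e: "r \<otimes> z = r \<otimes> w \<oplus> b"
          using sw(3) c S_carrier[OF r(1)] by (simp add: r_distr m_assoc[symmetric] a_comm)
        have "r \<otimes> w \<in> Z" using smod_smult[OF Suc.prems(1) r(1) sw(2)] smod_line_extension(2)[OF Suc.prems(1)] Z(2)
          Suc.prems(2) by (meson m_closed subsetD t_closed)
        then have "b \<in> Z" using smod_minus_cancel[OF Z(1) _ _ c(3)] smod_smult[OF Z(1) r(1) z(1)] e by metis
        moreover have "W \<subseteq> Z" using smod_line_extension(2)[OF Suc.prems(1)] Z(2) Suc.prems(2) by (meson m_closed order_trans t_closed)
        ultimately have "?W \<subseteq> Z" using line_extension_least[OF Z(1)] by blast
        then show ?thesis using Z(3) by blast
      qed
    qed
    then show ?thesis using comp_step[OF ms] by blast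
  qed
qed

text \<open>Generators of \<open>M\<close> over \<open>S\<close> are adjoined to \<open>N\<close>
  one at a time, each being moved into \<open>N\<close> by \<open>t [^] n\<close>. This gives finite
  length over \<open>S\<close>, and \<open>comp_finer\<close> turns it into finite length over
  \<open>C\<close>.\<close>

lemma comp_factors_exist:
  assumes "smod C N" "smod C M" "N \<subseteq> M" "S \<subseteq> C" "C \<subseteq> carrier R"
    and "set bs \<subseteq> carrier R" "M \<subseteq> Span S bs" and tM: "\<And>x. x \<in> M \<Longrightarrow> t [^] (n::nat) \<otimes> x \<in> N"
  shows "\<exists>ms. comp_factors C N M ms"
proof -
  have NS: "smod S N" and MS: "smod S M" using assms smod_mono by blast+
  obtain cs where cs: "set cs \<subseteq> M" "M = Span S cs" using Span_noetherian[OF assms(6) MS assms(7)] by blast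
  have *: "\<exists>Z ms. comp_factors S N Z ms \<and> set ds \<subseteq> Z" if "set ds \<subseteq> M" for ds
    using that
  proof (induction ds)
    case Nil
    then show ?case using comp_refl[OF NS] by auto
  next
    case (Cons d ds)
    then obtain Z ms where Z: "comp_factors S N Z ms" "set ds \<subseteq> Z" by auto
    have sZ: "smod S Z" and "N \<subseteq> Z" using comp_smod[OF Z(1)] by auto
    have d: "d \<in> carrier R" "t [^] n \<otimes> d \<in> Z" using Cons.prems tM \<open>N \<subseteq> Z\<close> smod_mem_carrier[OF MS] by auto
    obtain ms' where ms': "comp_factors S Z (line_extension S d Z) ms'" using comp_line_extension[OF sZ d] by blast
    show ?case
      using comp_trans[OF ms' Z(1)] smod_line_extension[OF sZ d(1)] Z(2) by fastforce
  qed
  then obtain Z ms where Z: "comp_factors S N Z ms" "set cs \<subseteq> Z" using cs by blast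
  have "M \<subseteq> Z" using Span_least[of Z cs] Z(2) comp_smod[OF Z(1)] cs(2) by blast
  then obtain a where "comp_factors S N M a" using comp_split[OF Z(1) MS assms(3) _ S_sub] by blast
  then show ?thesis using comp_finer assms by blast
qed

text \<open>A form of Chevalley's theorem on decreasing chains with intersection zero.\<close>

lemma chain_eventually_subset:
  fixes W :: "nat \<Rightarrow> 'a set"
  assumes bs: "set bs \<subseteq> carrier R"
    and W: "\<And>n. smod S (W n)" and dec: "\<And>n. W (Suc n) \<subseteq> W n"
    and big: "\<And>n. \<exists>k::nat. \<forall>x\<in>Span S bs. t [^] k \<otimes> x \<in> W n"
    and small: "\<And>x. x \<in> W 0 \<Longrightarrow> \<exists>k::nat. t [^] k \<otimes> x \<in> Span S bs"
    and int: "\<And>x. x \<in> Span S bs \<Longrightarrow> (\<And>n. x \<in> W n) \<Longrightarrow> x = \<zero>"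
  shows "\<exists>n. W n \<subseteq> Span S bs"
proof -
  let ?P = "Span S bs"
  have P: "smod S ?P" using smod_Span[OF bs] .
  note cP = smod_mem_carrier[OF P]
  have Wm: "W n \<subseteq> W m" if "m \<le> n" for m n using lift_Suc_antimono_le[of W, OF dec that] .
  \<comment> \<open>It suffices that some \<open>W n \<inter> ?P\<close> is contained in
    \<open>t \<otimes> ?P\<close>: for \<open>x\<close> in \<open>W n\<close> a multiple
    \<open>t [^] k \<otimes> x\<close> in \<open>?P\<close> can then be divided by \<open>t\<close>
    until \<open>x\<close> itself is seen to lie in \<open>?P\<close>.\<close>
  have "\<exists>n. \<forall>x\<in>W n \<inter> ?P. u \<otimes> x \<in> ?P"
  proof (rule ccontr)
    assume "\<not> ?thesis"
    then have no: "\<And>n. \<exists>x\<in>W n \<inter> ?P. u \<otimes> x \<notin> ?P" by blast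
    \<comment> \<open>For fixed \<open>k\<close> the images of \<open>W n \<inter> ?P\<close> modulo
      \<open>t [^] k\<close> form a decreasing chain in a module of finite length, hence become
      constant.\<close>
    have stab: "\<exists>N. \<forall>n\<ge>N. \<forall>m\<ge>n. \<forall>x\<in>W n \<inter> ?P. \<exists>y\<in>W m \<inter> ?P. \<exists>z\<in>?P. y \<ominus> x = t [^] k \<otimes> z" for k :: nat
    proof -
      let ?T = "(\<lambda>x. t [^] k \<otimes> x) ` ?P"
      define f where "f n = (W n \<inter> ?P) <+>\<^bsub>R\<^esub> ?T" for n
      have T: "smod S ?T" using smod_scale[OF P] .
      have WP: "smod S (W n \<inter> ?P)" for n using smod_Int[OF W P] .
      have f: "smod S (f n)" for n unfolding f_def using smod_sum[OF WP T S_sub] .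
      have Tf: "?T \<subseteq> f n" for n unfolding f_def using subset_sum_right[OF WP T] .
      have TP: "?T \<subseteq> ?P" using smod_tpow[OF P] by blast
      have fP: "f n \<subseteq> ?P" for n unfolding f_def using sum_least[OF P _ TP] by blast
      have fm: "f n \<subseteq> f m" if "m \<le> n" for m n
        unfolding f_def using Wm[OF that] by (auto simp: set_add_def')
      have ex: "\<exists>ms. comp_factors S ?T (f n) ms" for n
        using comp_factors_exist[OF T f Tf order_refl S_sub bs fP] fP by blast
      define l where "l n = size (SOME ms. comp_factors S ?T (f n) ms)" for n
      obtain N where N: "\<And>n. l N \<le> l n" using arg_min_nat_le[of "\<lambda>_. True" _ l] by blast
      have fN: "f n = f N" if Nn: "N \<le> n" for n
      proof -
        obtain a where a: "comp_factors S ?T (f N) a" "l N = size a" unfolding l_def using someI_ex[OF ex[of N]] by blast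
        obtain b where b: "comp_factors S ?T (f n) b" "l n = size b" unfolding l_def using someI_ex[OF ex[of n]] by blast
        obtain c d where cd: "comp_factors S ?T (f n) c" "comp_factors S (f n) (f N) d" "a = c + d"
          using comp_split[OF a(1) f Tf fm[OF Nn] S_sub] by blast
        have "c = b" using comp_unique[OF cd(1) b(1) S_sub] .
        then have "d = {#}" using N[of n] a(2) b(2) cd(3) by simp
        then show ?thesis using comp_self[OF cd(2)] by blast
      qed
      show ?thesis
      proof (intro exI[of _ N] allI impI ballI)
        fix n m x assume nm: "N \<le> n" "n \<le> m" and x: "x \<in> W n \<inter> ?P"
        have "x \<in> f m" using fN[of n] fN[of m] nm subset_sum_left[OF WP T, of n] x unfolding f_def by auto
        then obtain y z where yz: "y \<in> W m \<inter> ?P" "z \<in> ?P" "x = y \<oplus> t [^] k \<otimes> z"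
          unfolding f_def mem_set_add by blast
        have c: "y \<in> carrier R" "z \<in> carrier R" "t [^] k \<otimes> z \<in> carrier R" using yz cP by auto
        have "y \<ominus> x = \<ominus> (t [^] k \<otimes> z)" unfolding yz(3) using c by algebra
        also have "\<dots> = t [^] k \<otimes> (\<ominus> z)" using c by (simp add: r_minus)
        finally show "\<exists>y\<in>W m \<inter> ?P. \<exists>z\<in>?P. y \<ominus> x = t [^] k \<otimes> z"
          using yz(1) smod_neg[OF P yz(2)] by blast
      qed
    qed
    then obtain N where N: "\<And>k n m x. N k \<le> n \<Longrightarrow> n \<le> m \<Longrightarrow> x \<in> W n \<inter> ?P \<Longrightarrow>
        \<exists>y\<in>W m \<inter> ?P. \<exists>z\<in>?P. y \<ominus> x = t [^] (k::nat) \<otimes> z" by metis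
    \<comment> \<open>A monotone bound for \<open>N\<close>; the summand \<open>k\<close> makes the
      sequence below enter every \<open>W m\<close>.\<close>
    define M where "M k = (\<Sum>j\<le>k. N j) + k" for k
    have MN: "N k \<le> M k" for k
      unfolding M_def by (simp add: member_le_sum trans_le_add1)
    have MM: "M k \<le> M (Suc k)" for k unfolding M_def by simp
    have Mk: "k \<le> M k" for k unfolding M_def by simp
    \<comment> \<open>The start lies outside \<open>t \<otimes> ?P\<close>, and later terms change
      it by multiples of \<open>t\<close> only. The successors in the indices make already the first
      step a congruence modulo \<open>t\<close>.\<close>
    let ?Pr = "\<lambda>n x. x \<in> W (M (Suc n)) \<inter> ?P \<and> (n = 0 \<longrightarrow> u \<otimes> x \<notin> ?P)"
    let ?Qr = "\<lambda>n x y. \<exists>z\<in>?P. y \<ominus> x = t [^] Suc n \<otimes> z"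
    have "\<exists>f. \<forall>n. ?Pr n (f n) \<and> ?Qr n (f n) (f (Suc n))"
    proof (rule dependent_nat_choice)
      show "\<exists>x. ?Pr 0 x" using no by blast
      show "\<exists>y. ?Pr (Suc n) y \<and> ?Qr n x y" if "?Pr n x" for x n
        using N[OF MN[of "Suc n"] MM[of "Suc n"]] that by blast
    qed
    then obtain f where f: "\<And>n. ?Pr n (f n)" "\<And>n. ?Qr n (f n) (f (Suc n))" by blast
    have shift: "\<exists>z'\<in>?P. t [^] Suc n \<otimes> z = t [^] n \<otimes> z'" if "z \<in> ?P" for z and n :: nat
      using smod_smult[OF P t_in_S that] cP[OF that] by (intro bexI[of _ "t \<otimes> z"]) (auto simp: m_assoc)
    have "\<exists>w\<in>?P. f (Suc n) \<ominus> f n = t [^] n \<otimes> w" for n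
      using f(2)[of n] shift by metis
    then obtain y where y: "y \<in> ?P" "\<And>n. \<exists>w\<in>?P. y \<ominus> f n = t [^] n \<otimes> w"
      using Span_complete[OF bs, of f] f(1) by blast
    \<comment> \<open>\<open>W m\<close> is closed under limits, since it contains
      \<open>t [^] k \<otimes> ?P\<close> for some \<open>k\<close>.\<close>
    have yW: "y \<in> W m" for m
    proof -
      obtain k :: nat where k: "\<And>x. x \<in> ?P \<Longrightarrow> t [^] k \<otimes> x \<in> W m" using big[of m] by blast
      obtain w where w: "w \<in> ?P" "y \<ominus> f (k + m) = t [^] (k + m) \<otimes> w" using y(2) by blast
      have "t [^] (k + m) \<otimes> w \<in> W m" using tpow_mono[OF W cP[OF w(1)] k[OF w(1)]] by simp
      moreover have fW: "f (k + m) \<in> W m"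
        using f(1)[of "k + m"] Wm[of m "M (Suc (k + m))"] Mk[of "Suc (k + m)"] by auto
      ultimately have "f (k + m) \<oplus> (y \<ominus> f (k + m)) \<in> W m" using smod_add[OF W fW] w(2) by simp
      moreover have "f (k + m) \<oplus> (y \<ominus> f (k + m)) = y"
        using smod_mem_carrier[OF W fW] cP[OF y(1)] by algebra
      ultimately show ?thesis by simp
    qed
    have "y = \<zero>" using int[OF y(1) yW] .
    \<comment> \<open>The limit agrees with \<open>f n\<close> modulo \<open>t [^] n\<close>, which
      is void for \<open>n = 0\<close>; so \<open>f 0\<close> is reached through
      \<open>f 1\<close>.\<close>
    obtain w where w: "w \<in> ?P" "y \<ominus> f 1 = t [^] (1::nat) \<otimes> w" using y(2) by blast
    obtain z where z: "z \<in> ?P" "f 1 \<ominus> f 0 = t [^] (1::nat) \<otimes> z" using f(2)[of 0] by auto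
    have fc: "f n \<in> carrier R" for n using f(1) cP by blast
    have "f 0 = \<ominus> ((y \<ominus> f 1) \<oplus> (f 1 \<ominus> f 0))" using \<open>y = \<zero>\<close> fc[of 0] fc[of 1] by algebra
    also have "\<dots> = t \<otimes> (\<ominus> (w \<oplus> z))" unfolding w(2) z(2) using cP w(1) z(1) by (simp add: r_minus r_distr)
    finally have "u \<otimes> f 0 = \<ominus> (w \<oplus> z)" using cP w(1) z(1) u_t by (simp add: m_assoc[symmetric])
    then have "u \<otimes> f 0 \<in> ?P" using smod_neg[OF P smod_add[OF P w(1) z(1)]] by simp
    then show False using f(1)[of 0] by blast
  qed
  then obtain n where n: "\<And>x. x \<in> W n \<Longrightarrow> x \<in> ?P \<Longrightarrow> u \<otimes> x \<in> ?P" by blast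
  have "t [^] k \<otimes> x \<in> ?P \<Longrightarrow> x \<in> W n \<Longrightarrow> x \<in> ?P" for k :: nat and x
  proof (induction k)
    case 0
    then show ?case using smod_mem_carrier[OF W] by simp
  next
    case (Suc k)
    have c: "x \<in> carrier R" using Suc.prems smod_mem_carrier[OF W] by blast
    have "u \<otimes> (t [^] Suc k \<otimes> x) \<in> ?P" using n[OF smod_tpow[OF W Suc.prems(2)] Suc.prems(1)] .
    moreover have "u \<otimes> (t [^] Suc k \<otimes> x) = t [^] k \<otimes> x"
    proof -
      have "t [^] Suc k \<otimes> x = t \<otimes> (t [^] k \<otimes> x)" using c tpow_comm[of t k] by (simp add: m_assoc)
      then show ?thesis using c u_t by (simp add: m_assoc[symmetric])
    qed
    ultimately show ?case using Suc by simp
  qed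
  then show ?thesis using small Wm[of 0 n] by blast
qed

end

section \<open>Lattices in a minimal left ideal\<close>

text \<open>\<open>minimal\<close> says that every non-zero element of the left ideal
  \<open>R \<epsilon>\<close> generates it, that is, that this ideal is a simple module;
  \<open>\<Lambda>_big\<close> says that \<Lambda> becomes the whole algebra after inverting
  \<open>t\<close>.\<close>

locale minimal_left_ideal = central_dvr +
  fixes \<Lambda> :: "'a set" and bs :: "'a list" and \<epsilon> :: 'a
  assumes \<Lambda>_subring: "subring \<Lambda> R" and S_\<Lambda>: "S \<subseteq> \<Lambda>"
    and bs: "set bs \<subseteq> carrier R" and \<Lambda>_Span: "\<Lambda> = Span S bs"
    and \<Lambda>_big: "x \<in> carrier R \<Longrightarrow> \<exists>k::nat. t [^] k \<otimes> x \<in> \<Lambda>"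
    and \<epsilon>_closed [simp]: "\<epsilon> \<in> carrier R" and \<epsilon>_idem [simp]: "\<epsilon> \<otimes> \<epsilon> = \<epsilon>" and \<epsilon>_nonzero: "\<epsilon> \<noteq> \<zero>"
    and minimal: "\<lbrakk>x \<in> carrier R; x \<otimes> \<epsilon> = x; x \<noteq> \<zero>\<rbrakk> \<Longrightarrow> \<exists>a\<in>carrier R. a \<otimes> x = \<epsilon>"
begin

definition V :: "'a set" where "V = {x \<in> carrier R. x \<otimes> \<epsilon> = x}"
definition D :: "'a set" where "D = {d \<in> carrier R. \<epsilon> \<otimes> d = d \<and> d \<otimes> \<epsilon> = d}"
definition P :: "'a set" where "P = (\<lambda>x. x \<otimes> \<epsilon>) ` \<Lambda>"
definition rmul :: "'a set \<Rightarrow> 'a \<Rightarrow> 'a set" where "rmul N d = (\<lambda>x. x \<otimes> d) ` N"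

text \<open>Boundedness against \<open>P\<close> replaces finite generation over the noetherian ring
  \<open>S\<close>, and being non-zero replaces spanning \<open>V\<close>: as \<open>V\<close> is
  simple over the algebra, a non-zero \<Lambda>-submodule is full by
  \<open>lattice_\<epsilon>\<close>.\<close>

definition lattice :: "'a set \<Rightarrow> bool" where
  "lattice N \<longleftrightarrow> smod \<Lambda> N \<and> N \<subseteq> V \<and> N \<noteq> {\<zero>} \<and> (\<exists>k::nat. \<forall>x\<in>N. t [^] k \<otimes> x \<in> P)"

lemma \<Lambda>_sub: "\<Lambda> \<subseteq> carrier R" using subringE(1)[OF \<Lambda>_subring] .

lemma \<Lambda>_carrier: "x \<in> \<Lambda> \<Longrightarrow> x \<in> carrier R" using \<Lambda>_sub by blast

lemma V_carrier: "x \<in> V \<Longrightarrow> x \<in> carrier R" and V_\<epsilon>: "x \<in> V \<Longrightarrow> x \<otimes> \<epsilon> = x"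
  by (auto simp: V_def)

lemma D_carrier: "d \<in> D \<Longrightarrow> d \<in> carrier R" and D_l: "d \<in> D \<Longrightarrow> \<epsilon> \<otimes> d = d" and D_r: "d \<in> D \<Longrightarrow> d \<otimes> \<epsilon> = d"
  by (auto simp: D_def)

lemma D_V: "d \<in> D \<Longrightarrow> d \<in> V" by (simp add: D_def V_def)

lemma \<epsilon>_D: "\<epsilon> \<in> D" by (simp add: D_def)

lemma zero_D: "\<zero> \<in> D" by (simp add: D_def)

lemma D_mult: "c \<in> D \<Longrightarrow> d \<in> D \<Longrightarrow> c \<otimes> d \<in> D"
  by (simp add: D_def m_assoc[symmetric]) (simp add: m_assoc)

lemma D_minus: "c \<in> D \<Longrightarrow> d \<in> D \<Longrightarrow> c \<ominus> d \<in> D"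
  by (simp add: D_def minus_eq r_distr l_distr r_minus l_minus)

lemma tpow_D: "d \<in> D \<Longrightarrow> t [^] (n::nat) \<otimes> d \<in> D"
  by (simp add: D_def m_assoc tpow_pull)

lemma upow_D: "d \<in> D \<Longrightarrow> u [^] (n::nat) \<otimes> d \<in> D"
  by (simp add: D_def m_assoc upow_pull)

text \<open>Schur's lemma: minimality gives \<open>a\<close> with \<open>a d = \<epsilon>\<close>,
  and \<open>\<epsilon> a \<epsilon>\<close> is a left inverse of \<open>d\<close> inside
  \<open>D\<close>. As all non-zero elements have left inverses, these are two-sided.\<close>

lemma D_inverse:
  assumes "d \<in> D" "d \<noteq> \<zero>"
  obtains c where "c \<in> D" "c \<noteq> \<zero>" "c \<otimes> d = \<epsilon>" "d \<otimes> c = \<epsilon>"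
proof -
  have li: "\<exists>c\<in>D. c \<noteq> \<zero> \<and> c \<otimes> d = \<epsilon>" if d: "d \<in> D" "d \<noteq> \<zero>" for d
  proof -
    obtain a where a: "a \<in> carrier R" "a \<otimes> d = \<epsilon>" using minimal[of d] d by (auto simp: D_def)
    have "(\<epsilon> \<otimes> a \<otimes> \<epsilon>) \<otimes> d = \<epsilon> \<otimes> (a \<otimes> (\<epsilon> \<otimes> d))" using a d D_carrier by (simp add: m_assoc)
    also have "\<dots> = \<epsilon>" using a d D_l by simp
    finally have e: "(\<epsilon> \<otimes> a \<otimes> \<epsilon>) \<otimes> d = \<epsilon>" .
    have "\<epsilon> \<otimes> a \<otimes> \<epsilon> \<in> D" using a unfolding D_def by (simp add: m_assoc) (simp add: m_assoc[symmetric])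
    moreover have "\<epsilon> \<otimes> a \<otimes> \<epsilon> \<noteq> \<zero>" using e d D_carrier \<epsilon>_nonzero by auto
    ultimately show ?thesis using e by blast
  qed
  obtain c where c: "c \<in> D" "c \<noteq> \<zero>" "c \<otimes> d = \<epsilon>" using li assms by blast
  obtain b where b: "b \<in> D" "b \<otimes> c = \<epsilon>" using li c by blast
  have "b = b \<otimes> (c \<otimes> d)" using c D_r b by simp
  also have "\<dots> = (b \<otimes> c) \<otimes> d" using b c assms D_carrier by (intro m_assoc[symmetric]) auto
  also have "\<dots> = d" using b assms D_l by simp
  finally show ?thesis using that c b by blast
qed

lemma D_domain:
  assumes "c \<in> D" "d \<in> D" "c \<noteq> \<zero>" "d \<noteq> \<zero>" shows "c \<otimes> d \<noteq> \<zero>"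
proof
  assume h: "c \<otimes> d = \<zero>"
  obtain d' where d': "d' \<in> D" "d \<otimes> d' = \<epsilon>" using D_inverse assms by metis
  have "c = (c \<otimes> d) \<otimes> d'" using assms d' D_carrier D_r by (simp add: m_assoc)
  then show False using h assms d' D_carrier by simp
qed

section \<open>Right multiplication by elements of the division ring\<close>

lemma mem_rmul: "x \<in> rmul N d \<longleftrightarrow> (\<exists>y\<in>N. x = y \<otimes> d)" by (auto simp: rmul_def)

lemma rmul_mono: "N \<subseteq> M \<Longrightarrow> rmul N d \<subseteq> rmul M d" by (auto simp: rmul_def)

lemma rmul_rmul: "N \<subseteq> carrier R \<Longrightarrow> c \<in> carrier R \<Longrightarrow> d \<in> carrier R \<Longrightarrow> rmul (rmul N c) d = rmul N (c \<otimes> d)"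
  by (auto simp: rmul_def image_image m_assoc intro!: image_cong)

lemma rmul_\<epsilon>: "N \<subseteq> V \<Longrightarrow> rmul N \<epsilon> = N"
  by (force simp: rmul_def V_def)

lemma rmul_inverse:
  assumes "N \<subseteq> V" "c \<in> D" "d \<in> D" "c \<otimes> d = \<epsilon>" shows "rmul (rmul N c) d = N"
  using rmul_rmul[of N c d] rmul_\<epsilon>[OF assms(1)] assms V_carrier D_carrier by auto

lemma rmul_V: "d \<in> D \<Longrightarrow> N \<subseteq> carrier R \<Longrightarrow> rmul N d \<subseteq> V"
  using D_carrier D_r by (auto simp: rmul_def V_def m_assoc)

lemma rmul_smod:
  assumes "smod C N" "d \<in> carrier R" "C \<subseteq> carrier R" shows "smod C (rmul N d)"
proof (rule smodI)
  note c = smod_mem_carrier[OF assms(1)]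
  show "rmul N d \<subseteq> carrier R" using c assms by (auto simp: rmul_def)
  show "\<zero> \<in> rmul N d" using smod_zero[OF assms(1)] assms unfolding mem_rmul by (auto intro!: bexI[of _ \<zero>])
  fix x y assume "x \<in> rmul N d" "y \<in> rmul N d"
  then obtain x' y' where h: "x' \<in> N" "y' \<in> N" "x = x' \<otimes> d" "y = y' \<otimes> d" unfolding mem_rmul by blast
  then have "x \<ominus> y = (x' \<ominus> y') \<otimes> d" using c assms by (simp add: minus_eq l_distr l_minus)
  then show "x \<ominus> y \<in> rmul N d" using smod_minus[OF assms(1) h(1,2)] unfolding mem_rmul by blast
next
  fix k x assume k: "k \<in> C" "x \<in> rmul N d"
  then obtain y where y: "y \<in> N" "x = y \<otimes> d" unfolding mem_rmul by blast
  then have "k \<otimes> x = (k \<otimes> y) \<otimes> d" using k assms smod_mem_carrier[OF assms(1)] by (simp add: m_assoc subset_iff)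
  then show "k \<otimes> x \<in> rmul N d" using smod_smult[OF assms(1) k(1) y(1)] unfolding mem_rmul by blast
qed

lemma V_smod: "C \<subseteq> carrier R \<Longrightarrow> smod C V"
  by (rule smodI) (auto simp: V_def minus_eq l_distr l_minus m_assoc subset_iff)

lemma \<Lambda>_smod: "smod \<Lambda> \<Lambda>"
  using subring_smod[OF \<Lambda>_subring] by simp

lemma P_smod: "smod \<Lambda> P"
  using rmul_smod[OF \<Lambda>_smod \<epsilon>_closed \<Lambda>_sub] by (simp add: rmul_def P_def)

lemma P_V: "P \<subseteq> V"
  using \<Lambda>_carrier by (auto simp: P_def V_def m_assoc)

lemma \<epsilon>_P: "\<epsilon> \<in> P"
  unfolding P_def using subringE(3)[OF \<Lambda>_subring] by (auto intro!: image_eqI[of _ _ \<one>])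

definition P_gens :: "'a list" where "P_gens = map (\<lambda>b. b \<otimes> \<epsilon>) bs"

lemma P_gens_carrier: "set P_gens \<subseteq> carrier R" using bs by (auto simp: P_gens_def)

lemma P_Span: "P = Span S P_gens"
  using Span_rmult[OF bs \<epsilon>_closed] unfolding P_gens_def P_def \<Lambda>_Span[symmetric] .

lemma latticeD:
  assumes "lattice N"
  shows "smod \<Lambda> N" "N \<subseteq> V" "N \<noteq> {\<zero>}" "N \<subseteq> carrier R" "smod S N"
  using assms V_carrier smod_mono[OF _ S_\<Lambda>] by (auto simp: lattice_def)

lemma lattice_P: "lattice P"
  unfolding lattice_def using P_smod P_V \<epsilon>_P \<epsilon>_nonzero smod_tpow[OF smod_mono[OF P_smod S_\<Lambda>]] by blast

text \<open>A non-zero \<open>y\<close> in \<open>N\<close> generates \<open>V\<close> over the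
  whole algebra, so some \<open>a\<close> carries it to \<epsilon>, and a power of \<open>t\<close>
  brings \<open>a\<close> into \<Lambda>.\<close>

lemma lattice_\<epsilon>:
  assumes "smod \<Lambda> N" "N \<subseteq> V" "N \<noteq> {\<zero>}" shows "\<exists>k::nat. t [^] k \<otimes> \<epsilon> \<in> N"
proof -
  obtain y where y: "y \<in> N" "y \<noteq> \<zero>" using assms smod_zero by blast
  then obtain a where a: "a \<in> carrier R" "a \<otimes> y = \<epsilon>" using minimal[of y] assms(2) by (auto simp: V_def)
  obtain k :: nat where k: "t [^] k \<otimes> a \<in> \<Lambda>" using \<Lambda>_big a by blast
  have "(t [^] k \<otimes> a) \<otimes> y = t [^] k \<otimes> \<epsilon>" using a y assms(2) V_carrier by (auto simp: m_assoc)
  then show ?thesis using smod_smult[OF assms(1) k y(1)] by metis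
qed

lemma lattice_absorb_P:
  assumes "smod \<Lambda> N" "N \<subseteq> V" "N \<noteq> {\<zero>}" shows "\<exists>k::nat. \<forall>x\<in>P. t [^] k \<otimes> x \<in> N"
proof -
  obtain k :: nat where k: "t [^] k \<otimes> \<epsilon> \<in> N" using lattice_\<epsilon>[OF assms] by blast
  have "t [^] k \<otimes> x \<in> N" if xP: "x \<in> P" for x
  proof -
    obtain y where y: "y \<in> \<Lambda>" "x = y \<otimes> \<epsilon>" using xP by (auto simp: P_def)
    then show ?thesis using smod_smult[OF assms(1) y(1) k] tpow_pull[of y \<epsilon> k] \<Lambda>_carrier by simp
  qed
  then show ?thesis by blast
qed

lemma V_absorb: "x \<in> V \<Longrightarrow> \<exists>k::nat. t [^] k \<otimes> x \<in> P"
proof -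
  assume x: "x \<in> V"
  obtain k :: nat where k: "t [^] k \<otimes> x \<in> \<Lambda>" using \<Lambda>_big V_carrier x by blast
  have "t [^] k \<otimes> x = (t [^] k \<otimes> x) \<otimes> \<epsilon>" using x V_carrier V_\<epsilon> by (simp add: m_assoc)
  then show ?thesis using k unfolding P_def by blast
qed

lemma lattice_absorb:
  assumes "lattice N" "lattice M" shows "\<exists>k::nat. \<forall>x\<in>M. t [^] k \<otimes> x \<in> N"
proof -
  obtain k :: nat where k: "\<And>x. x \<in> P \<Longrightarrow> t [^] k \<otimes> x \<in> N" using lattice_absorb_P latticeD[OF assms(1)] by blast
  obtain j :: nat where j: "\<And>x. x \<in> M \<Longrightarrow> t [^] j \<otimes> x \<in> P" using assms(2) by (auto simp: lattice_def)
  have "t [^] (k + j) \<otimes> x \<in> N" if "x \<in> M" for x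
    using k[OF j[OF that]] tpow_add[of x k j] latticeD(4)[OF assms(2)] that by auto
  then show ?thesis by blast
qed

section \<open>Operations on lattices, and finite length of their quotients\<close>

lemma lattice_sub:
  assumes "lattice M" "smod \<Lambda> N" "N \<subseteq> M" "N \<noteq> {\<zero>}" shows "lattice N"
  using assms unfolding lattice_def by blast

lemma lattice_Int:
  assumes "lattice M" "lattice N" shows "lattice (M \<inter> N)"
proof (rule lattice_sub[OF assms(1)])
  show "smod \<Lambda> (M \<inter> N)" using smod_Int latticeD assms by blast
  obtain j :: nat where j: "t [^] j \<otimes> \<epsilon> \<in> M" using lattice_\<epsilon> latticeD assms by blast
  obtain k :: nat where k: "t [^] k \<otimes> \<epsilon> \<in> N" using lattice_\<epsilon> latticeD assms by blast
  have "t [^] (j + k) \<otimes> \<epsilon> \<in> M \<inter> N"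
    using tpow_mono[OF latticeD(5)[OF assms(1)] \<epsilon>_closed j] tpow_mono[OF latticeD(5)[OF assms(2)] \<epsilon>_closed k] by simp
  moreover have "t [^] (j + k) \<otimes> \<epsilon> \<noteq> \<zero>" using tpow_zero_iff \<epsilon>_nonzero by simp
  ultimately show "M \<inter> N \<noteq> {\<zero>}" by blast
qed simp

lemma lattice_sum:
  assumes "lattice M" "lattice N" shows "lattice (M <+>\<^bsub>R\<^esub> N)"
proof -
  note m = latticeD[OF assms(1)] and n = latticeD[OF assms(2)]
  have s: "smod \<Lambda> (M <+>\<^bsub>R\<^esub> N)" using smod_sum[OF m(1) n(1) \<Lambda>_sub] .
  obtain j :: nat where j: "\<And>x. x \<in> M \<Longrightarrow> t [^] j \<otimes> x \<in> P" using assms(1) by (auto simp: lattice_def)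
  obtain k :: nat where k: "\<And>x. x \<in> N \<Longrightarrow> t [^] k \<otimes> x \<in> P" using assms(2) by (auto simp: lattice_def)
  note PS = smod_mono[OF P_smod S_\<Lambda>]
  have b: "t [^] (j + k) \<otimes> x \<in> P" if xs: "x \<in> M <+>\<^bsub>R\<^esub> N" for x
  proof -
    obtain a b where ab: "a \<in> M" "b \<in> N" "x = a \<oplus> b" using xs unfolding mem_set_add by blast
    have c: "a \<in> carrier R" "b \<in> carrier R" using ab m n by auto
    show ?thesis unfolding ab(3) tpow_distr(1)[OF c]
      using smod_add[OF PS tpow_mono[OF PS c(1) j[OF ab(1)]] tpow_mono[OF PS c(2) k[OF ab(2)]]] by simp
  qed
  have "M <+>\<^bsub>R\<^esub> N \<subseteq> V" using sum_least[OF V_smod[OF \<Lambda>_sub] m(2) n(2)] .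
  moreover have "M \<subseteq> M <+>\<^bsub>R\<^esub> N" using subset_sum_left[OF m(1) n(1)] .
  ultimately show ?thesis unfolding lattice_def using s b m(1,3) smod_zero by blast
qed

text \<open>For \<open>x\<close> in \<open>N\<close> the multiple \<open>t [^] j \<otimes> x\<close>
  has the form \<open>y \<otimes> \<epsilon>\<close> with \<open>y\<close> in \<Lambda>; times
  \<open>d\<close> it becomes \<open>y \<otimes> d\<close>, so one exponent that brings
  \<open>d\<close> into \<open>P\<close> serves for all \<open>x\<close>.\<close>

lemma lattice_rmul:
  assumes "lattice N" "d \<in> D" "d \<noteq> \<zero>" shows "lattice (rmul N d)"
proof -
  note n = latticeD[OF assms(1)]
  have dc: "d \<in> carrier R" using D_carrier assms by blast
  obtain j :: nat where j: "\<And>x. x \<in> N \<Longrightarrow> t [^] j \<otimes> x \<in> P" using assms(1) by (auto simp: lattice_def)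
  obtain k :: nat where k: "t [^] k \<otimes> d \<in> P" using V_absorb D_V assms by blast
  have "t [^] (k + j) \<otimes> (x \<otimes> d) \<in> P" if x: "x \<in> N" for x
  proof -
    obtain y where y: "y \<in> \<Lambda>" "t [^] j \<otimes> x = y \<otimes> \<epsilon>" using j[OF x] by (auto simp: P_def)
    have xc: "x \<in> carrier R" using x n by blast
    have "t [^] (k + j) \<otimes> (x \<otimes> d) = t [^] k \<otimes> ((t [^] j \<otimes> x) \<otimes> d)"
      using xc dc by (simp add: m_assoc tpow_add)
    also have "\<dots> = t [^] k \<otimes> (y \<otimes> d)" using y dc \<Lambda>_carrier D_l assms by (simp add: m_assoc)
    also have "\<dots> = y \<otimes> (t [^] k \<otimes> d)" using tpow_pull[of y d k] y \<Lambda>_carrier dc by simp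
    finally show ?thesis using smod_smult[OF P_smod y(1) k] by simp
  qed
  then have "\<exists>k::nat. \<forall>x\<in>rmul N d. t [^] k \<otimes> x \<in> P" unfolding rmul_def by blast
  moreover have "rmul N d \<noteq> {\<zero>}"
  proof
    assume h: "rmul N d = {\<zero>}"
    obtain c where c: "c \<in> D" "d \<otimes> c = \<epsilon>" using D_inverse assms by metis
    have "N = rmul (rmul N d) c" using rmul_inverse[OF n(2) assms(2) c] by simp
    also have "\<dots> = {\<zero>}" unfolding h using D_carrier c by (simp add: rmul_def)
    finally show False using n by blast
  qed
  ultimately show ?thesis
    unfolding lattice_def using rmul_smod[OF n(1) dc \<Lambda>_sub] rmul_V[OF assms(2) n(4)] by blast
qed

text \<open>Boundedness places \<open>M\<close> inside \<open>u [^] j \<otimes> P\<close>, which is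
  finitely generated over \<open>S\<close>. As \<open>u\<close> is central, its power is written on
  the right to fit \<open>Span_rmult\<close>.\<close>

lemma comp_lattice:
  assumes "lattice N" "lattice M" "N \<subseteq> M" shows "\<exists>ms. comp_factors \<Lambda> N M ms"
proof -
  note n = latticeD[OF assms(1)] and m = latticeD[OF assms(2)]
  obtain j :: nat where j: "\<And>x. x \<in> M \<Longrightarrow> t [^] j \<otimes> x \<in> P" using assms(2) by (auto simp: lattice_def)
  obtain k :: nat where k: "\<And>x. x \<in> M \<Longrightarrow> t [^] k \<otimes> x \<in> N" using lattice_absorb assms by blast
  have e: "x \<otimes> u [^] j = u [^] j \<otimes> x" if "x \<in> carrier R" for x using upow_comm[OF that] by simp
  have "M \<subseteq> (\<lambda>x. x \<otimes> u [^] j) ` P"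
  proof
    fix x assume x: "x \<in> M"
    then have xc: "x \<in> carrier R" using m by blast
    have "(t [^] j \<otimes> x) \<otimes> u [^] j = x" using xc e by simp
    then show "x \<in> (\<lambda>x. x \<otimes> u [^] j) ` P" using j[OF x] by (metis imageI)
  qed
  then have Msub: "M \<subseteq> Span S (map (\<lambda>x. x \<otimes> u [^] j) P_gens)"
    using Span_rmult[OF P_gens_carrier, of "u [^] j"] by (simp add: P_Span)
  have "set (map (\<lambda>x. x \<otimes> u [^] j) P_gens) \<subseteq> carrier R" using P_gens_carrier by auto
  from comp_factors_exist[OF n(1) m(1) assms(3) S_\<Lambda> \<Lambda>_sub this Msub k] show ?thesis .
qed

lemma rmul_inj:
  assumes "d \<in> D" "d \<noteq> \<zero>" "x \<in> V" "y \<in> V" "x \<otimes> d = y \<otimes> d" shows "x = y"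
proof -
  obtain c where c: "c \<in> D" "d \<otimes> c = \<epsilon>" using D_inverse assms by metis
  have "z = (z \<otimes> d) \<otimes> c" if "z \<in> V" for z
    using that c assms(1) V_carrier V_\<epsilon> D_carrier by (simp add: m_assoc)
  then show ?thesis using assms by metis
qed

lemma mem_rmul_iff:
  assumes "d \<in> D" "d \<noteq> \<zero>" "x \<in> V" "N \<subseteq> V" shows "x \<otimes> d \<in> rmul N d \<longleftrightarrow> x \<in> N"
  unfolding mem_rmul using rmul_inj[OF assms(1,2,3)] assms(4) by blast

text \<open>Right multiplication by \<open>d\<close> is a bijection of \<open>V\<close> onto itself
  commuting with \<Lambda>, so it carries submodules to submodules and leaves left annihilators,
  hence keys, unchanged.\<close>

lemma covers_rmul:
  assumes "covers \<Lambda> N M" "M \<subseteq> V" "d \<in> D" "d \<noteq> \<zero>"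
  shows "covers \<Lambda> (rmul N d) (rmul M d)" "simple_key \<Lambda> (rmul N d) (rmul M d) = simple_key \<Lambda> N M"
proof -
  obtain c where c: "c \<in> D" "c \<otimes> d = \<epsilon>" "d \<otimes> c = \<epsilon>" using D_inverse assms by metis
  have N: "smod \<Lambda> N" "N \<subseteq> V" and M: "smod \<Lambda> M" and NM: "N \<subset> M" using assms by (auto simp: covers_def)
  note dc = D_carrier[OF assms(3)] D_carrier[OF c(1)]
  show "covers \<Lambda> (rmul N d) (rmul M d)"
    unfolding covers_def
  proof (intro conjI allI impI)
    show "smod \<Lambda> (rmul N d)" "smod \<Lambda> (rmul M d)" using rmul_smod N M dc \<Lambda>_sub by auto
    have "rmul N d \<noteq> rmul M d"
    proof
      assume "rmul N d = rmul M d"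
      then have "rmul (rmul N d) c = rmul (rmul M d) c" by simp
      then show False unfolding rmul_inverse[OF N(2) assms(3) c(1,3)] rmul_inverse[OF assms(2,3) c(1,3)] using NM by simp
    qed
    then show "rmul N d \<subset> rmul M d" using rmul_mono NM by blast
    fix W assume W: "smod \<Lambda> W" "rmul N d \<subseteq> W" "W \<subseteq> rmul M d"
    have WV: "W \<subseteq> V" using W(3) rmul_V[OF assms(3)] smod_carrier[OF M] by blast
    have "N \<subseteq> rmul W c" "rmul W c \<subseteq> M"
      using rmul_mono[OF W(2), of c] rmul_mono[OF W(3), of c]
        rmul_inverse[OF N(2) assms(3) c(1,3)] rmul_inverse[OF assms(2,3) c(1,3)] by auto
    then have "rmul W c = N \<or> rmul W c = M"
      using assms(1) rmul_smod[OF W(1) dc(2) \<Lambda>_sub] unfolding covers_def by blast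
    then have "rmul (rmul W c) d = rmul N d \<or> rmul (rmul W c) d = rmul M d" by blast
    then show "W = rmul N d \<or> W = rmul M d" unfolding rmul_inverse[OF WV c(1) assms(3) c(2)] .
  qed
  have key: "{k \<in> \<Lambda>. k \<otimes> (x \<otimes> d) \<in> rmul N d} = {k \<in> \<Lambda>. k \<otimes> x \<in> N}" if x: "x \<in> M" for x
  proof -
    have "k \<otimes> (x \<otimes> d) \<in> rmul N d \<longleftrightarrow> k \<otimes> x \<in> N" if k: "k \<in> \<Lambda>" for k
    proof -
      have "k \<otimes> (x \<otimes> d) = (k \<otimes> x) \<otimes> d" using k x \<Lambda>_carrier smod_mem_carrier[OF M] dc by (simp add: m_assoc)
      then show ?thesis using mem_rmul_iff[OF assms(3,4) _ N(2)] smod_smult[OF M k x] assms(2) by auto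
    qed
    then show ?thesis by blast
  qed
  have "rmul M d - rmul N d = (\<lambda>x. x \<otimes> d) ` (M - N)"
    using mem_rmul_iff[OF assms(3,4) _ N(2)] assms(2) by (auto simp: rmul_def)
  then have "simple_key \<Lambda> (rmul N d) (rmul M d) = (\<lambda>x. {k \<in> \<Lambda>. k \<otimes> (x \<otimes> d) \<in> rmul N d}) ` (M - N)"
    unfolding simple_key_def by (simp add: image_image)
  also have "\<dots> = simple_key \<Lambda> N M" unfolding simple_key_def by (rule image_cong) (use key in auto)
  finally show "simple_key \<Lambda> (rmul N d) (rmul M d) = simple_key \<Lambda> N M" .
qed

lemma comp_rmul:
  assumes "comp_factors \<Lambda> N M ms" "M \<subseteq> V" "d \<in> D" "d \<noteq> \<zero>"
  shows "comp_factors \<Lambda> (rmul N d) (rmul M d) ms"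
  using assms
proof (induction rule: comp_factors.induct)
  case (comp_refl N)
  then show ?case using comp_factors.comp_refl rmul_smod D_carrier \<Lambda>_sub by blast
next
  case (comp_step N M ms P')
  have "M \<subseteq> V" using comp_step by (auto simp: covers_def)
  then show ?case
    using comp_factors.comp_step[OF comp_step.IH covers_rmul(1)[OF comp_step.hyps(2) comp_step.prems]]
      covers_rmul(2)[OF comp_step.hyps(2) comp_step.prems] comp_step.prems by simp
qed

text \<open>Integer valued, since \<open>val\<close> takes differences.\<close>

definition len :: "'a set \<Rightarrow> 'a set \<Rightarrow> int" where
  "len N M = int (size (THE ms. comp_factors \<Lambda> N M ms))"

lemma len_eq: "comp_factors \<Lambda> N M ms \<Longrightarrow> len N M = int (size ms)"
  unfolding len_def using comp_unique[OF _ _ \<Lambda>_sub] by (metis (no_types, lifting) the_equality)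

section \<open>Length and the valuation of the division ring\<close>

lemma len_add:
  assumes "lattice N" "lattice M" "lattice Q" "N \<subseteq> M" "M \<subseteq> Q"
  shows "len N Q = len N M + len M Q"
proof -
  obtain a b where "comp_factors \<Lambda> N M a" "comp_factors \<Lambda> M Q b" using comp_lattice assms by metis
  then show ?thesis using comp_trans[of \<Lambda> M Q b N a] len_eq by fastforce
qed

lemma len_rmul:
  assumes "lattice N" "lattice M" "N \<subseteq> M" "d \<in> D" "d \<noteq> \<zero>"
  shows "len (rmul N d) (rmul M d) = len N M"
proof -
  obtain a where "comp_factors \<Lambda> N M a" using comp_lattice assms by metis
  then show ?thesis using comp_rmul[OF _ latticeD(2)[OF assms(2)] assms(4,5)] len_eq by metis
qed

lemma len_nonneg: "len N M \<ge> 0" by (simp add: len_def)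

lemma len_0:
  assumes "lattice N" "lattice M" "N \<subseteq> M" "len N M = 0" shows "N = M"
proof -
  obtain a where a: "comp_factors \<Lambda> N M a" using comp_lattice assms by metis
  then show ?thesis using len_eq[OF a] assms(4) comp_self[OF a] by auto
qed

lemma len_self: "lattice N \<Longrightarrow> len N N = 0"
  using len_eq[OF comp_refl] latticeD(1) by fastforce

text \<open>The length of \<open>N / N d\<close> when \<open>N d \<subseteq> N\<close>; by \<open>val_eq\<close> below the choice of \<open>Q\<close> and \<open>M\<close> is immaterial.\<close>

definition val :: "'a \<Rightarrow> int" where
  "val d = (SOME z. \<exists>Q M. lattice Q \<and> lattice M \<and> Q \<subseteq> M \<and> rmul Q d \<subseteq> M \<and> z = len (rmul Q d) M - len Q M)"

text \<open>Two choices are compared through \<open>Q \<inter> Q'\<close> and \<open>M + M'\<close>.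
  Enlarging the upper lattice adds the same length to both terms; shrinking \<open>Q\<close> to
  \<open>Q0\<close> adds the lengths of \<open>Q d / Q0 d\<close> and of \<open>Q / Q0\<close>,
  which agree.\<close>

lemma val_eq:
  assumes d: "d \<in> D" "d \<noteq> \<zero>" and QM: "lattice Q" "lattice M" "Q \<subseteq> M" "rmul Q d \<subseteq> M"
  shows "val d = len (rmul Q d) M - len Q M"
proof -
  have "\<exists>z Q M. lattice Q \<and> lattice M \<and> Q \<subseteq> M \<and> rmul Q d \<subseteq> M \<and> z = len (rmul Q d) M - len Q M"
    using QM by blast
  from someI_ex[OF this] obtain Q' M' where Q': "lattice Q'" "lattice M'" "Q' \<subseteq> M'" "rmul Q' d \<subseteq> M'"
    "val d = len (rmul Q' d) M' - len Q' M'" unfolding val_def by blast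
  have up: "len (rmul Q d) N - len Q N = len (rmul Q d) M - len Q M"
    if "lattice Q" "lattice M" "Q \<subseteq> M" "rmul Q d \<subseteq> M" "lattice N" "M \<subseteq> N" for Q M N
    using len_add[of "rmul Q d" M N] len_add[of Q M N] lattice_rmul[OF that(1) d] that by simp
  have down: "len (rmul Q0 d) M - len Q0 M = len (rmul Q d) M - len Q M"
    if "lattice Q" "lattice M" "Q \<subseteq> M" "rmul Q d \<subseteq> M" "lattice Q0" "Q0 \<subseteq> Q" for Q M Q0
    using len_add[of "rmul Q0 d" "rmul Q d" M] len_add[of Q0 Q M] lattice_rmul[OF that(1) d] lattice_rmul[OF that(5) d]
      len_rmul[OF that(5,1,6) d] that rmul_mono[OF that(6)] by simp
  let ?N = "M <+>\<^bsub>R\<^esub> M'" and ?Q = "Q \<inter> Q'"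
  have N: "lattice ?N" "M \<subseteq> ?N" "M' \<subseteq> ?N"
    using lattice_sum[OF QM(2) Q'(2)] subset_sum_left[OF latticeD(1)[OF QM(2)] latticeD(1)[OF Q'(2)]]
      subset_sum_right[OF latticeD(1)[OF QM(2)] latticeD(1)[OF Q'(2)]] by blast+
  have "len (rmul ?Q d) ?N - len ?Q ?N = len (rmul Q d) ?N - len Q ?N"
    by (rule down) (use QM N lattice_Int[OF QM(1) Q'(1)] in auto)
  moreover have "len (rmul ?Q d) ?N - len ?Q ?N = len (rmul Q' d) ?N - len Q' ?N"
    by (rule down) (use Q' N lattice_Int[OF QM(1) Q'(1)] in auto)
  ultimately show ?thesis using up[OF QM N(1,2)] up[OF Q'(1-4) N(1,3)] Q'(5) by simp
qed

lemma val_mult: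
  assumes "c \<in> D" "c \<noteq> \<zero>" "d \<in> D" "d \<noteq> \<zero>" shows "val (c \<otimes> d) = val c + val d"
proof -
  obtain c' where c': "c' \<in> D" "c' \<noteq> \<zero>" "c' \<otimes> c = \<epsilon>" using D_inverse[OF assms(1,2)] by metis
  obtain d' where d': "d' \<in> D" "d' \<noteq> \<zero>" "d' \<otimes> d = \<epsilon>" using D_inverse[OF assms(3,4)] by metis
  note cc = D_carrier[OF assms(1)] D_carrier[OF assms(3)]
  have Pc: "P \<subseteq> carrier R" using P_V V_carrier by blast
  \<comment> \<open>This is the set of all \<open>x\<close> in \<open>P\<close> with
    \<open>x \<otimes> c\<close> and \<open>x \<otimes> c \<otimes> d\<close> in \<open>P\<close>,
    so the three values can all be measured against \<open>P\<close>, and the lengths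
    telescope.\<close>
  let ?Q = "P \<inter> rmul (P \<inter> rmul P d') c'"
  have L: "lattice ?Q" using lattice_Int lattice_rmul lattice_P c' d' by simp
  have "rmul ?Q c \<subseteq> rmul (rmul (P \<inter> rmul P d') c') c" by (rule rmul_mono) blast
  moreover have "rmul (rmul (P \<inter> rmul P d') c') c = P \<inter> rmul P d'"
    using P_V by (intro rmul_inverse c' assms) blast
  ultimately have Qc: "rmul ?Q c \<subseteq> P \<inter> rmul P d'" by simp
  have "rmul (rmul ?Q c) d \<subseteq> rmul (rmul P d') d" using Qc rmul_mono by blast
  then have Qcd: "rmul (rmul ?Q c) d \<subseteq> P" using rmul_inverse[OF P_V d'(1) assms(3) d'(3)] by auto
  have e: "rmul (rmul ?Q c) d = rmul ?Q (c \<otimes> d)" using rmul_rmul[of ?Q c d] Pc cc by blast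
  have "val c = len (rmul ?Q c) P - len ?Q P"
    by (rule val_eq) (use assms L lattice_P Qc in auto)
  moreover have "val d = len (rmul (rmul ?Q c) d) P - len (rmul ?Q c) P"
    by (rule val_eq) (use assms L lattice_P Qc Qcd lattice_rmul[OF L] in auto)
  moreover have "val (c \<otimes> d) = len (rmul ?Q (c \<otimes> d)) P - len ?Q P"
    by (rule val_eq) (use assms L lattice_P Qcd D_mult D_domain in \<open>auto simp: e[symmetric]\<close>)
  ultimately show ?thesis using e by simp
qed

lemma val_\<epsilon>: "val \<epsilon> = 0"
  using val_mult[of \<epsilon> \<epsilon>] \<epsilon>_D \<epsilon>_nonzero by simp

lemma val_stable:
  assumes "lattice N" "d \<in> D" "d \<noteq> \<zero>" "rmul N d \<subseteq> N"
  shows "val d \<ge> 0" "val d = 0 \<Longrightarrow> rmul N d = N"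
proof -
  have e: "val d = len (rmul N d) N"
    using val_eq[OF assms(2,3,1,1) order_refl assms(4)] len_self[OF assms(1)] by simp
  show "val d \<ge> 0" using e len_nonneg by simp
  show "val d = 0 \<Longrightarrow> rmul N d = N" using len_0[OF lattice_rmul[OF assms(1-3)] assms(1,4)] e by simp
qed

text \<open>Let \<open>c\<close> be the inverse of \<open>d\<close>. \<open>W n\<close> consists of
  the \<open>x\<close> in \<open>P\<close> whose multiples by the first \<open>n\<close> powers of
  \<open>d\<close> stay in \<open>P\<close>. If the intersection of all \<open>W n\<close> is
  non-zero, it is a lattice stable under \<open>d\<close>. If it is zero,
  \<open>chain_eventually_subset\<close> gives \<open>n\<close> with
  \<open>W n c \<subseteq> P\<close>; then
  \<open>W n c \<subseteq> W (Suc n) \<subseteq> W n\<close>, that is,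
  \<open>W n \<subseteq> W n d\<close>.\<close>

lemma dichotomy:
  assumes d: "d \<in> D" "d \<noteq> \<zero>"
  shows "\<exists>N. lattice N \<and> (rmul N d \<subseteq> N \<or> N \<subseteq> rmul N d)"
proof -
  obtain c where c: "c \<in> D" "c \<noteq> \<zero>" "c \<otimes> d = \<epsilon>" "d \<otimes> c = \<epsilon>" using D_inverse[OF d] by metis
  define W where "W = rec_nat P (\<lambda>n N. P \<inter> rmul N c)"
  have W0: "W 0 = P" and WS: "W (Suc n) = P \<inter> rmul (W n) c" for n by (simp_all add: W_def)
  have L: "lattice (W n)" for n
    by (induction n) (auto simp: W0 WS lattice_P intro!: lattice_Int lattice_rmul c)
  have dec: "W (Suc n) \<subseteq> W n" for n
  proof (induction n)
    case 0
    then show ?case by (auto simp: W0 WS)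
  next
    case (Suc n)
    then have "rmul (W (Suc n)) c \<subseteq> rmul (W n) c" by (rule rmul_mono)
    then show ?case unfolding WS[of "Suc n"] WS[of n] by blast
  qed
  let ?I = "\<Inter>n. W n"
  have Wcd: "rmul (rmul (W n) c) d = W n" for n
    using rmul_inverse[OF latticeD(2)[OF L] c(1) d(1) c(3)] .
  show ?thesis
  proof (cases "?I = {\<zero>}")
    case False
    have "smod \<Lambda> ?I"
    proof (rule smodI)
      show "?I \<subseteq> carrier R" using latticeD(4)[OF L[of 0]] by blast
      show "\<zero> \<in> ?I" using smod_zero[OF latticeD(1)[OF L]] by blast
      show "x \<ominus> y \<in> ?I" if "x \<in> ?I" "y \<in> ?I" for x y
        using smod_minus[OF latticeD(1)[OF L]] that by simp
      show "c \<otimes> x \<in> ?I" if "c \<in> \<Lambda>" "x \<in> ?I" for c x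
        using smod_smult[OF latticeD(1)[OF L]] that by simp
    qed
    moreover have "?I \<subseteq> P" using W0 by blast
    ultimately have "lattice ?I" using lattice_sub[OF lattice_P] False by blast
    moreover have "rmul ?I d \<subseteq> ?I"
    proof -
      have "rmul ?I d \<subseteq> W n" for n
      proof -
        have "rmul ?I d \<subseteq> rmul (rmul (W n) c) d" by (rule rmul_mono) (use WS[of n] in blast)
        then show ?thesis using Wcd by simp
      qed
      then show ?thesis by blast
    qed
    ultimately show ?thesis by blast
  next
    case True
    \<comment> \<open>The chain lemma is applied to the lattices \<open>W n c\<close>, as
      \<open>W n\<close> itself lies in \<open>P\<close> from the beginning; and
      \<open>P \<inter> W n c\<close> is again a member of the original chain.\<close>
    let ?Y = "\<lambda>n. rmul (W n) c"
    have Y: "lattice (?Y n)" for n using lattice_rmul[OF L c(1,2)] .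
    have "\<exists>n. ?Y n \<subseteq> Span S P_gens"
    proof (rule chain_eventually_subset[OF P_gens_carrier])
      show "smod S (?Y n)" for n using latticeD(5)[OF Y] .
      show "?Y (Suc n) \<subseteq> ?Y n" for n using rmul_mono[OF dec] .
      show "\<exists>k::nat. \<forall>x\<in>Span S P_gens. t [^] k \<otimes> x \<in> ?Y n" for n
        using lattice_absorb[OF Y lattice_P] unfolding P_Span .
      show "\<exists>k::nat. t [^] k \<otimes> x \<in> Span S P_gens" if "x \<in> ?Y 0" for x
        using Y[of 0] that unfolding lattice_def P_Span by blast
      show "x = \<zero>" if h: "x \<in> Span S P_gens" "\<And>n. x \<in> ?Y n" for x
      proof -
        have "x \<in> W (Suc n)" for n unfolding WS using h P_Span by blast
        then have "x \<in> ?I" using dec by blast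
        then show ?thesis using True by blast
      qed
    qed
    then obtain n where n: "?Y n \<subseteq> P" using P_Span by blast
    then have "?Y n \<subseteq> W n" using dec[of n] unfolding WS by blast
    then have "W n \<subseteq> rmul (W n) d" using rmul_mono[of "?Y n" "W n" d] Wcd by simp
    then show ?thesis using L by blast
  qed
qed

text \<open>The second alternative of \<open>dichotomy\<close> makes the inverse \<open>c\<close> of
  \<open>d\<close> stabilise \<open>N\<close>. Then \<open>val c\<close> is both non-negative and
  equal to \<open>- val d\<close>, hence 0, so \<open>N c = N\<close> and also
  \<open>N d = N\<close>.\<close>

lemma val_nonneg_stable:
  assumes "d \<in> D" "d \<noteq> \<zero>" "val d \<ge> 0"
  shows "\<exists>N. lattice N \<and> rmul N d \<subseteq> N"
proof -
  obtain N where N: "lattice N" "rmul N d \<subseteq> N \<or> N \<subseteq> rmul N d" using dichotomy assms by blast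
  have "rmul N d \<subseteq> N" if h: "N \<subseteq> rmul N d"
  proof -
    obtain c where c: "c \<in> D" "c \<noteq> \<zero>" "c \<otimes> d = \<epsilon>" "d \<otimes> c = \<epsilon>" using D_inverse[OF assms(1,2)] by metis
    have NV: "N \<subseteq> V" using latticeD N by blast
    have "rmul N c \<subseteq> N" using rmul_mono[OF h, of c] rmul_inverse[OF NV assms(1) c(1,4)] by simp
    moreover have "val c = - val d" using val_mult[OF assms(1,2) c(1,2)] c(4) val_\<epsilon> by simp
    ultimately have "rmul N c = N" using val_stable[OF N(1) c(1,2)] assms(3) by simp
    then show ?thesis using rmul_inverse[OF NV c(1) assms(1) c(3)] by simp
  qed
  then show ?thesis using N by blast
qed

text \<open>\<open>val\<close> carries no information at zero, which is therefore added by
  hand.\<close>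

definition \<Delta> :: "'a set" where "\<Delta> = {d \<in> D. d = \<zero> \<or> val d \<ge> 0}"

section \<open>The valuation ring of the division ring\<close>

lemma \<Delta>_D: "d \<in> \<Delta> \<Longrightarrow> d \<in> D" by (simp add: \<Delta>_def)

lemma stable_\<Delta>: "\<lbrakk>lattice N; d \<in> D; rmul N d \<subseteq> N\<rbrakk> \<Longrightarrow> d \<in> \<Delta>"
  using val_stable(1) unfolding \<Delta>_def by blast

lemma \<Delta>_mult: "c \<in> \<Delta> \<Longrightarrow> d \<in> \<Delta> \<Longrightarrow> c \<otimes> d \<in> \<Delta>"
proof (cases "c = \<zero> \<or> d = \<zero>")
  case True
  assume "c \<in> \<Delta>" "d \<in> \<Delta>"
  then have "c \<in> carrier R" "d \<in> carrier R" by (auto simp: \<Delta>_def D_def)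
  with True have "c \<otimes> d = \<zero>" by auto
  then show ?thesis using zero_D by (simp add: \<Delta>_def)
next
  case False
  assume "c \<in> \<Delta>" "d \<in> \<Delta>"
  then show ?thesis using False D_mult[of c d] val_mult[of c d] by (simp add: \<Delta>_def)
qed

lemma zero_\<Delta>: "\<zero> \<in> \<Delta>" using zero_D by (simp add: \<Delta>_def)

text \<open>A lattice stable under \<open>c\<close> is stable under the scalar \<open>s\<close> too,
  hence under the difference. For two arbitrary elements of \<Delta> no common stable lattice is at
  hand at this point, which is why one operand is a scalar.\<close>

lemma \<Delta>_minus_\<epsilon>:
  assumes "c \<in> \<Delta>" "s \<in> S" shows "c \<ominus> s \<otimes> \<epsilon> \<in> \<Delta>" "s \<otimes> \<epsilon> \<ominus> c \<in> \<Delta>"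
proof -
  have sc: "s \<in> carrier R" using S_carrier[OF assms(2)] .
  have r: "(s \<otimes> \<epsilon>) \<otimes> \<epsilon> = s \<otimes> \<epsilon>" using m_assoc[OF sc \<epsilon>_closed \<epsilon>_closed] by simp
  have "\<epsilon> \<otimes> (s \<otimes> \<epsilon>) = (\<epsilon> \<otimes> s) \<otimes> \<epsilon>" using m_assoc[OF \<epsilon>_closed sc \<epsilon>_closed] by simp
  also have "\<epsilon> \<otimes> s = s \<otimes> \<epsilon>" using S_central[OF assms(2) \<epsilon>_closed] by simp
  finally have sD: "s \<otimes> \<epsilon> \<in> D" using sc r by (simp add: D_def)
  have cD: "c \<in> D" using assms \<Delta>_D by blast
  obtain N where N: "lattice N" "rmul N c \<subseteq> N"
  proof (cases "c = \<zero>")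
    case True
    then have "rmul P c \<subseteq> P" using latticeD[OF lattice_P] smod_zero by (auto simp: rmul_def)
    then show ?thesis using that lattice_P by blast
  next
    case False
    then show ?thesis using val_nonneg_stable[of c] assms(1) that by (auto simp: \<Delta>_def)
  qed
  note n = latticeD[OF N(1)]
  have "x \<otimes> (s \<otimes> \<epsilon>) \<in> N" if "x \<in> N" for x
  proof -
    have x: "x \<in> V" using that n by blast
    have "x \<otimes> (s \<otimes> \<epsilon>) = (s \<otimes> x) \<otimes> \<epsilon>"
      using S_central[OF assms(2) V_carrier[OF x]] S_carrier[OF assms(2)] V_carrier[OF x] by (simp add: m_assoc)
    also have "\<dots> = s \<otimes> x" using V_carrier[OF x] S_carrier[OF assms(2)] V_\<epsilon>[OF x] by (simp add: m_assoc)
    finally show ?thesis using smod_smult[OF n(5) assms(2) that] by simp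
  qed
  moreover have "x \<otimes> c \<in> N" if "x \<in> N" for x using N(2) that by (auto simp: rmul_def)
  moreover have "x \<otimes> (a \<ominus> b) = x \<otimes> a \<ominus> x \<otimes> b" if "x \<in> N" "a \<in> carrier R" "b \<in> carrier R" for x a b
    using that n(4) by (auto simp: minus_eq r_distr r_minus)
  ultimately have "rmul N (c \<ominus> s \<otimes> \<epsilon>) \<subseteq> N" "rmul N (s \<otimes> \<epsilon> \<ominus> c) \<subseteq> N"
    using smod_minus[OF n(1)] D_carrier[OF cD] D_carrier[OF sD] by (auto simp: rmul_def)
  then show "c \<ominus> s \<otimes> \<epsilon> \<in> \<Delta>" "s \<otimes> \<epsilon> \<ominus> c \<in> \<Delta>"
    using stable_\<Delta>[OF N(1)] D_minus cD sD by auto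
qed

text \<open>For \<open>val d \<le> val c\<close> one has \<open>c - d = (c d\<^sup>-\<^sup>1 - \<epsilon>) d\<close>, so that integrality of \<open>x - \<epsilon>\<close> for
  integral \<open>x\<close> is enough.\<close>

lemma \<Delta>_minus:
  assumes "c \<in> \<Delta>" "d \<in> \<Delta>" shows "c \<ominus> d \<in> \<Delta>"
proof -
  have cd: "c \<in> D" "d \<in> D" using assms \<Delta>_D by auto
  note car = D_carrier[OF cd(1)] D_carrier[OF cd(2)]
  have neg: "\<ominus> x \<in> \<Delta>" if "x \<in> \<Delta>" for x
  proof -
    have "(\<zero> \<ominus> \<one> \<otimes> \<epsilon>) \<otimes> x \<in> \<Delta>" using \<Delta>_mult[OF \<Delta>_minus_\<epsilon>(1)[OF zero_\<Delta> one_in_S] that] .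
    moreover have "(\<zero> \<ominus> \<one> \<otimes> \<epsilon>) \<otimes> x = \<ominus> x"
      using D_carrier[OF \<Delta>_D[OF that]] D_l[OF \<Delta>_D[OF that]] by (simp add: minus_eq l_minus)
    ultimately show ?thesis by simp
  qed
  have main: "c \<ominus> d \<in> \<Delta>" if h: "c \<in> \<Delta>" "d \<in> \<Delta>" "d \<noteq> \<zero>" "c \<noteq> \<zero>" "val d \<le> val c" for c d
  proof -
    have D: "c \<in> D" "d \<in> D" using h \<Delta>_D by auto
    obtain b where b: "b \<in> D" "b \<noteq> \<zero>" "b \<otimes> d = \<epsilon>" "d \<otimes> b = \<epsilon>" using D_inverse[OF D(2) h(3)] by metis
    have "val b = - val d" using val_mult[OF D(2) h(3) b(1,2)] b(4) val_\<epsilon> by simp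
    then have cb: "c \<otimes> b \<in> \<Delta>" using val_mult[OF D(1) h(4) b(1,2)] h(5) D_mult[OF D(1) b(1)] by (simp add: \<Delta>_def)
    have "(c \<otimes> b \<ominus> \<one> \<otimes> \<epsilon>) \<otimes> d \<in> \<Delta>" using \<Delta>_mult[OF \<Delta>_minus_\<epsilon>(1)[OF cb one_in_S] h(2)] .
    moreover have "(c \<otimes> b \<ominus> \<one> \<otimes> \<epsilon>) \<otimes> d = c \<ominus> d"
    proof -
      have "(c \<otimes> b \<ominus> \<one> \<otimes> \<epsilon>) \<otimes> d = c \<otimes> (b \<otimes> d) \<ominus> \<epsilon> \<otimes> d"
        using D_carrier D b by (simp add: minus_eq l_distr l_minus m_assoc)
      then show ?thesis using b D D_l D_r by simp
    qed
    ultimately show ?thesis by simp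
  qed
  consider "c = \<zero>" | "d = \<zero>" | "c \<noteq> \<zero>" "d \<noteq> \<zero>" "val d \<le> val c" | "c \<noteq> \<zero>" "d \<noteq> \<zero>" "val c \<le> val d" by linarith
  then show ?thesis
  proof cases
    case 1
    then show ?thesis using neg[OF assms(2)] car by (simp add: minus_eq)
  next
    case 2
    then show ?thesis using assms(1) car by (simp add: minus_eq)
  next
    case 3
    then show ?thesis using main assms by blast
  next
    case 4
    then have "d \<ominus> c \<in> \<Delta>" using main assms by blast
    from neg[OF this] show ?thesis using car by (simp add: minus_eq minus_add a_comm)
  qed
qed

text \<open>\<open>t \<otimes> \<epsilon>\<close> acts on \<open>V\<close> as multiplication by
  \<open>t\<close>. Value 0 would mean \<open>t P = P\<close>, and \<epsilon> would be divisible by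
  all powers of \<open>t\<close>, against \<open>Span_separated\<close>.\<close>

lemma val_t: "val (t \<otimes> \<epsilon>) > 0" and t\<epsilon>: "t \<otimes> \<epsilon> \<in> D" "t \<otimes> \<epsilon> \<noteq> \<zero>"
proof -
  show D: "t \<otimes> \<epsilon> \<in> D" using tpow_D[OF \<epsilon>_D, of 1] by simp
  show nz: "t \<otimes> \<epsilon> \<noteq> \<zero>" using tpow_zero_iff[of \<epsilon> 1] \<epsilon>_nonzero by simp
  have e: "x \<otimes> (t \<otimes> \<epsilon>) = t \<otimes> x" if "x \<in> P" for x
  proof -
    have x: "x \<in> V" using that P_V by blast
    show ?thesis using tpow_pull[of x \<epsilon> 1] V_carrier[OF x] V_\<epsilon>[OF x] by simp
  qed
  note PS = smod_mono[OF P_smod S_\<Lambda>]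
  have sub: "rmul P (t \<otimes> \<epsilon>) \<subseteq> P" using e smod_smult[OF PS t_in_S] by (auto simp: rmul_def)
  have "val (t \<otimes> \<epsilon>) \<noteq> 0"
  proof
    assume "val (t \<otimes> \<epsilon>) = 0"
    then have eq: "rmul P (t \<otimes> \<epsilon>) = P" using val_stable(2)[OF lattice_P D nz sub] by blast
    have div: "\<exists>y\<in>P. x = t [^] n \<otimes> y" if "x \<in> P" for x and n :: nat
    proof (induction n)
      case 0
      then show ?case using that P_V V_carrier by (intro bexI[of _ x]) auto
    next
      case (Suc n)
      then obtain y where y: "y \<in> P" "x = t [^] n \<otimes> y" by blast
      then obtain z where z: "z \<in> P" "y = z \<otimes> (t \<otimes> \<epsilon>)" using eq unfolding rmul_def by blast
      have "x = t [^] Suc n \<otimes> z" using y z e[OF z(1)] P_V V_carrier by (auto simp: m_assoc)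
      then show ?case using z(1) by blast
    qed
    have "\<epsilon> = \<zero>" using Span_separated[OF P_gens_carrier, of \<epsilon>] div[OF \<epsilon>_P] unfolding P_Span by blast
    then show False using \<epsilon>_nonzero by blast
  qed
  then show "val (t \<otimes> \<epsilon>) > 0" using val_stable(1)[OF lattice_P D nz sub] by simp
qed

lemma val_tpow:
  assumes "d \<in> D" "d \<noteq> \<zero>" shows "val (t [^] (n::nat) \<otimes> d) = int n * val (t \<otimes> \<epsilon>) + val d"
proof (induction n)
  case 0
  then show ?case using assms D_carrier by simp
next
  case (Suc n)
  have c: "t [^] n \<otimes> d \<in> D" "t [^] n \<otimes> d \<noteq> \<zero>" using tpow_D tpow_zero_iff assms D_carrier by auto
  have "t [^] Suc n \<otimes> d = t \<otimes> (t [^] n \<otimes> d)"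
    using assms D_carrier tpow_comm[of t n] by (simp add: m_assoc)
  also have "\<dots> = (t \<otimes> \<epsilon>) \<otimes> (t [^] n \<otimes> d)" using c D_carrier D_l by (simp add: m_assoc)
  finally show ?case using val_mult[OF t\<epsilon> c] Suc by (simp add: algebra_simps)
qed

text \<open>Dividing by \<open>t\<close> lowers the value by
  \<open>val (t \<otimes> \<epsilon>) \<ge> 1\<close>, so \<open>\<bar>val d\<bar> + 1\<close>
  divisions make it negative.\<close>

lemma \<Delta>_separated:
  assumes "d \<in> D" "\<And>n::nat. u [^] n \<otimes> d \<in> \<Delta>" shows "d = \<zero>"
proof (rule ccontr)
  assume nz: "d \<noteq> \<zero>"
  let ?n = "Suc (nat \<bar>val d\<bar>)"
  have c: "u [^] ?n \<otimes> d \<in> D" using upow_D[OF assms(1)] .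
  have e: "t [^] ?n \<otimes> (u [^] ?n \<otimes> d) = d" using D_carrier assms(1) by (intro tpow_upow) blast
  have nz': "u [^] ?n \<otimes> d \<noteq> \<zero>"
  proof
    assume "u [^] ?n \<otimes> d = \<zero>"
    then show False using e nz by (metis nat_pow_closed r_null t_closed)
  qed
  have "val (u [^] ?n \<otimes> d) \<ge> 0" using assms(2)[of ?n] nz' unfolding \<Delta>_def by blast
  then have "val d \<ge> int ?n * val (t \<otimes> \<epsilon>)" using val_tpow[OF c nz', of ?n] unfolding e by simp
  moreover have "int ?n * 1 \<le> int ?n * val (t \<otimes> \<epsilon>)" using val_t by (intro mult_left_mono) auto
  ultimately have "int ?n * 1 \<le> val d" by (rule order_trans[rotated])
  then show False by simp
qed

lemma uniformizer_exists:
  "\<exists>p\<in>D. p \<noteq> \<zero> \<and> val p > 0 \<and> (\<forall>d\<in>D. d \<noteq> \<zero> \<longrightarrow> val d > 0 \<longrightarrow> val p \<le> val d)"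
proof -
  let ?A = "\<lambda>d. d \<in> D \<and> d \<noteq> \<zero> \<and> val d > 0"
  let ?p = "ARG_MIN (\<lambda>d. nat (val d)) d. ?A d"
  have "?A (t \<otimes> \<epsilon>)" using val_t t\<epsilon> by blast
  from arg_min_nat_lemma[of ?A, OF this, of "\<lambda>d. nat (val d)"]
  have "?A ?p" "\<And>d. ?A d \<Longrightarrow> nat (val ?p) \<le> nat (val d)" by auto
  then have "?A ?p \<and> (\<forall>d. ?A d \<longrightarrow> val ?p \<le> val d)" by (simp add: nat_le_eq_zle)
  then show ?thesis by blast
qed

end

section \<open>Lattices over a maximal order\<close>

context minimal_left_ideal
begin

lemma lattice_separated:
  assumes "lattice N" "\<And>n::nat. \<exists>y\<in>N. x = t [^] n \<otimes> y" shows "x = \<zero>"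
proof -
  note n = latticeD[OF assms(1)]
  have xc: "x \<in> carrier R" using assms(2)[of 0] n by auto
  obtain j :: nat where j: "\<And>x. x \<in> N \<Longrightarrow> t [^] j \<otimes> x \<in> P" using assms(1) by (auto simp: lattice_def)
  have "\<exists>w\<in>P. t [^] j \<otimes> x = t [^] n \<otimes> w" for n :: nat
  proof -
    obtain y where y: "y \<in> N" "x = t [^] n \<otimes> y" using assms(2) by blast
    have yc: "y \<in> carrier R" using y n by blast
    have "t [^] j \<otimes> x = t [^] n \<otimes> (t [^] j \<otimes> y)" unfolding y(2) using yc by (simp add: tpow_add add.commute)
    then show ?thesis using j[OF y(1)] by blast
  qed
  then have "t [^] j \<otimes> x = \<zero>" using Span_separated[OF P_gens_carrier] unfolding P_Span by blast
  then show ?thesis using tpow_zero_iff[OF xc] by blast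
qed

text \<open>A power of \<open>t\<close>, which commutes with \<open>d\<close>, scales
  \<open>N\<close> to a lattice \<open>Q\<close> inside \<open>M\<close>. The factors of
  \<open>M / Q d\<close> are counted through \<open>M d\<close> and through \<open>Q\<close>: since
  \<open>d\<close> carries \<open>M / Q\<close> to \<open>M d / Q d\<close>, the common part cancels
  and leaves those of \<open>M / M d\<close> and of \<open>Q / Q d\<close>.\<close>

lemma comp_rmul_independent:
  assumes M: "lattice M" "comp_factors \<Lambda> (rmul M d) M a" and N: "lattice N" "comp_factors \<Lambda> (rmul N d) N b"
    and d: "d \<in> D" "d \<noteq> \<zero>"
  shows "a = b"
proof -
  obtain k :: nat where k: "\<And>x. x \<in> N \<Longrightarrow> t [^] k \<otimes> x \<in> M" using lattice_absorb[OF M(1) N(1)] by blast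
  let ?t = "t [^] k \<otimes> \<epsilon>"
  have t: "?t \<in> D" "?t \<noteq> \<zero>" using tpow_D[OF \<epsilon>_D] tpow_zero_iff[OF \<epsilon>_closed] \<epsilon>_nonzero by auto
  have dt: "d \<otimes> ?t = ?t \<otimes> d"
    using tpow_pull[of d \<epsilon> k] D_carrier[OF d(1)] D_l[OF d(1)] D_r[OF d(1)] by (simp add: m_assoc)
  let ?Q = "rmul N ?t"
  note n = latticeD[OF N(1)] and m = latticeD[OF M(1)]
  note cc = D_carrier[OF d(1)] D_carrier[OF t(1)]
  have xt: "x \<otimes> ?t = t [^] k \<otimes> x" if "x \<in> V" for x
    using tpow_pull[of x \<epsilon> k] V_carrier[OF that] V_\<epsilon>[OF that] by simp
  have Q: "lattice ?Q" "?Q \<subseteq> M" using lattice_rmul[OF N(1) t] xt n(2) k by (auto simp: rmul_def)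
  obtain c where c: "comp_factors \<Lambda> ?Q M c" using comp_lattice[OF Q(1) M(1) Q(2)] by blast
  have "comp_factors \<Lambda> (rmul ?Q d) (rmul M d) c" using comp_rmul[OF c m(2) d] .
  then have 1: "comp_factors \<Lambda> (rmul ?Q d) M (c + a)" using comp_trans[OF M(2)] by blast
  have "rmul (rmul N d) ?t = rmul ?Q d" using rmul_rmul[OF n(4)] cc dt by simp
  then have "comp_factors \<Lambda> (rmul ?Q d) ?Q b" using comp_rmul[OF N(2) n(2) t] by simp
  then have "comp_factors \<Lambda> (rmul ?Q d) M (b + c)" using comp_trans[OF c] by blast
  then show ?thesis using comp_unique[OF 1 _ \<Lambda>_sub] by (metis add.commute add_left_cancel)
qed

text \<open>Chosen where only \<Lambda> and \<epsilon> are known, hence the same element for all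
  maximal orders above \<Lambda>.\<close>

definition uniformizer :: 'a where
  "uniformizer = (SOME p. p \<in> D \<and> p \<noteq> \<zero> \<and> val p > 0 \<and> (\<forall>d\<in>D. d \<noteq> \<zero> \<longrightarrow> val d > 0 \<longrightarrow> val p \<le> val d))"

lemma uniformizer:
  shows "uniformizer \<in> D" "uniformizer \<noteq> \<zero>" "val uniformizer > 0"
    "\<lbrakk>d \<in> D; d \<noteq> \<zero>; val d > 0\<rbrakk> \<Longrightarrow> val uniformizer \<le> val d"
proof -
  have "\<exists>p. p \<in> D \<and> p \<noteq> \<zero> \<and> val p > 0 \<and> (\<forall>d\<in>D. d \<noteq> \<zero> \<longrightarrow> val d > 0 \<longrightarrow> val p \<le> val d)"
    using uniformizer_exists by blast
  from someI_ex[OF this] show "uniformizer \<in> D" "uniformizer \<noteq> \<zero>" "val uniformizer > 0"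
    "\<lbrakk>d \<in> D; d \<noteq> \<zero>; val d > 0\<rbrakk> \<Longrightarrow> val uniformizer \<le> val d"
    unfolding uniformizer_def by blast+
qed

end

text \<open>\<open>faithful\<close> says that no non-zero element of \<open>R e\<close> kills
  \<open>V\<close>. \<open>maximal\<close> ranges over the overrings that are bounded by \<Lambda>,
  a notion that does not mention the base field; \<open>overorder\<close> shows such rings to be
  orders.\<close>

locale maximal_overorder = minimal_left_ideal +
  fixes e :: 'a and \<Lambda>' :: "'a set"
  assumes e_closed [simp]: "e \<in> carrier R" and e_idem: "e \<otimes> e = e"
    and e_central: "x \<in> carrier R \<Longrightarrow> e \<otimes> x = x \<otimes> e" and e_\<epsilon>: "e \<otimes> \<epsilon> = \<epsilon>"
    and faithful: "\<lbrakk>b \<in> carrier R; b \<otimes> e = b; \<And>x. x \<in> carrier R \<Longrightarrow> x \<otimes> \<epsilon> = x \<Longrightarrow> b \<otimes> x = \<zero>\<rbrakk> \<Longrightarrow> b = \<zero>"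
    and \<Lambda>_\<Lambda>': "\<Lambda> \<subseteq> \<Lambda>'" and \<Lambda>'_subring: "subring \<Lambda>' R"
    and \<Lambda>'_bounded: "\<exists>k::nat. \<forall>x\<in>\<Lambda>'. t [^] k \<otimes> x \<in> \<Lambda>"
    and maximal: "\<lbrakk>subring \<Gamma> R; \<Lambda>' \<subseteq> \<Gamma>; \<exists>k::nat. \<forall>x\<in>\<Gamma>. t [^] k \<otimes> x \<in> \<Lambda>\<rbrakk> \<Longrightarrow> \<Gamma> = \<Lambda>'"
begin

lemma \<Lambda>'_sub: "\<Lambda>' \<subseteq> carrier R" using subringE(1)[OF \<Lambda>'_subring] .

lemma \<Lambda>'_carrier: "x \<in> \<Lambda>' \<Longrightarrow> x \<in> carrier R" using \<Lambda>'_sub by blast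

lemma \<Lambda>'_mult: "x \<in> \<Lambda>' \<Longrightarrow> y \<in> \<Lambda>' \<Longrightarrow> x \<otimes> y \<in> \<Lambda>'" using subringE(6)[OF \<Lambda>'_subring] .

lemma \<Lambda>'_smod: "smod \<Lambda>' \<Lambda>'"
  using subring_smod[OF \<Lambda>'_subring] by simp

lemma e_V: "x \<in> V \<Longrightarrow> e \<otimes> x = x"
proof -
  assume x: "x \<in> V"
  have "e \<otimes> x = e \<otimes> (x \<otimes> \<epsilon>)" using V_\<epsilon>[OF x] by simp
  also have "\<dots> = (e \<otimes> x) \<otimes> \<epsilon>" using V_carrier[OF x] by (simp add: m_assoc)
  also have "\<dots> = (x \<otimes> e) \<otimes> \<epsilon>" using e_central[OF V_carrier[OF x]] by simp
  also have "\<dots> = x" using V_carrier[OF x] V_\<epsilon>[OF x] e_\<epsilon> by (simp add: m_assoc)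
  finally show ?thesis .
qed

lemma lattice_\<Lambda>'\<epsilon>: "lattice (rmul \<Lambda>' \<epsilon>)" "smod \<Lambda>' (rmul \<Lambda>' \<epsilon>)"
proof -
  show s: "smod \<Lambda>' (rmul \<Lambda>' \<epsilon>)" using rmul_smod[OF \<Lambda>'_smod _ \<Lambda>'_sub] by simp
  have sub: "rmul \<Lambda>' \<epsilon> \<subseteq> V" using rmul_V[OF \<epsilon>_D \<Lambda>'_sub] .
  have "\<epsilon> \<in> rmul \<Lambda>' \<epsilon>" using \<epsilon>_P \<Lambda>_\<Lambda>' by (auto simp: P_def rmul_def)
  then have nz: "rmul \<Lambda>' \<epsilon> \<noteq> {\<zero>}" using \<epsilon>_nonzero by blast
  obtain k :: nat where k: "\<And>x. x \<in> \<Lambda>' \<Longrightarrow> t [^] k \<otimes> x \<in> \<Lambda>" using \<Lambda>'_bounded by blast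
  have "t [^] k \<otimes> x \<in> P" if "x \<in> rmul \<Lambda>' \<epsilon>" for x
  proof -
    obtain y where "y \<in> \<Lambda>'" "x = y \<otimes> \<epsilon>" using \<open>x \<in> rmul \<Lambda>' \<epsilon>\<close> unfolding mem_rmul by blast
    then show ?thesis using k[of y] \<Lambda>'_carrier unfolding P_def by (auto simp: m_assoc[symmetric])
  qed
  then show "lattice (rmul \<Lambda>' \<epsilon>)" unfolding lattice_def using smod_mono[OF s \<Lambda>_\<Lambda>'] sub nz by blast
qed

text \<open>As \<open>\<epsilon> g = g\<close>, one has
  \<open>(x \<epsilon>) (g \<epsilon>) = (x g) \<epsilon>\<close>, so right multiplication by
  \<open>g \<epsilon>\<close> stabilises the lattice \<open>\<Lambda>' \<epsilon>\<close> because
  \<Lambda>' is closed under products.\<close>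

lemma \<Lambda>'_\<Delta>:
  assumes "g \<in> \<Lambda>'" "\<epsilon> \<otimes> g = g" shows "g \<otimes> \<epsilon> \<in> \<Delta>"
proof (rule stable_\<Delta>[OF lattice_\<Lambda>'\<epsilon>(1)])
  have gc: "g \<in> carrier R" using \<Lambda>'_carrier assms by blast
  show "g \<otimes> \<epsilon> \<in> D" using gc assms(2) by (simp add: D_def m_assoc[symmetric]) (simp add: m_assoc)
  show "rmul (rmul \<Lambda>' \<epsilon>) (g \<otimes> \<epsilon>) \<subseteq> rmul \<Lambda>' \<epsilon>"
  proof
    fix z assume "z \<in> rmul (rmul \<Lambda>' \<epsilon>) (g \<otimes> \<epsilon>)"
    then obtain x where x: "x \<in> \<Lambda>'" "z = (x \<otimes> \<epsilon>) \<otimes> (g \<otimes> \<epsilon>)" unfolding rmul_def by blast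
    have xc: "x \<in> carrier R" using \<Lambda>'_carrier x by blast
    have "z = x \<otimes> ((\<epsilon> \<otimes> g) \<otimes> \<epsilon>)" unfolding x(2) using xc gc by (simp add: m_assoc)
    also have "\<dots> = (x \<otimes> g) \<otimes> \<epsilon>" unfolding assms(2) using xc gc by (simp add: m_assoc)
    finally show "z \<in> rmul \<Lambda>' \<epsilon>" using \<Lambda>'_mult[OF x(1) assms(1)] unfolding mem_rmul by blast
  qed
qed

text \<open>\<open>M\<close> is the bidual of \<open>\<Lambda>'\<epsilon>\<close> with respect to \<open>\<Delta>\<close>; being reflexive, it needs no \<open>\<Delta>\<close>-basis.\<close>

definition Mdual :: "'a set" where
  "Mdual = {b \<in> carrier R. \<epsilon> \<otimes> b = b \<and> (\<forall>g\<in>\<Lambda>'. b \<otimes> (g \<otimes> \<epsilon>) \<in> \<Delta>)}"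

definition M :: "'a set" where
  "M = {x \<in> V. \<forall>b\<in>Mdual. b \<otimes> x \<in> \<Delta>}"

section \<open>The bidual lattice and its left order\<close>

lemma Mdual_carrier: "b \<in> Mdual \<Longrightarrow> b \<in> carrier R" and Mdual_\<epsilon>: "b \<in> Mdual \<Longrightarrow> \<epsilon> \<otimes> b = b"
  by (auto simp: Mdual_def)

lemma Mdual_V_D: "b \<in> Mdual \<Longrightarrow> x \<in> V \<Longrightarrow> b \<otimes> x \<in> D"
  using Mdual_carrier Mdual_\<epsilon> by (simp add: D_def V_def m_assoc[symmetric]) (simp add: m_assoc)

lemma Mdual_mult: "b \<in> Mdual \<Longrightarrow> g \<in> \<Lambda>' \<Longrightarrow> b \<otimes> g \<in> Mdual"
proof -
  assume b: "b \<in> Mdual" and g: "g \<in> \<Lambda>'"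
  have bc: "b \<in> carrier R" and gc: "g \<in> carrier R" using Mdual_carrier \<Lambda>'_carrier b g by auto
  have "\<epsilon> \<otimes> (b \<otimes> g) = (\<epsilon> \<otimes> b) \<otimes> g" using bc gc by (simp add: m_assoc)
  moreover have "(b \<otimes> g) \<otimes> (h \<otimes> \<epsilon>) \<in> \<Delta>" if h: "h \<in> \<Lambda>'" for h
  proof -
    have "(b \<otimes> g) \<otimes> (h \<otimes> \<epsilon>) = b \<otimes> ((g \<otimes> h) \<otimes> \<epsilon>)" using bc gc \<Lambda>'_carrier[OF h] by (simp add: m_assoc)
    then show ?thesis using b \<Lambda>'_mult[OF g h] unfolding Mdual_def by auto
  qed
  ultimately show ?thesis using bc gc Mdual_\<epsilon>[OF b] by (simp add: Mdual_def)
qed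

text \<open>Minimality gives \<open>a\<close> with \<open>a x = \<epsilon>\<close>. Multiplied by
  \<epsilon> on the left and by a power of \<open>t\<close>, it becomes an element of \<Lambda>'
  that belongs to the dual by \<open>\<Lambda>'_\<Delta>\<close> and still does not kill
  \<open>x\<close>.\<close>

lemma Mdual_detects:
  assumes "x \<in> V" "x \<noteq> \<zero>" shows "\<exists>b\<in>Mdual. b \<otimes> x \<noteq> \<zero>"
proof -
  have xc: "x \<in> carrier R" using V_carrier assms by blast
  obtain a where a: "a \<in> carrier R" "a \<otimes> x = \<epsilon>" using minimal[of x] assms by (auto simp: V_def)
  obtain j :: nat where j: "t [^] j \<otimes> a \<in> \<Lambda>" using \<Lambda>_big a by blast
  obtain k :: nat where k: "t [^] k \<otimes> \<epsilon> \<in> \<Lambda>" using \<Lambda>_big[OF \<epsilon>_closed] by blast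
  let ?b = "(t [^] k \<otimes> \<epsilon>) \<otimes> (t [^] j \<otimes> a)"
  have b: "?b \<in> \<Lambda>'" using \<Lambda>'_mult[OF subsetD[OF \<Lambda>_\<Lambda>' k] subsetD[OF \<Lambda>_\<Lambda>' j]] .
  have eb: "\<epsilon> \<otimes> ?b = ?b"
  proof -
    have "\<epsilon> \<otimes> (t [^] k \<otimes> \<epsilon>) = t [^] k \<otimes> \<epsilon>" using tpow_pull[of \<epsilon> \<epsilon> k] by simp
    then show ?thesis using a(1) m_assoc[of \<epsilon> "t [^] k \<otimes> \<epsilon>" "t [^] j \<otimes> a"] by simp
  qed
  have "?b \<in> Mdual"
    unfolding Mdual_def
  proof (intro CollectI conjI ballI)
    show "?b \<in> carrier R" "\<epsilon> \<otimes> ?b = ?b" using a eb by auto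
    fix g assume g: "g \<in> \<Lambda>'"
    have gc: "g \<in> carrier R" and bc: "?b \<in> carrier R" using g b \<Lambda>'_carrier by auto
    have "\<epsilon> \<otimes> (?b \<otimes> g) = ?b \<otimes> g" using m_assoc[OF \<epsilon>_closed bc gc] eb by simp
    then have "(?b \<otimes> g) \<otimes> \<epsilon> \<in> \<Delta>" using \<Lambda>'_\<Delta>[OF \<Lambda>'_mult[OF b g]] by blast
    then show "?b \<otimes> (g \<otimes> \<epsilon>) \<in> \<Delta>" using m_assoc[OF bc gc \<epsilon>_closed] by simp
  qed
  moreover have "?b \<otimes> x = t [^] (k + j) \<otimes> \<epsilon>"
  proof -
    have "?b \<otimes> x = (t [^] k \<otimes> \<epsilon>) \<otimes> (t [^] j \<otimes> (a \<otimes> x))" using a(1) xc by (simp add: m_assoc)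
    also have "\<dots> = t [^] j \<otimes> (t [^] k \<otimes> \<epsilon>)" using a(2) tpow_pull[of "t [^] k \<otimes> \<epsilon>" \<epsilon> j] by (simp add: m_assoc)
    finally show ?thesis using tpow_add[of \<epsilon> j k] by (simp add: add.commute)
  qed
  ultimately show ?thesis using tpow_zero_iff[OF \<epsilon>_closed] \<epsilon>_nonzero by metis
qed

lemma M_V: "M \<subseteq> V" by (auto simp: M_def)

lemma M_carrier: "x \<in> M \<Longrightarrow> x \<in> carrier R" using M_V V_carrier by blast

lemma M_smod: "smod \<Lambda>' M"
proof (rule smodI)
  show "M \<subseteq> carrier R" using M_carrier by blast
  show "\<zero> \<in> M" using zero_\<Delta> Mdual_carrier by (auto simp: M_def V_def)
  fix x y assume xy: "x \<in> M" "y \<in> M"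
  have c: "x \<in> carrier R" "y \<in> carrier R" using xy M_carrier by auto
  have "x \<ominus> y \<in> V" using smod_minus[OF V_smod[OF \<Lambda>'_sub]] xy M_V by blast
  moreover have "b \<otimes> (x \<ominus> y) \<in> \<Delta>" if b: "b \<in> Mdual" for b
  proof -
    have "b \<otimes> (x \<ominus> y) = b \<otimes> x \<ominus> b \<otimes> y" using c Mdual_carrier[OF b] by (simp add: minus_eq r_distr r_minus)
    then show ?thesis using \<Delta>_minus[of "b \<otimes> x" "b \<otimes> y"] xy b by (simp add: M_def)
  qed
  ultimately show "x \<ominus> y \<in> M" by (simp add: M_def)
next
  fix g x assume g: "g \<in> \<Lambda>'" and x: "x \<in> M"
  have c: "x \<in> carrier R" "g \<in> carrier R" using x g M_carrier \<Lambda>'_carrier by auto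
  have "g \<otimes> x \<in> V" using smod_smult[OF V_smod[OF \<Lambda>'_sub] g] x M_V by blast
  moreover have "b \<otimes> (g \<otimes> x) \<in> \<Delta>" if b: "b \<in> Mdual" for b
  proof -
    have "(b \<otimes> g) \<otimes> x \<in> \<Delta>" using Mdual_mult[OF b g] x by (simp add: M_def)
    then show ?thesis using m_assoc[OF Mdual_carrier[OF b] c(2,1)] by simp
  qed
  ultimately show "g \<otimes> x \<in> M" by (simp add: M_def)
qed

lemma \<Lambda>'\<epsilon>_M: "rmul \<Lambda>' \<epsilon> \<subseteq> M"
  using rmul_V[OF \<epsilon>_D \<Lambda>'_sub] by (auto simp: M_def Mdual_def rmul_def)

lemma M_\<Delta>: "x \<in> M \<Longrightarrow> d \<in> \<Delta> \<Longrightarrow> x \<otimes> d \<in> M"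
proof -
  assume x: "x \<in> M" and d: "d \<in> \<Delta>"
  have c: "x \<in> carrier R" "d \<in> carrier R" "d \<in> D" using x d M_carrier D_carrier \<Delta>_D by auto
  have "x \<otimes> d \<in> V" using c D_r by (simp add: V_def m_assoc)
  moreover have "b \<otimes> (x \<otimes> d) \<in> \<Delta>" if b: "b \<in> Mdual" for b
  proof -
    have "b \<otimes> x \<in> \<Delta>" using x b by (simp add: M_def)
    then have "(b \<otimes> x) \<otimes> d \<in> \<Delta>" using \<Delta>_mult d by blast
    then show ?thesis using m_assoc[OF Mdual_carrier[OF b] c(1,2)] by simp
  qed
  ultimately show ?thesis by (simp add: M_def)
qed

text \<open>The difficulty is boundedness. An element \<open>x\<close> of all
  \<open>t [^] n \<otimes> M\<close> would have \<open>u [^] n \<otimes> (b \<otimes> x)\<close> in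
  \<Delta> for all \<open>n\<close> and all \<open>b\<close> in the dual, so
  \<open>b \<otimes> x = \<zero>\<close> by \<open>\<Delta>_separated\<close> and
  \<open>x = \<zero>\<close> by \<open>Mdual_detects\<close>. The chain argument then puts some
  \<open>t [^] n \<otimes> M\<close> inside \<open>P\<close>.\<close>

lemma M_lattice: "lattice M"
proof -
  have MS: "smod S M" using smod_mono[OF M_smod] S_\<Lambda> \<Lambda>_\<Lambda>' by blast
  have PM: "P \<subseteq> M" using \<Lambda>'\<epsilon>_M \<Lambda>_\<Lambda>' by (auto simp: P_def rmul_def)
  let ?W = "\<lambda>n::nat. (\<lambda>x. t [^] n \<otimes> x) ` M"
  have "\<exists>n. ?W n \<subseteq> Span S P_gens"
  proof (rule chain_eventually_subset[OF P_gens_carrier])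
    show "smod S (?W n)" for n using smod_scale[OF MS] .
    show "?W (Suc n) \<subseteq> ?W n" for n
    proof
      fix z assume "z \<in> ?W (Suc n)"
      then obtain x where x: "x \<in> M" "z = t [^] Suc n \<otimes> x" by blast
      then have "z = t [^] n \<otimes> (t \<otimes> x)" using M_carrier by (simp add: m_assoc)
      then show "z \<in> ?W n" using smod_smult[OF MS t_in_S x(1)] by blast
    qed
    show "\<exists>k::nat. \<forall>x\<in>Span S P_gens. t [^] k \<otimes> x \<in> ?W n" for n
      using PM unfolding P_Span by blast
    show "\<exists>k::nat. t [^] k \<otimes> x \<in> Span S P_gens" if "x \<in> ?W 0" for x
    proof -
      have "x \<in> V" using that M_V V_carrier by auto
      then show ?thesis using V_absorb P_Span by simp
    qed
    show "x = \<zero>" if h: "x \<in> Span S P_gens" "\<And>n. x \<in> ?W n" for x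
    proof (rule ccontr)
      assume nz: "x \<noteq> \<zero>"
      have xV: "x \<in> V" using h(1) P_V P_Span by blast
      then obtain b where b: "b \<in> Mdual" "b \<otimes> x \<noteq> \<zero>" using Mdual_detects nz by blast
      have "u [^] n \<otimes> (b \<otimes> x) \<in> \<Delta>" for n :: nat
      proof -
        obtain y where y: "y \<in> M" "x = t [^] n \<otimes> y" using h(2)[of n] by blast
        have "u [^] n \<otimes> x = y" using y M_carrier by simp
        then have "u [^] n \<otimes> (b \<otimes> x) = b \<otimes> y" using upow_pull[OF Mdual_carrier[OF b(1)] V_carrier[OF xV], of n] by simp
        then show ?thesis using y(1) b(1) by (simp add: M_def)
      qed
      then show False using \<Delta>_separated[OF Mdual_V_D[OF b(1) xV]] b(2) by blast
    qed
  qed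
  then obtain n where "?W n \<subseteq> P" using P_Span by auto
  then have "\<exists>k::nat. \<forall>x\<in>M. t [^] k \<otimes> x \<in> P" by blast
  moreover have "M \<noteq> {\<zero>}" using PM \<epsilon>_P \<epsilon>_nonzero by blast
  ultimately show ?thesis unfolding lattice_def using smod_mono[OF M_smod \<Lambda>_\<Lambda>'] M_V by blast
qed

text \<open>Only the part inside \<open>R e\<close>; the other components are added in
  \<open>left_order_\<Lambda>'\<close>.\<close>

definition left_order :: "'a set" where
  "left_order = {b \<in> carrier R. b \<otimes> e = b \<and> (\<forall>x\<in>M. b \<otimes> x \<in> M)}"

lemma left_order_smod: "smod S left_order"
proof (rule smodI)
  show "left_order \<subseteq> carrier R" by (auto simp: left_order_def)
  show "\<zero> \<in> left_order" using smod_zero[OF M_smod] M_carrier by (auto simp: left_order_def)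
  show "x \<ominus> y \<in> left_order" if "x \<in> left_order" "y \<in> left_order" for x y
  proof -
    have c: "x \<in> carrier R" "y \<in> carrier R" "x \<otimes> e = x" "y \<otimes> e = y" using that by (auto simp: left_order_def)
    have "(x \<ominus> y) \<otimes> e = x \<ominus> y" using c by (simp add: minus_eq l_distr l_minus)
    moreover have "(x \<ominus> y) \<otimes> m \<in> M" if m: "m \<in> M" for m
    proof -
      have "(x \<ominus> y) \<otimes> m = x \<otimes> m \<ominus> y \<otimes> m" using c M_carrier[OF m] by (simp add: minus_eq l_distr l_minus)
      then show ?thesis using smod_minus[OF M_smod] \<open>x \<in> left_order\<close> \<open>y \<in> left_order\<close> m by (simp add: left_order_def)
    qed
    ultimately show ?thesis using c by (simp add: left_order_def)
  qed
  show "s \<otimes> x \<in> left_order" if "s \<in> S" "x \<in> left_order" for s x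
    using that S_carrier M_carrier smod_smult[OF M_smod] S_\<Lambda> \<Lambda>_\<Lambda>'
    by (auto simp: left_order_def m_assoc subset_iff)
qed

text \<open>The argument of \<open>M_lattice\<close> once more, with \<open>\<Lambda> e\<close> in
  place of \<open>P\<close>. An element lying in every \<open>t [^] n\<close> times the left order
  maps the separated lattice \<open>M\<close> to zero, hence kills \<open>V\<close>, and is zero by
  \<open>faithful\<close>.\<close>

lemma left_order_bounded: "\<exists>k::nat. \<forall>b\<in>left_order. t [^] k \<otimes> b \<in> \<Lambda>"
proof -
  let ?W = "\<lambda>n::nat. (\<lambda>x. t [^] n \<otimes> x) ` left_order"
  let ?cs = "map (\<lambda>b. b \<otimes> e) bs"
  have cs: "set ?cs \<subseteq> carrier R" using bs by auto
  have sp: "Span S ?cs = (\<lambda>x. x \<otimes> e) ` \<Lambda>" using Span_rmult[OF bs e_closed] \<Lambda>_Span by simp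
  note lc = smod_mem_carrier[OF left_order_smod]
  have "\<exists>n. ?W n \<subseteq> Span S ?cs"
  proof (rule chain_eventually_subset[OF cs])
    show "smod S (?W n)" for n using smod_scale[OF left_order_smod] .
    show "?W (Suc n) \<subseteq> ?W n" for n
    proof
      fix z assume "z \<in> ?W (Suc n)"
      then obtain x where x: "x \<in> left_order" "z = t [^] Suc n \<otimes> x" by blast
      then have "z = t [^] n \<otimes> (t \<otimes> x)" using lc by (simp add: m_assoc)
      then show "z \<in> ?W n" using smod_smult[OF left_order_smod t_in_S x(1)] by blast
    qed
    show "\<exists>k::nat. \<forall>x\<in>Span S ?cs. t [^] k \<otimes> x \<in> ?W n" for n
    proof (intro exI[of _ n] ballI)
      fix x assume "x \<in> Span S ?cs"
      then obtain y where y: "y \<in> \<Lambda>" "x = y \<otimes> e" unfolding sp by blast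
      have yc: "y \<in> carrier R" using y \<Lambda>_carrier by blast
      have "(y \<otimes> e) \<otimes> m \<in> M" if m: "m \<in> M" for m
      proof -
        have "m \<in> V" and "y \<in> \<Lambda>'" using m M_V y(1) \<Lambda>_\<Lambda>' by auto
        then show ?thesis
          using m_assoc[OF yc e_closed M_carrier[OF m]] e_V[of m] smod_smult[OF M_smod, of y m] m by simp
      qed
      then have "x \<in> left_order" unfolding y(2) using yc e_idem by (simp add: left_order_def m_assoc)
      then show "t [^] n \<otimes> x \<in> ?W n" by blast
    qed
    show "\<exists>k::nat. t [^] k \<otimes> x \<in> Span S ?cs" if "x \<in> ?W 0" for x
    proof -
      have x: "x \<in> carrier R" "x \<otimes> e = x" using that by (auto simp: left_order_def)
      obtain k :: nat where k: "t [^] k \<otimes> x \<in> \<Lambda>" using \<Lambda>_big x by blast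
      have "(t [^] k \<otimes> x) \<otimes> e = t [^] k \<otimes> x" using x by (simp add: m_assoc)
      then show ?thesis using k unfolding sp by (metis imageI)
    qed
    show "b = \<zero>" if h: "b \<in> Span S ?cs" "\<And>n. b \<in> ?W n" for b
    proof -
      have "b \<in> ?W 0" using h(2) .
      then have b: "b \<in> carrier R" "b \<otimes> e = b" by (auto simp: left_order_def)
      have bM: "b \<otimes> x = \<zero>" if x: "x \<in> M" for x
      proof (rule lattice_separated[OF M_lattice])
        fix n :: nat
        obtain y where y: "y \<in> left_order" "b = t [^] n \<otimes> y" using h(2)[of n] by blast
        then have "b \<otimes> x = t [^] n \<otimes> (y \<otimes> x)" using M_carrier[OF x] lc by (simp add: m_assoc)
        then show "\<exists>y\<in>M. b \<otimes> x = t [^] n \<otimes> y" using y(1) x by (auto simp: left_order_def)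
      qed
      have "b \<otimes> x = \<zero>" if "x \<in> carrier R" "x \<otimes> \<epsilon> = x" for x
      proof -
        have xV: "x \<in> V" using that by (simp add: V_def)
        obtain k :: nat where "t [^] k \<otimes> x \<in> P" using V_absorb[OF xV] by blast
        then have "t [^] k \<otimes> x \<in> M" using \<Lambda>'\<epsilon>_M \<Lambda>_\<Lambda>' by (auto simp: P_def rmul_def)
        then have "t [^] k \<otimes> (b \<otimes> x) = \<zero>" using bM tpow_pull[OF b(1) that(1), of k] by simp
        then show ?thesis using tpow_zero_iff b that by simp
      qed
      then show ?thesis using faithful[OF b] by blast
    qed
  qed
  then obtain n where n: "?W n \<subseteq> (\<lambda>x. x \<otimes> e) ` \<Lambda>" unfolding sp by blast
  obtain j :: nat where j: "t [^] j \<otimes> e \<in> \<Lambda>" using \<Lambda>_big[OF e_closed] by blast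
  have "t [^] (j + n) \<otimes> b \<in> \<Lambda>" if b: "b \<in> left_order" for b
  proof -
    obtain y where y: "y \<in> \<Lambda>" "t [^] n \<otimes> b = y \<otimes> e" using n b by blast
    have "t [^] (j + n) \<otimes> b = y \<otimes> (t [^] j \<otimes> e)"
      using tpow_add[OF lc[OF b], of j n] y tpow_pull[OF \<Lambda>_carrier[OF y(1)] e_closed, of j] by simp
    then show ?thesis using subringE(6)[OF \<Lambda>_subring y(1) j] by simp
  qed
  then show ?thesis by blast
qed

text \<open>The left order of \<open>M\<close>, completed by the other components of \<open>\<Lambda>'\<close>, is an order containing \<open>\<Lambda>'\<close>.\<close>

lemma left_order_\<Lambda>':
  assumes b: "b \<in> carrier R" "b \<otimes> e = b" and bM: "\<And>x. x \<in> M \<Longrightarrow> b \<otimes> x \<in> M"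
  shows "b \<in> \<Lambda>'"
proof -
  let ?f = "\<one> \<ominus> e"
  have fc: "?f \<in> carrier R" by simp
  have ff: "?f \<otimes> ?f = ?f" using e_idem by (simp add: minus_eq l_distr r_distr l_minus r_minus a_assoc r_neg2 minus_minus l_neg r_neg)
  have fcen: "?f \<otimes> x = x \<otimes> ?f" if "x \<in> carrier R" for x
    using e_central[OF that] that by (simp add: minus_eq l_distr r_distr l_minus r_minus)
  let ?\<Gamma> = "{b \<in> carrier R. (\<forall>x\<in>M. b \<otimes> x \<in> M) \<and> (\<exists>y\<in>\<Lambda>'. b \<otimes> ?f = y \<otimes> ?f)}"
  have "subring ?\<Gamma> R"
  proof (rule subringI)
    show "?\<Gamma> \<subseteq> carrier R" by blast
    show "\<one> \<in> ?\<Gamma>" using M_carrier subringE(3)[OF \<Lambda>'_subring] fc by (auto intro!: bexI[of _ \<one>] simp del: minus_closed)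
    fix x assume x: "x \<in> ?\<Gamma>"
    then obtain y where y: "y \<in> \<Lambda>'" "x \<otimes> ?f = y \<otimes> ?f" and xc: "x \<in> carrier R" by blast
    have "(\<ominus> x) \<otimes> ?f = (\<ominus> y) \<otimes> ?f" using y \<Lambda>'_carrier xc fc by (simp add: l_minus)
    moreover have "(\<ominus> x) \<otimes> m \<in> M" if m: "m \<in> M" for m
      using x m smod_neg[OF M_smod, of "x \<otimes> m"] M_carrier[OF m] by (auto simp: l_minus)
    ultimately show "\<ominus> x \<in> ?\<Gamma>" using xc subringE(5)[OF \<Lambda>'_subring y(1)] by blast
    fix z assume z: "z \<in> ?\<Gamma>"
    then obtain w where w: "w \<in> \<Lambda>'" "z \<otimes> ?f = w \<otimes> ?f" and zc: "z \<in> carrier R" by blast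
    have yc: "y \<in> carrier R" and wc: "w \<in> carrier R" using y w \<Lambda>'_carrier by auto
    have "(x \<otimes> z) \<otimes> ?f = x \<otimes> (?f \<otimes> (z \<otimes> ?f))"
      using xc zc fc fcen[OF zc] ff by (metis m_assoc m_closed)
    also have "\<dots> = (x \<otimes> ?f) \<otimes> (z \<otimes> ?f)" using xc zc fc by (simp only: m_assoc m_closed)
    also have "\<dots> = y \<otimes> (?f \<otimes> (w \<otimes> ?f))" unfolding y(2) w(2) using yc wc fc by (simp only: m_assoc m_closed)
    also have "\<dots> = (y \<otimes> w) \<otimes> ?f" using yc wc fc fcen[OF wc] ff by (metis m_assoc m_closed)
    finally have "(x \<otimes> z) \<otimes> ?f = (y \<otimes> w) \<otimes> ?f" .
    moreover have "(x \<otimes> z) \<otimes> m \<in> M" if m: "m \<in> M" for m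
      using x z m xc zc M_carrier[OF m] by (auto simp: m_assoc)
    ultimately show "x \<otimes> z \<in> ?\<Gamma>" using xc zc \<Lambda>'_mult[OF y(1) w(1)] by blast
    have "(x \<oplus> z) \<otimes> ?f = (y \<oplus> w) \<otimes> ?f" using y(2) w(2) xc zc yc wc fc by (simp add: l_distr)
    moreover have "(x \<oplus> z) \<otimes> m \<in> M" if m: "m \<in> M" for m
      using x z m xc zc M_carrier[OF m] smod_add[OF M_smod] by (auto simp: l_distr)
    ultimately show "x \<oplus> z \<in> ?\<Gamma>" using xc zc subringE(7)[OF \<Lambda>'_subring y(1) w(1)] by blast
  qed
  moreover have "\<Lambda>' \<subseteq> ?\<Gamma>" using \<Lambda>'_carrier smod_smult[OF M_smod] by blast
  moreover have "\<exists>k::nat. \<forall>x\<in>?\<Gamma>. t [^] k \<otimes> x \<in> \<Lambda>"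
  proof -
    obtain k :: nat where k: "\<And>b. b \<in> left_order \<Longrightarrow> t [^] k \<otimes> b \<in> \<Lambda>" using left_order_bounded by blast
    obtain i :: nat where i: "\<And>x. x \<in> \<Lambda>' \<Longrightarrow> t [^] i \<otimes> x \<in> \<Lambda>" using \<Lambda>'_bounded by blast
    \<comment> \<open>\<open>?f\<close> need not lie in \<Lambda>, so its denominator is cleared
      separately from that of \<open>y\<close>.\<close>
    obtain j :: nat where j: "t [^] j \<otimes> ?f \<in> \<Lambda>" using \<Lambda>_big[OF fc] by blast
    note \<Lambda>S = smod_mono[OF \<Lambda>_smod S_\<Lambda>]
    have "t [^] (k + (i + j)) \<otimes> x \<in> \<Lambda>" if x: "x \<in> ?\<Gamma>" for x
    proof -
      have xc: "x \<in> carrier R" using x by blast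
      obtain y where y: "y \<in> \<Lambda>'" "x \<otimes> ?f = y \<otimes> ?f" using x by blast
      have yc: "y \<in> carrier R" using y \<Lambda>'_carrier by blast
      have "(x \<otimes> e) \<otimes> m \<in> M" if m: "m \<in> M" for m
        using m_assoc[OF xc e_closed M_carrier[OF m]] e_V[of m] M_V m x by auto
      then have "x \<otimes> e \<in> left_order" using xc e_idem by (simp add: left_order_def m_assoc)
      then have 1: "t [^] (k + (i + j)) \<otimes> (x \<otimes> e) \<in> \<Lambda>"
        using tpow_mono[OF \<Lambda>S _ k, of "x \<otimes> e" "k + (i + j)"] xc by simp
      have "(t [^] i \<otimes> y) \<otimes> (t [^] j \<otimes> ?f) = t [^] (i + j) \<otimes> (y \<otimes> ?f)"
        using tpow_pull[of "t [^] i \<otimes> y" ?f j] tpow_add[of "y \<otimes> ?f" j i] yc fc by (simp add: m_assoc add.commute)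
      then have "t [^] (i + j) \<otimes> (x \<otimes> ?f) \<in> \<Lambda>" using y(2) subringE(6)[OF \<Lambda>_subring i[OF y(1)] j] by simp
      then have 2: "t [^] (k + (i + j)) \<otimes> (x \<otimes> ?f) \<in> \<Lambda>"
        using tpow_mono[OF \<Lambda>S, of "x \<otimes> ?f" "i + j" "k + (i + j)"] xc fc by simp
      have "x = x \<otimes> e \<oplus> x \<otimes> ?f"
      proof -
        have "x \<otimes> e \<oplus> x \<otimes> ?f = x \<otimes> (e \<oplus> ?f)" using xc fc by (simp add: r_distr)
        moreover have "e \<oplus> ?f = \<one>" using e_closed one_closed by algebra
        ultimately show ?thesis using xc by simp
      qed
      then have "t [^] (k + (i + j)) \<otimes> x = t [^] (k + (i + j)) \<otimes> (x \<otimes> e) \<oplus> t [^] (k + (i + j)) \<otimes> (x \<otimes> ?f)"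
        using tpow_distr(1)[of "x \<otimes> e" "x \<otimes> ?f" "k + (i + j)"] xc fc by simp
      then show ?thesis using smod_add[OF \<Lambda>S 1 2] by simp
    qed
    then show ?thesis by blast
  qed
  ultimately have "?\<Gamma> = \<Lambda>'" by (rule maximal)
  moreover have "b \<in> ?\<Gamma>"
  proof -
    have "b \<otimes> ?f = \<zero>" using b by (simp add: minus_eq r_distr r_minus r_neg)
    also have "\<dots> = \<zero> \<otimes> ?f" using fc by simp
    finally have "\<exists>y\<in>\<Lambda>'. b \<otimes> ?f = y \<otimes> ?f" using subringE(2)[OF \<Lambda>'_subring] by blast
    then show ?thesis using b bM by blast
  qed
  ultimately show ?thesis by blast
qed

text \<open>Take \<open>b0\<close> in the dual and \<open>x0\<close> in \<open>N\<close> with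
  \<open>val (b0 \<otimes> x0)\<close> least, and \<open>c = b0 \<otimes> x0\<close>. Minimality
  makes \<open>b x c^-1\<close> integral for all \<open>b\<close> in the dual and \<open>x\<close>
  in \<open>N\<close>, so \<open>N c^-1 \<subseteq> M\<close>, as \<open>M\<close> is itself defined
  as a dual. Conversely, for \<open>m\<close> in \<open>M\<close> the element \<open>m b0\<close>
  maps \<open>M\<close> into \<open>M \<Delta> \<subseteq> M\<close>, hence lies in \<Lambda>' by
  \<open>left_order_\<Lambda>'\<close>, and \<open>m c = (m b0) x0\<close> lies in
  \<open>N\<close>.\<close>

theorem overlattice_rmul:
  assumes N: "lattice N" "smod \<Lambda>' N"
  obtains c where "c \<in> D" "c \<noteq> \<zero>" "N = rmul M c"
proof -
  note n = latticeD[OF N(1)]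
  have "\<exists>x\<in>N. x \<noteq> \<zero>" using n(3) smod_zero[OF n(1)] by blast
  then obtain b1 x1 where bx1: "b1 \<in> Mdual" "x1 \<in> N" "b1 \<otimes> x1 \<noteq> \<zero>"
    using Mdual_detects n(2) by blast
  obtain k :: nat where k: "\<And>x. x \<in> N \<Longrightarrow> t [^] k \<otimes> x \<in> M" using lattice_absorb[OF M_lattice N(1)] by blast
  \<comment> \<open>Since \<open>t [^] k \<otimes> N \<subseteq> M\<close>, the values
    \<open>val (b \<otimes> x)\<close> are at least \<open>- K\<close>; adding \<open>K\<close>
    makes them natural numbers, among which a least one exists.\<close>
  define K where "K = int k * val (t \<otimes> \<epsilon>)"
  have low: "val (b \<otimes> x) + K \<ge> 0" if "b \<in> Mdual" "x \<in> N" "b \<otimes> x \<noteq> \<zero>" for b x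
  proof -
    have xV: "x \<in> V" using that n by blast
    have d: "b \<otimes> x \<in> D" using Mdual_V_D that xV by blast
    have "b \<otimes> (t [^] k \<otimes> x) \<in> \<Delta>" using k that by (simp add: M_def)
    then have "t [^] k \<otimes> (b \<otimes> x) \<in> \<Delta>" using tpow_pull[OF Mdual_carrier V_carrier] that xV by simp
    moreover have "t [^] k \<otimes> (b \<otimes> x) \<noteq> \<zero>" using tpow_zero_iff[OF D_carrier[OF d]] that by blast
    ultimately have "val (t [^] k \<otimes> (b \<otimes> x)) \<ge> 0" by (simp add: \<Delta>_def)
    then show ?thesis using val_tpow[OF d that(3), of k] unfolding K_def by simp
  qed
  let ?P = "\<lambda>(b, x). b \<in> Mdual \<and> x \<in> N \<and> b \<otimes> x \<noteq> \<zero>"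
  let ?f = "\<lambda>(b, x). nat (val (b \<otimes> x) + K)"
  have "?P (b1, x1)" using bx1 by simp
  note am = arg_min_nat_lemma[of ?P, OF this, of ?f]
  obtain b0 x0 where bx0: "arg_min ?f ?P = (b0, x0)" by (cases "arg_min ?f ?P")
  have b0: "?P (b0, x0)" and least: "\<And>b x. ?P (b, x) \<Longrightarrow> ?f (b0, x0) \<le> ?f (b, x)"
    using am unfolding bx0 by blast+
  let ?c = "b0 \<otimes> x0"
  have x0V: "x0 \<in> V" using b0 n by auto
  have c: "?c \<in> D" "?c \<noteq> \<zero>" using Mdual_V_D[OF _ x0V] b0 by auto
  obtain c' where c': "c' \<in> D" "c' \<noteq> \<zero>" "c' \<otimes> ?c = \<epsilon>" "?c \<otimes> c' = \<epsilon>" using D_inverse[OF c] by metis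
  have vc': "val c' = - val ?c" using val_mult[OF c c'(1,2)] c'(4) val_\<epsilon> by simp
  have "N \<subseteq> rmul M ?c"
  proof
    fix x assume x: "x \<in> N"
    have xV: "x \<in> V" using x n by blast
    note cc = V_carrier[OF xV] D_carrier[OF c'(1)] D_carrier[OF c(1)]
    have "b \<otimes> (x \<otimes> c') \<in> \<Delta>" if b: "b \<in> Mdual" for b
    proof (cases "b \<otimes> x = \<zero>")
      case True
      then have "b \<otimes> (x \<otimes> c') = \<zero>" using m_assoc[OF Mdual_carrier[OF b] cc(1,2)] cc by simp
      then show ?thesis using zero_\<Delta> by simp
    next
      case False
      have bx: "b \<otimes> x \<in> D" using Mdual_V_D[OF b xV] .
      have "nat (val ?c + K) \<le> nat (val (b \<otimes> x) + K)" using least[of b x] b x False by simp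
      then have "val ?c \<le> val (b \<otimes> x)" using low[of b0 x0] low[OF b x False] b0 by simp
      then have "val ((b \<otimes> x) \<otimes> c') \<ge> 0" using val_mult[OF bx False c'(1,2)] vc' by simp
      then show ?thesis using m_assoc[OF Mdual_carrier[OF b] cc(1,2)] D_mult[OF bx c'(1)] by (simp add: \<Delta>_def)
    qed
    moreover have "x \<otimes> c' \<in> V" using cc c' D_r by (simp add: V_def m_assoc)
    ultimately have "x \<otimes> c' \<in> M" by (simp add: M_def)
    moreover have "x = (x \<otimes> c') \<otimes> ?c" using m_assoc[OF cc] c'(3) V_\<epsilon>[OF xV] by simp
    ultimately show "x \<in> rmul M ?c" unfolding mem_rmul by blast
  qed
  moreover have "rmul M ?c \<subseteq> N"
  proof
    fix z assume "z \<in> rmul M ?c"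
    then obtain m where m: "m \<in> M" "z = m \<otimes> ?c" unfolding mem_rmul by blast
    have cc: "m \<in> carrier R" "b0 \<in> carrier R" "x0 \<in> carrier R"
      using m M_carrier b0 Mdual_carrier x0V V_carrier by auto
    have "m \<otimes> b0 \<in> \<Lambda>'"
    proof (rule left_order_\<Lambda>')
      show "m \<otimes> b0 \<in> carrier R" using cc by simp
      have "(m \<otimes> b0) \<otimes> e = (e \<otimes> m) \<otimes> b0" using e_central[of "m \<otimes> b0"] cc by (simp add: m_assoc)
      then show "(m \<otimes> b0) \<otimes> e = m \<otimes> b0" using e_V[of m] m M_V by auto
      show "(m \<otimes> b0) \<otimes> x \<in> M" if x: "x \<in> M" for x
      proof -
        have "b0 \<otimes> x \<in> \<Delta>" using x b0 by (simp add: M_def)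
        then show ?thesis using M_\<Delta>[OF m(1)] m_assoc[OF cc(1,2) M_carrier[OF x]] by simp
      qed
    qed
    then have "(m \<otimes> b0) \<otimes> x0 \<in> N" using smod_smult[OF N(2)] b0 by auto
    then show "z \<in> N" unfolding m(2) using m_assoc[OF cc] by simp
  qed
  ultimately show ?thesis using that c by blast
qed

text \<open>With \<open>N1 = M c1\<close>, \<open>N2 = M c2\<close> and \<open>d = c1 c2^-1\<close>
  the lattice \<open>M d\<close> is properly contained in \<open>M\<close>, so
  \<open>val p \<le> val d\<close> and \<open>M d \<subseteq> M p\<close> for the uniformizer
  \<open>p\<close>. Thus \<open>N1 \<subseteq> M p c2 \<subset> N2\<close>, and simplicity forces
  \<open>N1 = M p c2\<close>; right multiplication by \<open>c2\<close> carries
  \<open>M / M p\<close> to \<open>N2 / N1\<close>.\<close>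

theorem comp_simple_quotient:
  assumes N1: "lattice N1" "smod \<Lambda>' N1" and N2: "lattice N2" "smod \<Lambda>' N2" and N12: "N1 \<subset> N2"
    and simple: "\<And>N. \<lbrakk>smod \<Lambda>' N; N1 \<subseteq> N; N \<subseteq> N2\<rbrakk> \<Longrightarrow> N = N1 \<or> N = N2"
    and comp: "comp_factors \<Lambda> (rmul M uniformizer) M ms"
  shows "comp_factors \<Lambda> N1 N2 ms"
proof -
  let ?p = uniformizer
  note p = uniformizer(1-3)
  obtain c1 where c1: "c1 \<in> D" "c1 \<noteq> \<zero>" "N1 = rmul M c1" using overlattice_rmul[OF N1] by blast
  obtain c2 where c2: "c2 \<in> D" "c2 \<noteq> \<zero>" "N2 = rmul M c2" using overlattice_rmul[OF N2] by blast
  obtain c' where c': "c' \<in> D" "c' \<noteq> \<zero>" "c' \<otimes> c2 = \<epsilon>" "c2 \<otimes> c' = \<epsilon>" using D_inverse[OF c2(1,2)] by metis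
  obtain p' where p': "p' \<in> D" "p' \<noteq> \<zero>" "p' \<otimes> ?p = \<epsilon>" "?p \<otimes> p' = \<epsilon>" using D_inverse[OF p(1,2)] by metis
  have Mc: "M \<subseteq> carrier R" using M_carrier by blast
  note car = D_carrier[OF c1(1)] D_carrier[OF c2(1)] D_carrier[OF c'(1)] D_carrier[OF p(1)] D_carrier[OF p'(1)]
  let ?d = "c1 \<otimes> c'"
  have d: "?d \<in> D" "?d \<noteq> \<zero>" using D_mult D_domain c1 c' by auto
  have Md: "rmul M ?d = rmul N1 c'" using rmul_rmul[OF Mc car(1,3)] c1(3) by simp
  have N2c: "rmul N2 c' = M" using rmul_inverse[OF M_V c2(1) c'(1,4)] c2(3) by simp
  have sub: "rmul M ?d \<subseteq> M" using rmul_mono[of N1 N2 c'] N12 Md N2c by auto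
  have N1V: "N1 \<subseteq> V" using latticeD[OF N1(1)] by blast
  have N1d: "rmul (rmul M ?d) c2 = N1" unfolding Md using rmul_inverse[OF N1V c'(1) c2(1) c'(3)] .
  have "rmul M ?d \<noteq> M" using N1d c2(3) N12 by auto
  then have "val ?d > 0" using val_stable[OF M_lattice d sub] by fastforce
  then have "val ?p \<le> val ?d" using uniformizer(4) d by blast
  moreover have "val p' = - val ?p" using val_mult[OF p(1,2) p'(1,2)] p'(4) val_\<epsilon> by simp
  ultimately have "?d \<otimes> p' \<in> \<Delta>" using val_mult[OF d p'(1,2)] D_mult[OF d(1) p'(1)] by (simp add: \<Delta>_def)
  then have "rmul M (?d \<otimes> p') \<subseteq> M" using M_\<Delta> by (auto simp: rmul_def)
  then have "rmul (rmul M (?d \<otimes> p')) ?p \<subseteq> rmul M ?p" by (rule rmul_mono)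
  moreover have "rmul (rmul M (?d \<otimes> p')) ?p = rmul M ?d"
  proof -
    have "rmul (rmul M (?d \<otimes> p')) ?p = rmul M ((?d \<otimes> p') \<otimes> ?p)" using rmul_rmul[OF Mc] car by simp
    also have "(?d \<otimes> p') \<otimes> ?p = ?d"
      using m_assoc[of ?d p' ?p] car p'(3) D_r[OF d(1)] D_carrier[OF d(1)] by simp
    finally show ?thesis .
  qed
  ultimately have "rmul M ?d \<subseteq> rmul M ?p" by simp
  then have 1: "N1 \<subseteq> rmul (rmul M ?p) c2" using rmul_mono N1d by blast
  have p\<Delta>: "?p \<in> \<Delta>" using p by (simp add: \<Delta>_def)
  have pM: "rmul M ?p \<subseteq> M" using M_\<Delta> p\<Delta> by (auto simp: rmul_def)
  have 2: "rmul (rmul M ?p) c2 \<subseteq> N2" unfolding c2(3) using rmul_mono[OF pM] .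
  have s: "smod \<Lambda>' (rmul (rmul M ?p) c2)" using rmul_smod M_smod car \<Lambda>'_sub by blast
  \<comment> \<open>Equality would give \<open>M p = M\<close>, so the inverse of \<open>p\<close>,
    whose value is negative, would stabilise \<open>M\<close>.\<close>
  have "rmul (rmul M ?p) c2 \<noteq> N2"
  proof
    assume h: "rmul (rmul M ?p) c2 = N2"
    have "rmul M ?p \<subseteq> V" using pM M_V by blast
    then have "rmul M ?p = rmul (rmul (rmul M ?p) c2) c'" using rmul_inverse[OF _ c2(1) c'(1,4)] by simp
    also have "\<dots> = M" unfolding h N2c ..
    finally have eq: "rmul M ?p = M" .
    then have "rmul M p' = M" using rmul_inverse[OF M_V p(1) p'(1,4)] by simp
    then have "val p' \<ge> 0" using val_stable(1)[OF M_lattice p'(1,2)] by simp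
    then show False using \<open>val p' = - val ?p\<close> p(3) by simp
  qed
  then have "rmul (rmul M ?p) c2 = N1" using simple[OF s 1 2] by blast
  then show ?thesis using comp_rmul[OF comp M_V c2(1,2)] c2(3) by simp
qed

end

section \<open>Simple modules over a component of a maximal order\<close>

context left_module
begin

lemma smult_zero_left: "x \<in> carrier M \<Longrightarrow> \<zero>\<^bsub>R\<^esub> \<odot>\<^bsub>M\<^esub> x = \<zero>\<^bsub>M\<^esub>"
proof -
  assume x: "x \<in> carrier M"
  have "\<zero>\<^bsub>R\<^esub> \<odot>\<^bsub>M\<^esub> x \<oplus>\<^bsub>M\<^esub> \<zero>\<^bsub>R\<^esub> \<odot>\<^bsub>M\<^esub> x = \<zero>\<^bsub>R\<^esub> \<odot>\<^bsub>M\<^esub> x"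
    using smult_l_distr[OF R.zero_closed R.zero_closed x] by simp
  then show ?thesis using smult_closed[OF R.zero_closed x] by (metis M.add.r_cancel_one')
qed

lemma smult_zero_right: "a \<in> carrier R \<Longrightarrow> a \<odot>\<^bsub>M\<^esub> \<zero>\<^bsub>M\<^esub> = \<zero>\<^bsub>M\<^esub>"
proof -
  assume a: "a \<in> carrier R"
  have "a \<odot>\<^bsub>M\<^esub> \<zero>\<^bsub>M\<^esub> \<oplus>\<^bsub>M\<^esub> a \<odot>\<^bsub>M\<^esub> \<zero>\<^bsub>M\<^esub> = a \<odot>\<^bsub>M\<^esub> \<zero>\<^bsub>M\<^esub>"
    using smult_r_distr[OF a M.zero_closed M.zero_closed] by simp
  then show ?thesis using smult_closed[OF a M.zero_closed] by (metis M.add.r_cancel_one')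
qed

lemma smult_minus_one: "x \<in> carrier M \<Longrightarrow> (\<ominus>\<^bsub>R\<^esub> \<one>\<^bsub>R\<^esub>) \<odot>\<^bsub>M\<^esub> x = \<ominus>\<^bsub>M\<^esub> x"
proof -
  assume x: "x \<in> carrier M"
  have "(\<ominus>\<^bsub>R\<^esub> \<one>\<^bsub>R\<^esub>) \<odot>\<^bsub>M\<^esub> x \<oplus>\<^bsub>M\<^esub> x = ((\<ominus>\<^bsub>R\<^esub> \<one>\<^bsub>R\<^esub>) \<oplus>\<^bsub>R\<^esub> \<one>\<^bsub>R\<^esub>) \<odot>\<^bsub>M\<^esub> x"
    using smult_l_distr[of "\<ominus>\<^bsub>R\<^esub> \<one>\<^bsub>R\<^esub>" "\<one>\<^bsub>R\<^esub>" x] x by simp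
  also have "\<dots> = \<zero>\<^bsub>M\<^esub>" using smult_zero_left[OF x] by (simp add: R.l_neg)
  finally show ?thesis using x by (simp add: M.minus_equality)
qed

text \<open>Closure under negation, which the library notion includes, comes from multiplication by
  -1.\<close>

lemma submodule_iff:
  "submodule N R M \<longleftrightarrow> N \<subseteq> carrier M \<and> \<zero>\<^bsub>M\<^esub> \<in> N \<and> (\<forall>x\<in>N. \<forall>y\<in>N. x \<oplus>\<^bsub>M\<^esub> y \<in> N) \<and>
     (\<forall>a\<in>carrier R. \<forall>x\<in>N. a \<odot>\<^bsub>M\<^esub> x \<in> N)"
proof
  assume h: "submodule N R M"
  interpret submodule N R M by fact
  show "N \<subseteq> carrier M \<and> \<zero>\<^bsub>M\<^esub> \<in> N \<and> (\<forall>x\<in>N. \<forall>y\<in>N. x \<oplus>\<^bsub>M\<^esub> y \<in> N) \<and>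
     (\<forall>a\<in>carrier R. \<forall>x\<in>N. a \<odot>\<^bsub>M\<^esub> x \<in> N)"
    using subset one_closed m_closed submodule.smult_closed[OF h] by simp
next
  assume h: "N \<subseteq> carrier M \<and> \<zero>\<^bsub>M\<^esub> \<in> N \<and> (\<forall>x\<in>N. \<forall>y\<in>N. x \<oplus>\<^bsub>M\<^esub> y \<in> N) \<and>
     (\<forall>a\<in>carrier R. \<forall>x\<in>N. a \<odot>\<^bsub>M\<^esub> x \<in> N)"
  have "\<ominus>\<^bsub>M\<^esub> x \<in> N" if "x \<in> N" for x
  proof -
    have "(\<ominus>\<^bsub>R\<^esub> \<one>\<^bsub>R\<^esub>) \<odot>\<^bsub>M\<^esub> x \<in> N" using h that by simp
    moreover have "x \<in> carrier M" using h that by blast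
    ultimately show ?thesis using smult_minus_one by simp
  qed
  then show "submodule N R M"
    by (intro submodule.intro subgroup.intro submodule_axioms.intro)
      (use h in \<open>auto simp: a_inv_def\<close>)
qed

end

locale simple_over_maximal = maximal_overorder +
  fixes T :: "('a, 'm) module"
  assumes T_simple: "simple_module (idempotent_component R \<Lambda>' e) T"
begin

abbreviation "\<Lambda>e \<equiv> idempotent_component R \<Lambda>' e"

lemma T_module: "left_module \<Lambda>e T"
  using T_simple by (simp add: simple_module_def)

sublocale T: left_module \<Lambda>e T by (rule T_module)

definition act :: "'a \<Rightarrow> 'm \<Rightarrow> 'm" where "act x s = (x \<otimes> e) \<odot>\<^bsub>T\<^esub> s"

lemma comp_simps: "carrier \<Lambda>e = (\<lambda>x. x \<otimes> e) ` \<Lambda>'" "monoid.mult \<Lambda>e = monoid.mult R" "monoid.one \<Lambda>e = e" "ring.zero \<Lambda>e = \<zero>" "ring.add \<Lambda>e = ring.add R"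
  by (simp_all add: idempotent_component_def)

lemma xe_closed: "x \<in> \<Lambda>' \<Longrightarrow> x \<otimes> e \<in> carrier \<Lambda>e"
  by (simp add: comp_simps)

section \<open>The action of the maximal order on a simple module\<close>

lemma act_closed: "x \<in> \<Lambda>' \<Longrightarrow> s \<in> carrier T \<Longrightarrow> act x s \<in> carrier T"
  unfolding act_def using T.smult_closed[OF xe_closed] by blast

lemma act_one: "s \<in> carrier T \<Longrightarrow> act \<one> s = s"
  unfolding act_def using T.smult_one[of s] by (simp add: comp_simps)

lemma act_add:
  assumes "x \<in> \<Lambda>'" "y \<in> \<Lambda>'" "s \<in> carrier T" shows "act (x \<oplus> y) s = act x s \<oplus>\<^bsub>T\<^esub> act y s"
proof -
  have "(x \<oplus> y) \<otimes> e = x \<otimes> e \<oplus> y \<otimes> e" using assms \<Lambda>'_carrier by (simp add: l_distr)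
  then show ?thesis unfolding act_def
    using T.smult_l_distr[OF xe_closed[OF assms(1)] xe_closed[OF assms(2)] assms(3)] by (simp add: comp_simps)
qed

lemma act_mult:
  assumes "x \<in> \<Lambda>'" "y \<in> \<Lambda>'" "s \<in> carrier T" shows "act (x \<otimes> y) s = act x (act y s)"
proof -
  have c: "x \<in> carrier R" "y \<in> carrier R" using assms \<Lambda>'_carrier by auto
  have "(x \<otimes> e) \<otimes> (y \<otimes> e) = x \<otimes> ((e \<otimes> y) \<otimes> e)" using c by (simp add: m_assoc)
  also have "\<dots> = x \<otimes> (y \<otimes> (e \<otimes> e))" unfolding e_central[OF c(2)] using c by (simp add: m_assoc)
  also have "\<dots> = (x \<otimes> y) \<otimes> e" unfolding e_idem using c by (simp add: m_assoc)
  finally show ?thesis unfolding act_def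
    using T.smult_assoc1[OF xe_closed[OF assms(1)] xe_closed[OF assms(2)] assms(3)] by (simp add: comp_simps)
qed

lemma act_zero: "s \<in> carrier T \<Longrightarrow> act \<zero> s = \<zero>\<^bsub>T\<^esub>"
  unfolding act_def using T.smult_zero_left[of s] by (simp add: comp_simps)

lemma act_right_zero: "x \<in> \<Lambda>' \<Longrightarrow> act x \<zero>\<^bsub>T\<^esub> = \<zero>\<^bsub>T\<^esub>"
  unfolding act_def using T.smult_zero_right[OF xe_closed] by blast

lemma act_minus:
  assumes "x \<in> \<Lambda>'" "y \<in> \<Lambda>'" "s \<in> carrier T" shows "act (x \<ominus> y) s = act x s \<ominus>\<^bsub>T\<^esub> act y s"
proof -
  have d: "x \<ominus> y \<in> \<Lambda>'" using smod_minus[OF \<Lambda>'_smod] assms by blast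
  have "(x \<ominus> y) \<oplus> y = x" using \<Lambda>'_carrier assms by (simp add: minus_eq a_assoc l_neg)
  then have "act x s = act (x \<ominus> y) s \<oplus>\<^bsub>T\<^esub> act y s" using act_add[OF d assms(2,3)] by simp
  moreover have "act (x \<ominus> y) s \<in> carrier T" "act y s \<in> carrier T" using act_closed assms d by auto
  ultimately show ?thesis by (simp add: T.M.minus_eq T.M.a_assoc T.M.r_neg)
qed

lemma zero_\<Lambda>': "\<zero> \<in> \<Lambda>'" and one_\<Lambda>': "\<one> \<in> \<Lambda>'"
  using subringE[OF \<Lambda>'_subring] by auto

definition s0 :: 'm where "s0 = (SOME s. s \<in> carrier T \<and> s \<noteq> \<zero>\<^bsub>T\<^esub>)"

lemma s0: "s0 \<in> carrier T" "s0 \<noteq> \<zero>\<^bsub>T\<^esub>"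
proof -
  have "\<exists>s. s \<in> carrier T \<and> s \<noteq> \<zero>\<^bsub>T\<^esub>"
    using T_simple T.M.zero_closed unfolding simple_module_def by blast
  from someI_ex[OF this] show "s0 \<in> carrier T" "s0 \<noteq> \<zero>\<^bsub>T\<^esub>" unfolding s0_def by auto
qed

text \<open>A maximal left ideal of \<Lambda>', with \<open>T\<close> isomorphic to \<Lambda>'
  modulo \<open>Ann\<close>.\<close>

definition Ann :: "'a set" where "Ann = {x \<in> \<Lambda>'. act x s0 = \<zero>\<^bsub>T\<^esub>}"

lemma Ann_smod: "smod \<Lambda>' Ann"
proof (rule smodI)
  show "Ann \<subseteq> carrier R" using \<Lambda>'_carrier by (auto simp: Ann_def)
  show "\<zero> \<in> Ann" using act_zero[OF s0(1)] zero_\<Lambda>' by (simp add: Ann_def)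
  show "x \<ominus> y \<in> Ann" if "x \<in> Ann" "y \<in> Ann" for x y
    using that act_minus[of x y s0] s0 smod_minus[OF \<Lambda>'_smod, of x y] by (simp add: Ann_def T.M.minus_eq)
  show "g \<otimes> x \<in> Ann" if "g \<in> \<Lambda>'" "x \<in> Ann" for g x
    using that act_mult[of g x s0] s0 act_right_zero[of g] \<Lambda>'_mult[of g x] by (simp add: Ann_def)
qed

lemma orbit_submodule:
  assumes "smod \<Lambda>' J" "J \<subseteq> \<Lambda>'" shows "(\<lambda>x. act x s0) ` J = {\<zero>\<^bsub>T\<^esub>} \<or> (\<lambda>x. act x s0) ` J = carrier T"
proof -
  have "submodule ((\<lambda>x. act x s0) ` J) \<Lambda>e T"
    unfolding T.submodule_iff
  proof (intro conjI ballI)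
    show "(\<lambda>x. act x s0) ` J \<subseteq> carrier T" using act_closed s0 assms by auto
    show "\<zero>\<^bsub>T\<^esub> \<in> (\<lambda>x. act x s0) ` J" using act_zero[OF s0(1)] smod_zero[OF assms(1)] by (metis imageI)
    fix y z assume "y \<in> (\<lambda>x. act x s0) ` J" "z \<in> (\<lambda>x. act x s0) ` J"
    then obtain a b where ab: "a \<in> J" "b \<in> J" "y = act a s0" "z = act b s0" by blast
    then have "y \<oplus>\<^bsub>T\<^esub> z = act (a \<oplus> b) s0" using act_add[OF subsetD[OF assms(2)] subsetD[OF assms(2)] s0(1)] by simp
    then show "y \<oplus>\<^bsub>T\<^esub> z \<in> (\<lambda>x. act x s0) ` J" using smod_add[OF assms(1) ab(1,2)] by blast
  next
    fix g y assume "g \<in> carrier \<Lambda>e" "y \<in> (\<lambda>x. act x s0) ` J"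
    then obtain a b where ab: "a \<in> J" "b \<in> \<Lambda>'" "y = act a s0" "g = b \<otimes> e" by (auto simp: comp_simps)
    then have "g \<odot>\<^bsub>T\<^esub> y = act (b \<otimes> a) s0" using act_mult[of b a s0] s0 assms(2) by (auto simp: act_def)
    then show "g \<odot>\<^bsub>T\<^esub> y \<in> (\<lambda>x. act x s0) ` J" using smod_smult[OF assms(1) ab(2,1)] by blast
  qed
  then show ?thesis using T_simple by (simp add: simple_module_def)
qed

text \<open>Maximality of \<open>Ann\<close>, elementwise: a left ideal not contained in it moves
  \<open>s0\<close> onto every vector, in particular onto \<open>s0\<close> itself.\<close>

lemma Ann_dichotomy:
  assumes "smod \<Lambda>' J" "J \<subseteq> \<Lambda>'" shows "J \<subseteq> Ann \<or> (\<exists>x\<in>J. \<one> \<ominus> x \<in> Ann)"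
  using orbit_submodule[OF assms]
proof
  assume "(\<lambda>x. act x s0) ` J = {\<zero>\<^bsub>T\<^esub>}"
  then show ?thesis using assms(2) by (auto simp: Ann_def)
next
  assume "(\<lambda>x. act x s0) ` J = carrier T"
  then have "s0 \<in> (\<lambda>x. act x s0) ` J" using s0(1) by simp
  then obtain x where x': "x \<in> J" "s0 = act x s0" by (rule imageE)
  note x = x'(1) x'(2)[symmetric]
  have xL: "x \<in> \<Lambda>'" using x assms by blast
  have "act (\<one> \<ominus> x) s0 = \<zero>\<^bsub>T\<^esub>"
    using act_minus[OF one_\<Lambda>' xL s0(1)] act_one[OF s0(1)] x(2) s0(1) by (simp add: T.M.minus_eq T.M.r_neg)
  then have "\<one> \<ominus> x \<in> Ann" using smod_minus[OF \<Lambda>'_smod one_\<Lambda>' xL] by (simp add: Ann_def)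
  then show ?thesis using x(1) by blast
qed

lemma act_surj: "s \<in> carrier T \<Longrightarrow> \<exists>x\<in>\<Lambda>'. s = act x s0"
proof -
  assume s: "s \<in> carrier T"
  have "s0 \<in> (\<lambda>x. act x s0) ` \<Lambda>'" using one_\<Lambda>' act_one[OF s0(1)] by (metis imageI)
  then have "(\<lambda>x. act x s0) ` \<Lambda>' = carrier T" using orbit_submodule[OF \<Lambda>'_smod order_refl] s0(2) by auto
  then show ?thesis using s by blast
qed

text \<open>If every vector were fixed by some element of \<open>Ann\<close>, then so would be every finite list of
  vectors: when \<open>l\<close> fixes a list and \<open>l'\<close> fixes \<open>v - l v\<close>, then \<open>l + l' - l' l\<close> fixes both the list
  and \<open>v\<close>. As \<open>V\<close> is finitely generated and faithful, this would put \<open>e\<close> into \<open>Ann\<close>.\<close>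

lemma Ann_moves: "\<exists>v\<in>V. \<forall>l\<in>Ann. l \<otimes> v \<noteq> v"
proof (rule ccontr)
  assume "\<not> ?thesis"
  then have fix1: "\<And>v. v \<in> V \<Longrightarrow> \<exists>l\<in>Ann. l \<otimes> v = v" by blast
  note Ac = smod_mem_carrier[OF Ann_smod]
  have fixl: "\<exists>l\<in>Ann. \<forall>v\<in>set vs. l \<otimes> v = v" if "set vs \<subseteq> V" for vs
    using that
  proof (induction vs)
    case Nil
    then show ?case using smod_zero[OF Ann_smod] by auto
  next
    case (Cons v vs)
    then obtain l where l: "l \<in> Ann" "\<And>w. w \<in> set vs \<Longrightarrow> l \<otimes> w = w" by auto
    have v: "v \<in> V" using Cons.prems by auto
    have lL: "l \<in> \<Lambda>'" using l by (simp add: Ann_def)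
    have "l \<otimes> v \<in> V" using smod_smult[OF V_smod[OF \<Lambda>'_sub] lL v] .
    then have w: "v \<ominus> l \<otimes> v \<in> V" using smod_minus[OF V_smod[OF \<Lambda>'_sub] v] by blast
    obtain k where k: "k \<in> Ann" "k \<otimes> (v \<ominus> l \<otimes> v) = v \<ominus> l \<otimes> v" using fix1[OF w] by blast
    have kL: "k \<in> \<Lambda>'" using k by (simp add: Ann_def)
    let ?m = "k \<oplus> l \<ominus> k \<otimes> l"
    have c: "l \<in> carrier R" "k \<in> carrier R" using Ac l k by auto
    have m: "?m \<in> Ann"
      using smod_minus[OF Ann_smod smod_add[OF Ann_smod k(1) l(1)] smod_smult[OF Ann_smod kL l(1)]] .
    have mm: "?m \<otimes> x = k \<otimes> (x \<ominus> l \<otimes> x) \<oplus> l \<otimes> x" if "x \<in> carrier R" for x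
      using that c by algebra
    have "?m \<otimes> v = v"
    proof -
      have vc: "v \<in> carrier R" using V_carrier[OF v] .
      have "?m \<otimes> v = (v \<ominus> l \<otimes> v) \<oplus> l \<otimes> v" using mm[OF vc] k(2) by simp
      also have "\<dots> = v" using vc c by algebra
      finally show ?thesis .
    qed
    moreover have "?m \<otimes> x = x" if x: "x \<in> set vs" for x
    proof -
      have xc: "x \<in> carrier R" using x Cons.prems V_carrier by auto
      have "x \<ominus> l \<otimes> x = \<zero>" using l(2)[OF x] xc by (simp add: minus_eq r_neg)
      then have "?m \<otimes> x = k \<otimes> \<zero> \<oplus> x" using mm[OF xc] l(2)[OF x] by simp
      then show ?thesis using c xc by simp
    qed
    ultimately show ?case using m by auto
  qed
  have "set P_gens \<subseteq> V" using Span_superset[OF P_gens_carrier] P_Span P_V by blast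
  then obtain l where l: "l \<in> Ann" "\<And>v. v \<in> set P_gens \<Longrightarrow> l \<otimes> v = v" using fixl by blast
  have lc: "l \<in> carrier R" using Ac l by blast
  \<comment> \<open>The vectors fixed by \<open>l\<close> form an \<open>S\<close>-module, hence
    include \<open>P\<close>; dividing by powers of \<open>t\<close> then gives all of
    \<open>V\<close>.\<close>
  let ?F = "{x \<in> carrier R. l \<otimes> x = x}"
  have "smod S ?F"
  proof (rule smodI)
    show "s \<otimes> x \<in> ?F" if "s \<in> S" "x \<in> ?F" for s x
    proof -
      have c: "s \<in> carrier R" "x \<in> carrier R" "l \<otimes> x = x" using that S_carrier by auto
      have "l \<otimes> (s \<otimes> x) = (l \<otimes> s) \<otimes> x" using lc c by (simp add: m_assoc)
      also have "\<dots> = s \<otimes> (l \<otimes> x)" using S_central[OF that(1) lc] lc c(1,2) by (simp add: m_assoc[symmetric])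
      finally show ?thesis using c by simp
    qed
  qed (use lc in \<open>auto simp: minus_eq r_distr r_minus\<close>)
  then have PF: "P \<subseteq> ?F" unfolding P_Span using Span_least[of ?F P_gens] l(2) P_gens_carrier by blast
  have lV: "l \<otimes> x = x" if x: "x \<in> V" for x
  proof -
    have xc: "x \<in> carrier R" using V_carrier[OF x] .
    obtain k :: nat where "t [^] k \<otimes> x \<in> P" using V_absorb[OF x] by blast
    then have "l \<otimes> (t [^] k \<otimes> x) = t [^] k \<otimes> x" using PF by blast
    then have "t [^] k \<otimes> (l \<otimes> x) = t [^] k \<otimes> x" using tpow_pull[OF lc xc] by simp
    then show ?thesis using upow_tpow[of "l \<otimes> x" k] upow_tpow[OF xc, of k] lc xc by simp
  qed
  let ?b = "(\<one> \<ominus> l) \<otimes> e"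
  have "?b = \<zero>"
  proof (rule faithful)
    show "?b \<in> carrier R" using lc by simp
    show "?b \<otimes> e = ?b" using lc e_idem by (simp add: m_assoc)
    fix x assume x: "x \<in> carrier R" "x \<otimes> \<epsilon> = x"
    then have xV: "x \<in> V" by (simp add: V_def)
    have "?b \<otimes> x = (\<one> \<ominus> l) \<otimes> x" using x lc e_V[OF xV] by (simp add: m_assoc)
    also have "\<dots> = x \<ominus> l \<otimes> x" using x lc by (simp add: minus_eq l_distr l_minus)
    finally show "?b \<otimes> x = \<zero>" using lV[OF xV] x by (simp add: minus_eq r_neg)
  qed
  moreover have "e = ?b \<oplus> l \<otimes> e" using lc e_closed by algebra
  \<comment> \<open>So \<open>l\<close> fixes \<open>s0\<close>, although it annihilates
    \<open>s0\<close>.\<close>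
  ultimately have "e = l \<otimes> e" using lc by simp
  then have "act l s0 = act \<one> s0" by (simp add: act_def)
  then show False using l(1) act_one[OF s0(1)] s0(2) by (simp add: Ann_def)
qed

text \<open>With \<open>v\<close> from \<open>Ann_moves\<close> put \<open>N2 = \<Lambda>' v\<close>
  and \<open>N1 = Ann v\<close>, so that \<open>v\<close> is not in \<open>N1\<close>. The left
  ideal of all \<open>x\<close> with \<open>x v\<close> in \<open>N1\<close> contains
  \<open>Ann\<close> but not 1, so it equals \<open>Ann\<close> by maximality; hence
  \<open>x v \<mapsto> x s0\<close> is well defined with kernel \<open>N1\<close>.\<close>

theorem simple_presentation:
  assumes comp: "comp_factors \<Lambda> (rmul M uniformizer) M ms"
  shows "\<exists>N1 N2 \<phi>. comp_factors \<Lambda> N1 N2 ms \<and> \<phi> ` N2 = carrier T \<and>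
    (\<forall>x\<in>N2. \<forall>y\<in>N2. \<phi> (x \<oplus> y) = \<phi> x \<oplus>\<^bsub>T\<^esub> \<phi> y) \<and>
    (\<forall>a\<in>\<Lambda>. \<forall>x\<in>N2. \<phi> (a \<otimes> x) = (a \<otimes> e) \<odot>\<^bsub>T\<^esub> \<phi> x) \<and>
    (\<forall>x\<in>N2. \<phi> x = \<zero>\<^bsub>T\<^esub> \<longleftrightarrow> x \<in> N1)"
proof -
  obtain v where v: "v \<in> V" and vA: "\<And>l. l \<in> Ann \<Longrightarrow> l \<otimes> v \<noteq> v" using Ann_moves by blast
  have vc: "v \<in> carrier R" using V_carrier[OF v] .
  have vnz: "v \<noteq> \<zero>" using vA[OF smod_zero[OF Ann_smod]] by auto
  note Ac = smod_mem_carrier[OF Ann_smod]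
  have AL: "Ann \<subseteq> \<Lambda>'" by (auto simp: Ann_def)
  define N1 where "N1 = rmul Ann v"
  define N2 where "N2 = rmul \<Lambda>' v"
  have s1: "smod \<Lambda>' N1" and s2: "smod \<Lambda>' N2"
    unfolding N1_def N2_def using rmul_smod[OF Ann_smod vc \<Lambda>'_sub] rmul_smod[OF \<Lambda>'_smod vc \<Lambda>'_sub] by auto
  have N12: "N1 \<subseteq> N2" unfolding N1_def N2_def using rmul_mono[OF AL] .
  have N2V: "N2 \<subseteq> V" unfolding N2_def rmul_def using smod_smult[OF V_smod[OF \<Lambda>'_sub] _ v] by blast
  have vN2: "v \<in> N2" unfolding N2_def mem_rmul using one_\<Lambda>' vc by (intro bexI[of _ \<one>]) auto
  have vN1: "v \<notin> N1" unfolding N1_def mem_rmul using vA by metis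
  have colon: "smod \<Lambda>' {x \<in> \<Lambda>'. x \<otimes> v \<in> N}" if N: "smod \<Lambda>' N" for N
  proof (rule smodI)
    show "{x \<in> \<Lambda>'. x \<otimes> v \<in> N} \<subseteq> carrier R" using \<Lambda>'_carrier by blast
    show "\<zero> \<in> {x \<in> \<Lambda>'. x \<otimes> v \<in> N}" using zero_\<Lambda>' smod_zero[OF N] vc by simp
    show "x \<ominus> y \<in> {x \<in> \<Lambda>'. x \<otimes> v \<in> N}" if xy: "x \<in> {x \<in> \<Lambda>'. x \<otimes> v \<in> N}" "y \<in> {x \<in> \<Lambda>'. x \<otimes> v \<in> N}" for x y
    proof -
      have "(x \<ominus> y) \<otimes> v = x \<otimes> v \<ominus> y \<otimes> v" using xy \<Lambda>'_carrier vc by (simp add: minus_eq l_distr l_minus)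
      then show ?thesis using xy smod_minus[OF N] smod_minus[OF \<Lambda>'_smod] by simp
    qed
    show "g \<otimes> x \<in> {x \<in> \<Lambda>'. x \<otimes> v \<in> N}" if gx: "g \<in> \<Lambda>'" "x \<in> {x \<in> \<Lambda>'. x \<otimes> v \<in> N}" for g x
    proof -
      have "(g \<otimes> x) \<otimes> v = g \<otimes> (x \<otimes> v)" using gx \<Lambda>'_carrier vc by (simp add: m_assoc)
      then show ?thesis using gx smod_smult[OF N] \<Lambda>'_mult by simp
    qed
  qed
  have dich: "(\<forall>x\<in>\<Lambda>'. x \<otimes> v \<in> N \<longrightarrow> x \<in> Ann) \<or> (\<exists>x\<in>\<Lambda>'. x \<otimes> v \<in> N \<and> \<one> \<ominus> x \<in> Ann)" if "smod \<Lambda>' N" for N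
    using Ann_dichotomy[OF colon[OF that]] by blast
  have vsplit: "v = (\<one> \<ominus> x) \<otimes> v \<oplus> x \<otimes> v" if "x \<in> \<Lambda>'" for x
    using \<Lambda>'_carrier[OF that] vc by algebra
  have kerA: "x \<in> Ann" if x: "x \<in> \<Lambda>'" "x \<otimes> v \<in> N1" for x
  proof -
    have "\<not> (\<exists>x\<in>\<Lambda>'. x \<otimes> v \<in> N1 \<and> \<one> \<ominus> x \<in> Ann)"
    proof
      assume "\<exists>x\<in>\<Lambda>'. x \<otimes> v \<in> N1 \<and> \<one> \<ominus> x \<in> Ann"
      then obtain x where x: "x \<in> \<Lambda>'" "x \<otimes> v \<in> N1" "\<one> \<ominus> x \<in> Ann" by blast
      then have "(\<one> \<ominus> x) \<otimes> v \<in> N1" unfolding N1_def mem_rmul by blast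
      then show False using smod_add[OF s1 _ x(2)] vsplit[OF x(1)] vN1 by metis
    qed
    then show ?thesis using dich[OF s1] x by blast
  qed
  have L2: "lattice N2"
  proof -
    obtain i :: nat where i: "\<And>x. x \<in> \<Lambda>' \<Longrightarrow> t [^] i \<otimes> x \<in> \<Lambda>" using \<Lambda>'_bounded by blast
    obtain j :: nat where j: "t [^] j \<otimes> v \<in> P" using V_absorb[OF v] by blast
    have "t [^] (j + i) \<otimes> z \<in> P" if "z \<in> N2" for z
    proof -
      obtain x where x: "x \<in> \<Lambda>'" "z = x \<otimes> v" using \<open>z \<in> N2\<close> unfolding N2_def mem_rmul by blast
      have xc: "x \<in> carrier R" using x \<Lambda>'_carrier by blast
      have "t [^] (j + i) \<otimes> z = t [^] j \<otimes> ((t [^] i \<otimes> x) \<otimes> v)"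
        unfolding x(2) using xc vc by (simp add: tpow_add m_assoc)
      also have "\<dots> = (t [^] i \<otimes> x) \<otimes> (t [^] j \<otimes> v)" using tpow_pull[of "t [^] i \<otimes> x" v j] xc vc by simp
      finally show ?thesis using smod_smult[OF P_smod i[OF x(1)] j] by simp
    qed
    then show ?thesis unfolding lattice_def using smod_mono[OF s2 \<Lambda>_\<Lambda>'] N2V vN2 vnz by blast
  qed
  \<comment> \<open>A lattice has to be non-zero. If \<open>N1\<close> were zero,
    \<open>\<Lambda>' v\<close> would be simple, so \<open>t \<otimes> N2\<close> would be zero or
    all of \<open>N2\<close>: the first gives \<open>t v = 0\<close>, the second makes
    \<open>v\<close> divisible by every power of \<open>t\<close>.\<close>
  have "N1 \<noteq> {\<zero>}"
  proof
    assume h: "N1 = {\<zero>}"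
    let ?t = "(\<lambda>x. t [^] (1::nat) \<otimes> x) ` N2"
    have st: "smod \<Lambda>' ?t"
    proof -
      have "?t = rmul N2 t"
        unfolding rmul_def using tpow_comm[of _ 1] smod_mem_carrier[OF s2] by (intro image_cong) auto
      then show ?thesis using rmul_smod[OF s2 t_closed \<Lambda>'_sub] by simp
    qed
    from dich[OF st] show False
    proof
      assume a: "\<forall>x\<in>\<Lambda>'. x \<otimes> v \<in> ?t \<longrightarrow> x \<in> Ann"
      have tL: "t \<in> \<Lambda>'" using t_in_S S_\<Lambda> \<Lambda>_\<Lambda>' by blast
      have "t \<otimes> v \<in> ?t" using vN2 by force
      then have "t \<in> Ann" using a tL by blast
      then have "t \<otimes> v = \<zero>" using h unfolding N1_def rmul_def by blast
      then show False using tpow_zero_iff[OF vc, of 1] vnz by simp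
    next
      assume "\<exists>x\<in>\<Lambda>'. x \<otimes> v \<in> ?t \<and> \<one> \<ominus> x \<in> Ann"
      then obtain x where x: "x \<in> \<Lambda>'" "x \<otimes> v \<in> ?t" "\<one> \<ominus> x \<in> Ann" by blast
      have "(\<one> \<ominus> x) \<otimes> v = \<zero>" using x(3) h unfolding N1_def rmul_def by blast
      then have "v = x \<otimes> v" using vsplit[OF x(1)] \<Lambda>'_carrier[OF x(1)] vc by simp
      then obtain z where z: "z \<in> N2" "v = t \<otimes> z" using x(2) smod_mem_carrier[OF s2] by auto
      then obtain y where y: "y \<in> \<Lambda>'" "z = y \<otimes> v" unfolding N2_def mem_rmul by blast
      have "\<exists>w\<in>N2. v = t [^] n \<otimes> w" for n :: nat
      proof (induction n)
        case 0
        then show ?case using vN2 vc by (intro bexI[of _ v]) simp_all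
      next
        case (Suc n)
        then obtain w where w: "w \<in> N2" "v = t [^] n \<otimes> w" by blast
        have yc: "y \<in> carrier R" and wc: "w \<in> carrier R" using y \<Lambda>'_carrier w smod_mem_carrier[OF s2] by auto
        have "v = t \<otimes> (y \<otimes> (t [^] n \<otimes> w))" using z(2) y(2) w(2) by simp
        also have "\<dots> = t \<otimes> (t [^] n \<otimes> (y \<otimes> w))" using tpow_pull[OF yc wc, of n] by simp
        also have "\<dots> = t [^] Suc n \<otimes> (y \<otimes> w)" using tpow_comm[of t n] yc wc by (simp add: m_assoc[symmetric])
        finally show ?case using smod_smult[OF s2 y(1) w(1)] by blast
      qed
      then show False using lattice_separated[OF L2] vnz by blast
    qed
  qed
  then have L1: "lattice N1" using lattice_sub[OF L2 smod_mono[OF s1 \<Lambda>_\<Lambda>'] N12] by blast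
  have simple: "N = N1 \<or> N = N2" if N: "smod \<Lambda>' N" "N1 \<subseteq> N" "N \<subseteq> N2" for N
    using dich[OF N(1)]
  proof
    assume a: "\<forall>x\<in>\<Lambda>'. x \<otimes> v \<in> N \<longrightarrow> x \<in> Ann"
    have "N \<subseteq> N1"
    proof
      fix z assume z: "z \<in> N"
      then obtain x where x: "x \<in> \<Lambda>'" "z = x \<otimes> v" using N(3) unfolding N2_def rmul_def by blast
      then show "z \<in> N1" using a z unfolding N1_def rmul_def by blast
    qed
    then show ?thesis using N by blast
  next
    assume "\<exists>x\<in>\<Lambda>'. x \<otimes> v \<in> N \<and> \<one> \<ominus> x \<in> Ann"
    then obtain x where x: "x \<in> \<Lambda>'" "x \<otimes> v \<in> N" "\<one> \<ominus> x \<in> Ann" by blast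
    then have "(\<one> \<ominus> x) \<otimes> v \<in> N" using N(2) unfolding N1_def rmul_def by blast
    then have "v \<in> N" using smod_add[OF N(1) _ x(2)] vsplit[OF x(1)] by metis
    then have "N2 \<subseteq> N" unfolding N2_def rmul_def using smod_smult[OF N(1)] by blast
    then show ?thesis using N by blast
  qed
  have cN: "comp_factors \<Lambda> N1 N2 ms"
    using comp_simple_quotient[OF L1 s1 L2 s2 _ simple comp] N12 vN1 vN2 by blast
  \<comment> \<open>The choice is immaterial: by \<open>kerA\<close> the product
    \<open>x \<otimes> v\<close> determines \<open>x\<close> modulo \<open>Ann\<close>.\<close>
  define \<phi> where "\<phi> z = act (SOME x. x \<in> \<Lambda>' \<and> z = x \<otimes> v) s0" for z
  have \<phi>: "\<phi> (x \<otimes> v) = act x s0" if x: "x \<in> \<Lambda>'" for x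
  proof -
    define y where "y = (SOME y. y \<in> \<Lambda>' \<and> x \<otimes> v = y \<otimes> v)"
    have y: "y \<in> \<Lambda>'" "x \<otimes> v = y \<otimes> v" unfolding y_def by (rule someI2[of _ x]; use x in auto)+
    have c: "x \<in> carrier R" "y \<in> carrier R" using x y \<Lambda>'_carrier by auto
    have "(x \<ominus> y) \<otimes> v = x \<otimes> v \<ominus> y \<otimes> v" using c vc by (simp add: minus_eq l_distr l_minus)
    also have "\<dots> = \<zero>" using y(2) c vc by (simp add: minus_eq r_neg)
    finally have "x \<ominus> y \<in> Ann" using kerA smod_minus[OF \<Lambda>'_smod x y(1)] smod_zero[OF s1] by simp
    then have d: "x \<ominus> y \<in> \<Lambda>'" "act (x \<ominus> y) s0 = \<zero>\<^bsub>T\<^esub>" by (auto simp: Ann_def)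
    have "x = (x \<ominus> y) \<oplus> y" using c by algebra
    then have "act x s0 = act (x \<ominus> y) s0 \<oplus>\<^bsub>T\<^esub> act y s0" using act_add[OF d(1) y(1) s0(1)] by simp
    then have "act x s0 = act y s0" using d(2) act_closed[OF y(1) s0(1)] by simp
    then show ?thesis by (simp add: \<phi>_def y_def)
  qed
  have rep: "\<exists>x\<in>\<Lambda>'. z = x \<otimes> v" if "z \<in> N2" for z using that unfolding N2_def mem_rmul .
  have "\<phi> ` N2 = carrier T"
  proof
    show "\<phi> ` N2 \<subseteq> carrier T" using rep \<phi> act_closed s0(1) by fastforce
    show "carrier T \<subseteq> \<phi> ` N2"
    proof
      fix s assume "s \<in> carrier T"
      then obtain x where x: "x \<in> \<Lambda>'" "s = act x s0" using act_surj by blast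
      then have "s = \<phi> (x \<otimes> v)" "x \<otimes> v \<in> N2" using \<phi> by (auto simp: N2_def rmul_def)
      then show "s \<in> \<phi> ` N2" by blast
    qed
  qed
  moreover have "\<phi> (z \<oplus> w) = \<phi> z \<oplus>\<^bsub>T\<^esub> \<phi> w" if zw: "z \<in> N2" "w \<in> N2" for z w
  proof -
    obtain x y where xy: "x \<in> \<Lambda>'" "z = x \<otimes> v" "y \<in> \<Lambda>'" "w = y \<otimes> v" using rep zw by blast
    have "z \<oplus> w = (x \<oplus> y) \<otimes> v" unfolding xy using xy \<Lambda>'_carrier vc by (simp add: l_distr)
    then show ?thesis
      using \<phi>[OF smod_add[OF \<Lambda>'_smod xy(1,3)]] act_add[OF xy(1,3) s0(1)] \<phi>[OF xy(1)] \<phi>[OF xy(3)] xy by simp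
  qed
  moreover have "\<phi> (a \<otimes> z) = (a \<otimes> e) \<odot>\<^bsub>T\<^esub> \<phi> z" if az: "a \<in> \<Lambda>" "z \<in> N2" for a z
  proof -
    obtain x where x: "x \<in> \<Lambda>'" "z = x \<otimes> v" using rep az by blast
    have a: "a \<in> \<Lambda>'" using az \<Lambda>_\<Lambda>' by blast
    have "a \<otimes> z = (a \<otimes> x) \<otimes> v" unfolding x(2) using a x(1) \<Lambda>'_carrier vc by (simp add: m_assoc)
    then show ?thesis using \<phi>[OF \<Lambda>'_mult[OF a x(1)]] act_mult[OF a x(1) s0(1)] \<phi>[OF x(1)] x(2) by (simp add: act_def)
  qed
  moreover have "\<phi> z = \<zero>\<^bsub>T\<^esub> \<longleftrightarrow> z \<in> N1" if z: "z \<in> N2" for z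
  proof -
    obtain x where x: "x \<in> \<Lambda>'" "z = x \<otimes> v" using rep z by blast
    have "x \<in> Ann" if "z \<in> N1" using kerA[OF x(1)] that x(2) by simp
    moreover have "z \<in> N1" if "x \<in> Ann" using imageI[OF that, of "\<lambda>x. x \<otimes> v"] x(2) by (simp add: N1_def rmul_def)
    ultimately have "x \<in> Ann \<longleftrightarrow> z \<in> N1" by blast
    then show ?thesis using \<phi>[OF x(1)] x by (simp add: Ann_def)
  qed
  ultimately show ?thesis using cN by blast
qed

end

section \<open>Relations in the Grothendieck group\<close>

lemma relations_subgroup:
  fixes L :: "('l, 'x) ring_scheme"
  shows "subgroup (grothendieck_relations L :: (('l, 'm) module \<Rightarrow>\<^sub>0 int) set) (free_Abelian_group (finite_length_modules L))"
  unfolding grothendieck_relations_def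
proof (rule group.generate_is_subgroup[OF group_free_Abelian_group], safe)
  fix M N Q :: "('l, 'm) module"
  assume h: "M \<in> finite_length_modules L" "N \<in> finite_length_modules L" "Q \<in> finite_length_modules L"
  let ?G = "free_Abelian_group (finite_length_modules L) :: (('l, 'm) module \<Rightarrow>\<^sub>0 int) monoid"
  have c: "frag_of M \<in> carrier ?G" "frag_of N \<in> carrier ?G" "frag_of Q \<in> carrier ?G"
    using h by simp_all
  have "frag_of N + frag_of Q \<in> carrier ?G"
    using monoid.m_closed[OF group.is_monoid[OF group_free_Abelian_group] c(2,3)] by (simp del: carrier_free_Abelian_group_iff)
  then show "frag_of M - (frag_of N + frag_of Q) \<in> carrier ?G"
    using c(1) keys_diff[of "frag_of M" "frag_of N + frag_of Q"] unfolding carrier_free_Abelian_group_iff by blast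
qed

lemma relations_add: "a \<in> grothendieck_relations L \<Longrightarrow> b \<in> grothendieck_relations L \<Longrightarrow> a + b \<in> grothendieck_relations L"
  using subgroup.m_closed[OF relations_subgroup, of a L b] by simp

lemma relations_uminus:
  assumes "a \<in> grothendieck_relations L" shows "- a \<in> grothendieck_relations L"
proof -
  have "a \<in> carrier (free_Abelian_group (finite_length_modules L))"
    using subgroup.mem_carrier[OF relations_subgroup assms] .
  then show ?thesis using subgroup.m_inv_closed[OF relations_subgroup assms] by simp
qed

lemma relations_diff: "a \<in> grothendieck_relations L \<Longrightarrow> b \<in> grothendieck_relations L \<Longrightarrow> a - b \<in> grothendieck_relations L"
  using relations_add[OF _ relations_uminus, of a L b] by simp

lemma relations_exact:
  assumes "finite_length_module L M" "finite_length_module L N" "finite_length_module L Q" "short_exact L N M Q"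
  shows "frag_of M - (frag_of N + frag_of Q) \<in> grothendieck_relations L"
  unfolding grothendieck_relations_def
  by (rule generate.incl) (use assms in \<open>unfold finite_length_modules_def, blast\<close>)

lemma left_module_restrict:
  assumes "left_module L T" "submodule N L T" shows "left_module L (T\<lparr>carrier := N\<rparr>)"
proof -
  interpret T: left_module L T by fact
  note N = assms(2)[unfolded T.submodule_iff]
  have c: "x \<in> carrier T" if "x \<in> N" for x using N that by blast
  have neg: "\<ominus>\<^bsub>T\<^esub> x \<in> N" if "x \<in> N" for x
    using N T.smult_minus_one[OF c[OF that]] that by (metis T.R.add.inv_closed T.R.one_closed)
  show ?thesis
  proof (intro left_module.intro left_module_axioms.intro abelian_groupI)
    show "ring L" by (rule T.R.ring_axioms)
  next
    fix x assume x: "x \<in> carrier (T\<lparr>carrier := N\<rparr>)"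
    then show "\<exists>y\<in>carrier (T\<lparr>carrier := N\<rparr>). y \<oplus>\<^bsub>T\<lparr>carrier := N\<rparr>\<^esub> x = \<zero>\<^bsub>T\<lparr>carrier := N\<rparr>\<^esub>"
      using neg[of x] T.M.l_neg[OF c] by (intro bexI[of _ "\<ominus>\<^bsub>T\<^esub> x"]) auto
  qed (use N c in \<open>auto simp: T.M.a_ac T.smult_l_distr T.smult_r_distr T.smult_assoc1\<close>)
qed

text \<open>Quotient modules on transversals, which stay inside the type of the given module.\<close>

lemma quotient_module_exists:
  fixes T :: "('l, 'm) module"
  assumes "left_module L T" "submodule N L T"
  shows "\<exists>(Q :: ('l, 'm) module) g. left_module L Q \<and> g \<in> module_hom_set L T Q \<and> g ` carrier T = carrier Q \<and>
    {x \<in> carrier T. g x = \<zero>\<^bsub>Q\<^esub>} = N"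
proof -
  interpret T: left_module L T by fact
  note N = assms(2)[unfolded T.submodule_iff]
  have c: "x \<in> carrier T" if "x \<in> N" for x using N that by blast
  have neg: "\<ominus>\<^bsub>T\<^esub> x \<in> N" if "x \<in> N" for x
    using N T.smult_minus_one[OF c[OF that]] that by (metis T.R.add.inv_closed T.R.one_closed)
  have z0: "\<ominus>\<^bsub>T\<^esub> \<zero>\<^bsub>T\<^esub> = \<zero>\<^bsub>T\<^esub>" using T.M.minus_equality[of "\<zero>\<^bsub>T\<^esub>" "\<zero>\<^bsub>T\<^esub>"] by simp
  define g where "g x = (SOME y. y \<in> carrier T \<and> x \<ominus>\<^bsub>T\<^esub> y \<in> N)" for x
  have g: "g x \<in> carrier T" "x \<ominus>\<^bsub>T\<^esub> g x \<in> N" if x: "x \<in> carrier T" for x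
  proof -
    have "\<exists>y. y \<in> carrier T \<and> x \<ominus>\<^bsub>T\<^esub> y \<in> N"
      using x N by (intro exI[of _ x]) (simp add: T.M.minus_eq T.M.r_neg)
    from someI_ex[OF this] show "g x \<in> carrier T" "x \<ominus>\<^bsub>T\<^esub> g x \<in> N" by (auto simp: g_def)
  qed
  have trans: "x \<ominus>\<^bsub>T\<^esub> z \<in> N" if h: "x \<in> carrier T" "y \<in> carrier T" "z \<in> carrier T" "x \<ominus>\<^bsub>T\<^esub> y \<in> N" "y \<ominus>\<^bsub>T\<^esub> z \<in> N" for x y z
  proof -
    have "x \<ominus>\<^bsub>T\<^esub> z = (x \<ominus>\<^bsub>T\<^esub> y) \<oplus>\<^bsub>T\<^esub> (y \<ominus>\<^bsub>T\<^esub> z)" using h(1-3) by (simp add: T.M.minus_eq T.M.a_assoc T.M.r_neg1)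
    then show ?thesis using N h(4,5) by simp
  qed
  have symm: "y \<ominus>\<^bsub>T\<^esub> x \<in> N" if h: "x \<in> carrier T" "y \<in> carrier T" "x \<ominus>\<^bsub>T\<^esub> y \<in> N" for x y
  proof -
    have "y \<ominus>\<^bsub>T\<^esub> x = \<ominus>\<^bsub>T\<^esub> (x \<ominus>\<^bsub>T\<^esub> y)" using h(1,2) by (simp add: T.M.minus_eq T.M.minus_add T.M.a_comm)
    then show ?thesis using neg[OF h(3)] by simp
  qed
  have g_eq: "g x = g y" if h: "x \<in> carrier T" "y \<in> carrier T" "x \<ominus>\<^bsub>T\<^esub> y \<in> N" for x y
  proof -
    have "x \<ominus>\<^bsub>T\<^esub> z \<in> N \<longleftrightarrow> y \<ominus>\<^bsub>T\<^esub> z \<in> N" if "z \<in> carrier T" for z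
      using trans[OF h(1,2) that h(3)] trans[OF h(2,1) that symm[OF h]] by blast
    then have "(\<lambda>z. z \<in> carrier T \<and> x \<ominus>\<^bsub>T\<^esub> z \<in> N) = (\<lambda>z. z \<in> carrier T \<and> y \<ominus>\<^bsub>T\<^esub> z \<in> N)" by blast
    then show ?thesis by (simp add: g_def)
  qed
  have gg: "g (g x) = g x" if "x \<in> carrier T" for x
    using g_eq[OF that g(1)[OF that] g(2)[OF that]] by simp
  have g_add: "g (g x \<oplus>\<^bsub>T\<^esub> y) = g (x \<oplus>\<^bsub>T\<^esub> y)" if h: "x \<in> carrier T" "y \<in> carrier T" for x y
  proof -
    have gx: "g x \<in> carrier T" using g h by blast
    have "(x \<oplus>\<^bsub>T\<^esub> y) \<ominus>\<^bsub>T\<^esub> (g x \<oplus>\<^bsub>T\<^esub> y) = x \<ominus>\<^bsub>T\<^esub> g x"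
      using h gx by (simp add: T.M.minus_eq T.M.minus_add T.M.a_ac T.M.r_neg1 T.M.r_neg2 T.M.r_neg)
    then have "(x \<oplus>\<^bsub>T\<^esub> y) \<ominus>\<^bsub>T\<^esub> (g x \<oplus>\<^bsub>T\<^esub> y) \<in> N" using g(2)[OF h(1)] by simp
    from g_eq[OF _ _ this] show ?thesis using h gx by simp
  qed
  have g_add2: "g (x \<oplus>\<^bsub>T\<^esub> g y) = g (x \<oplus>\<^bsub>T\<^esub> y)" if h: "x \<in> carrier T" "y \<in> carrier T" for x y
    using g_add[OF h(2,1)] T.M.a_comm[OF h] T.M.a_comm[OF h(1) g(1)[OF h(2)]] by simp
  have g_smult: "g (a \<odot>\<^bsub>T\<^esub> g x) = g (a \<odot>\<^bsub>T\<^esub> x)" if h: "a \<in> carrier L" "x \<in> carrier T" for a x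
  proof -
    have gx: "g x \<in> carrier T" using g h by blast
    have "a \<odot>\<^bsub>T\<^esub> (x \<ominus>\<^bsub>T\<^esub> g x) \<oplus>\<^bsub>T\<^esub> a \<odot>\<^bsub>T\<^esub> g x = a \<odot>\<^bsub>T\<^esub> ((x \<ominus>\<^bsub>T\<^esub> g x) \<oplus>\<^bsub>T\<^esub> g x)"
      using h gx by (simp add: T.smult_r_distr)
    also have "\<dots> = a \<odot>\<^bsub>T\<^esub> x" using h gx by (simp add: T.M.minus_eq T.M.a_assoc T.M.l_neg)
    finally have e: "a \<odot>\<^bsub>T\<^esub> x = a \<odot>\<^bsub>T\<^esub> (x \<ominus>\<^bsub>T\<^esub> g x) \<oplus>\<^bsub>T\<^esub> a \<odot>\<^bsub>T\<^esub> g x" by simp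
    have "a \<odot>\<^bsub>T\<^esub> x \<ominus>\<^bsub>T\<^esub> a \<odot>\<^bsub>T\<^esub> g x = a \<odot>\<^bsub>T\<^esub> (x \<ominus>\<^bsub>T\<^esub> g x)"
      unfolding e using h gx by (simp add: T.M.minus_eq T.M.a_assoc T.M.r_neg)
    then have "a \<odot>\<^bsub>T\<^esub> x \<ominus>\<^bsub>T\<^esub> a \<odot>\<^bsub>T\<^esub> g x \<in> N" using N g(2)[OF h(2)] h(1) by simp
    from g_eq[OF _ _ this] show ?thesis using h gx by simp
  qed
  define Q :: "('l, 'm) module" where
    "Q = \<lparr>carrier = g ` carrier T, monoid.mult = monoid.mult T, one = \<one>\<^bsub>T\<^esub>, ring.zero = g \<zero>\<^bsub>T\<^esub>,
      add = (\<lambda>x y. g (x \<oplus>\<^bsub>T\<^esub> y)), smult = (\<lambda>a x. g (a \<odot>\<^bsub>T\<^esub> x))\<rparr>"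
  have Qs: "carrier Q = g ` carrier T" "\<zero>\<^bsub>Q\<^esub> = g \<zero>\<^bsub>T\<^esub>" "\<And>x y. x \<oplus>\<^bsub>Q\<^esub> y = g (x \<oplus>\<^bsub>T\<^esub> y)"
    "\<And>a x. a \<odot>\<^bsub>Q\<^esub> x = g (a \<odot>\<^bsub>T\<^esub> x)" by (simp_all add: Q_def)
  have "left_module L Q"
  proof (intro left_module.intro left_module_axioms.intro abelian_groupI)
    show "ring L" by (rule T.R.ring_axioms)
    fix x assume x: "x \<in> carrier Q"
    then obtain x' where x': "x' \<in> carrier T" "x = g x'" by (auto simp: Qs)
    have "g (\<ominus>\<^bsub>T\<^esub> x') \<oplus>\<^bsub>Q\<^esub> x = \<zero>\<^bsub>Q\<^esub>" using x' g by (simp add: Qs g_add g_add2 T.M.l_neg)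
    then show "\<exists>y\<in>carrier Q. y \<oplus>\<^bsub>Q\<^esub> x = \<zero>\<^bsub>Q\<^esub>" using x' by (auto simp: Qs)
  next
    fix a b x assume ab: "a \<in> carrier L" "b \<in> carrier L" and "x \<in> carrier Q"
    then obtain x' where x': "x' \<in> carrier T" "x = g x'" by (auto simp: Qs)
    have "(a \<oplus>\<^bsub>L\<^esub> b) \<odot>\<^bsub>Q\<^esub> x = g ((a \<oplus>\<^bsub>L\<^esub> b) \<odot>\<^bsub>T\<^esub> x')"
      using g_smult[of "a \<oplus>\<^bsub>L\<^esub> b" x'] ab x' by (simp only: Qs T.R.a_closed)
    also have "\<dots> = g (a \<odot>\<^bsub>T\<^esub> x' \<oplus>\<^bsub>T\<^esub> b \<odot>\<^bsub>T\<^esub> x')" using T.smult_l_distr ab x' by simp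
    also have "\<dots> = a \<odot>\<^bsub>Q\<^esub> x \<oplus>\<^bsub>Q\<^esub> b \<odot>\<^bsub>Q\<^esub> x" using ab x' by (simp add: Qs g_add g_add2 g_smult g)
    finally show "(a \<oplus>\<^bsub>L\<^esub> b) \<odot>\<^bsub>Q\<^esub> x = a \<odot>\<^bsub>Q\<^esub> x \<oplus>\<^bsub>Q\<^esub> b \<odot>\<^bsub>Q\<^esub> x" .
    have "(a \<otimes>\<^bsub>L\<^esub> b) \<odot>\<^bsub>Q\<^esub> x = g ((a \<otimes>\<^bsub>L\<^esub> b) \<odot>\<^bsub>T\<^esub> x')"
      using g_smult[of "a \<otimes>\<^bsub>L\<^esub> b" x'] ab x' by (simp only: Qs T.R.m_closed)
    also have "\<dots> = g (a \<odot>\<^bsub>T\<^esub> (b \<odot>\<^bsub>T\<^esub> x'))" using T.smult_assoc1 ab x' by simp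
    also have "\<dots> = a \<odot>\<^bsub>Q\<^esub> (b \<odot>\<^bsub>Q\<^esub> x)" using ab x' by (simp add: Qs g_smult g)
    finally show "(a \<otimes>\<^bsub>L\<^esub> b) \<odot>\<^bsub>Q\<^esub> x = a \<odot>\<^bsub>Q\<^esub> (b \<odot>\<^bsub>Q\<^esub> x)" .
  next
    fix x y z assume "x \<in> carrier Q" "y \<in> carrier Q" "z \<in> carrier Q"
    then obtain x' y' z' where h: "x' \<in> carrier T" "x = g x'" "y' \<in> carrier T" "y = g y'" "z' \<in> carrier T" "z = g z'"
      by (auto simp: Qs)
    have "x \<oplus>\<^bsub>Q\<^esub> y \<oplus>\<^bsub>Q\<^esub> z = g ((x' \<oplus>\<^bsub>T\<^esub> y') \<oplus>\<^bsub>T\<^esub> z')" using h by (simp add: Qs g_add g_add2 g)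
    also have "\<dots> = g (x' \<oplus>\<^bsub>T\<^esub> (y' \<oplus>\<^bsub>T\<^esub> z'))" using h by (simp add: T.M.a_assoc)
    also have "\<dots> = x \<oplus>\<^bsub>Q\<^esub> (y \<oplus>\<^bsub>Q\<^esub> z)" using h by (simp add: Qs g_add g_add2 g)
    finally show "x \<oplus>\<^bsub>Q\<^esub> y \<oplus>\<^bsub>Q\<^esub> z = x \<oplus>\<^bsub>Q\<^esub> (y \<oplus>\<^bsub>Q\<^esub> z)" .
  next
    fix x y assume "x \<in> carrier Q" "y \<in> carrier Q"
    then show "x \<oplus>\<^bsub>Q\<^esub> y = y \<oplus>\<^bsub>Q\<^esub> x" using T.M.a_comm g by (auto simp: Qs)
  qed (auto simp: Qs g_add g_add2 g_smult gg g T.smult_r_distr)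
  moreover have "g \<in> module_hom_set L T Q"
    by (auto simp: module_hom_set_def Qs g_add g_add2 g_smult g)
  moreover have "{x \<in> carrier T. g x = \<zero>\<^bsub>Q\<^esub>} = N"
  proof
    show "{x \<in> carrier T. g x = \<zero>\<^bsub>Q\<^esub>} \<subseteq> N"
    proof
      fix x assume "x \<in> {x \<in> carrier T. g x = \<zero>\<^bsub>Q\<^esub>}"
      then have x: "x \<in> carrier T" "g x = g \<zero>\<^bsub>T\<^esub>" by (auto simp: Qs)
      have "\<zero>\<^bsub>T\<^esub> \<ominus>\<^bsub>T\<^esub> g x \<in> N" using g(2)[of "\<zero>\<^bsub>T\<^esub>"] x by simp
      then have "x \<ominus>\<^bsub>T\<^esub> \<zero>\<^bsub>T\<^esub> \<in> N" using trans[OF x(1) g(1)[OF x(1)] _ g(2)[OF x(1)]] symm[of "\<zero>\<^bsub>T\<^esub>" "g x"] g(1)[OF x(1)] by simp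
      then show "x \<in> N" using x z0 by (simp add: T.M.minus_eq)
    qed
    show "N \<subseteq> {x \<in> carrier T. g x = \<zero>\<^bsub>Q\<^esub>}"
    proof
      fix x assume x: "x \<in> N"
      then have "x \<ominus>\<^bsub>T\<^esub> \<zero>\<^bsub>T\<^esub> \<in> N" using N neg[of "\<zero>\<^bsub>T\<^esub>"] unfolding T.M.minus_eq by blast
      then show "x \<in> {x \<in> carrier T. g x = \<zero>\<^bsub>Q\<^esub>}" using g_eq[OF c[OF x] T.M.zero_closed] c[OF x] by (simp add: Qs)
    qed
  qed
  ultimately show ?thesis using Qs(1) by blast
qed

lemma finite_length_zero:
  assumes "left_module L T" "carrier T = {\<zero>\<^bsub>T\<^esub>}" shows "finite_length_module L T"
proof -
  interpret T: left_module L T by fact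
  have "submodule {\<zero>\<^bsub>T\<^esub>} L T" using T.submodule_iff T.smult_zero_right by simp
  then show ?thesis unfolding finite_length_module_def using assms
    by (intro conjI exI[of _ "\<lambda>_. {\<zero>\<^bsub>T\<^esub>}"] exI[of _ 0]) auto
qed

lemma finite_length_simple:
  assumes "simple_module L T" shows "finite_length_module L T"
proof -
  interpret T: left_module L T using assms by (simp add: simple_module_def)
  have s: "submodule {\<zero>\<^bsub>T\<^esub>} L T" "submodule (carrier T) L T" using T.submodule_iff T.smult_zero_right by auto
  have ne: "{\<zero>\<^bsub>T\<^esub>} \<subset> carrier T" using assms by (auto simp: simple_module_def)
  let ?F = "\<lambda>j::nat. if j = 0 then {\<zero>\<^bsub>T\<^esub>} else carrier T"
  have "?F 0 = {\<zero>\<^bsub>T\<^esub>} \<and> ?F 1 = carrier T \<and> (\<forall>j\<le>1. submodule (?F j) L T) \<and>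
        (\<forall>j<1. ?F j \<subset> ?F (Suc j) \<and>
           (\<forall>N. submodule N L T \<and> ?F j \<subseteq> N \<and> N \<subseteq> ?F (Suc j) \<longrightarrow> N = ?F j \<or> N = ?F (Suc j)))"
  proof (intro conjI allI impI)
    show "submodule (?F j) L T" for j using s by simp
    fix j :: nat assume j: "j < 1"
    then show "?F j \<subset> ?F (Suc j)" using ne by simp
    fix N assume "submodule N L T \<and> ?F j \<subseteq> N \<and> N \<subseteq> ?F (Suc j)"
    then show "N = ?F j \<or> N = ?F (Suc j)" using assms j by (simp add: simple_module_def)
  qed simp_all
  then show ?thesis unfolding finite_length_module_def
    by (intro conjI[OF T.left_module_axioms] exI[of _ ?F] exI[of _ 1])
qed

text \<open>The zero module is an extension of itself by itself, and the resulting relation is minus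
  its generator.\<close>

lemma relations_zero_module:
  assumes "left_module L T" "carrier T = {\<zero>\<^bsub>T\<^esub>}" shows "frag_of T \<in> grothendieck_relations L"
proof -
  interpret T: left_module L T by fact
  have f: "finite_length_module L T" using finite_length_zero assms .
  have "(\<lambda>x. x) \<in> module_hom_set L T T" by (simp add: module_hom_set_def)
  then have "short_exact L T T T"
    unfolding short_exact_def using assms(2) by (intro exI[of _ "\<lambda>x. x"]) auto
  then have "frag_of T - (frag_of T + frag_of T) \<in> grothendieck_relations L" using relations_exact f by blast
  from relations_uminus[OF this] show ?thesis by simp
qed

lemma relations_iso:
  assumes M: "finite_length_module L M" and N: "finite_length_module L N"
    and f: "f \<in> module_hom_set L N M" "bij_betw f (carrier N) (carrier M)"
  shows "frag_of M - frag_of N \<in> grothendieck_relations L"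
proof -
  have lm: "left_module L M" "left_module L N" using M N by (auto simp: finite_length_module_def)
  interpret M: left_module L M by (rule lm)
  interpret N: left_module L N by (rule lm)
  let ?Z = "M\<lparr>carrier := {\<zero>\<^bsub>M\<^esub>}\<rparr>"
  have Z: "left_module L ?Z" using left_module_restrict[OF lm(1)] M.submodule_iff M.smult_zero_right by simp
  have "(\<lambda>_. \<zero>\<^bsub>M\<^esub>) \<in> module_hom_set L M ?Z" using M.smult_zero_right by (simp add: module_hom_set_def)
  then have "short_exact L N M ?Z"
    unfolding short_exact_def using f M.M.zero_closed by (intro exI[of _ f] exI[of _ "\<lambda>_. \<zero>\<^bsub>M\<^esub>"]) (auto simp: bij_betw_def)
  then have "frag_of M - (frag_of N + frag_of ?Z) \<in> grothendieck_relations L"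
    using relations_exact[OF M N finite_length_zero[OF Z]] by simp
  from relations_add[OF this relations_zero_module[OF Z]] show ?thesis by simp
qed

text \<open>The counterpart of \<open>simple_key\<close> for an abstract module.\<close>

definition annihilators :: "('l, 'x) ring_scheme \<Rightarrow> ('l, 'm, 'y) module_scheme \<Rightarrow> 'l set set" where
  "annihilators L Q = (\<lambda>q. {a \<in> carrier L. a \<odot>\<^bsub>Q\<^esub> q = \<zero>\<^bsub>Q\<^esub>}) ` (carrier Q - {\<zero>\<^bsub>Q\<^esub>})"

text \<open>Equality of the two families yields generators \<open>p\<close> of \<open>Q\<close> and
  \<open>q\<close> of \<open>Q'\<close> with the same annihilator, and
  \<open>a q \<mapsto> a p\<close> is then an isomorphism.\<close>

lemma relations_simple:
  fixes Q Q' :: "('l, 'm) module"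
  assumes Q: "simple_module L Q" and Q': "simple_module L Q'" and eq: "annihilators L Q = annihilators L Q'"
  shows "frag_of Q - frag_of Q' \<in> grothendieck_relations L"
proof -
  interpret Q: left_module L Q using Q by (simp add: simple_module_def)
  interpret Q': left_module L Q' using Q' by (simp add: simple_module_def)
  obtain q where q: "q \<in> carrier Q'" "q \<noteq> \<zero>\<^bsub>Q'\<^esub>" using Q' Q'.M.zero_closed by (auto simp: simple_module_def)
  then have "{a \<in> carrier L. a \<odot>\<^bsub>Q'\<^esub> q = \<zero>\<^bsub>Q'\<^esub>} \<in> annihilators L Q" unfolding eq by (auto simp: annihilators_def)
  then obtain p where p: "p \<in> carrier Q" "p \<noteq> \<zero>\<^bsub>Q\<^esub>"
    and ann: "{a \<in> carrier L. a \<odot>\<^bsub>Q'\<^esub> q = \<zero>\<^bsub>Q'\<^esub>} = {a \<in> carrier L. a \<odot>\<^bsub>Q\<^esub> p = \<zero>\<^bsub>Q\<^esub>}"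
    by (auto simp: annihilators_def)
  have orbit: "(\<lambda>a. a \<odot>\<^bsub>W\<^esub> w) ` carrier L = carrier W" if W: "simple_module L W" "w \<in> carrier W" "w \<noteq> \<zero>\<^bsub>W\<^esub>"
    for W :: "('l, 'm) module" and w
  proof -
    interpret W: left_module L W using W by (simp add: simple_module_def)
    have "submodule ((\<lambda>a. a \<odot>\<^bsub>W\<^esub> w) ` carrier L) L W"
      unfolding W.submodule_iff
    proof (intro conjI ballI)
      show "(\<lambda>a. a \<odot>\<^bsub>W\<^esub> w) ` carrier L \<subseteq> carrier W" using W by auto
      show "\<zero>\<^bsub>W\<^esub> \<in> (\<lambda>a. a \<odot>\<^bsub>W\<^esub> w) ` carrier L"
        using W.smult_zero_left[OF W(2)] Q.R.zero_closed by (metis imageI)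
      fix x y assume "x \<in> (\<lambda>a. a \<odot>\<^bsub>W\<^esub> w) ` carrier L" "y \<in> (\<lambda>a. a \<odot>\<^bsub>W\<^esub> w) ` carrier L"
      then obtain a b where ab: "a \<in> carrier L" "b \<in> carrier L" "x = a \<odot>\<^bsub>W\<^esub> w" "y = b \<odot>\<^bsub>W\<^esub> w" by blast
      then have "x \<oplus>\<^bsub>W\<^esub> y = (a \<oplus>\<^bsub>L\<^esub> b) \<odot>\<^bsub>W\<^esub> w" using W.smult_l_distr W(2) by simp
      then show "x \<oplus>\<^bsub>W\<^esub> y \<in> (\<lambda>a. a \<odot>\<^bsub>W\<^esub> w) ` carrier L" using ab by blast
    next
      fix k x assume k: "k \<in> carrier L" "x \<in> (\<lambda>a. a \<odot>\<^bsub>W\<^esub> w) ` carrier L"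
      then obtain a where a: "a \<in> carrier L" "x = a \<odot>\<^bsub>W\<^esub> w" by blast
      then have "k \<odot>\<^bsub>W\<^esub> x = (k \<otimes>\<^bsub>L\<^esub> a) \<odot>\<^bsub>W\<^esub> w" using W.smult_assoc1 k W(2) by simp
      then show "k \<odot>\<^bsub>W\<^esub> x \<in> (\<lambda>a. a \<odot>\<^bsub>W\<^esub> w) ` carrier L" using a k by blast
    qed
    moreover have "w \<in> (\<lambda>a. a \<odot>\<^bsub>W\<^esub> w) ` carrier L" using W.smult_one[OF W(2)] Q.R.one_closed by (metis imageI)
    ultimately show ?thesis using W by (auto simp: simple_module_def)
  qed
  have same: "a \<odot>\<^bsub>Q'\<^esub> q = b \<odot>\<^bsub>Q'\<^esub> q \<longleftrightarrow> a \<odot>\<^bsub>Q\<^esub> p = b \<odot>\<^bsub>Q\<^esub> p" if ab: "a \<in> carrier L" "b \<in> carrier L" for a b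
  proof -
    have dif: "(a \<ominus>\<^bsub>L\<^esub> b) \<odot>\<^bsub>W\<^esub> w = \<zero>\<^bsub>W\<^esub> \<longleftrightarrow> a \<odot>\<^bsub>W\<^esub> w = b \<odot>\<^bsub>W\<^esub> w" if W: "left_module L W" "w \<in> carrier W"
      for W :: "('l, 'm) module" and w
    proof -
      interpret W: left_module L W by fact
      have d: "a \<ominus>\<^bsub>L\<^esub> b \<in> carrier L" using ab by simp
      have "a = (a \<ominus>\<^bsub>L\<^esub> b) \<oplus>\<^bsub>L\<^esub> b" using ab by (simp add: Q.R.minus_eq Q.R.a_assoc Q.R.l_neg)
      then have "a \<odot>\<^bsub>W\<^esub> w = (a \<ominus>\<^bsub>L\<^esub> b) \<odot>\<^bsub>W\<^esub> w \<oplus>\<^bsub>W\<^esub> b \<odot>\<^bsub>W\<^esub> w" using W.smult_l_distr[OF d ab(2) W(2)] by simp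
      then show ?thesis using W.smult_closed[OF d W(2)] W.smult_closed[OF ab(2) W(2)] W.M.add.r_cancel_one' by auto
    qed
    have "a \<ominus>\<^bsub>L\<^esub> b \<in> carrier L" using ab by simp
    then show ?thesis using dif[OF Q.left_module_axioms p(1)] dif[OF Q'.left_module_axioms q(1)] ann by blast
  qed
  define f where "f z = (SOME a. a \<in> carrier L \<and> z = a \<odot>\<^bsub>Q'\<^esub> q) \<odot>\<^bsub>Q\<^esub> p" for z
  have f: "f (a \<odot>\<^bsub>Q'\<^esub> q) = a \<odot>\<^bsub>Q\<^esub> p" if a: "a \<in> carrier L" for a
  proof -
    have "\<exists>b. b \<in> carrier L \<and> a \<odot>\<^bsub>Q'\<^esub> q = b \<odot>\<^bsub>Q'\<^esub> q" using a by blast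
    from someI_ex[OF this] show ?thesis unfolding f_def using same[OF a] by metis
  qed
  note oq = orbit[OF Q' q] and op = orbit[OF Q p]
  have rep: "\<exists>a\<in>carrier L. x = a \<odot>\<^bsub>Q'\<^esub> q" if "x \<in> carrier Q'" for x using oq that by blast
  have "f \<in> module_hom_set L Q' Q"
    unfolding module_hom_set_def
  proof (intro CollectI conjI ballI Pi_I)
    show "f x \<in> carrier Q" if "x \<in> carrier Q'" for x using rep[OF that] f Q.smult_closed p(1) by auto
    show "f (x \<oplus>\<^bsub>Q'\<^esub> y) = f x \<oplus>\<^bsub>Q\<^esub> f y" if xy: "x \<in> carrier Q'" "y \<in> carrier Q'" for x y
    proof -
      obtain a b where ab: "a \<in> carrier L" "b \<in> carrier L" "x = a \<odot>\<^bsub>Q'\<^esub> q" "y = b \<odot>\<^bsub>Q'\<^esub> q" using rep xy by metis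
      have "x \<oplus>\<^bsub>Q'\<^esub> y = (a \<oplus>\<^bsub>L\<^esub> b) \<odot>\<^bsub>Q'\<^esub> q" using ab Q'.smult_l_distr q(1) by simp
      then show ?thesis using f[of "a \<oplus>\<^bsub>L\<^esub> b"] f ab Q.smult_l_distr p(1) by simp
    qed
    show "f (k \<odot>\<^bsub>Q'\<^esub> x) = k \<odot>\<^bsub>Q\<^esub> f x" if kx: "k \<in> carrier L" "x \<in> carrier Q'" for k x
    proof -
      obtain a where a: "a \<in> carrier L" "x = a \<odot>\<^bsub>Q'\<^esub> q" using rep kx by metis
      have "k \<odot>\<^bsub>Q'\<^esub> x = (k \<otimes>\<^bsub>L\<^esub> a) \<odot>\<^bsub>Q'\<^esub> q" using a kx Q'.smult_assoc1 q(1) by simp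
      then show ?thesis using f[of "k \<otimes>\<^bsub>L\<^esub> a"] f a kx Q.smult_assoc1 p(1) by simp
    qed
  qed
  moreover have "bij_betw f (carrier Q') (carrier Q)"
    unfolding bij_betw_def
  proof
    show "inj_on f (carrier Q')"
    proof (rule inj_onI)
      fix x y assume xy: "x \<in> carrier Q'" "y \<in> carrier Q'" "f x = f y"
      obtain a b where ab: "a \<in> carrier L" "b \<in> carrier L" "x = a \<odot>\<^bsub>Q'\<^esub> q" "y = b \<odot>\<^bsub>Q'\<^esub> q" using rep xy by metis
      show "x = y" using same[OF ab(1,2)] xy(3) f ab by simp
    qed
    have "f ` carrier Q' = (\<lambda>a. f (a \<odot>\<^bsub>Q'\<^esub> q)) ` carrier L" using oq by (metis image_image)
    also have "\<dots> = carrier Q" using f op by simp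
    finally show "f ` carrier Q' = carrier Q" .
  qed
  ultimately show ?thesis
    using relations_iso[OF finite_length_simple[OF Q] finite_length_simple[OF Q']] by blast
qed

text \<open>A representative that depends on the key alone, so that sums over a multiset of keys
  make sense without the modules they came from. For a key that occurs, the choice does not matter
  up to relations.\<close>

definition simple_class :: "('l, 'x) ring_scheme \<Rightarrow> 'l set set \<Rightarrow> (('l, 'm) module \<Rightarrow>\<^sub>0 int)" where
  "simple_class L \<kappa> = frag_of (SOME Q. simple_module L Q \<and> annihilators L Q = \<kappa>)"

lemma simple_class:
  fixes Q :: "('l, 'm) module"
  assumes "simple_module L Q"
  shows "frag_of Q - simple_class L (annihilators L Q) \<in> grothendieck_relations L"
proof -
  have "\<exists>Q' :: ('l, 'm) module. simple_module L Q' \<and> annihilators L Q' = annihilators L Q" using assms by blast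
  note s = someI_ex[OF this]
  show ?thesis unfolding simple_class_def by (rule relations_simple[OF assms conjunct1[OF s] conjunct2[OF s, symmetric]])
qed

lemma finite_length_extend:
  fixes T :: "('l, 'm) module"
  assumes T: "left_module L T" and N: "submodule N L T" "N \<subset> carrier T"
    and fl: "finite_length_module L (T\<lparr>carrier := N\<rparr>)"
    and cov: "\<And>W. \<lbrakk>submodule W L T; N \<subseteq> W\<rbrakk> \<Longrightarrow> W = N \<or> W = carrier T"
  shows "finite_length_module L T"
proof -
  interpret T: left_module L T by fact
  interpret N: left_module L "T\<lparr>carrier := N\<rparr>" using left_module_restrict[OF T N(1)] .
  have sub: "submodule W L (T\<lparr>carrier := N\<rparr>) \<longleftrightarrow> submodule W L T \<and> W \<subseteq> N" for W
    unfolding N.submodule_iff T.submodule_iff using N(2) by auto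
  obtain F n where F: "F 0 = {\<zero>\<^bsub>T\<^esub>}" "F n = N" "\<And>j. j \<le> n \<Longrightarrow> submodule (F j) L (T\<lparr>carrier := N\<rparr>)"
    "\<And>j. j < n \<Longrightarrow> F j \<subset> F (Suc j)"
    "\<And>j W. j < n \<Longrightarrow> submodule W L (T\<lparr>carrier := N\<rparr>) \<Longrightarrow> F j \<subseteq> W \<Longrightarrow> W \<subseteq> F (Suc j) \<Longrightarrow> W = F j \<or> W = F (Suc j)"
    using fl unfolding finite_length_module_def by auto
  let ?F = "\<lambda>j. if j \<le> n then F j else carrier T"
  have cT: "submodule (carrier T) L T" using T.submodule_iff by auto
  have Fs: "submodule (F j) L T" "F j \<subseteq> N" if "j \<le> n" for j using F(3)[OF that] sub by auto
  have "?F 0 = {\<zero>\<^bsub>T\<^esub>} \<and> ?F (Suc n) = carrier T \<and> (\<forall>j\<le>Suc n. submodule (?F j) L T) \<and>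
        (\<forall>j<Suc n. ?F j \<subset> ?F (Suc j) \<and>
           (\<forall>W. submodule W L T \<and> ?F j \<subseteq> W \<and> W \<subseteq> ?F (Suc j) \<longrightarrow> W = ?F j \<or> W = ?F (Suc j)))"
  proof (intro conjI allI impI)
    show "?F 0 = {\<zero>\<^bsub>T\<^esub>}" "?F (Suc n) = carrier T" using F by auto
    show "submodule (?F j) L T" for j using Fs cT by auto
    fix j assume j: "j < Suc n"
    show "?F j \<subset> ?F (Suc j)"
    proof (cases "j = n")
      case True
      then show ?thesis using F(2) N(2) by simp
    next
      case False
      then show ?thesis using F(4)[of j] j by simp
    qed
    fix W assume W: "submodule W L T \<and> ?F j \<subseteq> W \<and> W \<subseteq> ?F (Suc j)"
    show "W = ?F j \<or> W = ?F (Suc j)"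
    proof (cases "j = n")
      case True
      then show ?thesis using W cov[of W] F(2) by simp
    next
      case False
      then have jn: "j < n" using j by simp
      then have "W \<subseteq> N" using W Fs(2)[of "Suc j"] by auto
      then show ?thesis using W sub F(5)[OF jn] jn by simp
    qed
  qed
  then show ?thesis unfolding finite_length_module_def
    by (intro conjI[OF T] exI[of _ ?F] exI[of _ "Suc n"])
qed

context ring
begin

text \<open>\<open>T\<close>, whose elements may live in another type, is isomorphic to
  \<open>P / N\<close> through \<open>\<phi>\<close>; again no quotient is formed.\<close>

definition presents :: "'a set \<Rightarrow> 'a set \<Rightarrow> 'a set \<Rightarrow> ('a \<Rightarrow> 'm) \<Rightarrow> ('a, 'm) module \<Rightarrow> bool" where
  "presents C N P \<phi> T \<longleftrightarrow> \<phi> ` P = carrier T \<and>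
    (\<forall>x\<in>P. \<forall>y\<in>P. \<phi> (x \<oplus> y) = \<phi> x \<oplus>\<^bsub>T\<^esub> \<phi> y) \<and>
    (\<forall>a\<in>C. \<forall>x\<in>P. \<phi> (a \<otimes> x) = a \<odot>\<^bsub>T\<^esub> \<phi> x) \<and>
    (\<forall>x\<in>P. \<phi> x = \<zero>\<^bsub>T\<^esub> \<longleftrightarrow> x \<in> N)"

section \<open>From chains of submodules of the ring to classes of abstract modules\<close>

lemma presents_vimage:
  assumes T: "left_module (R\<lparr>carrier := C\<rparr>) T" and p: "presents C N P \<phi> T" and P: "smod C P" and N: "\<zero> \<in> N"
    and C: "subring C R" and W: "submodule W (R\<lparr>carrier := C\<rparr>) T"
  shows "smod C {x \<in> P. \<phi> x \<in> W}"
proof -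
  interpret T: left_module "R\<lparr>carrier := C\<rparr>" T by fact
  note W' = W[unfolded T.submodule_iff]
  note p' = p[unfolded presents_def]
  have n1: "\<ominus> \<one> \<in> C" using subringE(5)[OF C subringE(3)[OF C]] .
  show ?thesis
  proof (rule smodI)
    show "{x \<in> P. \<phi> x \<in> W} \<subseteq> carrier R" using smod_carrier[OF P] by blast
    show "\<zero> \<in> {x \<in> P. \<phi> x \<in> W}" using p' N smod_zero[OF P] W' by auto
    fix x y assume xy: "x \<in> {x \<in> P. \<phi> x \<in> W}" "y \<in> {x \<in> P. \<phi> x \<in> W}"
    have c: "y \<in> carrier R" "x \<in> carrier R" using xy smod_mem_carrier[OF P] by auto
    have e: "x \<ominus> y = x \<oplus> (\<ominus> \<one>) \<otimes> y" using c by (simp add: minus_eq l_minus)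
    have "\<phi> (x \<ominus> y) = \<phi> x \<oplus>\<^bsub>T\<^esub> (\<ominus> \<one>) \<odot>\<^bsub>T\<^esub> \<phi> y" unfolding e using p' xy n1 smod_smult[OF P n1] by simp
    then show "x \<ominus> y \<in> {x \<in> P. \<phi> x \<in> W}" using W' xy n1 smod_minus[OF P] by simp
  next
    fix a x assume "a \<in> C" "x \<in> {x \<in> P. \<phi> x \<in> W}"
    then show "a \<otimes> x \<in> {x \<in> P. \<phi> x \<in> W}" using p' W' smod_smult[OF P] by simp
  qed
qed

lemma presents_mem_iff:
  assumes T: "left_module (R\<lparr>carrier := C\<rparr>) T" and p: "presents C N P \<phi> T" and P: "smod C P"
    and M: "smod C M" "N \<subseteq> M" "M \<subseteq> P" and x: "x \<in> P"
  shows "\<phi> x \<in> \<phi> ` M \<longleftrightarrow> x \<in> M"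
proof
  interpret T: left_module "R\<lparr>carrier := C\<rparr>" T by fact
  note p' = p[unfolded presents_def]
  assume "\<phi> x \<in> \<phi> ` M"
  then obtain y where y: "y \<in> M" "\<phi> x = \<phi> y" by blast
  have d: "x \<ominus> y \<in> P" using smod_minus[OF P x] y M by blast
  have c: "x \<in> carrier R" "y \<in> carrier R" using smod_mem_carrier[OF P] x y M by auto
  have yP: "y \<in> P" using y M by blast
  have xe: "x = (x \<ominus> y) \<oplus> y" using c by algebra
  have "\<phi> x = \<phi> (x \<ominus> y) \<oplus>\<^bsub>T\<^esub> \<phi> y" using p' d yP by (subst xe) simp
  moreover have "\<phi> (x \<ominus> y) \<in> carrier T" "\<phi> y \<in> carrier T" using p' d yP by auto
  ultimately have "\<phi> (x \<ominus> y) = \<zero>\<^bsub>T\<^esub>" using y(2) T.M.add.r_cancel_one' by metis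
  then have "x \<ominus> y \<in> M" using p' d M by auto
  then show "x \<in> M" using smod_add[OF M(1) _ y(1)] xe by metis
qed blast

lemma presents_submodule:
  assumes T: "left_module (R\<lparr>carrier := C\<rparr>) T" and p: "presents C N P \<phi> T" and N: "smod C N"
    and M: "smod C M" "N \<subseteq> M" "M \<subseteq> P"
  shows "submodule (\<phi> ` M) (R\<lparr>carrier := C\<rparr>) T" "presents C N M \<phi> (T\<lparr>carrier := \<phi> ` M\<rparr>)"
proof -
  interpret T: left_module "R\<lparr>carrier := C\<rparr>" T by fact
  note p' = p[unfolded presents_def]
  have s: "x \<in> P" if "x \<in> M" for x using that M by blast
  show "submodule (\<phi> ` M) (R\<lparr>carrier := C\<rparr>) T"
    unfolding T.submodule_iff
  proof (intro conjI ballI)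
    show "\<phi> ` M \<subseteq> carrier T" using p' M by blast
    have "\<phi> \<zero> = \<zero>\<^bsub>T\<^esub>" using p' smod_zero[OF N] s[OF smod_zero[OF M(1)]] by blast
    then show "\<zero>\<^bsub>T\<^esub> \<in> \<phi> ` M" using smod_zero[OF M(1)] by (metis imageI)
    fix y z assume "y \<in> \<phi> ` M" "z \<in> \<phi> ` M"
    then obtain a b where ab: "a \<in> M" "b \<in> M" "y = \<phi> a" "z = \<phi> b" by blast
    then have "y \<oplus>\<^bsub>T\<^esub> z = \<phi> (a \<oplus> b)" using p' s by simp
    then show "y \<oplus>\<^bsub>T\<^esub> z \<in> \<phi> ` M" using smod_add[OF M(1) ab(1,2)] by blast
  next
    fix k y assume k: "k \<in> carrier (R\<lparr>carrier := C\<rparr>)" "y \<in> \<phi> ` M"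
    then obtain a where a: "a \<in> M" "y = \<phi> a" by blast
    have "k \<odot>\<^bsub>T\<^esub> y = \<phi> (k \<otimes> a)" using p' s[OF a(1)] a(2) k by simp
    then show "k \<odot>\<^bsub>T\<^esub> y \<in> \<phi> ` M" using smod_smult[OF M(1) _ a(1)] k by simp
  qed
  show "presents C N M \<phi> (T\<lparr>carrier := \<phi> ` M\<rparr>)" using p' s unfolding presents_def by simp
qed

text \<open>Submodules of \<open>T\<close> pull back to submodules between \<open>N\<close> and
  \<open>P\<close>. Since \<open>a\<close> kills the image of \<open>x\<close> exactly when
  \<open>a \<otimes> x\<close> lies in \<open>N\<close>, the annihilators of the non-zero vectors of
  \<open>T\<close> are the members of the key of \<open>P / N\<close>; this links multisets of keys
  to modules.\<close>

lemma presents_covers_simple: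
  assumes T: "left_module (R\<lparr>carrier := C\<rparr>) T" and p: "presents C N P \<phi> T" and cov: "covers C N P" and C: "subring C R"
  shows "simple_module (R\<lparr>carrier := C\<rparr>) T" "annihilators (R\<lparr>carrier := C\<rparr>) T = simple_key C N P"
proof -
  interpret T: left_module "R\<lparr>carrier := C\<rparr>" T by fact
  note p' = p[unfolded presents_def]
  have P: "smod C P" and N: "smod C N" and NP: "N \<subset> P" using cov by (auto simp: covers_def)
  have N0: "\<zero> \<in> N" using smod_zero[OF N] .
  have sub: "W = {\<zero>\<^bsub>T\<^esub>} \<or> W = carrier T" if W: "submodule W (R\<lparr>carrier := C\<rparr>) T" for W
  proof -
    note W' = W[unfolded T.submodule_iff]
    let ?J = "{x \<in> P. \<phi> x \<in> W}"
    have WJ: "W = \<phi> ` ?J"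
    proof -
      have "W \<subseteq> \<phi> ` P" using W' p' by blast
      then show ?thesis by blast
    qed
    have "smod C ?J" using presents_vimage[OF T p P N0 C W] .
    moreover have "N \<subseteq> ?J"
    proof
      fix x assume "x \<in> N"
      then have "x \<in> P" "\<phi> x = \<zero>\<^bsub>T\<^esub>" using NP p' by auto
      then show "x \<in> ?J" using W' by simp
    qed
    ultimately have "?J = N \<or> ?J = P" using cov unfolding covers_def by blast
    then show ?thesis
    proof
      assume J: "?J = N"
      have "\<phi> ` N \<subseteq> {\<zero>\<^bsub>T\<^esub>}" using p' NP by blast
      then show ?thesis using WJ W' unfolding J by blast
    next
      assume "?J = P"
      then show ?thesis using WJ p' by simp
    qed
  qed
  moreover have "carrier T \<noteq> {\<zero>\<^bsub>T\<^esub>}"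
  proof
    assume h: "carrier T = {\<zero>\<^bsub>T\<^esub>}"
    obtain x where x: "x \<in> P" "x \<notin> N" using NP by blast
    have "\<phi> x \<in> carrier T" using p' x by blast
    then show False using p' x h by auto
  qed
  ultimately show "simple_module (R\<lparr>carrier := C\<rparr>) T" using T by (simp add: simple_module_def)
  have "carrier T - {\<zero>\<^bsub>T\<^esub>} = \<phi> ` (P - N)"
  proof -
    have 1: "carrier T = \<phi> ` P" using p' by simp
    have 2: "\<And>x. x \<in> P \<Longrightarrow> \<phi> x = \<zero>\<^bsub>T\<^esub> \<longleftrightarrow> x \<in> N" using p' by blast
    show ?thesis unfolding 1 by (auto simp: 2)
  qed
  moreover have "{a \<in> C. a \<odot>\<^bsub>T\<^esub> \<phi> x = \<zero>\<^bsub>T\<^esub>} = {a \<in> C. a \<otimes> x \<in> N}" if x: "x \<in> P" for x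
  proof -
    have "a \<odot>\<^bsub>T\<^esub> \<phi> x = \<zero>\<^bsub>T\<^esub> \<longleftrightarrow> a \<otimes> x \<in> N" if a: "a \<in> C" for a
    proof -
      have ax: "a \<otimes> x \<in> P" using smod_smult[OF P a x] .
      have "a \<odot>\<^bsub>T\<^esub> \<phi> x = \<phi> (a \<otimes> x)" using p' a x by simp
      then show ?thesis using p' ax by simp
    qed
    then show ?thesis by blast
  qed
  ultimately show "annihilators (R\<lparr>carrier := C\<rparr>) T = simple_key C N P"
    unfolding annihilators_def simple_key_def by (simp add: image_image cong: image_cong_simp)
qed

text \<open>Induction along the chain: \<open>\<phi>\<close> restricted to \<open>M\<close> presents
  a submodule of \<open>T\<close>, the quotient by it is presented by \<open>P / M\<close> and is
  simple, and the exact sequence adds one simple class. Finite length is carried along because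
  relations exist only between modules of finite length.\<close>

theorem presents_class:
  fixes T :: "('a, 'm) module"
  assumes "comp_factors C N P ms" "subring C R" "left_module (R\<lparr>carrier := C\<rparr>) T" "presents C N P \<phi> T"
  shows "finite_length_module (R\<lparr>carrier := C\<rparr>) T \<and>
    frag_of T - (\<Sum>\<kappa>\<in>#ms. simple_class (R\<lparr>carrier := C\<rparr>) \<kappa>) \<in> grothendieck_relations (R\<lparr>carrier := C\<rparr>)"
  using assms
proof (induction arbitrary: T rule: comp_factors.induct)
  case (comp_refl N)
  interpret T: left_module "R\<lparr>carrier := C\<rparr>" T by fact
  note p' = comp_refl.prems(3)[unfolded presents_def]
  have z: "carrier T = {\<zero>\<^bsub>T\<^esub>}"
  proof -
    have "y = \<zero>\<^bsub>T\<^esub>" if "y \<in> carrier T" for y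
    proof -
      have "y \<in> \<phi> ` N" using that unfolding p'[THEN conjunct1] .
      then obtain x where "x \<in> N" "y = \<phi> x" by (rule imageE) simp
      then show ?thesis using p' by simp
    qed
    then show ?thesis using T.M.zero_closed by blast
  qed
  show ?case using finite_length_zero[OF comp_refl.prems(2) z] relations_zero_module[OF comp_refl.prems(2) z] by simp
next
  case (comp_step N M ms P)
  let ?L = "R\<lparr>carrier := C\<rparr>"
  note T = comp_step.prems(2) and p = comp_step.prems(3) and C = comp_step.prems(1)
  interpret T: left_module ?L T by (rule T)
  have N: "smod C N" and M: "smod C M" "N \<subseteq> M" using comp_smod[OF comp_step.hyps(1)] by auto
  have P: "smod C P" and MP: "M \<subset> P" using comp_step.hyps(2) by (auto simp: covers_def)
  have MP': "M \<subseteq> P" using MP by blast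
  note p' = p[unfolded presents_def]
  let ?T1 = "T\<lparr>carrier := \<phi> ` M\<rparr>"
  note s1 = presents_submodule[OF T p N M MP']
  have T1: "left_module ?L ?T1" using left_module_restrict[OF T s1(1)] .
  have ih: "finite_length_module ?L ?T1" "frag_of ?T1 - (\<Sum>\<kappa>\<in>#ms. simple_class ?L \<kappa>) \<in> grothendieck_relations ?L"
    using comp_step.IH[OF C T1 s1(2)] by auto
  obtain Q :: "('a, 'm) module" and g where Q: "left_module ?L Q" "g \<in> module_hom_set ?L T Q"
    "g ` carrier T = carrier Q" "{x \<in> carrier T. g x = \<zero>\<^bsub>Q\<^esub>} = \<phi> ` M"
    using quotient_module_exists[OF T s1(1)] by blast
  have g: "\<And>x y. x \<in> carrier T \<Longrightarrow> y \<in> carrier T \<Longrightarrow> g (x \<oplus>\<^bsub>T\<^esub> y) = g x \<oplus>\<^bsub>Q\<^esub> g y"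
    "\<And>a x. a \<in> C \<Longrightarrow> x \<in> carrier T \<Longrightarrow> g (a \<odot>\<^bsub>T\<^esub> x) = a \<odot>\<^bsub>Q\<^esub> g x"
    using Q(2) by (auto simp: module_hom_set_def)
  have \<phi>c: "\<phi> x \<in> carrier T" if "x \<in> P" for x using p' that by blast
  have pQ: "presents C M P (\<lambda>x. g (\<phi> x)) Q"
    unfolding presents_def
  proof (intro conjI ballI)
    have "(\<lambda>x. g (\<phi> x)) ` P = g ` (\<phi> ` P)" by (simp add: image_image)
    then show "(\<lambda>x. g (\<phi> x)) ` P = carrier Q" using p' Q(3) by simp
    show "g (\<phi> (x \<oplus> y)) = g (\<phi> x) \<oplus>\<^bsub>Q\<^esub> g (\<phi> y)" if "x \<in> P" "y \<in> P" for x y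
      using p' g \<phi>c that by simp
    show "g (\<phi> (a \<otimes> x)) = a \<odot>\<^bsub>Q\<^esub> g (\<phi> x)" if "a \<in> C" "x \<in> P" for a x
      using p' g \<phi>c that by simp
    show "g (\<phi> x) = \<zero>\<^bsub>Q\<^esub> \<longleftrightarrow> x \<in> M" if "x \<in> P" for x
      using Q(4) \<phi>c[OF that] presents_mem_iff[OF T p P M MP' that] by blast
  qed
  note sQ = presents_covers_simple[OF Q(1) pQ comp_step.hyps(2) C]
  have rQ: "frag_of Q - simple_class ?L (simple_key C M P) \<in> grothendieck_relations ?L"
    using simple_class[OF sQ(1)] sQ(2) by simp
  have proper: "\<phi> ` M \<subset> carrier T"
  proof -
    obtain x where x: "x \<in> P" "x \<notin> M" using MP by blast
    then have "\<phi> x \<notin> \<phi> ` M" using presents_mem_iff[OF T p P M MP' x(1)] by blast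
    then show ?thesis using \<phi>c MP x by blast
  qed
  have flT: "finite_length_module ?L T"
  proof (rule finite_length_extend[OF T s1(1) proper ih(1)])
    fix W assume W: "submodule W ?L T" "\<phi> ` M \<subseteq> W"
    note W' = W(1)[unfolded T.submodule_iff]
    let ?J = "{x \<in> P. \<phi> x \<in> W}"
    have WJ: "W = \<phi> ` ?J"
    proof -
      have "W \<subseteq> \<phi> ` P" using W' p' by blast
      then show ?thesis by blast
    qed
    have "smod C ?J" using presents_vimage[OF T p P smod_zero[OF N] C W(1)] .
    moreover have "M \<subseteq> ?J" using W(2) MP by blast
    ultimately have "?J = M \<or> ?J = P" using comp_step.hyps(2) unfolding covers_def by blast
    then show "W = \<phi> ` M \<or> W = carrier T" using WJ p' by auto
  qed
  have "short_exact ?L ?T1 T Q"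
  proof -
    have "(\<lambda>x. x) \<in> module_hom_set ?L ?T1 T" using proper by (auto simp: module_hom_set_def)
    then show ?thesis unfolding short_exact_def using Q(2-4)
      by (intro exI[of _ "\<lambda>x. x"] exI[of _ g]) auto
  qed
  then have "frag_of T - (frag_of ?T1 + frag_of Q) \<in> grothendieck_relations ?L"
    using relations_exact[OF flT ih(1) finite_length_simple[OF sQ(1)]] by blast
  from relations_add[OF relations_add[OF this ih(2)] rQ] show ?case
    using flT by (simp add: algebra_simps)
qed

end

lemma grothendieck_class_eqI:
  fixes T T' :: "('l, 'm) module"
  assumes "finite_length_module L T" "finite_length_module L T'" "frag_of T - frag_of T' \<in> grothendieck_relations L"
  shows "grothendieck_class L T = grothendieck_class L T'"
proof -
  let ?G = "free_Abelian_group (finite_length_modules L) :: (('l, 'm) module \<Rightarrow>\<^sub>0 int) monoid"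
  have c: "frag_of T' \<in> carrier ?G" using assms(2) by (simp add: finite_length_modules_def)
  have "frag_of T = (frag_of T - frag_of T') \<otimes>\<^bsub>?G\<^esub> frag_of T'" by simp
  then have "frag_of T \<in> grothendieck_relations L #>\<^bsub>?G\<^esub> frag_of T'"
    using assms(3) unfolding r_coset_def by blast
  then show ?thesis unfolding grothendieck_class_def
    using group.repr_independence[OF group_free_Abelian_group _ c relations_subgroup] by simp
qed

lemma grothendieck_class_closed:
  fixes T :: "('l, 'm) module"
  assumes "finite_length_module L T" shows "grothendieck_class L T \<in> carrier (grothendieck_group L)"
proof -
  let ?G = "free_Abelian_group (finite_length_modules L) :: (('l, 'm) module \<Rightarrow>\<^sub>0 int) monoid"
  have "frag_of T \<in> carrier ?G" using assms by (simp add: finite_length_modules_def)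
  then have "grothendieck_relations L #>\<^bsub>?G\<^esub> frag_of T \<in> rcosets\<^bsub>?G\<^esub> (grothendieck_relations L)"
    by (rule group.rcosetsI[OF group_free_Abelian_group subgroup.subset[OF relations_subgroup]])
  then show ?thesis by (simp add: grothendieck_class_def grothendieck_group_def FactGroup_def)
qed

section \<open>Semisimple rings and complete discrete valuation rings\<close>

context ring
begin

text \<open>Semisimplicity of the regular module, restated for left ideals.\<close>

definition complemented :: bool where
  "complemented \<longleftrightarrow> (\<forall>N. smod (carrier R) N \<longrightarrow>
     (\<exists>N'. smod (carrier R) N' \<and> N \<inter> N' = {\<zero>} \<and> N <+>\<^bsub>R\<^esub> N' = carrier R))"

lemma complement:
  assumes "complemented" "smod (carrier R) N"
  obtains N' f g where "smod (carrier R) N'" "N \<inter> N' = {\<zero>}" "f \<in> N" "g \<in> N'" "\<one> = f \<oplus> g"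
proof -
  obtain N' where N': "smod (carrier R) N'" "N \<inter> N' = {\<zero>}" "N <+>\<^bsub>R\<^esub> N' = carrier R"
    using assms unfolding complemented_def by blast
  have "\<one> \<in> N <+>\<^bsub>R\<^esub> N'" using N'(3) by simp
  then show ?thesis using that N' unfolding mem_set_add by blast
qed

text \<open>Right multiplication by \<open>f\<close> is the projection onto \<open>N\<close> along
  \<open>N'\<close>: the other component \<open>y \<otimes> g\<close> of \<open>y\<close> lies in
  \<open>N \<inter> N'\<close>.\<close>

lemma projection_id:
  assumes N: "smod (carrier R) N" "smod (carrier R) N'" "N \<inter> N' = {\<zero>}" and f: "f \<in> N" "g \<in> N'" "\<one> = f \<oplus> g"
    and y: "y \<in> N"
  shows "y \<otimes> f = y"
proof -
  have c: "y \<in> carrier R" "f \<in> carrier R" "g \<in> carrier R" using smod_mem_carrier N f y by blast+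
  have "y = y \<otimes> (f \<oplus> g)" unfolding f(3)[symmetric] using c by simp
  also have "\<dots> = y \<otimes> f \<oplus> y \<otimes> g" using c by (simp add: r_distr)
  finally have e: "y = y \<otimes> f \<oplus> y \<otimes> g" .
  have "y \<otimes> f \<in> N" "y \<otimes> g \<in> N'" using smod_smult N f c by blast+
  moreover have "y \<otimes> g \<in> N" using smod_minus_cancel[OF N(1) _ \<open>y \<otimes> f \<in> N\<close>, of "y \<otimes> g"] e y c by simp
  ultimately have "y \<otimes> g = \<zero>" using N(3) by blast
  then show ?thesis using e c by simp
qed

lemma principal_left_ideal: "z \<in> carrier R \<Longrightarrow> smod (carrier R) ((\<lambda>a. a \<otimes> z) ` carrier R)"
proof (rule smodI)
  assume z: "z \<in> carrier R"
  show "(\<lambda>a. a \<otimes> z) ` carrier R \<subseteq> carrier R" using z by auto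
  show "\<zero> \<in> (\<lambda>a. a \<otimes> z) ` carrier R" using z by (intro image_eqI[of _ _ \<zero>]) auto
  fix x y assume "x \<in> (\<lambda>a. a \<otimes> z) ` carrier R" "y \<in> (\<lambda>a. a \<otimes> z) ` carrier R"
  then obtain a b where ab: "a \<in> carrier R" "b \<in> carrier R" "x = a \<otimes> z" "y = b \<otimes> z" by blast
  then have "x \<ominus> y = (a \<ominus> b) \<otimes> z" using z by (simp add: minus_eq l_distr l_minus)
  then show "x \<ominus> y \<in> (\<lambda>a. a \<otimes> z) ` carrier R" using ab by blast
next
  fix c x assume z: "z \<in> carrier R" and c: "c \<in> carrier R" "x \<in> (\<lambda>a. a \<otimes> z) ` carrier R"
  then obtain a where a: "a \<in> carrier R" "x = a \<otimes> z" by blast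
  then have "c \<otimes> x = (c \<otimes> a) \<otimes> z" using z c by (simp add: m_assoc)
  then show "c \<otimes> x \<in> (\<lambda>a. a \<otimes> z) ` carrier R" using a c by blast
qed

text \<open>A complement of a maximal left ideal containing \<open>1 - e\<close> is a minimal left ideal inside \<open>R e\<close>.\<close>

lemma minimal_left_ideal_exists:
  assumes comp: "complemented" and e: "e \<in> carrier R" "e \<otimes> e = e" "e \<noteq> \<zero>"
  obtains \<epsilon> where "\<epsilon> \<in> carrier R" "\<epsilon> \<noteq> \<zero>" "\<epsilon> \<otimes> \<epsilon> = \<epsilon>" "e \<otimes> \<epsilon> = \<epsilon>"
    "\<And>x. \<lbrakk>x \<in> carrier R; x \<otimes> \<epsilon> = x; x \<noteq> \<zero>\<rbrakk> \<Longrightarrow> \<exists>a\<in>carrier R. a \<otimes> x = \<epsilon>"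
proof -
  let ?A = "{J. smod (carrier R) J \<and> \<one> \<ominus> e \<in> J \<and> \<one> \<notin> J}"
  have "smod (carrier R) {x \<in> carrier R. x \<otimes> e = \<zero>}"
    by (rule smodI) (use e in \<open>auto simp: minus_eq l_distr l_minus m_assoc\<close>)
  moreover have "(\<one> \<ominus> e) \<otimes> e = \<zero>" using e by (simp add: minus_eq l_distr l_minus r_neg)
  ultimately have "{x \<in> carrier R. x \<otimes> e = \<zero>} \<in> ?A" using e by simp
  then have ne: "?A \<noteq> {}" by blast
  have ch: "\<Union>C \<in> ?A" if C: "C \<noteq> {}" "subset.chain ?A C" for C
  proof -
    have CA: "J \<in> ?A" if "J \<in> C" for J using C(2) that unfolding subset.chain_def by blast
    have sm: "smod (carrier R) J" if "J \<in> C" for J using CA[OF that] by blast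
    obtain J0 where J0: "J0 \<in> C" using C(1) by blast
    have "smod (carrier R) (\<Union>C)"
    proof (rule smodI)
      show "\<Union>C \<subseteq> carrier R" using smod_carrier[OF sm] by blast
      show "\<zero> \<in> \<Union>C" using smod_zero[OF sm[OF J0]] J0 by blast
      show "x \<ominus> y \<in> \<Union>C" if xy: "x \<in> \<Union>C" "y \<in> \<Union>C" for x y
      proof -
        obtain I J where IJ: "I \<in> C" "J \<in> C" "x \<in> I" "y \<in> J" using xy by blast
        have "I \<subseteq> J \<or> J \<subseteq> I" using C(2) IJ unfolding subset_chain_def by blast
        then obtain K where K: "K \<in> C" "x \<in> K" "y \<in> K" using IJ by blast
        then show ?thesis using smod_minus[OF sm[OF K(1)] K(2,3)] by blast
      qed
      show "c \<otimes> x \<in> \<Union>C" if cx: "c \<in> carrier R" "x \<in> \<Union>C" for c x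
      proof -
        obtain I where I: "I \<in> C" "x \<in> I" using cx by blast
        then show ?thesis using smod_smult[OF sm[OF I(1)] cx(1) I(2)] by blast
      qed
    qed
    moreover have "\<one> \<ominus> e \<in> \<Union>C" using CA[OF J0] J0 by blast
    moreover have "\<one> \<notin> \<Union>C" using CA by blast
    ultimately show ?thesis by blast
  qed
  obtain J where J: "smod (carrier R) J" "\<one> \<ominus> e \<in> J" "\<one> \<notin> J" and
    mx: "\<And>I. smod (carrier R) I \<Longrightarrow> \<one> \<ominus> e \<in> I \<Longrightarrow> \<one> \<notin> I \<Longrightarrow> J \<subseteq> I \<Longrightarrow> I = J"
    using subset_Zorn_nonempty[OF ne ch] by auto
  obtain N j \<epsilon> where N: "smod (carrier R) N" "J \<inter> N = {\<zero>}" and j: "j \<in> J" "\<epsilon> \<in> N" "\<one> = j \<oplus> \<epsilon>"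
    using complement[OF comp J(1)] by metis
  have c: "j \<in> carrier R" "\<epsilon> \<in> carrier R" using smod_mem_carrier J N j by blast+
  have one: "\<one> = \<epsilon> \<oplus> j" using j(3) a_comm[OF c] by simp
  have NJ: "N \<inter> J = {\<zero>}" using N by blast
  have N\<epsilon>: "y \<otimes> \<epsilon> = y" if "y \<in> N" for y using projection_id[OF N(1) J(1) NJ j(2,1) one that] .
  have \<epsilon>N: "x \<in> N" if "x \<in> carrier R" "x \<otimes> \<epsilon> = x" for x using smod_smult[OF N(1) that(1) j(2)] that(2) by simp
  show ?thesis
  proof (rule that)
    show "\<epsilon> \<in> carrier R" by (rule c)
    show "\<epsilon> \<noteq> \<zero>" using j J(3) c by auto
    show "\<epsilon> \<otimes> \<epsilon> = \<epsilon>" using N\<epsilon> j by blast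
    \<comment> \<open>\<open>(\<one> \<ominus> e) \<otimes> \<epsilon>\<close> lies in
      \<open>N\<close>, and also in \<open>J\<close>, being the difference of
      \<open>\<one> \<ominus> e\<close> and \<open>(\<one> \<ominus> e) \<otimes> j\<close>.\<close>
    show "e \<otimes> \<epsilon> = \<epsilon>"
    proof -
      have f: "\<one> \<ominus> e \<in> carrier R" using e by simp
      have 1: "(\<one> \<ominus> e) \<otimes> j = \<one> \<ominus> e \<ominus> (\<one> \<ominus> e) \<otimes> \<epsilon>"
      proof -
        have "\<one> \<ominus> e = (\<one> \<ominus> e) \<otimes> (j \<oplus> \<epsilon>)" unfolding j(3)[symmetric] using f by simp
        also have "\<dots> = (\<one> \<ominus> e) \<otimes> j \<oplus> (\<one> \<ominus> e) \<otimes> \<epsilon>" using c f by (simp add: r_distr)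
        finally have "\<one> \<ominus> e \<ominus> (\<one> \<ominus> e) \<otimes> \<epsilon> = ((\<one> \<ominus> e) \<otimes> j \<oplus> (\<one> \<ominus> e) \<otimes> \<epsilon>) \<ominus> (\<one> \<ominus> e) \<otimes> \<epsilon>" by simp
        also have "\<dots> = (\<one> \<ominus> e) \<otimes> j" using c f by (simp add: minus_eq a_assoc r_neg)
        finally show ?thesis by simp
      qed
      have p: "(\<one> \<ominus> e) \<otimes> j \<in> J" "(\<one> \<ominus> e) \<otimes> \<epsilon> \<in> N" using smod_smult J(1) N(1) j f by blast+
      have "(\<one> \<ominus> e) \<ominus> (\<one> \<ominus> e) \<otimes> j \<in> J" using smod_minus[OF J(1,2) p(1)] .
      moreover have "(\<one> \<ominus> e) \<ominus> (\<one> \<ominus> e) \<otimes> j = (\<one> \<ominus> e) \<otimes> \<epsilon>"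
        unfolding 1 using f c by (simp add: minus_eq minus_add a_assoc[symmetric] r_neg)
      ultimately have "(\<one> \<ominus> e) \<otimes> \<epsilon> \<in> J \<inter> N" using p by simp
      then have "(\<one> \<ominus> e) \<otimes> \<epsilon> = \<zero>" using N(2) by blast
      then have "\<epsilon> \<ominus> e \<otimes> \<epsilon> = \<zero>" using c e by (simp add: minus_eq l_distr l_minus)
      then show ?thesis using c e by simp
    qed
    fix x assume x: "x \<in> carrier R" "x \<otimes> \<epsilon> = x" "x \<noteq> \<zero>"
    let ?X = "(\<lambda>a. a \<otimes> x) ` carrier R"
    let ?I = "J <+>\<^bsub>R\<^esub> ?X"
    have sX: "smod (carrier R) ?X" using principal_left_ideal x by blast
    have sI: "smod (carrier R) ?I" using smod_sum[OF J(1) sX] by blast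
    have JI: "J \<subseteq> ?I" and XI: "?X \<subseteq> ?I" using subset_sum_left[OF J(1) sX] subset_sum_right[OF J(1) sX] by auto
    have "x \<in> ?X" using x by (intro image_eqI[of _ _ \<one>]) auto
    moreover have "x \<notin> J" using \<epsilon>N[OF x(1,2)] N(2) x(3) by blast
    ultimately have "?I \<noteq> J" using XI by blast
    \<comment> \<open>Maximality of \<open>J\<close> makes \<open>J + R x\<close> the whole ring.
      Comparing \<open>1 = i + a x\<close> with \<open>1 = j + \<epsilon>\<close> puts
      \<open>\<epsilon> - a x\<close> into \<open>J \<inter> N\<close>, so it vanishes.\<close>
    then have "\<one> \<in> ?I" using mx[OF sI _ _ JI] J(2) JI by blast
    then obtain i a where ia: "i \<in> J" "a \<in> carrier R" "\<one> = i \<oplus> a \<otimes> x" unfolding mem_set_add by blast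
    have ic: "i \<in> carrier R" using smod_mem_carrier J ia by blast
    have "\<epsilon> \<ominus> a \<otimes> x = i \<ominus> j"
    proof -
      have "j \<oplus> \<epsilon> = i \<oplus> a \<otimes> x" using j ia by simp
      moreover have "\<epsilon> \<ominus> a \<otimes> x = (j \<oplus> \<epsilon>) \<ominus> j \<ominus> a \<otimes> x" using c x ia by algebra
      moreover have "(i \<oplus> a \<otimes> x) \<ominus> j \<ominus> a \<otimes> x = i \<ominus> j" using c x ia ic by algebra
      ultimately show ?thesis by simp
    qed
    moreover have "i \<ominus> j \<in> J" using smod_minus[OF J(1) ia(1) j(1)] .
    moreover have "\<epsilon> \<ominus> a \<otimes> x \<in> N" using smod_minus[OF N(1) j(2) smod_smult[OF N(1) ia(2) \<epsilon>N[OF x(1,2)]]] .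
    ultimately have "\<epsilon> \<ominus> a \<otimes> x \<in> J \<inter> N" by simp
    then have "\<epsilon> \<ominus> a \<otimes> x = \<zero>" using N(2) by blast
    then have "a \<otimes> x = \<epsilon>" using c x ia by simp
    then show "\<exists>a\<in>carrier R. a \<otimes> x = \<epsilon>" using ia(2) by blast
  qed
qed

text \<open>The annihilator of \<open>R \<epsilon>\<close> in \<open>R e\<close> is a two-sided ideal, hence generated by an idempotent \<open>f\<close>,
  and \<open>f\<close> is central because \<open>z = (1 - f) x f\<close> satisfies \<open>z R z = 0\<close>.\<close>

lemma primitive_component_faithful:
  assumes comp: "complemented" and pe: "primitive_central_idempotent R e"
    and \<epsilon>: "\<epsilon> \<in> carrier R" "\<epsilon> \<noteq> \<zero>" "\<epsilon> \<otimes> \<epsilon> = \<epsilon>" "e \<otimes> \<epsilon> = \<epsilon>"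
    and b: "b \<in> carrier R" "b \<otimes> e = b" "\<And>x. x \<in> carrier R \<Longrightarrow> x \<otimes> \<epsilon> = x \<Longrightarrow> b \<otimes> x = \<zero>"
  shows "b = \<zero>"
proof -
  have ce: "central_idempotent R e" and prim: "\<And>f g. central_idempotent R f \<Longrightarrow> central_idempotent R g \<Longrightarrow> f \<otimes> g = \<zero> \<Longrightarrow> e = f \<oplus> g \<Longrightarrow> f = \<zero> \<or> g = \<zero>"
    using pe unfolding primitive_central_idempotent_def by blast+
  have e: "e \<in> carrier R" "e \<otimes> e = e" and cen: "\<And>x. x \<in> carrier R \<Longrightarrow> e \<otimes> x = x \<otimes> e"
    using ce unfolding central_idempotent_def by blast+
  let ?W = "{b \<in> carrier R. b \<otimes> e = b \<and> (\<forall>x\<in>carrier R. x \<otimes> \<epsilon> = x \<longrightarrow> b \<otimes> x = \<zero>)}"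
  have W: "smod (carrier R) ?W"
    by (rule smodI) (use e in \<open>auto simp: minus_eq l_distr l_minus m_assoc\<close>)
  have Wr: "y \<otimes> a \<in> ?W" if y: "y \<in> ?W" "a \<in> carrier R" for y a
  proof -
    have yc: "y \<in> carrier R" using y by blast
    have "(y \<otimes> a) \<otimes> e = (y \<otimes> e) \<otimes> a" using cen[OF y(2)] yc y(2) e by (simp add: m_assoc)
    moreover have "(y \<otimes> a) \<otimes> x = \<zero>" if x: "x \<in> carrier R" "x \<otimes> \<epsilon> = x" for x
    proof -
      have "(a \<otimes> x) \<otimes> \<epsilon> = a \<otimes> x" using x y(2) \<epsilon> by (simp add: m_assoc)
      then have "y \<otimes> (a \<otimes> x) = \<zero>" using y x by simp
      then show ?thesis using yc y(2) x by (simp add: m_assoc)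
    qed
    ultimately show ?thesis using y yc by simp
  qed
  obtain N f g where N: "smod (carrier R) N" "?W \<inter> N = {\<zero>}" and fg: "f \<in> ?W" "g \<in> N" "\<one> = f \<oplus> g"
    using complement[OF comp W] by blast
  have Wf: "y \<otimes> f = y" if "y \<in> ?W" for y using projection_id[OF W N(1,2) fg that] .
  have fc: "f \<in> carrier R" and fe: "f \<otimes> e = f" using fg by auto
  have ff: "f \<otimes> f = f" using Wf fg by blast
  have fcen: "f \<otimes> x = x \<otimes> f" if x: "x \<in> carrier R" for x
  proof -
    let ?z = "x \<otimes> f \<ominus> f \<otimes> x \<otimes> f"
    have zc: "?z \<in> carrier R" using x fc by simp
    \<comment> \<open>\<open>f \<otimes> a\<close> lies in the two-sided ideal \<open>?W\<close>, on
      which right multiplication by \<open>f\<close> is the identity.\<close>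
    have fa: "f \<otimes> a \<otimes> f = f \<otimes> a" if "a \<in> carrier R" for a using Wf[OF Wr[OF fg(1) that]] .
    have fz: "f \<otimes> (a \<otimes> ?z) = \<zero>" if a: "a \<in> carrier R" for a
    proof -
      have "f \<otimes> (a \<otimes> ?z) = (f \<otimes> a \<otimes> f) \<otimes> ?z" using fa[OF a] a fc zc by (simp add: m_assoc)
      also have "\<dots> = f \<otimes> a \<otimes> (f \<otimes> x \<otimes> f \<ominus> (f \<otimes> f) \<otimes> x \<otimes> f)"
        using a fc x by (simp add: m_assoc minus_eq r_distr r_minus)
      also have "\<dots> = \<zero>" unfolding ff using a fc x by (simp add: minus_eq r_neg)
      finally show ?thesis .
    qed
    have zaz: "?z \<otimes> (a \<otimes> ?z) = \<zero>" if a: "a \<in> carrier R" for a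
    proof -
      have "?z \<otimes> (a \<otimes> ?z) = (x \<ominus> f \<otimes> x) \<otimes> (f \<otimes> (a \<otimes> ?z))"
        using a fc x zc by (simp add: m_assoc minus_eq l_distr l_minus)
      then show ?thesis using fz[OF a] x fc by simp
    qed
    \<comment> \<open>This left ideal has square zero; but a complemented left ideal is generated by
      an idempotent, so it vanishes.\<close>
    let ?Z = "(\<lambda>a. a \<otimes> ?z) ` carrier R"
    have Z: "smod (carrier R) ?Z" using principal_left_ideal[OF zc] .
    obtain N' h k where N': "smod (carrier R) N'" "?Z \<inter> N' = {\<zero>}" and hk: "h \<in> ?Z" "k \<in> N'" "\<one> = h \<oplus> k"
      using complement[OF comp Z] by blast
    obtain a where a: "a \<in> carrier R" "h = a \<otimes> ?z" using hk(1) by blast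
    have "h = h \<otimes> h" using projection_id[OF Z N'(1,2) hk hk(1)] by simp
    also have "\<dots> = a \<otimes> (?z \<otimes> (a \<otimes> ?z))" unfolding a(2) using a(1) zc by (simp add: m_assoc)
    also have "\<dots> = \<zero>" using zaz[OF a(1)] a(1) by simp
    finally have h0: "h = \<zero>" .
    have "?z \<in> ?Z" using zc by (intro image_eqI[of _ _ \<one>]) simp_all
    from projection_id[OF Z N'(1,2) hk this] have "?z = ?z \<otimes> h" by simp
    also have "\<dots> = \<zero>" unfolding h0 using zc by simp
    finally have "x \<otimes> f = f \<otimes> x \<otimes> f" using x fc by simp
    then show ?thesis using fa[OF x] by simp
  qed
  have cf: "central_idempotent R f" unfolding central_idempotent_def using fc ff fcen by blast
  have ef: "e \<otimes> f = f" using cen[OF fc] fe by simp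
  let ?g = "e \<ominus> f"
  have "central_idempotent R ?g"
    unfolding central_idempotent_def
  proof (intro conjI ballI)
    show "?g \<in> carrier R" using e fc by simp
    have "?g \<otimes> ?g = (e \<otimes> e \<ominus> e \<otimes> f) \<ominus> (f \<otimes> e \<ominus> f \<otimes> f)" using e fc by algebra
    also have "\<dots> = (e \<ominus> f) \<ominus> (f \<ominus> f)" unfolding e(2) ef fe ff ..
    also have "\<dots> = ?g" using e fc by algebra
    finally show "?g \<otimes> ?g = ?g" .
    show "?g \<otimes> x = x \<otimes> ?g" if "x \<in> carrier R" for x
      using cen[OF that] fcen[OF that] that e fc by (simp add: minus_eq l_distr r_distr l_minus r_minus)
  qed
  moreover have "f \<otimes> ?g = \<zero>" using e fc fe ff by (simp add: minus_eq r_distr r_minus r_neg)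
  moreover have "e = f \<oplus> ?g" using e fc by algebra
  \<comment> \<open>Primitivity leaves \<open>f = \<zero>\<close>, which makes the annihilator
    trivial, or \<open>f = e\<close>, which is impossible because \<open>f\<close> kills the
    non-zero \<epsilon> and \<open>e\<close> fixes it.\<close>
  ultimately have "f = \<zero> \<or> ?g = \<zero>" using prim[OF cf] by blast
  then show ?thesis
  proof
    assume "f = \<zero>"
    moreover have "b \<in> ?W" using b by blast
    ultimately show ?thesis using Wf[of b] b(1) by simp
  next
    assume "?g = \<zero>"
    then have "e = f" using e fc by simp
    moreover have "f \<otimes> \<epsilon> = \<zero>" using fg(1) \<epsilon> by blast
    ultimately show ?thesis using \<epsilon> by simp
  qed
qed

lemma smod_finsum:
  assumes "smod C W" "finite F" "\<And>x. x \<in> F \<Longrightarrow> f x \<in> W" shows "finsum R f F \<in> W"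
  using assms(2,3)
proof (induction F rule: finite_induct)
  case empty
  then show ?case using smod_zero[OF assms(1)] by simp
next
  case (insert x F)
  have "f \<in> F \<rightarrow> carrier R" "f x \<in> carrier R" using insert.prems smod_mem_carrier[OF assms(1)] by auto
  then show ?case using insert smod_add[OF assms(1)] by simp
qed

end

lemma complemented_if_semisimple:
  fixes A :: "('k, 'a) module"
  assumes "semisimple_ring A" shows "ring.complemented A"
proof -
  interpret A: ring A using assms by (simp add: semisimple_ring_def)
  interpret M: left_module A "regular_module A"
    using assms by (simp add: semisimple_ring_def semisimple_module_def)
  have s: "submodule N A (regular_module A) \<longleftrightarrow> A.smod (carrier A) N" for N
  proof
    assume "submodule N A (regular_module A)"
    then have h: "N \<subseteq> carrier A" "\<zero>\<^bsub>A\<^esub> \<in> N" "\<And>x y. x \<in> N \<Longrightarrow> y \<in> N \<Longrightarrow> x \<oplus>\<^bsub>A\<^esub> y \<in> N"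
      "\<And>a x. a \<in> carrier A \<Longrightarrow> x \<in> N \<Longrightarrow> a \<otimes>\<^bsub>A\<^esub> x \<in> N"
      unfolding M.submodule_iff by (auto simp: regular_module_def)
    show "A.smod (carrier A) N"
    proof (rule A.smodI)
      fix x y assume xy: "x \<in> N" "y \<in> N"
      have c: "x \<in> carrier A" "y \<in> carrier A" using xy h by auto
      have "x \<ominus>\<^bsub>A\<^esub> y = x \<oplus>\<^bsub>A\<^esub> (\<ominus>\<^bsub>A\<^esub> \<one>\<^bsub>A\<^esub>) \<otimes>\<^bsub>A\<^esub> y" using c by (simp add: A.minus_eq A.l_minus)
      then show "x \<ominus>\<^bsub>A\<^esub> y \<in> N" using h(3)[OF xy(1) h(4)[OF _ xy(2)]] by simp
    qed (use h in auto)
  next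
    assume h: "A.smod (carrier A) N"
    show "submodule N A (regular_module A)"
      unfolding M.submodule_iff
      using A.smod_carrier[OF h] A.smod_zero[OF h] A.smod_add[OF h] A.smod_smult[OF h]
      by (auto simp: regular_module_def)
  qed
  have "N <+>\<^bsub>regular_module A\<^esub> N' = N <+>\<^bsub>A\<^esub> N'" for N N'
    unfolding set_add_def' by (simp add: regular_module_def)
  then show ?thesis
    using assms s unfolding semisimple_ring_def semisimple_module_def A.complemented_def
    by (simp add: regular_module_def)
qed

text \<open>\<open>\<tau>\<close> generates the maximal ideal, whose powers then consist of the
  multiples of \<open>\<tau> [^] n\<close>. The limit statement is written with sums instead of
  differences: in \<open>K\<lparr>carrier := R0\<rparr>\<close>, where it is applied, addition and
  multiplication are those of K, whereas additive inverses are defined relative to the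
  carrier.\<close>

lemma complete_dvr_uniformizer:
  fixes B :: "('r, 'x) ring_scheme" (structure)
  assumes "complete_discrete_valuation_ring B"
  obtains \<tau> where "\<tau> \<in> carrier B" "\<tau> \<noteq> \<zero>"
    "\<And>s. s \<in> carrier B \<Longrightarrow> (\<exists>r\<in>carrier B. s = \<tau> \<otimes> r) \<or> (\<exists>r\<in>carrier B. s \<otimes> r = \<one>)"
    "\<And>s. \<lbrakk>s \<in> carrier B; \<And>n::nat. \<exists>r\<in>carrier B. s = \<tau> [^] n \<otimes> r\<rbrakk> \<Longrightarrow> s = \<zero>"
    "\<And>a. \<lbrakk>\<And>n. a n \<in> carrier B; \<And>n::nat. \<exists>r\<in>carrier B. a (Suc n) = a n \<oplus> \<tau> [^] n \<otimes> r\<rbrakk> \<Longrightarrow>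
       \<exists>y\<in>carrier B. \<forall>n. \<exists>r\<in>carrier B. y = a n \<oplus> \<tau> [^] n \<otimes> r"
proof -
  have dvr: "principal_domain B" "\<exists>!m. maximalideal m B" "\<not> field B"
    using assms by (auto simp: complete_discrete_valuation_ring_def discrete_valuation_ring_def)
  interpret B: principal_domain B by (rule dvr)
  obtain m where m: "maximalideal m B" and mu: "\<And>m'. maximalideal m' B \<Longrightarrow> m' = m" using dvr(2) by blast
  have mi: "ideal m B" using m by (simp add: maximalideal_def)
  obtain \<tau> where \<tau>: "\<tau> \<in> carrier B" "m = PIdl \<tau>" using B.exists_gen[OF mi] by blast
  have mem: "x \<in> m \<longleftrightarrow> (\<exists>r\<in>carrier B. x = \<tau> \<otimes> r)" for x
    unfolding \<tau>(2) cgenideal_def using \<tau>(1) B.m_comm by auto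
  have nz: "\<tau> \<noteq> \<zero>"
  proof
    assume "\<tau> = \<zero>"
    then have "m = {\<zero>}" using mem by auto
    then show False using m B.zeromaximalideal_fieldI dvr(3) by blast
  qed
  have loc: "(\<exists>r\<in>carrier B. s = \<tau> \<otimes> r) \<or> (\<exists>r\<in>carrier B. s \<otimes> r = \<one>)" if s: "s \<in> carrier B" for s
  proof (cases "s = \<zero> \<or> s \<in> Units B")
    case True
    then show ?thesis
    proof
      assume "s = \<zero>"
      then show ?thesis using \<tau>(1) by (intro disjI1 bexI[of _ "\<zero>"]) auto
    next
      assume "s \<in> Units B"
      then show ?thesis unfolding Units_def by blast
    qed
  next
    case False
    \<comment> \<open>An irreducible divisor of a non-zero non-unit generates a maximal ideal, which
      is \<open>m\<close> by uniqueness.\<close>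
    then obtain b where b: "b \<in> carrier B" "ring_irreducible b" "b divides s"
      using B.exists_irreducible_divisor[of s] s by blast
    have "PIdl b = m" using mu[OF B.irreducible_imp_maximalideal[OF b(1,2)]] .
    then have "b \<in> m" using B.cgenideal_self[OF b(1)] by simp
    moreover obtain r where "r \<in> carrier B" "s = b \<otimes> r" using b(3) unfolding factor_def by blast
    ultimately have "s \<in> m" using ideal.I_r_closed[OF mi] by simp
    then show ?thesis using mem by blast
  qed
  have pw: "x \<in> ideal_power B m n \<longleftrightarrow> (\<exists>r\<in>carrier B. x = \<tau> [^] n \<otimes> r)" for x n
  proof (induction n arbitrary: x)
    case 0
    then show ?case by (auto simp: ideal_power_def)
  next
    case (Suc n)
    have S: "ideal_power B m (Suc n) = ideal_prod B m (ideal_power B m n)" by (simp add: ideal_power_def)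
    have tp: "\<tau> [^] n \<in> carrier B" using \<tau> by simp
    have "\<exists>r\<in>carrier B. x = \<tau> [^] Suc n \<otimes> r" if "x \<in> ideal_prod B m (ideal_power B m n)"
      using that
    proof (induction x rule: ideal_prod.induct)
      case (prod i j)
      then obtain a b where ab: "a \<in> carrier B" "b \<in> carrier B" "i = \<tau> \<otimes> a" "j = \<tau> [^] n \<otimes> b"
        using mem Suc.IH by blast
      then have "i \<otimes> j = \<tau> [^] Suc n \<otimes> (a \<otimes> b)" using \<tau>(1) tp by (simp add: B.m_ac)
      then show ?case using ab by blast
    next
      case (sum s1 s2)
      then obtain a b where ab: "a \<in> carrier B" "b \<in> carrier B" "s1 = \<tau> [^] Suc n \<otimes> a" "s2 = \<tau> [^] Suc n \<otimes> b" by blast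
      then have "s1 \<oplus> s2 = \<tau> [^] Suc n \<otimes> (a \<oplus> b)" using \<tau>(1) tp by (simp add: B.r_distr)
      then show ?case using ab by blast
    qed
    moreover have "x \<in> ideal_prod B m (ideal_power B m n)" if h: "\<exists>r\<in>carrier B. x = \<tau> [^] Suc n \<otimes> r"
    proof -
      obtain r where r: "r \<in> carrier B" "x = \<tau> [^] Suc n \<otimes> r" using h by blast
      have "\<tau> \<in> m" using mem \<tau>(1) by (auto intro!: bexI[of _ "\<one>"])
      moreover have "\<tau> [^] n \<otimes> r \<in> ideal_power B m n" using Suc.IH r by blast
      ultimately have "\<tau> \<otimes> (\<tau> [^] n \<otimes> r) \<in> ideal_prod B m (ideal_power B m n)" by (rule ideal_prod.prod)
      moreover have "\<tau> \<otimes> (\<tau> [^] n \<otimes> r) = x" using r \<tau>(1) tp by (simp add: B.m_ac)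
      ultimately show ?thesis by simp
    qed
    ultimately show ?case unfolding S by blast
  qed
  let ?I = "\<lambda>n. {x. \<exists>r\<in>carrier B. x = \<tau> [^] (n::nat) \<otimes> r}"
  have I0: "\<zero> \<in> ?I n" for n using \<tau>(1) by (auto intro!: bexI[of _ "\<zero>"])
  have Ic: "x \<in> carrier B" if "x \<in> ?I n" for x n using that \<tau>(1) by auto
  have Ia: "x \<oplus> y \<in> ?I n" if h: "x \<in> ?I n" "y \<in> ?I n" for x y n
  proof -
    obtain a b where ab: "a \<in> carrier B" "b \<in> carrier B" "x = \<tau> [^] n \<otimes> a" "y = \<tau> [^] n \<otimes> b" using h by blast
    then have "x \<oplus> y = \<tau> [^] n \<otimes> (a \<oplus> b)" using \<tau>(1) by (simp add: B.r_distr)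
    then show ?thesis using ab by blast
  qed
  have In: "\<ominus> x \<in> ?I n" if h: "x \<in> ?I n" for x n
  proof -
    obtain a where a: "a \<in> carrier B" "x = \<tau> [^] n \<otimes> a" using h by blast
    then have "\<ominus> x = \<tau> [^] n \<otimes> (\<ominus> a)" using \<tau>(1) by (simp add: B.r_minus)
    then show ?thesis using a by blast
  qed
  have Im: "x \<in> ?I k" if h: "x \<in> ?I n" "k \<le> n" for x n k
  proof -
    obtain a where a: "a \<in> carrier B" "x = \<tau> [^] n \<otimes> a" using h(1) by blast
    have "\<tau> [^] n = \<tau> [^] k \<otimes> \<tau> [^] (n - k)" using B.nat_pow_mult[OF \<tau>(1), of k "n - k"] h(2) by simp
    then have "x = \<tau> [^] k \<otimes> (\<tau> [^] (n - k) \<otimes> a)" using a \<tau>(1) by (simp add: B.m_assoc)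
    then show ?thesis using a \<tau>(1) by blast
  qed
  have pwI: "ideal_power B m n = ?I n" for n using pw by blast
  have "adically_complete B m" using assms m unfolding complete_discrete_valuation_ring_def by blast
  note ac = this[unfolded adically_complete_def pwI]
  have compl: "\<exists>!y. y \<in> carrier B \<and> (\<forall>N. \<exists>k. \<forall>n\<ge>k. x n \<ominus> y \<in> ?I N)"
    if "range x \<subseteq> carrier B" "\<forall>N. \<exists>k. \<forall>i\<ge>k. \<forall>n\<ge>k. x i \<ominus> x n \<in> ?I N" for x :: "nat \<Rightarrow> 'r"
    by (rule ac[THEN spec, THEN mp, THEN mp, OF that])
  show ?thesis
  proof (rule that[OF \<tau>(1) nz loc])
    \<comment> \<open>Separatedness is uniqueness of limits: the zero sequence converges to
      \<open>s\<close> as well as to zero.\<close>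
    show "s = \<zero>" if s: "s \<in> carrier B" "\<And>n::nat. \<exists>r\<in>carrier B. s = \<tau> [^] n \<otimes> r" for s
    proof -
      have z0: "\<zero> \<ominus> \<zero> = \<zero>" unfolding B.minus_eq by (rule B.r_neg) simp
      have "\<exists>!y. y \<in> carrier B \<and> (\<forall>N. \<exists>k::nat. \<forall>n\<ge>k. \<zero> \<ominus> y \<in> ?I N)"
        by (rule compl[of "\<lambda>_. \<zero>"]) (use I0 in \<open>auto simp only: z0 B.zero_closed\<close>)
      moreover have "\<zero> \<ominus> s \<in> ?I N" for N
        using In[of s N] s unfolding B.minus_eq by simp
      moreover have "\<zero> \<ominus> \<zero> \<in> ?I N" for N unfolding z0 by (rule I0)
      ultimately show ?thesis using s(1) B.zero_closed by blast
    qed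
    fix a :: "nat \<Rightarrow> 'r" assume a: "\<And>n. a n \<in> carrier B"
      "\<And>n::nat. \<exists>r\<in>carrier B. a (Suc n) = a n \<oplus> \<tau> [^] n \<otimes> r"
    have step: "a (k + d) \<ominus> a k \<in> ?I k" for k d
    proof (induction d)
      case 0
      then show ?case using I0[of k] a(1)[of k] by (simp add: B.minus_eq B.r_neg)
    next
      case (Suc d)
      obtain r where r: "r \<in> carrier B" "a (Suc (k + d)) = a (k + d) \<oplus> \<tau> [^] (k + d) \<otimes> r" using a(2) by blast
      have i: "\<tau> [^] (k + d) \<otimes> r \<in> ?I k" using Im[of _ "k + d" k] r(1) by auto
      have "a (k + Suc d) \<ominus> a k = (a (k + d) \<ominus> a k) \<oplus> \<tau> [^] (k + d) \<otimes> r"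
        using r a(1)[of k] a(1)[of "k + d"] Ic[OF i] by (simp add: B.minus_eq B.a_ac)
      then show ?case using Ia[OF Suc.IH i] by simp
    qed
    have step': "a i \<ominus> a n \<in> ?I k" if "k \<le> i" "k \<le> n" for i n k
    proof -
      have 1: "a i \<ominus> a k \<in> ?I k" "a n \<ominus> a k \<in> ?I k" using step[of k "i - k"] step[of k "n - k"] that by auto
      have "a i \<ominus> a n = (a i \<ominus> a k) \<oplus> (\<ominus> (a n \<ominus> a k))"
        using a(1)[of i] a(1)[of n] a(1)[of k] by (simp add: B.minus_eq B.minus_add B.a_ac B.r_neg1 B.r_neg2)
      then show ?thesis using Ia[OF 1(1) In[OF 1(2)]] by simp
    qed
    have "\<exists>!y. y \<in> carrier B \<and> (\<forall>N. \<exists>k. \<forall>n\<ge>k. a n \<ominus> y \<in> ?I N)"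
    proof (rule compl)
      show "range a \<subseteq> carrier B" using a(1) by blast
      show "\<forall>N. \<exists>k. \<forall>i\<ge>k. \<forall>n\<ge>k. a i \<ominus> a n \<in> ?I N" using step' by blast
    qed
    then obtain y where y: "y \<in> carrier B" "\<And>N. \<exists>k. \<forall>n\<ge>k. a n \<ominus> y \<in> ?I N" by blast
    have "\<exists>r\<in>carrier B. y = a n \<oplus> \<tau> [^] n \<otimes> r" for n
    proof -
      obtain k where k: "\<And>i. i \<ge> k \<Longrightarrow> a i \<ominus> y \<in> ?I n" using y(2) by blast
      \<comment> \<open>Far enough out, the sequence is congruent both to its limit and to
        \<open>a n\<close> modulo the \<open>n\<close>-th power of the maximal ideal.\<close>
      let ?i = "max k n"
      have 1: "a ?i \<ominus> y \<in> ?I n" "a ?i \<ominus> a n \<in> ?I n" using k[of ?i] step'[of n ?i n] by auto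
      have "(a ?i \<ominus> a n) \<oplus> (\<ominus> (a ?i \<ominus> y)) \<in> ?I n" using Ia[OF 1(2) In[OF 1(1)]] .
      then obtain r where r: "r \<in> carrier B" "(a ?i \<ominus> a n) \<oplus> (\<ominus> (a ?i \<ominus> y)) = \<tau> [^] n \<otimes> r" by blast
      have "y = a n \<oplus> ((a ?i \<ominus> a n) \<oplus> (\<ominus> (a ?i \<ominus> y)))"
        using a(1)[of ?i] a(1)[of n] y(1) by (simp add: B.minus_eq B.minus_add B.a_ac B.r_neg B.r_neg1 B.r_neg2)
      then show ?thesis using r by auto
    qed
    then show "\<exists>y\<in>carrier B. \<forall>n. \<exists>r\<in>carrier B. y = a n \<oplus> \<tau> [^] n \<otimes> r" using y(1) by blast
  qed
qed

section \<open>Orders in an algebra over the fraction field\<close>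

text \<open>Scalars enter A as multiples of 1, which makes the purely ring-theoretic locales
  applicable; \<open>\<tau>_big\<close> says that powers of \<open>\<tau>\<close> suffice as
  denominators in K.\<close>

locale dvr_algebra =
  fixes K :: "'k ring" and R0 :: "'k set" and A :: "('k, 'a) module" (structure) and \<tau> :: 'k
  assumes alg: "assoc_algebra K A" and K_field: "field K" and R_subring: "subring R0 K"
    and dvr: "central_dvr A ((\<lambda>r. r \<odot> \<one>) ` R0) (\<tau> \<odot> \<one>) (inv\<^bsub>K\<^esub> \<tau> \<odot> \<one>)"
    and \<tau>_R: "\<tau> \<in> R0" and \<tau>_big: "c \<in> carrier K \<Longrightarrow> \<exists>n::nat. \<tau> [^]\<^bsub>K\<^esub> n \<otimes>\<^bsub>K\<^esub> c \<in> R0"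
begin

abbreviation "Sc \<equiv> (\<lambda>r. r \<odot> \<one>) ` R0"
abbreviation "tA \<equiv> \<tau> \<odot> \<one>"
abbreviation "uA \<equiv> inv\<^bsub>K\<^esub> \<tau> \<odot> \<one>"

sublocale D: central_dvr A Sc tA uA by (rule dvr)

sublocale K: field K by (rule K_field)

sublocale A: module K A using alg by (simp add: assoc_algebra_def)

lemma R_carrier: "r \<in> R0 \<Longrightarrow> r \<in> carrier K"
  using subringE(1)[OF R_subring] by blast

lemma smult_eq: "r \<in> carrier K \<Longrightarrow> x \<in> carrier A \<Longrightarrow> r \<odot> x = (r \<odot> \<one>) \<otimes> x"
  using assoc_algebra.smult_assoc2[OF alg, of r "\<one>" x] by simp

lemma scalar_mult:
  assumes "r \<in> carrier K" "s \<in> carrier K"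
  shows "(r \<odot> \<one>) \<otimes> (s \<odot> \<one>) = (r \<otimes>\<^bsub>K\<^esub> s) \<odot> \<one>"
  using smult_eq[of r "s \<odot> \<one>"] A.smult_assoc1[of r s "\<one>"] assms A.smult_closed by simp

lemma tau_pow: "tA [^] (n::nat) = (\<tau> [^]\<^bsub>K\<^esub> n) \<odot> \<one>"
proof (induction n)
  case 0
  then show ?case using A.smult_one by simp
next
  case (Suc n)
  then show ?case using scalar_mult[of "\<tau> [^]\<^bsub>K\<^esub> n" \<tau>] R_carrier[OF \<tau>_R] by simp
qed

lemma order_sub: "is_order K R0 A \<Lambda> \<Longrightarrow> subring \<Lambda> A"
  by (simp add: is_order_def)

lemma order_scalars: "is_order K R0 A \<Lambda> \<Longrightarrow> Sc \<subseteq> \<Lambda>"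
  using subringE(3)[OF order_sub] by (auto simp: is_order_def)

lemma order_smod: "is_order K R0 A \<Lambda> \<Longrightarrow> D.smod Sc \<Lambda>"
  using D.subring_smod[OF order_sub order_scalars] .

lemma order_Span:
  assumes "is_order K R0 A \<Lambda>" shows "\<exists>bs. set bs \<subseteq> \<Lambda> \<and> \<Lambda> = D.Span Sc bs"
proof -
  obtain B where B: "finite B" "B \<subseteq> \<Lambda>" "lin_span R0 A B = \<Lambda>" using assms by (auto simp: is_order_def)
  obtain bs where bs: "set bs = B" using finite_list[OF B(1)] by blast
  have bc: "set bs \<subseteq> carrier A" using bs B(2) subringE(1)[OF order_sub[OF assms]] by blast
  note Sp = D.smod_Span[OF bc] and sup = D.Span_superset[OF bc]
  have "\<Lambda> \<subseteq> D.Span Sc bs"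
  proof
    fix x assume "x \<in> \<Lambda>"
    then obtain c F where cF: "finite F" "F \<subseteq> B" "c \<in> F \<rightarrow> R0" "x = (\<Oplus> y\<in>F. c y \<odot> y)"
      unfolding B(3)[symmetric] lin_span_def by blast
    show "x \<in> D.Span Sc bs"
      unfolding cF(4)
    proof (rule D.smod_finsum[OF Sp cF(1)])
      fix y assume y: "y \<in> F"
      have cy: "c y \<in> R0" "y \<in> set bs" using y cF bs by auto
      have "(c y \<odot> \<one>) \<otimes> y \<in> D.Span Sc bs"
        using D.smod_smult[OF Sp] cy sup by blast
      then show "c y \<odot> y \<in> D.Span Sc bs"
        unfolding smult_eq[OF R_carrier[OF cy(1)] subsetD[OF bc cy(2)]] .
    qed
  qed
  moreover have "D.Span Sc bs \<subseteq> \<Lambda>" using D.Span_least[OF order_smod[OF assms]] bs B(2) by blast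
  ultimately show ?thesis using bs B(2) by blast
qed

lemma absorbed_smod:
  assumes "D.smod Sc \<Lambda>" shows "D.smod Sc {x \<in> carrier A. \<exists>k::nat. tA [^] k \<otimes> x \<in> \<Lambda>}"
proof (rule D.smodI)
  note c = D.smod_mem_carrier[OF assms]
  show "\<zero> \<in> {x \<in> carrier A. \<exists>k::nat. tA [^] k \<otimes> x \<in> \<Lambda>}"
    using D.smod_zero[OF assms] by simp
  fix x y assume "x \<in> {x \<in> carrier A. \<exists>k::nat. tA [^] k \<otimes> x \<in> \<Lambda>}"
    "y \<in> {x \<in> carrier A. \<exists>k::nat. tA [^] k \<otimes> x \<in> \<Lambda>}"
  then obtain i j :: nat where h: "x \<in> carrier A" "y \<in> carrier A" "tA [^] i \<otimes> x \<in> \<Lambda>" "tA [^] j \<otimes> y \<in> \<Lambda>" by blast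
  have "tA [^] (i + j) \<otimes> (x \<ominus> y) \<in> \<Lambda>"
    unfolding D.tpow_distr(2)[OF h(1,2)]
    using D.smod_minus[OF assms D.tpow_mono[OF assms h(1,3)] D.tpow_mono[OF assms h(2,4)]] by simp
  then show "x \<ominus> y \<in> {x \<in> carrier A. \<exists>k::nat. tA [^] k \<otimes> x \<in> \<Lambda>}" using h by blast
next
  fix s x assume s: "s \<in> Sc" and "x \<in> {x \<in> carrier A. \<exists>k::nat. tA [^] k \<otimes> x \<in> \<Lambda>}"
  then obtain k :: nat where k: "x \<in> carrier A" "tA [^] k \<otimes> x \<in> \<Lambda>" by blast
  have sc: "s \<in> carrier A" using D.S_carrier s by blast
  have "tA [^] k \<otimes> (s \<otimes> x) \<in> \<Lambda>"
    using D.smod_smult[OF assms s k(2)] D.tpow_pull[OF sc k(1)] by simp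
  then show "s \<otimes> x \<in> {x \<in> carrier A. \<exists>k::nat. tA [^] k \<otimes> x \<in> \<Lambda>}" using sc k(1) by blast
qed blast

lemma order_absorbs:
  assumes "is_order K R0 A \<Lambda>" "x \<in> carrier A" shows "\<exists>k::nat. tA [^] k \<otimes> x \<in> \<Lambda>"
proof -
  note sm = order_smod[OF assms(1)]
  have "x \<in> lin_span (carrier K) A \<Lambda>" using assms by (simp add: is_order_def)
  then obtain c F where cF: "finite F" "F \<subseteq> \<Lambda>" "c \<in> F \<rightarrow> carrier K" "x = (\<Oplus> y\<in>F. c y \<odot> y)"
    unfolding lin_span_def by blast
  have "x \<in> {x \<in> carrier A. \<exists>k::nat. tA [^] k \<otimes> x \<in> \<Lambda>}"
    unfolding cF(4)
  proof (rule D.smod_finsum[OF absorbed_smod[OF sm] cF(1)])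
    fix y assume y: "y \<in> F"
    have c: "c y \<in> carrier K" "y \<in> carrier A" "y \<in> \<Lambda>" using y cF D.smod_mem_carrier[OF sm] by auto
    obtain n :: nat where n: "\<tau> [^]\<^bsub>K\<^esub> n \<otimes>\<^bsub>K\<^esub> c y \<in> R0" using \<tau>_big c by blast
    have tn: "\<tau> [^]\<^bsub>K\<^esub> n \<in> carrier K" using R_carrier[OF \<tau>_R] by simp
    have "tA [^] n \<otimes> (c y \<odot> y) = \<tau> [^]\<^bsub>K\<^esub> n \<odot> (c y \<odot> y)"
      unfolding tau_pow using smult_eq[OF tn A.smult_closed[OF c(1,2)]] by simp
    also have "\<dots> = (\<tau> [^]\<^bsub>K\<^esub> n \<otimes>\<^bsub>K\<^esub> c y) \<odot> y" using A.smult_assoc1[OF tn c(1,2)] by simp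
    finally have "tA [^] n \<otimes> (c y \<odot> y) \<in> \<Lambda>" using assms(1) n c(3) by (simp add: is_order_def)
    then show "c y \<odot> y \<in> {x \<in> carrier A. \<exists>k::nat. tA [^] k \<otimes> x \<in> \<Lambda>}"
      using A.smult_closed[OF c(1,2)] by blast
  qed
  then show ?thesis by blast
qed

text \<open>Only finitely many generators of \<Lambda>' have to be brought into \<Lambda>.\<close>

lemma order_commensurable:
  assumes "is_order K R0 A \<Lambda>" "is_order K R0 A \<Lambda>'"
  shows "\<exists>k::nat. \<forall>x\<in>\<Lambda>'. tA [^] k \<otimes> x \<in> \<Lambda>"
proof -
  note sm = order_smod[OF assms(1)]
  obtain bs where bs: "set bs \<subseteq> \<Lambda>'" "\<Lambda>' = D.Span Sc bs" using order_Span[OF assms(2)] by blast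
  have bc: "set bs \<subseteq> carrier A" using bs(1) subringE(1)[OF order_sub[OF assms(2)]] by blast
  have "\<exists>k::nat. \<forall>b\<in>set cs. tA [^] k \<otimes> b \<in> \<Lambda>" if "set cs \<subseteq> carrier A" for cs
    using that
  proof (induction cs)
    case (Cons c cs)
    then obtain k :: nat where k: "\<And>b. b \<in> set cs \<Longrightarrow> tA [^] k \<otimes> b \<in> \<Lambda>" by auto
    obtain j :: nat where j: "tA [^] j \<otimes> c \<in> \<Lambda>" using order_absorbs[OF assms(1)] Cons.prems by auto
    have "tA [^] (k + j) \<otimes> b \<in> \<Lambda>" if b: "b \<in> set (c # cs)" for b
    proof (cases "b = c")
      case True
      then show ?thesis using D.tpow_mono[OF sm _ j, of "k + j"] Cons.prems by simp
    next
      case False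
      then show ?thesis using D.tpow_mono[OF sm _ k, of b "k + j"] Cons.prems b by auto
    qed
    then show ?case by blast
  qed simp
  then obtain k :: nat where k: "\<And>b. b \<in> set bs \<Longrightarrow> tA [^] k \<otimes> b \<in> \<Lambda>" using bc by blast
  let ?W = "{x \<in> carrier A. tA [^] k \<otimes> x \<in> \<Lambda>}"
  have "D.smod Sc ?W"
  proof (rule D.smodI)
    show "\<zero> \<in> ?W" using D.smod_zero[OF sm] by simp
    show "x \<ominus> y \<in> ?W" if "x \<in> ?W" "y \<in> ?W" for x y
      using that D.tpow_distr(2)[of x y k] D.smod_minus[OF sm] by simp
    show "s \<otimes> x \<in> ?W" if s: "s \<in> Sc" "x \<in> ?W" for s x
    proof -
      have x: "x \<in> carrier A" "tA [^] k \<otimes> x \<in> \<Lambda>" using s(2) by auto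
      have "tA [^] k \<otimes> (s \<otimes> x) \<in> \<Lambda>"
        using D.smod_smult[OF sm s(1) x(2)] D.tpow_pull[OF D.S_carrier[OF s(1)] x(1), of k] by argo
      then show ?thesis using D.m_closed[OF D.S_carrier[OF s(1)] x(1)] by blast
    qed
  qed blast
  moreover have "set bs \<subseteq> ?W" using k bc by blast
  ultimately have "\<Lambda>' \<subseteq> ?W" unfolding bs(2) by (rule D.Span_least)
  then show ?thesis by blast
qed

lemma lin_span_Span:
  assumes "set cs \<subseteq> carrier A" shows "D.Span Sc cs \<subseteq> lin_span R0 A (set cs)"
proof -
  \<comment> \<open>Combinations range over the whole of \<open>set cs\<close>, with zero
    coefficients allowed, so that two of them are subtracted coefficientwise.\<close>
  define W where "W = {(\<Oplus> y\<in>set cs. c y \<odot> y) | c. c \<in> set cs \<rightarrow> R0}"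
  note Rs = subringE[OF R_subring]
  have cl: "(\<lambda>y. c y \<odot> y) \<in> set cs \<rightarrow> carrier A" if "c \<in> set cs \<rightarrow> R0" for c
    using that assms R_carrier A.smult_closed by auto
  have "D.smod Sc W"
  proof (rule D.smodI)
    show "W \<subseteq> carrier A" using D.finsum_closed[OF cl] by (auto simp: W_def)
    have "(\<Oplus> y\<in>set cs. \<zero>\<^bsub>K\<^esub> \<odot> y) = \<zero>"
    proof -
      have "(\<Oplus> y\<in>set cs. \<zero>\<^bsub>K\<^esub> \<odot> y) = (\<Oplus> y\<in>set cs. \<zero>)"
        using assms A.smult_l_null by (intro D.finsum_cong') auto
      then show ?thesis by simp
    qed
    then show "\<zero> \<in> W" unfolding W_def using Rs(2) by (intro CollectI exI[of _ "\<lambda>_. \<zero>\<^bsub>K\<^esub>"]) auto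
    fix x y assume "x \<in> W" "y \<in> W"
    then obtain c d where cd: "c \<in> set cs \<rightarrow> R0" "d \<in> set cs \<rightarrow> R0" "x = (\<Oplus> y\<in>set cs. c y \<odot> y)"
      "y = (\<Oplus> y\<in>set cs. d y \<odot> y)" unfolding W_def by blast
    let ?e = "\<lambda>y. c y \<ominus>\<^bsub>K\<^esub> d y"
    have e: "?e \<in> set cs \<rightarrow> R0" 
      using cd(1,2) Rs(7)[OF _ Rs(5)] unfolding K.minus_eq by blast
    let ?z = "(\<Oplus> y\<in>set cs. ?e y \<odot> y)"
    have "?z \<oplus> y = (\<Oplus> y\<in>set cs. ?e y \<odot> y \<oplus> d y \<odot> y)"
      unfolding cd(4) using D.finsum_addf[OF cl[OF e] cl[OF cd(2)]] by simp
    also have "\<dots> = x"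
      unfolding cd(3)
    proof (rule D.finsum_cong'[OF refl cl[OF cd(1)]])
      fix w assume w: "w \<in> set cs"
      have k: "c w \<in> carrier K" "d w \<in> carrier K" "w \<in> carrier A" using w cd(1,2) R_carrier assms by auto
      have "?e w \<odot> w \<oplus> d w \<odot> w = (?e w \<oplus>\<^bsub>K\<^esub> d w) \<odot> w"
        using A.smult_l_distr[of "?e w" "d w" w] k by simp
      also have "?e w \<oplus>\<^bsub>K\<^esub> d w = c w" using k by (simp add: K.minus_eq K.a_assoc K.l_neg)
      finally show "?e w \<odot> w \<oplus> d w \<odot> w = c w \<odot> w" .
    qed
    finally have s: "?z \<oplus> y = x" .
    have zc: "?z \<in> carrier A" "y \<in> carrier A" using D.finsum_closed[OF cl[OF e]] D.finsum_closed[OF cl[OF cd(2)]] cd(4) by auto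
    have "x \<ominus> y = ?z" unfolding s[symmetric] using zc by (simp add: D.minus_eq D.a_assoc D.r_neg)
    then show "x \<ominus> y \<in> W" unfolding W_def using e by (intro CollectI exI[of _ ?e] conjI)
  next
    fix s x assume "s \<in> Sc" "x \<in> W"
    then obtain r c where rc: "r \<in> R0" "s = r \<odot> \<one>" "c \<in> set cs \<rightarrow> R0" "x = (\<Oplus> y\<in>set cs. c y \<odot> y)"
      unfolding W_def by blast
    let ?e = "\<lambda>y. r \<otimes>\<^bsub>K\<^esub> c y"
    have e: "?e \<in> set cs \<rightarrow> R0" using rc Rs(6) by auto
    have xc: "x \<in> carrier A" using D.finsum_closed[OF cl[OF rc(3)]] rc(4) by simp
    have "s \<otimes> x = r \<odot> x" using smult_eq[OF R_carrier[OF rc(1)] xc] rc(2) by simp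
    also have "\<dots> = (\<Oplus> y\<in>set cs. r \<odot> (c y \<odot> y))"
      unfolding rc(4) using A.finsum_smult_ldistr[OF _ R_carrier[OF rc(1)] cl[OF rc(3)]] by simp
    also have "\<dots> = (\<Oplus> y\<in>set cs. ?e y \<odot> y)"
    proof (rule D.finsum_cong'[OF refl cl[OF e]])
      fix w assume w: "w \<in> set cs"
      then have "c w \<in> carrier K" "w \<in> carrier A" using rc(3) R_carrier assms by auto
      then show "r \<odot> (c w \<odot> w) = ?e w \<odot> w" using A.smult_assoc1 R_carrier[OF rc(1)] by simp
    qed
    finally show "s \<otimes> x \<in> W" unfolding W_def using e by (intro CollectI exI[of _ ?e] conjI)
  qed
  moreover have "set cs \<subseteq> W"
  proof
    fix b assume b: "b \<in> set cs"
    let ?c = "\<lambda>y. if b = y then \<one>\<^bsub>K\<^esub> else \<zero>\<^bsub>K\<^esub>"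
    have c: "?c \<in> set cs \<rightarrow> R0" using Rs(2,3) by auto
    have "(\<Oplus> y\<in>set cs. ?c y \<odot> y) = (\<Oplus> y\<in>set cs. if b = y then y else \<zero>)"
      using assms A.smult_one A.smult_l_null by (intro D.finsum_cong') auto
    also have "\<dots> = b" using D.finsum_singleton[OF b, of "\<lambda>y. y"] assms by auto
    finally show "b \<in> W" unfolding W_def using c by (intro CollectI exI[of _ ?c]) simp
  qed
  ultimately have "D.Span Sc cs \<subseteq> W" by (rule D.Span_least)
  moreover have "W \<subseteq> lin_span R0 A (set cs)" unfolding W_def lin_span_def by blast
  ultimately show ?thesis by blast
qed

lemma lin_span_mono: "B \<subseteq> B' \<Longrightarrow> lin_span C A B \<subseteq> lin_span C A B'"
  unfolding lin_span_def by blast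

lemma lin_span_subset:
  assumes "D.smod Sc W" "C \<subseteq> carrier K" "\<And>r x. r \<in> C \<Longrightarrow> x \<in> W \<Longrightarrow> r \<odot> x \<in> W" "B \<subseteq> W"
  shows "lin_span C A B \<subseteq> W"
proof
  fix x assume "x \<in> lin_span C A B"
  then obtain c F where cF: "finite F" "F \<subseteq> B" "c \<in> F \<rightarrow> C" "x = (\<Oplus> y\<in>F. c y \<odot> y)"
    unfolding lin_span_def by blast
  show "x \<in> W" unfolding cF(4) by (rule D.smod_finsum[OF assms(1) cF(1)]) (use cF assms in blast)
qed

text \<open>Boundedness puts \<Gamma> inside \<open>u^k \<Lambda>\<close>, where \<open>u\<close> is
  the inverse of the uniformizer. This is finitely generated over the noetherian valuation ring, so
  \<Gamma> is finitely generated as well. Thus maximality among orders becomes maximality among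
  bounded overrings, as \<open>maximal_overorder\<close> asks.\<close>

lemma overorder:
  assumes \<Lambda>: "is_order K R0 A \<Lambda>" and \<Gamma>: "subring \<Gamma> A" "\<Lambda> \<subseteq> \<Gamma>"
    and b: "\<exists>k::nat. \<forall>x\<in>\<Gamma>. tA [^] k \<otimes> x \<in> \<Lambda>"
  shows "is_order K R0 A \<Gamma>"
proof -
  note g = subringE[OF \<Gamma>(1)]
  have Sc\<Gamma>: "Sc \<subseteq> \<Gamma>" using order_scalars[OF \<Lambda>] \<Gamma>(2) by blast
  have sm: "D.smod Sc \<Gamma>" using D.subring_smod[OF \<Gamma>(1) Sc\<Gamma>] .
  have rs: "r \<odot> x \<in> \<Gamma>" if "r \<in> R0" "x \<in> \<Gamma>" for r x
  proof -
    have "r \<odot> x = (r \<odot> \<one>) \<otimes> x" using smult_eq[OF R_carrier[OF that(1)]] that(2) g(1) by blast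
    then show ?thesis using g(6) Sc\<Gamma> that by auto
  qed
  obtain k :: nat where k: "\<And>x. x \<in> \<Gamma> \<Longrightarrow> tA [^] k \<otimes> x \<in> \<Lambda>" using b by blast
  obtain bs where bs: "set bs \<subseteq> \<Lambda>" "\<Lambda> = D.Span Sc bs" using order_Span[OF \<Lambda>] by blast
  have bc: "set bs \<subseteq> carrier A" using bs(1) \<Gamma>(2) g(1) by blast
  let ?u = "uA [^] k"
  have uc: "?u \<in> carrier A" by simp
  have "\<Gamma> \<subseteq> D.Span Sc (map (\<lambda>b. b \<otimes> ?u) bs)"
  proof
    fix x assume x: "x \<in> \<Gamma>"
    have xc: "x \<in> carrier A" using x g(1) by blast
    have "(tA [^] k \<otimes> x) \<otimes> ?u = x"
      using D.upow_comm[of "tA [^] k \<otimes> x" k] D.upow_tpow[OF xc, of k] xc by simp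
    then have "x \<in> (\<lambda>x. x \<otimes> ?u) ` D.Span Sc bs" using k[OF x] bs(2) by (metis imageI)
    then show "x \<in> D.Span Sc (map (\<lambda>b. b \<otimes> ?u) bs)" using D.Span_rmult[OF bc uc] by simp
  qed
  moreover have "set (map (\<lambda>b. b \<otimes> ?u) bs) \<subseteq> carrier A" using bc by auto
  ultimately obtain cs where cs: "set cs \<subseteq> \<Gamma>" "\<Gamma> = D.Span Sc cs" using D.Span_noetherian[OF _ sm] by blast
  have cc: "set cs \<subseteq> carrier A" using cs(1) g(1) by blast
  have "lin_span R0 A (set cs) = \<Gamma>"
    using lin_span_Span[OF cc] cs lin_span_subset[OF sm _ rs cs(1)] R_carrier by blast
  moreover have "lin_span (carrier K) A \<Gamma> = carrier A"
  proof
    show "lin_span (carrier K) A \<Gamma> \<subseteq> carrier A"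
    proof (rule lin_span_subset)
      show "D.smod Sc (carrier A)" by (rule D.smodI) (auto simp: D.S_carrier)
    qed (use A.smult_closed g(1) in auto)
    have "lin_span (carrier K) A \<Lambda> = carrier A" using \<Lambda> by (simp add: is_order_def)
    then show "carrier A \<subseteq> lin_span (carrier K) A \<Gamma>" using lin_span_mono[OF \<Gamma>(2)] by blast
  qed
  ultimately show ?thesis unfolding is_order_def using \<Gamma>(1) rs cs(1) by blast
qed

end

text \<open>Sending a scalar to its multiple of 1 is injective, because K is a field and A is
  non-zero; the properties of \<open>\<tau>\<close> in the valuation ring therefore carry over to
  the image in A.\<close>

lemma dvr_algebra_exists:
  fixes K :: "'k ring" and A :: "('k, 'a) module" (structure)
  assumes ff: "is_fraction_field K R0" and cd: "complete_discrete_valuation_ring (K\<lparr>carrier := R0\<rparr>)"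
    and alg: "assoc_algebra K A" and nt: "\<one> \<noteq> \<zero>"
  obtains \<tau> where "dvr_algebra K R0 A \<tau>"
proof -
  let ?B = "K\<lparr>carrier := R0\<rparr>"
  have fK: "field K" and sR: "subring R0 K" using ff by (auto simp: is_fraction_field_def)
  interpret K: field K by (rule fK)
  interpret ringA: ring A using alg by (simp add: assoc_algebra_def)
  interpret A: module K A using alg by (simp add: assoc_algebra_def)
  have pw: "x [^]\<^bsub>?B\<^esub> (n::nat) = x [^]\<^bsub>K\<^esub> n" for x n by (simp add: nat_pow_def)
  have Bs: "carrier ?B = R0" "monoid.mult ?B = monoid.mult K" "monoid.one ?B = \<one>\<^bsub>K\<^esub>"
    "ring.add ?B = ring.add K" "ring.zero ?B = \<zero>\<^bsub>K\<^esub>" by simp_all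
  obtain \<tau> where \<tau>: "\<tau> \<in> R0" "\<tau> \<noteq> \<zero>\<^bsub>K\<^esub>"
    and loc: "\<And>s. s \<in> R0 \<Longrightarrow> (\<exists>r\<in>R0. s = \<tau> \<otimes>\<^bsub>K\<^esub> r) \<or> (\<exists>r\<in>R0. s \<otimes>\<^bsub>K\<^esub> r = \<one>\<^bsub>K\<^esub>)"
    and sep: "\<And>s. \<lbrakk>s \<in> R0; \<And>n::nat. \<exists>r\<in>R0. s = \<tau> [^]\<^bsub>K\<^esub> n \<otimes>\<^bsub>K\<^esub> r\<rbrakk> \<Longrightarrow> s = \<zero>\<^bsub>K\<^esub>"
    and compl: "\<And>a. \<lbrakk>\<And>n. a n \<in> R0; \<And>n::nat. \<exists>r\<in>R0. a (Suc n) = a n \<oplus>\<^bsub>K\<^esub> \<tau> [^]\<^bsub>K\<^esub> n \<otimes>\<^bsub>K\<^esub> r\<rbrakk> \<Longrightarrow>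
       \<exists>y\<in>R0. \<forall>n. \<exists>r\<in>R0. y = a n \<oplus>\<^bsub>K\<^esub> \<tau> [^]\<^bsub>K\<^esub> n \<otimes>\<^bsub>K\<^esub> r"
    by (fact complete_dvr_uniformizer[OF cd, unfolded pw Bs])
  have Rc: "r \<in> carrier K" if "r \<in> R0" for r using subringE(1)[OF sR] that by blast
  note Rs = subringE[OF sR]
  define h where "h r = r \<odot> \<one>" for r
  have hc: "h r \<in> carrier A" if "r \<in> carrier K" for r using A.smult_closed that by (simp add: h_def)
  have hx: "h r \<otimes> x = r \<odot> x" if "r \<in> carrier K" "x \<in> carrier A" for r x
    using assoc_algebra.smult_assoc2[OF alg that(1) ringA.one_closed that(2)] that by (simp add: h_def)
  have xh: "x \<otimes> h r = r \<odot> x" if "r \<in> carrier K" "x \<in> carrier A" for r x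
    using assoc_algebra.smult_assoc3[OF alg that(1,2) ringA.one_closed] that by (simp add: h_def)
  have hm: "h r \<otimes> h s = h (r \<otimes>\<^bsub>K\<^esub> s)" if "r \<in> carrier K" "s \<in> carrier K" for r s
    using hx[OF that(1) hc[OF that(2)]] A.smult_assoc1[OF that ringA.one_closed] by (simp add: h_def)
  have ha: "h r \<oplus> h s = h (r \<oplus>\<^bsub>K\<^esub> s)" if "r \<in> carrier K" "s \<in> carrier K" for r s
    using A.smult_l_distr[OF that ringA.one_closed] by (simp add: h_def)
  have h1: "h \<one>\<^bsub>K\<^esub> = \<one>" using A.smult_one by (simp add: h_def)
  have h0: "h \<zero>\<^bsub>K\<^esub> = \<zero>" using A.smult_l_null by (simp add: h_def)
  have hn: "\<ominus> h r = h (\<ominus>\<^bsub>K\<^esub> r)" if "r \<in> carrier K" for r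
    using A.smult_l_minus[OF that ringA.one_closed] by (simp add: h_def)
  have hp: "h \<tau> [^] (n::nat) = h (\<tau> [^]\<^bsub>K\<^esub> n)" for n
  proof (induction n)
    case 0
    then show ?case using h1 by simp
  next
    case (Suc n)
    then show ?case using hm[of "\<tau> [^]\<^bsub>K\<^esub> n" \<tau>] Rc[OF \<tau>(1)] by simp
  qed
  have h_zero: "r = \<zero>\<^bsub>K\<^esub>" if r: "r \<in> carrier K" "h r = \<zero>" for r
  proof (rule ccontr)
    assume "r \<noteq> \<zero>\<^bsub>K\<^esub>"
    then have u: "r \<in> Units K" using r(1) K.field_Units by simp
    have "\<one> = h (inv\<^bsub>K\<^esub> r) \<otimes> h r" using hm[OF K.Units_inv_closed[OF u] r(1)] K.Units_l_inv[OF u] h1 by simp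
    also have "\<dots> = \<zero>" using r(2) hc[OF K.Units_inv_closed[OF u]] by simp
    finally show False using nt by simp
  qed
  have h_inj: "r = s" if rs: "r \<in> carrier K" "s \<in> carrier K" "h r = h s" for r s
  proof -
    have "h (r \<oplus>\<^bsub>K\<^esub> \<ominus>\<^bsub>K\<^esub> s) = h r \<oplus> (\<ominus> h s)" using ha[of r "\<ominus>\<^bsub>K\<^esub> s"] hn[OF rs(2)] rs by simp
    also have "\<dots> = \<zero>" using rs(3) hc[OF rs(2)] by (simp add: ringA.r_neg)
    finally have "r \<oplus>\<^bsub>K\<^esub> \<ominus>\<^bsub>K\<^esub> s = \<zero>\<^bsub>K\<^esub>" using h_zero rs by simp
    then show ?thesis using rs K.r_right_minus_eq[of r s] by (simp add: K.minus_eq)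
  qed
  have tu: "\<tau> \<in> Units K" using \<tau> Rc K.field_Units by simp
  have tp: "\<tau> [^]\<^bsub>K\<^esub> (n::nat) \<in> carrier K" for n using Rc[OF \<tau>(1)] by simp
  have dvr: "central_dvr A (h ` R0) (h \<tau>) (h (inv\<^bsub>K\<^esub> \<tau>))"
  proof (intro central_dvr.intro central_dvr_axioms.intro)
    show "ring A" by (rule ringA.ring_axioms)
    show "subring (h ` R0) A"
    proof (rule ringA.subringI)
      show "h ` R0 \<subseteq> carrier A" using hc Rc by auto
      show "\<one> \<in> h ` R0" using h1 Rs(3) by (metis imageI)
      show "\<ominus> x \<in> h ` R0" if "x \<in> h ` R0" for x using that hn Rc Rs(5) by auto
      show "x \<otimes> y \<in> h ` R0" if "x \<in> h ` R0" "y \<in> h ` R0" for x y using that hm Rc Rs(6) by auto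
      show "x \<oplus> y \<in> h ` R0" if "x \<in> h ` R0" "y \<in> h ` R0" for x y using that ha Rc Rs(7) by auto
    qed
    show "s \<otimes> x = x \<otimes> s" if "s \<in> h ` R0" "x \<in> carrier A" for s x using that hx xh Rc by auto
    show "h \<tau> \<in> h ` R0" using \<tau> by blast
    show "h (inv\<^bsub>K\<^esub> \<tau>) \<in> carrier A" using hc K.Units_inv_closed[OF tu] by blast
    show "h \<tau> \<otimes> h (inv\<^bsub>K\<^esub> \<tau>) = \<one>"
      using hm[OF Rc[OF \<tau>(1)] K.Units_inv_closed[OF tu]] K.Units_r_inv[OF tu] h1 by simp
    show "(\<exists>r\<in>h ` R0. s = h \<tau> \<otimes> r) \<or> (\<exists>r\<in>h ` R0. s \<otimes> r = \<one>)" if "s \<in> h ` R0" for s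
    proof -
      obtain r where r: "r \<in> R0" "s = h r" using \<open>s \<in> h ` R0\<close> by blast
      show ?thesis using loc[OF r(1)]
      proof
        assume "\<exists>q\<in>R0. r = \<tau> \<otimes>\<^bsub>K\<^esub> q"
        then obtain q where q: "q \<in> R0" "r = \<tau> \<otimes>\<^bsub>K\<^esub> q" by blast
        then have "s = h \<tau> \<otimes> h q" using r hm Rc \<tau> by simp
        then show ?thesis using q by blast
      next
        assume "\<exists>q\<in>R0. r \<otimes>\<^bsub>K\<^esub> q = \<one>\<^bsub>K\<^esub>"
        then obtain q where q: "q \<in> R0" "r \<otimes>\<^bsub>K\<^esub> q = \<one>\<^bsub>K\<^esub>" by blast
        then have "s \<otimes> h q = \<one>" using r hm Rc h1 by simp
        then show ?thesis using q by blast
      qed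
    qed
    show "s = \<zero>" if s: "s \<in> h ` R0" "\<And>n::nat. \<exists>r\<in>h ` R0. s = h \<tau> [^] n \<otimes> r" for s
    proof -
      obtain r where r: "r \<in> R0" "s = h r" using s(1) by blast
      have "\<exists>q\<in>R0. r = \<tau> [^]\<^bsub>K\<^esub> n \<otimes>\<^bsub>K\<^esub> q" for n :: nat
      proof -
        obtain q where q: "q \<in> R0" "s = h \<tau> [^] n \<otimes> h q" using s(2)[of n] by blast
        then have "h r = h (\<tau> [^]\<^bsub>K\<^esub> n \<otimes>\<^bsub>K\<^esub> q)" using r hp hm[OF tp Rc[OF q(1)]] by simp
        then have "r = \<tau> [^]\<^bsub>K\<^esub> n \<otimes>\<^bsub>K\<^esub> q" using h_inj r q Rc tp by simp
        then show ?thesis using q(1) by blast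
      qed
      then show ?thesis using sep[OF r(1)] r(2) h0 by simp
    qed
    fix a :: "nat \<Rightarrow> 'a"
    assume a: "\<And>n. a n \<in> h ` R0" "\<And>n::nat. \<exists>r\<in>h ` R0. a (Suc n) \<ominus> a n = h \<tau> [^] n \<otimes> r"
    have "\<exists>b. \<forall>n. b n \<in> R0 \<and> a n = h (b n)" using a(1) by (intro choice) blast
    then obtain b where b: "\<And>n. b n \<in> R0" "\<And>n. a n = h (b n)" by blast
    \<comment> \<open>Differences in A are translated into sums in K, the form in which completeness
      is available for the subring.\<close>
    have diff: "h x \<ominus> h y = h z \<longleftrightarrow> x = y \<oplus>\<^bsub>K\<^esub> z" if "x \<in> carrier K" "y \<in> carrier K" "z \<in> carrier K" for x y z
    proof
      assume "h x \<ominus> h y = h z"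
      then have "h y \<oplus> (h x \<ominus> h y) = h y \<oplus> h z" by simp
      moreover have "h y \<oplus> (h x \<ominus> h y) = h x" using hc[OF that(1)] hc[OF that(2)]
        by (simp add: ringA.minus_eq ringA.a_lcomm ringA.r_neg)
      ultimately have "h x = h (y \<oplus>\<^bsub>K\<^esub> z)" using ha[OF that(2,3)] by simp
      then show "x = y \<oplus>\<^bsub>K\<^esub> z" using h_inj that by simp
    next
      assume "x = y \<oplus>\<^bsub>K\<^esub> z"
      then have "h x = h z \<oplus> h y" using ha[OF that(3,2)] K.a_comm[OF that(2,3)] by simp
      then show "h x \<ominus> h y = h z" using hc[OF that(2)] hc[OF that(3)] by (simp add: ringA.minus_eq ringA.a_assoc ringA.r_neg)
    qed
    have "\<exists>r\<in>R0. b (Suc n) = b n \<oplus>\<^bsub>K\<^esub> \<tau> [^]\<^bsub>K\<^esub> n \<otimes>\<^bsub>K\<^esub> r" for n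
    proof -
      obtain r where r: "r \<in> R0" "a (Suc n) \<ominus> a n = h \<tau> [^] n \<otimes> h r" using a(2)[of n] by blast
      then have "h (b (Suc n)) \<ominus> h (b n) = h (\<tau> [^]\<^bsub>K\<^esub> n \<otimes>\<^bsub>K\<^esub> r)" using b hp hm[OF tp Rc[OF r(1)]] by simp
      then show ?thesis using diff[OF Rc[OF b(1)] Rc[OF b(1)], of "\<tau> [^]\<^bsub>K\<^esub> n \<otimes>\<^bsub>K\<^esub> r"] tp Rc r(1) by auto
    qed
    then obtain y where y: "y \<in> R0" "\<And>n. \<exists>r\<in>R0. y = b n \<oplus>\<^bsub>K\<^esub> \<tau> [^]\<^bsub>K\<^esub> n \<otimes>\<^bsub>K\<^esub> r"
      using compl[of b] b(1) by blast
    have "\<exists>r\<in>h ` R0. h y \<ominus> a n = h \<tau> [^] n \<otimes> r" for n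
    proof -
      obtain r where r: "r \<in> R0" "y = b n \<oplus>\<^bsub>K\<^esub> \<tau> [^]\<^bsub>K\<^esub> n \<otimes>\<^bsub>K\<^esub> r" using y(2) by blast
      have "h y \<ominus> h (b n) = h (\<tau> [^]\<^bsub>K\<^esub> n \<otimes>\<^bsub>K\<^esub> r)"
        using diff[OF Rc[OF y(1)] Rc[OF b(1)], of "\<tau> [^]\<^bsub>K\<^esub> n \<otimes>\<^bsub>K\<^esub> r"] tp Rc r by simp
      then have "h y \<ominus> a n = h \<tau> [^] n \<otimes> h r" using b(2) hp hm[OF tp Rc[OF r(1)]] by simp
      then show ?thesis using r(1) by blast
    qed
    then show "\<exists>y\<in>h ` R0. \<forall>n. \<exists>r\<in>h ` R0. y \<ominus> a n = h \<tau> [^] n \<otimes> r" using y(1) by blast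
  qed
  have big: "\<exists>n::nat. \<tau> [^]\<^bsub>K\<^esub> n \<otimes>\<^bsub>K\<^esub> c \<in> R0" if c: "c \<in> carrier K" for c
  proof -
    obtain a b where ab: "a \<in> R0" "b \<in> R0" "b \<noteq> \<zero>\<^bsub>K\<^esub>" "c = a \<otimes>\<^bsub>K\<^esub> inv\<^bsub>K\<^esub> b"
      using ff c unfolding is_fraction_field_def by blast
    interpret D: central_dvr A "h ` R0" "h \<tau>" "h (inv\<^bsub>K\<^esub> \<tau>)" by (rule dvr)
    have "h b \<in> h ` R0" "h b \<noteq> \<zero>" using ab h_zero Rc by auto
    \<comment> \<open>The denominator \<open>b\<close> is a unit times a power of
      \<open>\<tau>\<close>; this is read off in A, where \<open>S_valuation\<close> is available,
      and pulled back along \<open>h\<close>.\<close>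
    then obtain n :: nat and z where z: "z \<in> h ` R0" "z \<otimes> h b = h \<tau> [^] n"
      using D.S_valuation by metis
    then obtain q where q: "q \<in> R0" "z = h q" by blast
    have bu: "b \<in> Units K" using ab Rc K.field_Units by simp
    have "h (q \<otimes>\<^bsub>K\<^esub> b) = h (\<tau> [^]\<^bsub>K\<^esub> n)" using z q hm Rc ab hp by simp
    then have e: "q \<otimes>\<^bsub>K\<^esub> b = \<tau> [^]\<^bsub>K\<^esub> n" using h_inj q ab Rc tp by simp
    have "\<tau> [^]\<^bsub>K\<^esub> n \<otimes>\<^bsub>K\<^esub> c = (q \<otimes>\<^bsub>K\<^esub> a) \<otimes>\<^bsub>K\<^esub> (b \<otimes>\<^bsub>K\<^esub> inv\<^bsub>K\<^esub> b)"
      unfolding e[symmetric] ab(4) using Rc q ab(1,2) K.Units_inv_closed[OF bu] by (simp add: K.m_ac)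
    also have "\<dots> = q \<otimes>\<^bsub>K\<^esub> a" using K.Units_r_inv[OF bu] Rc q ab(1) by simp
    finally show ?thesis using Rs(6) q(1) ab(1) by metis
  qed
  have "dvr_algebra K R0 A \<tau>"
    by (intro dvr_algebra.intro alg fK sR \<tau>(1) big) (use dvr in \<open>simp_all add: h_def[abs_def]\<close>)
  then show ?thesis by (rule that)
qed

context simple_over_maximal
begin

lemma restrict_module: "left_module (R\<lparr>carrier := \<Lambda>\<rparr>) (restrict_scalars (\<lambda>a. a \<otimes> e) T)"
proof (intro left_module.intro left_module_axioms.intro abelian_groupI)
  let ?T = "restrict_scalars (\<lambda>a. a \<otimes> e) T"
  show "ring (R\<lparr>carrier := \<Lambda>\<rparr>)" using subring_is_ring[OF \<Lambda>_subring] .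
  have a: "a \<in> \<Lambda>'" if "a \<in> \<Lambda>" for a using that \<Lambda>_\<Lambda>' by blast
  fix x assume "x \<in> carrier ?T"
  then show "\<exists>y\<in>carrier ?T. y \<oplus>\<^bsub>?T\<^esub> x = \<zero>\<^bsub>?T\<^esub>"
    using T.M.l_neg[of x] by (auto simp: restrict_scalars_def intro!: bexI[of _ "\<ominus>\<^bsub>T\<^esub> x"])
  show "\<one>\<^bsub>R\<lparr>carrier := \<Lambda>\<rparr>\<^esub> \<odot>\<^bsub>?T\<^esub> x = x" if "x \<in> carrier ?T" for x
    using act_one[of x] that by (simp add: restrict_scalars_def act_def)
  show "a \<odot>\<^bsub>?T\<^esub> x \<in> carrier ?T" if "a \<in> carrier (R\<lparr>carrier := \<Lambda>\<rparr>)" "x \<in> carrier ?T" for a x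
    using act_closed[of a x] that a by (simp add: restrict_scalars_def act_def)
  show "(a \<oplus>\<^bsub>R\<lparr>carrier := \<Lambda>\<rparr>\<^esub> b) \<odot>\<^bsub>?T\<^esub> x = a \<odot>\<^bsub>?T\<^esub> x \<oplus>\<^bsub>?T\<^esub> b \<odot>\<^bsub>?T\<^esub> x"
    if "a \<in> carrier (R\<lparr>carrier := \<Lambda>\<rparr>)" "b \<in> carrier (R\<lparr>carrier := \<Lambda>\<rparr>)" "x \<in> carrier ?T" for a b x
    using act_add[of a b x] that a by (simp add: restrict_scalars_def act_def)
  show "(a \<otimes>\<^bsub>R\<lparr>carrier := \<Lambda>\<rparr>\<^esub> b) \<odot>\<^bsub>?T\<^esub> x = a \<odot>\<^bsub>?T\<^esub> (b \<odot>\<^bsub>?T\<^esub> x)"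
    if "a \<in> carrier (R\<lparr>carrier := \<Lambda>\<rparr>)" "b \<in> carrier (R\<lparr>carrier := \<Lambda>\<rparr>)" "x \<in> carrier ?T" for a b x
    using act_mult[of a b x] that a by (simp add: restrict_scalars_def act_def)
  show "a \<odot>\<^bsub>?T\<^esub> (x \<oplus>\<^bsub>?T\<^esub> y) = a \<odot>\<^bsub>?T\<^esub> x \<oplus>\<^bsub>?T\<^esub> a \<odot>\<^bsub>?T\<^esub> y"
    if "a \<in> carrier (R\<lparr>carrier := \<Lambda>\<rparr>)" "x \<in> carrier ?T" "y \<in> carrier ?T" for a x y
    using T.smult_r_distr[OF xe_closed[OF a], of a x y] that by (simp add: restrict_scalars_def)
qed (auto simp: restrict_scalars_def T.M.a_assoc intro: T.M.a_comm)

text \<open>The sum of simple classes is determined by \<open>ms\<close> alone and no longer refers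
  to the maximal order, so modules over two maximal orders can be compared through it.\<close>

theorem restrict_class:
  assumes "comp_factors \<Lambda> (rmul M uniformizer) M ms"
  shows "finite_length_module (R\<lparr>carrier := \<Lambda>\<rparr>) (restrict_scalars (\<lambda>a. a \<otimes> e) T) \<and>
    frag_of (restrict_scalars (\<lambda>a. a \<otimes> e) T) - (\<Sum>\<kappa>\<in>#ms. simple_class (R\<lparr>carrier := \<Lambda>\<rparr>) \<kappa>)
      \<in> grothendieck_relations (R\<lparr>carrier := \<Lambda>\<rparr>)"
proof -
  obtain N1 N2 \<phi> where h: "comp_factors \<Lambda> N1 N2 ms" "\<phi> ` N2 = carrier T"
    "\<forall>x\<in>N2. \<forall>y\<in>N2. \<phi> (x \<oplus> y) = \<phi> x \<oplus>\<^bsub>T\<^esub> \<phi> y"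
    "\<forall>a\<in>\<Lambda>. \<forall>x\<in>N2. \<phi> (a \<otimes> x) = (a \<otimes> e) \<odot>\<^bsub>T\<^esub> \<phi> x"
    "\<forall>x\<in>N2. \<phi> x = \<zero>\<^bsub>T\<^esub> \<longleftrightarrow> x \<in> N1"
    using simple_presentation[OF assms] by blast
  have "presents \<Lambda> N1 N2 \<phi> (restrict_scalars (\<lambda>a. a \<otimes> e) T)"
    unfolding presents_def using h(2-5) by (simp add: restrict_scalars_def)
  then show ?thesis using presents_class[OF h(1) \<Lambda>_subring restrict_module] by blast
qed

end

theorem proposition3p3:
  fixes K :: "'k ring" and R :: "'k set" and A :: "('k, 'a) module"
    and \<Lambda> \<Lambda>' \<Lambda>'' :: "'a set"
    and I :: "'i set" and e :: "'i \<Rightarrow> 'a" and i :: 'i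
    and S' S'' :: "('a, 'm) module"
  assumes "is_fraction_field K R"
    and "complete_discrete_valuation_ring (K\<lparr>carrier := R\<rparr>)"
    and "finite_dimensional_algebra K A"
    and "semisimple_ring A"
    and "is_order K R A \<Lambda>"
    and "is_maximal_order K R A \<Lambda>'" and "\<Lambda> \<subseteq> \<Lambda>'"
    and "is_maximal_order K R A \<Lambda>''" and "\<Lambda> \<subseteq> \<Lambda>''"
    and "complete_primitive_central_idempotents A I e"
    and "i \<in> I"
    and "simple_module (idempotent_component A \<Lambda>' (e i)) S'"
    and "simple_module (idempotent_component A \<Lambda>'' (e i)) S''"
  defines "L \<equiv> A\<lparr>carrier := \<Lambda>\<rparr>"
    and "T' \<equiv> restrict_scalars (\<lambda>a. a \<otimes>\<^bsub>A\<^esub> e i) S'"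
    and "T'' \<equiv> restrict_scalars (\<lambda>a. a \<otimes>\<^bsub>A\<^esub> e i) S''"
  shows "grothendieck_class L T' \<in> carrier (grothendieck_group L)
       \<and> grothendieck_class L T'' \<in> carrier (grothendieck_group L)
       \<and> grothendieck_class L T' = grothendieck_class L T''"
proof -
  have alg: "assoc_algebra K A" using assms(3) by (simp add: finite_dimensional_algebra_def)
  have pe: "primitive_central_idempotent A (e i)" using assms(10,11) by (simp add: complete_primitive_central_idempotents_def)
  interpret ringA: ring A using alg by (simp add: assoc_algebra_def)
  have ec: "e i \<in> carrier A" "e i \<otimes>\<^bsub>A\<^esub> e i = e i" "e i \<noteq> \<zero>\<^bsub>A\<^esub>"
    and ecen: "\<And>x. x \<in> carrier A \<Longrightarrow> e i \<otimes>\<^bsub>A\<^esub> x = x \<otimes>\<^bsub>A\<^esub> e i"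
    using pe unfolding primitive_central_idempotent_def central_idempotent_def by blast+
  have nt: "\<one>\<^bsub>A\<^esub> \<noteq> \<zero>\<^bsub>A\<^esub>" using ec ringA.r_one ringA.r_null by metis
  obtain \<tau> where "dvr_algebra K R A \<tau>" using dvr_algebra_exists[OF assms(1,2) alg nt] by blast
  then interpret dvr_algebra K R A \<tau> .
  have comp: "ringA.complemented" using complemented_if_semisimple[OF assms(4)] .
  obtain \<epsilon> where \<epsilon>: "\<epsilon> \<in> carrier A" "\<epsilon> \<noteq> \<zero>\<^bsub>A\<^esub>" "\<epsilon> \<otimes>\<^bsub>A\<^esub> \<epsilon> = \<epsilon>" "e i \<otimes>\<^bsub>A\<^esub> \<epsilon> = \<epsilon>"
    and min: "\<And>x. \<lbrakk>x \<in> carrier A; x \<otimes>\<^bsub>A\<^esub> \<epsilon> = x; x \<noteq> \<zero>\<^bsub>A\<^esub>\<rbrakk> \<Longrightarrow> \<exists>a\<in>carrier A. a \<otimes>\<^bsub>A\<^esub> x = \<epsilon>"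
    using ringA.minimal_left_ideal_exists[OF comp ec] by metis
  obtain bs where bs: "set bs \<subseteq> \<Lambda>" "\<Lambda> = ringA.Span Sc bs" using order_Span[OF assms(5)] by blast
  have bc: "set bs \<subseteq> carrier A" using bs(1) subringE(1)[OF order_sub[OF assms(5)]] by blast
  have mli: "minimal_left_ideal A Sc tA uA \<Lambda> bs \<epsilon>"
    by (intro minimal_left_ideal.intro D.central_dvr_axioms minimal_left_ideal_axioms.intro)
      (use order_sub[OF assms(5)] order_scalars[OF assms(5)] bc bs(2) order_absorbs[OF assms(5)] \<epsilon> min in auto)
  \<comment> \<open>The part of the setting shared by both maximal orders; in particular
    \<open>MI.uniformizer\<close> is the same for both.\<close>
  interpret MI: minimal_left_ideal A Sc tA uA \<Lambda> bs \<epsilon> by (rule mli)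
  have mo: "maximal_overorder A Sc tA uA \<Lambda> bs \<epsilon> (e i) \<Gamma>"
    if \<Gamma>: "is_maximal_order K R A \<Gamma>" "\<Lambda> \<subseteq> \<Gamma>" for \<Gamma>
  proof (intro maximal_overorder.intro mli maximal_overorder_axioms.intro)
    have o: "is_order K R A \<Gamma>" using \<Gamma>(1) by (simp add: is_maximal_order_def)
    show "subring \<Gamma> A" using order_sub[OF o] .
    show "\<exists>k::nat. \<forall>x\<in>\<Gamma>. tA [^]\<^bsub>A\<^esub> k \<otimes>\<^bsub>A\<^esub> x \<in> \<Lambda>" using order_commensurable[OF assms(5) o] .
    show "\<Gamma>' = \<Gamma>" if "subring \<Gamma>' A" "\<Gamma> \<subseteq> \<Gamma>'" "\<exists>k::nat. \<forall>x\<in>\<Gamma>'. tA [^]\<^bsub>A\<^esub> k \<otimes>\<^bsub>A\<^esub> x \<in> \<Lambda>" for \<Gamma>'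
    proof -
      have "is_order K R A \<Gamma>'" using overorder[OF assms(5) that(1) _ that(3)] \<Gamma>(2) that(2) by blast
      then show ?thesis using \<Gamma>(1) that(2) by (simp add: is_maximal_order_def)
    qed
    show "b = \<zero>\<^bsub>A\<^esub>" if "b \<in> carrier A" "b \<otimes>\<^bsub>A\<^esub> e i = b"
      "\<And>x. x \<in> carrier A \<Longrightarrow> x \<otimes>\<^bsub>A\<^esub> \<epsilon> = x \<Longrightarrow> b \<otimes>\<^bsub>A\<^esub> x = \<zero>\<^bsub>A\<^esub>" for b
      using ringA.primitive_component_faithful[OF comp pe \<epsilon> that] .
  qed (fact ec ecen \<epsilon> \<Gamma>(2))+
  interpret M1: simple_over_maximal A Sc tA uA \<Lambda> bs \<epsilon> "e i" \<Lambda>' S'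
    by (intro simple_over_maximal.intro mo simple_over_maximal_axioms.intro assms)
  interpret M2: simple_over_maximal A Sc tA uA \<Lambda> bs \<epsilon> "e i" \<Lambda>'' S''
    by (intro simple_over_maximal.intro mo simple_over_maximal_axioms.intro assms)
  have p: "MI.uniformizer \<in> MI.\<Delta>" using MI.uniformizer by (simp add: MI.\<Delta>_def)
  have s1: "MI.rmul M1.M MI.uniformizer \<subseteq> M1.M" using M1.M_\<Delta>[OF _ p] by (auto simp: MI.rmul_def)
  have s2: "MI.rmul M2.M MI.uniformizer \<subseteq> M2.M" using M2.M_\<Delta>[OF _ p] by (auto simp: MI.rmul_def)
  obtain ms where ms: "ringA.comp_factors \<Lambda> (MI.rmul M1.M MI.uniformizer) M1.M ms"
    using MI.comp_lattice[OF MI.lattice_rmul[OF M1.M_lattice MI.uniformizer(1,2)] M1.M_lattice s1] by blast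
  obtain ms' where ms': "ringA.comp_factors \<Lambda> (MI.rmul M2.M MI.uniformizer) M2.M ms'"
    using MI.comp_lattice[OF MI.lattice_rmul[OF M2.M_lattice MI.uniformizer(1,2)] M2.M_lattice s2] by blast
  \<comment> \<open>The two lattices \<open>M1.M\<close> and \<open>M2.M\<close> belong to different
    orders, but as lattices over \<Lambda> in the same \<open>V\<close> they have the same factors
    modulo the common uniformizer. This is the only point where the two orders are compared.\<close>
  have eq: "ms = ms'"
    using MI.comp_rmul_independent[OF M1.M_lattice ms M2.M_lattice ms' MI.uniformizer(1,2)] .
  note c1 = M1.restrict_class[OF ms, folded L_def T'_def]
  note c2 = M2.restrict_class[OF ms'[folded eq], folded L_def T''_def]
  have "frag_of T' - frag_of T'' \<in> grothendieck_relations L"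
    using relations_diff[OF conjunct2[OF c1] conjunct2[OF c2]] by simp
  then show ?thesis
    using c1 c2 grothendieck_class_closed grothendieck_class_eqI[of L T' T''] by blast
qed

end
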